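(* Let $\Phi$ be a Young function such that its complementary function $\tilde\Phi$ has an upper type $r$ and a lower type $s$, for some $1<s<r$. Let $T$ be a linear operator, bounded on $L^2(\mathbb{R}^n)$, such that for every $f\in L^2(\mathbb{R}^n)$ with compact support $$Tf(x)=\int_{\mathbb{R}^n}K(x-y)f(y)\,dy,\qquad x\notin\mathrm{supp}\,f,$$ where $K:\mathbb{R}^n\setminus\{0\}\to\mathbb{C}$ is a measurable function with $K\in H_\Phi$. Assume that there exist $1<p<r'$, Young functions $\eta,\varphi$ and $z_0\ge 0$ such that $\eta\in B_{p'}$ and $\eta^{-1}(z)\varphi^{-1}(z)\lesssim \tilde\Phi^{-1}(z)$ for every $z\geq z_0$. If $u\ge 0$ is a locally integrable function on $\mathbb{R}^n$ and $v\in \mathrm{RH}_\infty\cap A_q$ with $q=1+(p-1)/r$, then there exists a constant $C>0$ such that the inequality $$uv\left(\left\{x\in \mathbb{R}^n: \frac{|T(fv)(x)|}{v(x)}>t\right\}\right)\leq \frac{C}{t}\int_{\mathbb{R}^n}|f(x)|\,M_{\varphi_p, v^{1-q'}}u(x)\,M(\Psi(v))(x)\,dx$$ holds for every $t>0$ and every bounded function $f$ with compact support, where $\varphi_p(z)=\varphi(z^{1/p})$ and $\Psi(z)=z^{p'+1-q'}\mathcal{X}_{[0,1]}(z)+z^{p'}\mathcal{X}_{[1,\infty)}(z)$.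
   Context: Notation. $\mathcal{X}_E$ is the characteristic function of $E$; $p'=p/(p-1)$, and similarly $q'$, $r'$, are conjugate exponents. For a nonnegative function $g$ and a measurable set $E$, $g(E)=\int_E g(x)\,dx$; thus $uv(E)=\int_E u(x)v(x)\,dx$. Cubes are cubes in $\mathbb{R}^n$ with sides parallel to the coordinate axes. $A\lesssim B$ means that $A\le cB$ for some constant $c>0$ (independent of the variables involved). $\Psi(v)$ denotes the composition $\Psi\circ v$. Weights. A weight is a locally integrable function $w$ with $0<w(x)<\infty$ for almost every $x$. For $1<q<\infty$, $w\in A_q$ if there is $C>0$ with $\left(\frac{1}{|Q|}\int_Q w\right)\left(\frac{1}{|Q|}\int_Q w^{1-q'}\right)^{q-1}\leq C$ for every cube $Q$. A weight $w$ belongs to $\mathrm{RH}_\infty$ if there is $C>0$ with $\sup_Q w\leq \frac{C}{|Q|}\int_Q w$ for every cube $Q$ (essential supremum). Young functions. A Young function is a function $\varphi:[0,\infty)\to[0,\infty)$ that is convex, strictly increasing, with $\varphi(0)=0$ and $\lim_{t\to\infty}\varphi(t)=\infty$. All Young functions considered, including complementary functions, satisfy $0<\varphi(t)<\infty$ for $t>0$; $\varphi^{-1}$ is the inverse function, $\varphi^{-1}(t)=\inf\{s\ge 0:\varphi(s)\ge t\}$. The complementary function is $\tilde\varphi(t)=\sup\{ts-\varphi(s):s\ge 0\}$, $t\ge 0$. A Young function $\varphi$ has an upper type $p$ ($0<p<\infty$) if there is $C>0$ with $\varphi(st)\le Cs^p\varphi(t)$ for all $s\ge 1$, $t\ge 0$;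 it has a lower type $p$ if there is $C>0$ with $\varphi(st)\le Cs^p\varphi(t)$ for all $0\le s\le 1$, $t\ge 0$. For $p>1$, $\varphi\in B_p$ if there is $c>0$ with $\int_c^\infty \frac{\varphi(t)}{t^p}\frac{dt}{t}<\infty$. Luxemburg averages and maximal operators. For a weight $w$, a cube or ball $E$, and a function $\varphi$ (a Young function, or $\varphi_p$ as in the claim), $$\|f\|_{\varphi,E,w}=\inf\left\{\lambda>0: \frac{1}{w(E)}\int_E \varphi\left(\frac{|f(y)|}{\lambda}\right)w(y)\,dy\leq 1\right\}$$ (with $\inf\emptyset=\infty$), $\|f\|_{\varphi,E}=\|f\|_{\varphi,E,1}$, and $M_{\varphi,w}f(x)=\sup_{Q\ni x}\|f\|_{\varphi,Q,w}$, the supremum being over all cubes $Q$ containing $x$. $M$ is the classical Hardy-Littlewood maximal operator, $Mf(x)=\sup_{Q\ni x}\frac{1}{|Q|}\int_Q|f|$. $L^\Phi$-Hörmander condition. For $s>0$ put $\|f\|_{\Phi,|x|\sim s}=\left\|f\,\mathcal{X}_{\{s<|x|\le 2s\}}\right\|_{\Phi,B(0,2s)}$. We write $K\in H_\Phi$ if there exist constants $c\ge 1$ and $C_\Phi>0$ such that $$\sum_{k=1}^\infty (2^kR)^n\,\|K(\cdot-y)-K(\cdot)\|_{\Phi,|x|\sim 2^kR}\leq C_\Phi$$ for every $y\in\mathbb{R}^n$ and every $R>c|y|$. *)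

theory Defs
  imports "HOL-Analysis.Analysis" "HOL-Probability.Essential_Supremum"
begin

definition conj_exp :: "real \<Rightarrow> real" where
  "conj_exp p = p / (p - 1)"

definition cubes :: "(real ^ 'n) set set" where
  "cubes = {cbox a (a + vec h) | a h. 0 < h}"

definition weighted :: "(real ^ 'n \<Rightarrow> real) \<Rightarrow> (real ^ 'n) set \<Rightarrow> ennreal" where
  "weighted g E = (\<integral>\<^sup>+x\<in>E. ennreal (g x) \<partial>lebesgue)"

definition avg :: "(real ^ 'n \<Rightarrow> real) \<Rightarrow> (real ^ 'n) set \<Rightarrow> real" where
  "avg w Q = (LINT x:Q|lebesgue. w x) / measure lebesgue Q"

definition locally_integrable :: "(real ^ 'n \<Rightarrow> real) \<Rightarrow> bool" where
  "locally_integrable w \<longleftrightarrow> (\<forall>S. compact S \<longrightarrow> set_integrable lebesgue S w)"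

definition weight :: "(real ^ 'n \<Rightarrow> real) \<Rightarrow> bool" where
  "weight w \<longleftrightarrow> locally_integrable w \<and> (AE x in lebesgue. 0 < w x)"

text \<open>The integral of \<open>w powr (1 - q')\<close> over a cube may diverge, in which case the condition is
  meant to fail; as \<open>LINT\<close> of a non-integrable function is 0, integrability is stated explicitly.\<close>

definition A_class :: "real \<Rightarrow> (real ^ 'n \<Rightarrow> real) set" where
  "A_class q = {w. weight w \<and>
     (\<exists>C>0. \<forall>Q\<in>cubes.
        set_integrable lebesgue Q (\<lambda>x. w x powr (1 - conj_exp q)) \<and>
        avg w Q * avg (\<lambda>x. w x powr (1 - conj_exp q)) Q powr (q - 1) \<le> C)}"

definition RH_inf :: "(real ^ 'n \<Rightarrow> real) set" where
  "RH_inf = {w. weight w \<and>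
     (\<exists>C>0. \<forall>Q\<in>cubes. esssup (lebesgue_on Q) (\<lambda>x. ereal (w x)) \<le> ereal (C * avg w Q))}"

text \<open>Young functions are represented by functions on all reals, of which only the values on
  \<open>{0..}\<close> matter.\<close>

definition young :: "(real \<Rightarrow> real) \<Rightarrow> bool" where
  "young \<phi> \<longleftrightarrow> convex_on {0..} \<phi> \<and> strict_mono_on {0..} \<phi> \<and> \<phi> 0 = 0 \<and> filterlim \<phi> at_top at_top"

definition complementary :: "(real \<Rightarrow> real) \<Rightarrow> real \<Rightarrow> real" where
  "complementary \<phi> t = (SUP s\<in>{0..}. t * s - \<phi> s)"

text \<open>The standing assumption that the complementary function takes values strictly between 0 and
  \<open>\<infinity>\<close> at positive arguments. The boundedness makes the real supremum in \<open>complementary\<close> a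
  genuine one.\<close>

definition proper_complementary :: "(real \<Rightarrow> real) \<Rightarrow> bool" where
  "proper_complementary \<phi> \<longleftrightarrow>
     (\<forall>t>0. bdd_above ((\<lambda>s. t * s - \<phi> s) ` {0..}) \<and> 0 < complementary \<phi> t)"

definition young_inv :: "(real \<Rightarrow> real) \<Rightarrow> real \<Rightarrow> real" where
  "young_inv \<phi> t = Inf {s. 0 \<le> s \<and> t \<le> \<phi> s}"

definition upper_type :: "(real \<Rightarrow> real) \<Rightarrow> real \<Rightarrow> bool" where
  "upper_type \<phi> p \<longleftrightarrow> 0 < p \<and> (\<exists>C>0. \<forall>s\<ge>1. \<forall>t\<ge>0. \<phi> (s * t) \<le> C * s powr p * \<phi> t)"

definition lower_type :: "(real \<Rightarrow> real) \<Rightarrow> real \<Rightarrow> bool" where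
  "lower_type \<phi> p \<longleftrightarrow> 0 < p \<and> (\<exists>C>0. \<forall>s\<in>{0..1}. \<forall>t\<ge>0. \<phi> (s * t) \<le> C * s powr p * \<phi> t)"

definition B_class :: "real \<Rightarrow> (real \<Rightarrow> real) set" where
  "B_class p = {\<phi>. \<exists>c>0. (\<integral>\<^sup>+t\<in>{c..}. ennreal (\<phi> t / t powr p / t) \<partial>lborel) < \<infinity>}"

definition luxemburg ::
  "(real \<Rightarrow> real) \<Rightarrow> (real ^ 'n) set \<Rightarrow> (real ^ 'n \<Rightarrow> real) \<Rightarrow>
   (real ^ 'n \<Rightarrow> 'b::real_normed_vector) \<Rightarrow> ennreal" where
  "luxemburg \<phi> E w f =
     Inf {ennreal l | l. 0 < l \<and>
       (\<integral>\<^sup>+y\<in>E. ennreal (\<phi> (norm (f y) / l) * w y) \<partial>lebesgue) / weighted w E \<le> 1}"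

definition maximal_lux ::
  "(real \<Rightarrow> real) \<Rightarrow> (real ^ 'n \<Rightarrow> real) \<Rightarrow> (real ^ 'n \<Rightarrow> 'b::real_normed_vector) \<Rightarrow>
   real ^ 'n \<Rightarrow> ennreal" where
  "maximal_lux \<phi> w f x = (SUP Q\<in>{Q \<in> cubes. x \<in> Q}. luxemburg \<phi> Q w f)"

definition hl_maximal :: "(real ^ 'n \<Rightarrow> 'b::real_normed_vector) \<Rightarrow> real ^ 'n \<Rightarrow> ennreal" where
  "hl_maximal f x =
     (SUP Q\<in>{Q \<in> cubes. x \<in> Q}.
        (\<integral>\<^sup>+y\<in>Q. ennreal (norm (f y)) \<partial>lebesgue) / emeasure lebesgue Q)"

definition annular_lux ::
  "(real \<Rightarrow> real) \<Rightarrow> real \<Rightarrow> (real ^ 'n \<Rightarrow> 'b::real_normed_vector) \<Rightarrow> ennreal" where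
  "annular_lux \<Phi> s f =
     luxemburg \<Phi> (ball 0 (2 * s)) (\<lambda>_. 1)
       (\<lambda>x. indicat_real {x. s < norm x \<and> norm x \<le> 2 * s} x *\<^sub>R f x)"

definition hoermander :: "(real \<Rightarrow> real) \<Rightarrow> (real ^ 'n \<Rightarrow> complex) set" where
  "hoermander \<Phi> = {K. \<exists>c\<ge>1. \<exists>C>0. \<forall>y R. R > c * norm y \<longrightarrow>
     (\<Sum>k. ennreal ((2 ^ Suc k * R) ^ CARD('n)) *
          annular_lux \<Phi> (2 ^ Suc k * R) (\<lambda>x. K (x - y) - K x)) \<le> ennreal C}"

definition L2 :: "(real ^ 'n \<Rightarrow> complex) set" where
  "L2 = {f \<in> borel_measurable lebesgue. integrable lebesgue (\<lambda>x. (norm (f x))\<^sup>2)}"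

definition L2_norm :: "(real ^ 'n \<Rightarrow> complex) \<Rightarrow> real" where
  "L2_norm f = sqrt (LINT x|lebesgue. (norm (f x))\<^sup>2)"

text \<open>Operators act on representatives; all identities between functions hold almost everywhere.
  Together with the norm bound, linearity implies that functions that agree almost everywhere
  have images that agree almost everywhere.\<close>

definition L2_bounded_linear ::
  "((real ^ 'n \<Rightarrow> complex) \<Rightarrow> real ^ 'n \<Rightarrow> complex) \<Rightarrow> bool" where
  "L2_bounded_linear T \<longleftrightarrow>
     (\<forall>f\<in>L2. T f \<in> L2) \<and>
     (\<forall>f\<in>L2. \<forall>g\<in>L2. AE x in lebesgue. T (\<lambda>y. f y + g y) x = T f x + T g x) \<and>
     (\<forall>a. \<forall>f\<in>L2. AE x in lebesgue. T (\<lambda>y. a * f y) x = a * T f x) \<and>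
     (\<exists>B. \<forall>f\<in>L2. L2_norm (T f) \<le> B * L2_norm f)"

definition support :: "(real ^ 'n \<Rightarrow> complex) \<Rightarrow> (real ^ 'n) set" where
  "support f = closure {x. f x \<noteq> 0}"

text \<open>The absolute convergence of the integral is part of the representation formula.\<close>

definition has_kernel ::
  "((real ^ 'n \<Rightarrow> complex) \<Rightarrow> real ^ 'n \<Rightarrow> complex) \<Rightarrow> (real ^ 'n \<Rightarrow> complex) \<Rightarrow> bool" where
  "has_kernel T K \<longleftrightarrow>
     (\<forall>f\<in>L2. compact (support f) \<longrightarrow>
        (AE x in lebesgue. x \<notin> support f \<longrightarrow>
           integrable lebesgue (\<lambda>y. K (x - y) * f y) \<and>
           T f x = (LINT y|lebesgue. K (x - y) * f y)))"

definition Psi :: "real \<Rightarrow> real \<Rightarrow> real \<Rightarrow> real" where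
  "Psi p q z =
     z powr (conj_exp p + 1 - conj_exp q) * indicat_real {0..1} z +
     z powr conj_exp p * indicat_real {1..} z"

end

theory Submission
  imports Defs
begin

text \<open>Since \<open>\<Psi>(z) \<ge> z\<close> for \<open>z > 0\<close> and \<open>v\<close> is essentially bounded on a cube by its average there, \<open>M(\<Psi>(v))\<close>
  dominates \<open>v\<close>, and it suffices to bound the left side by \<open>\<integral> |f| M\<^sub>\<phi> u v\<close>. Outside the dilates
  of the Calderon--Zygmund cubes of \<open>f\<close> at height \<open>t\<close> with respect to the measure \<open>v dx\<close>, whose \<open>uv\<close>-measure
  is controlled directly, let \<open>E\<close> be a bounded part of the level set and test \<open>T(fv)\<close> against \<open>u 1\<^sub>E\<close> with
  the phase of \<open>T(fv)\<close>. The bad part of \<open>f\<close> is handled by the Hoermander condition. The good part is a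
  telescoping sum over the heights \<open>t/2\<^sup>i\<close> of functions with mean zero on the stopping cubes \<open>Q\<close>. Each of them is
  paired with \<open>u = (uv)\<^sup>\<theta> u\<^bsup>1-\<theta>\<^esup> v\<^bsup>-\<theta>\<^esup>\<close>: for small \<open>\<theta>\<close> the Young function complementary to
  \<open>\<Phi>\<close> leaves enough room to bound the three factors by the averages of \<open>(uv 1\<^sub>E)\<^bsup>1/2\<^esup>\<close>, by the Luxemburg
  averages of \<open>u\<close> and by the Muckenhoupt condition. Weighting the arithmetic-geometric mean inequality with
  geometric factors \<open>2\<^bsup>i/2\<^esup>\<close>, the sum over \<open>i\<close> is at most a multiple of the right side plus
  \<open>t uv(E)/2\<close>, where the second term comes from the \<open>L\<^sup>2\<close> bound of the maximal operator and is absorbed.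
  Only the \<open>L\<^sup>2\<close> bound of \<open>T\<close> is used: on the dilate of \<open>Q\<close> the test function is decomposed as well.\<close>

text \<open>Two obstacles shape the argument. Absorbing \<open>t uv(E) / 2\<close> requires
  \<open>uv(E)\<close> to be finite, and testing in L2 requires \<open>u\<close> to be bounded on
  \<open>E\<close>; hence only bounded pieces of the level set are treated, with constants free of
  those bounds, and monotone convergence comes last. Moreover the good part has no L2 bound against
  \<open>u\<close>, so some power of the unknown \<open>uv(E)\<close> has to enter at each height.
  The root \<open>(uv 1_E)^(1/2)\<close> is the choice for which the L2 norm of the maximal function
  returns \<open>uv(E)\<close> itself. Its power \<open>1/a\<close>, with
  \<open>a = 1/(2 theta)\<close>, stands in the test function, and the growth estimate ends with
  \<open>x powr a\<close>, which is linear in the root, so that plain averages suffice. At height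
  \<open>t / 2^i\<close> the mean inequality with weight \<open>sigma\<close> costs
  \<open>sigma^(-theta/(1-theta))\<close> times the right side plus \<open>sigma t / 2^i\<close>
  times \<open>uv(E)\<close>. A constant \<open>sigma\<close> fails in the first sum,
  \<open>sigma = 2^i\<close> in the second; \<open>2^(i/2)\<close> makes both geometric, and a small
  constant in front keeps the second below one half.\<close>

section \<open>Set integrals over countable disjoint unions\<close>

lemma set_integral_countable_Union_tendsto:
  fixes f :: "'a \<Rightarrow> 'b::{banach, second_countable_topology}"
  assumes "countable S" "S \<noteq> {}" "disjoint S" "S \<subseteq> sets M" "set_integrable M (\<Union>S) f"
  shows "(\<lambda>n. \<Sum>Q\<in>from_nat_into S ` {..<n}. LINT x:Q|M. f x) \<longlonglongrightarrow> (LINT x:\<Union>S|M. f x)"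
proof -
  define A where "A = from_nat_into S"
  define B where "B = (\<lambda>n. \<Union>(A ` {..<n}))"
  have AS: "A n \<in> S" for n using from_nat_into[OF assms(2)] by (simp add: A_def)
  have ran: "range A = S" using range_from_nat_into[OF assms(2,1)] by (simp add: A_def)
  have inc: "incseq B" unfolding B_def by (intro incseq_SucI UN_mono) auto
  have UB: "(\<Union>n. B n) = \<Union>S" unfolding ran[symmetric] B_def by (auto simp: lessThan_Suc)
  have Bs: "B n \<in> sets M" for n using AS assms(4) by (auto simp: B_def)
  have "(\<lambda>n. LINT x:B n|M. f x) \<longlonglongrightarrow> (LINT x:(\<Union>n. B n)|M. f x)"
    by (rule set_integral_cont_up) (use Bs inc assms(5) in \<open>simp_all add: UB\<close>)
  \<comment> \<open>The sum runs over the image of the enumeration and not over indices, because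
    \<open>from_nat_into\<close> repeats members when \<open>S\<close> is finite.\<close>
  moreover have "(LINT x:B n|M. f x) = (\<Sum>Q\<in>A ` {..<n}. LINT x:Q|M. f x)" for n
  proof -
    have "(LINT x:(\<Union>Q\<in>A ` {..<n}. Q)|M. f x) = (\<Sum>Q\<in>A ` {..<n}. LINT x:Q|M. f x)"
    proof (rule set_integral_finite_Union)
      show "disjoint_family_on (\<lambda>Q. Q) (A ` {..<n})"
        using assms(3) AS unfolding disjoint_family_on_def pairwise_def disjnt_def by blast
      show "set_integrable M Q f" if "Q \<in> A ` {..<n}" for Q
        using that AS assms(4) by (intro set_integrable_subset[OF assms(5)]) auto
      show "Q \<in> sets M" if "Q \<in> A ` {..<n}" for Q
        using that AS assms(4) by auto
    qed auto
    then show ?thesis by (simp add: B_def)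
  qed
  ultimately show ?thesis by (simp add: UB A_def)
qed

lemma set_integral_countable_Union_mono:
  fixes f g :: "'a \<Rightarrow> real"
  assumes "countable S" "disjoint S" "S \<subseteq> sets M" "set_integrable M (\<Union>S) f" "set_integrable M (\<Union>S) g"
    and "\<And>Q. Q \<in> S \<Longrightarrow> (LINT x:Q|M. f x) \<le> (LINT x:Q|M. g x)"
  shows "(LINT x:\<Union>S|M. f x) \<le> (LINT x:\<Union>S|M. g x)"
proof (cases "S = {}")
  case True then show ?thesis by (simp add: set_lebesgue_integral_def)
next
  case False
  show ?thesis
  proof (rule LIMSEQ_le)
    show "(\<lambda>n. \<Sum>Q\<in>from_nat_into S ` {..<n}. LINT x:Q|M. f x) \<longlonglongrightarrow> (LINT x:\<Union>S|M. f x)"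
      by (rule set_integral_countable_Union_tendsto[OF assms(1) False assms(2-4)])
    show "(\<lambda>n. \<Sum>Q\<in>from_nat_into S ` {..<n}. LINT x:Q|M. g x) \<longlonglongrightarrow> (LINT x:\<Union>S|M. g x)"
      by (rule set_integral_countable_Union_tendsto[OF assms(1) False assms(2,3,5)])
    show "\<exists>N. \<forall>n\<ge>N. (\<Sum>Q\<in>from_nat_into S ` {..<n}. LINT x:Q|M. f x) \<le> (\<Sum>Q\<in>from_nat_into S ` {..<n}. LINT x:Q|M. g x)"
      using from_nat_into[OF False] by (auto intro!: exI[of _ 0] sum_mono assms(6))
  qed
qed

lemma set_integral_countable_Union_cong:
  fixes f g :: "'a \<Rightarrow> 'b::{banach, second_countable_topology}"
  assumes "countable S" "disjoint S" "S \<subseteq> sets M" "set_integrable M (\<Union>S) f" "set_integrable M (\<Union>S) g"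
    and "\<And>Q. Q \<in> S \<Longrightarrow> (LINT x:Q|M. f x) = (LINT x:Q|M. g x)"
  shows "(LINT x:\<Union>S|M. f x) = (LINT x:\<Union>S|M. g x)"
proof (cases "S = {}")
  case True then show ?thesis by (simp add: set_lebesgue_integral_def)
next
  case False
  have "(\<Sum>Q\<in>from_nat_into S ` {..<n}. LINT x:Q|M. f x) = (\<Sum>Q\<in>from_nat_into S ` {..<n}. LINT x:Q|M. g x)" for n
    using from_nat_into[OF False] by (auto intro!: sum.cong assms(6))
  then show ?thesis
    using set_integral_countable_Union_tendsto[OF assms(1) False assms(2-4)]
      set_integral_countable_Union_tendsto[OF assms(1) False assms(2,3,5)]
    by (auto intro: LIMSEQ_unique)
qed

subsection \<open>Half-open cubes\<close>

text \<open>Half-open, so that the dyadic cubes of one generation partition space exactly; the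
  closed cubes of the statement differ from them by a null set.\<close>

definition hcube :: "real ^ 'n \<Rightarrow> real \<Rightarrow> (real ^ 'n) set" where
  "hcube b l = {y. \<forall>i. b $ i \<le> y $ i \<and> y $ i < b $ i + l}"

lemma hcube_borel: "hcube b l \<in> sets (borel :: (real ^ 'n) measure)"
proof -
  have "hcube b l = (\<Inter>i. {y. b $ i \<le> y $ i} \<inter> {y. y $ i < b $ i + l})"
    by (auto simp: hcube_def)
  also have "\<dots> \<in> sets borel"
    by (intro sets.countable_INT'' sets.Int) (auto intro!: borel_closed borel_open
        closed_halfspace_component_ge_cart open_halfspace_component_lt_cart)
  finally show ?thesis .
qed

lemma hcube_sets [measurable, simp]: "hcube b l \<in> sets lebesgue"
  by (rule sets_completionI_sets) (simp add: hcube_borel)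

lemma hcube_subset_cbox: "hcube b l \<subseteq> cbox b (b + vec l)"
  unfolding hcube_def subset_iff mem_box_cart by (simp add: less_imp_le)

lemma box_subset_hcube: "box b (b + vec l) \<subseteq> hcube b l"
  unfolding hcube_def subset_iff mem_box_cart by (simp add: less_imp_le)

lemma corner_in_hcube: "0 < l \<Longrightarrow> b \<in> hcube b l"
  by (simp add: hcube_def)

lemma AE_cbox_hcube: "AE x in lebesgue. x \<in> cbox b (b + vec l) \<longleftrightarrow> x \<in> hcube b (l::real)"
proof -
  have "cbox b (b + vec l) - box b (b + vec l) \<in> null_sets lebesgue"
    using null_sets_cbox_Diff_box null_sets_completionI by blast
  then show ?thesis
    by (rule AE_I') (use hcube_subset_cbox[of b l] box_subset_hcube[of b l] in auto)
qed

lemma set_integral_cbox_hcube: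
  fixes f :: "real ^ 'n \<Rightarrow> 'b::{banach, second_countable_topology}"
  assumes "set_integrable lebesgue (cbox b (b + vec l)) f"
  shows "(LINT x:cbox b (b + vec l)|lebesgue. f x) = (LINT x:hcube b l|lebesgue. f x)"
proof (rule set_integral_cong_set)
  show "set_borel_measurable lebesgue (cbox b (b + vec l)) f"
    using assms by (auto simp: set_borel_measurable_def set_integrable_def)
  show "set_borel_measurable lebesgue (hcube b l) f"
    using set_integrable_subset[OF assms _ hcube_subset_cbox]
    by (auto simp: set_borel_measurable_def set_integrable_def)
  show "AE x in lebesgue. (x \<in> hcube b l) = (x \<in> cbox b (b + vec l))"
    using AE_cbox_hcube[of b l] by eventually_elim auto
qed

lemma emeasure_cbox_cube:
  assumes "0 \<le> l"
  shows "emeasure lebesgue (cbox b (b + vec l) :: (real ^ 'n) set) = ennreal (l ^ CARD('n))"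
proof -
  have "emeasure lborel (cbox b (b + vec l) :: (real ^ 'n) set) = ennreal (measure lborel (cbox b (b + vec l)))"
    by (rule emeasure_eq_ennreal_measure) (use emeasure_lborel_cbox_finite[of b "b + vec l"] in auto)
  also have "measure lborel (cbox b (b + vec l)) = l ^ CARD('n)"
    using assms by (subst content_cbox_cart) (auto simp: interval_ne_empty_cart)
  finally show ?thesis by simp
qed

lemma measure_cbox_cube:
  "0 \<le> l \<Longrightarrow> measure lebesgue (cbox b (b + vec l) :: (real ^ 'n) set) = l ^ CARD('n)"
  by (simp add: measure_def emeasure_cbox_cube del: emeasure_completion)

lemma emeasure_hcube:
  assumes "0 \<le> l"
  shows "emeasure lebesgue (hcube b l :: (real ^ 'n) set) = ennreal (l ^ CARD('n))"
proof -
  have "emeasure lebesgue (hcube b l) = emeasure lebesgue (cbox b (b + vec l))"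
    by (rule emeasure_eq_AE) (use AE_cbox_hcube[of b l] in \<open>auto elim: eventually_mono\<close>)
  then show ?thesis using emeasure_cbox_cube[OF assms] by metis
qed

lemma measure_hcube:
  "0 \<le> l \<Longrightarrow> measure lebesgue (hcube b l :: (real ^ 'n) set) = l ^ CARD('n)"
  by (simp add: measure_def emeasure_hcube del: emeasure_completion)

lemma hcube_lmeasurable [simp]: "hcube b l \<in> lmeasurable"
  by (rule bounded_set_imp_lmeasurable) (auto intro: bounded_subset[OF bounded_cbox hcube_subset_cbox])

lemma hcube_norm_diff:
  assumes "x \<in> hcube b l" "y \<in> hcube b (l::real)"
  shows "norm (x - y :: real ^ 'n) \<le> real CARD('n) * l"
proof -
  have "norm (x - y) \<le> (\<Sum>i\<in>UNIV. \<bar>(x - y) $ i\<bar>)" by (rule norm_le_l1_cart)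
  also have "\<dots> \<le> (\<Sum>i\<in>(UNIV::'n set). l)"
  proof (rule sum_mono)
    fix i show "\<bar>(x - y) $ i\<bar> \<le> l"
    proof -
      have "b $ i \<le> x $ i" "x $ i < b $ i + l" "b $ i \<le> y $ i" "y $ i < b $ i + l"
        using assms unfolding hcube_def by blast+
      then show ?thesis by simp
    qed
  qed
  finally show ?thesis by simp
qed

lemma cubes_iff: "B \<in> cubes \<longleftrightarrow> (\<exists>b h. 0 < h \<and> B = cbox b (b + vec h))"
  by (auto simp: cubes_def)

subsection \<open>Dyadic subdivision\<close>

text \<open>The cube of generation \<open>k\<close> through \<open>x\<close> in the grid with corner
  \<open>a\<close> and unit \<open>l\<close>, written as a class of the relation "same integer
  index". Membership is an equality of floors, so disjointness and nesting become
  arithmetic.\<close>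

definition dcube :: "real ^ 'n \<Rightarrow> real \<Rightarrow> nat \<Rightarrow> real ^ 'n \<Rightarrow> (real ^ 'n) set" where
  "dcube a l k x = {y. \<forall>i. \<lfloor>2 ^ k * (y $ i - a $ i) / l\<rfloor> = \<lfloor>2 ^ k * (x $ i - a $ i) / l\<rfloor>}"

lemma dcube_self [simp]: "x \<in> dcube a l k x"
  by (simp add: dcube_def)

lemma dcube_eq: "y \<in> dcube a l k x \<Longrightarrow> dcube a l k y = dcube a l k x"
  by (auto simp: dcube_def)

lemma dcube_hcube:
  assumes "0 < l"
  shows "dcube a l k x = hcube (\<chi> i. a $ i + l / 2 ^ k * of_int \<lfloor>2 ^ k * (x $ i - a $ i) / l\<rfloor>) (l / 2 ^ k)"
proof -
  have "\<lfloor>2 ^ k * (y - c) / l\<rfloor> = n \<longleftrightarrow>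
     c + l / 2 ^ k * of_int n \<le> y \<and> y < c + l / 2 ^ k * of_int n + l / 2 ^ k" for y c :: real and n
    unfolding floor_eq_iff using assms by (simp add: field_simps)
  then show ?thesis by (simp add: dcube_def hcube_def)
qed

lemma dcube_is_hcube:
  assumes "0 < l"
  obtains b where "dcube a l k x = hcube b (l / 2 ^ k)"
  using dcube_hcube[OF assms] by blast

lemma dcube_sets [measurable, simp]: "0 < l \<Longrightarrow> dcube a l k x \<in> sets lebesgue"
  by (simp add: dcube_hcube)

text \<open>The index of the coarser cube is the integer quotient of the finer index by
  \<open>2 ^ (k - j)\<close>, hence determined by it.\<close>

lemma dcube_mono:
  assumes "j \<le> k"
  shows "dcube a l k x \<subseteq> dcube a l j x"
proof -
  have "\<lfloor>2 ^ j * t / l\<rfloor> = \<lfloor>2 ^ k * t / l\<rfloor> div 2 ^ (k - j)" for t :: real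
  proof -
    have "(2::real) ^ k = 2 ^ j * 2 ^ (k - j)" using assms by (simp add: power_add[symmetric])
    then have "2 ^ j * t / l = (2 ^ k * t / l) / real_of_int (2 ^ (k - j))"
      by simp
    then have "\<lfloor>2 ^ j * t / l\<rfloor> = \<lfloor>(2 ^ k * t / l) / real_of_int (2 ^ (k - j))\<rfloor>" by (rule arg_cong)
    also have "\<dots> = \<lfloor>2 ^ k * t / l\<rfloor> div 2 ^ (k - j)"
      by (rule floor_divide_real_eq_div) simp
    finally show ?thesis .
  qed
  then show ?thesis by (simp add: dcube_def subset_iff)
qed

lemma dcube_zero: "0 < l \<Longrightarrow> x \<in> hcube a l \<Longrightarrow> dcube a l 0 x = hcube a l"
  using dcube_hcube[of l a 0 a] dcube_eq[of x a l 0 a] by (simp add: vec_lambda_eta)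

lemma dcube_subset: "0 < l \<Longrightarrow> x \<in> hcube a l \<Longrightarrow> dcube a l k x \<subseteq> hcube a l"
  using dcube_mono[of 0 k a l x] dcube_zero by blast

lemma dcube_norm_diff:
  assumes "0 < l" "y \<in> dcube a l k x"
  shows "norm (y - x :: real ^ 'n) \<le> real CARD('n) * (l / 2 ^ k)"
proof -
  obtain b where b: "dcube a l k x = hcube b (l / 2 ^ k)" using dcube_is_hcube[OF assms(1)] .
  show ?thesis
    by (rule hcube_norm_diff[of _ b]) (use assms(2) dcube_self[of x a l k] in \<open>simp_all add: b\<close>)
qed

subsection \<open>Young functions\<close>

lemma young_mono: "young \<phi> \<Longrightarrow> 0 \<le> a \<Longrightarrow> a \<le> b \<Longrightarrow> \<phi> a \<le> \<phi> b"
  unfolding young_def using strict_mono_on_leD[of "{0..}" \<phi> a b] by auto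

lemma young_less: "young \<phi> \<Longrightarrow> 0 \<le> a \<Longrightarrow> a < b \<Longrightarrow> \<phi> a < \<phi> b"
  unfolding young_def strict_mono_on_def by auto

lemma young_zero: "young \<phi> \<Longrightarrow> \<phi> 0 = 0"
  by (simp add: young_def)

lemma young_nonneg: "young \<phi> \<Longrightarrow> 0 \<le> a \<Longrightarrow> 0 \<le> \<phi> a"
  using young_mono[of \<phi> 0 a] by (simp add: young_zero)

lemma complementary_bdd:
  assumes "young \<Phi>" "proper_complementary \<Phi>" "0 \<le> t"
  shows "bdd_above ((\<lambda>s. t * s - \<Phi> s) ` {0..})"
proof (cases "t = 0")
  case True
  show ?thesis
  proof (rule bdd_aboveI2)
    fix x :: real assume "x \<in> {0..}"
    then have "0 \<le> \<Phi> x" using young_nonneg[OF assms(1)] by simp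
    then show "t * x - \<Phi> x \<le> 0" using True by simp
  qed
next
  case False
  then have "t > 0" using assms(3) by simp
  then show ?thesis using assms(2) unfolding proper_complementary_def by simp
qed

lemma young_inequality:
  assumes "young \<Phi>" "proper_complementary \<Phi>" "0 \<le> a" "0 \<le> b"
  shows "a * b \<le> \<Phi> a + complementary \<Phi> b"
proof -
  have "b * a - \<Phi> a \<le> complementary \<Phi> b"
    unfolding complementary_def
    by (rule cSUP_upper) (use assms complementary_bdd[OF assms(1,2,4)] in auto)
  then show ?thesis by (simp add: mult.commute)
qed

lemma complementary_nonneg:
  assumes "young \<Phi>" "proper_complementary \<Phi>" "0 \<le> t"
  shows "0 \<le> complementary \<Phi> t"
  using young_inequality[OF assms(1,2) order.refl assms(3)] by (simp add: young_zero[OF assms(1)])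

lemma complementary_zero:
  assumes "young \<Phi>" "proper_complementary \<Phi>"
  shows "complementary \<Phi> 0 = 0"
proof (rule antisym)
  show "complementary \<Phi> 0 \<le> 0"
    unfolding complementary_def
    by (rule cSUP_least) (use young_nonneg[OF assms(1)] in auto)
qed (use complementary_nonneg[OF assms] in auto)

lemma complementary_mono:
  assumes "young \<Phi>" "proper_complementary \<Phi>" "0 \<le> a" "a \<le> b"
  shows "complementary \<Phi> a \<le> complementary \<Phi> b"
  unfolding complementary_def
proof (rule cSUP_mono)
  show "bdd_above ((\<lambda>s. b * s - \<Phi> s) ` {0..})"
    using complementary_bdd[OF assms(1,2)] assms by auto
  show "\<exists>m\<in>{0..}. a * n - \<Phi> n \<le> b * m - \<Phi> m" if "n \<in> {0..}" for n
    using that assms by (intro bexI[of _ n]) (auto intro: mult_right_mono)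
qed auto

lemma complementary_upper:
  assumes "upper_type (complementary \<Phi>) r"
  obtains C where "C > 0" "\<And>x t. 1 \<le> x \<Longrightarrow> 0 \<le> t \<Longrightarrow>
    complementary \<Phi> (x * t) \<le> C * x powr r * complementary \<Phi> t"
  using assms unfolding upper_type_def by auto

lemma complementary_lower_bound:
  assumes "young \<Phi>" "proper_complementary \<Phi>" "lower_type (complementary \<Phi>) s"
  obtains c where "c > 0" "\<And>t. 1 \<le> t \<Longrightarrow> c * t powr s \<le> complementary \<Phi> t"
proof -
  from assms(3) obtain C where C: "C > 0" "\<And>x t. 0 \<le> x \<Longrightarrow> x \<le> 1 \<Longrightarrow> 0 \<le> t \<Longrightarrow>
    complementary \<Phi> (x * t) \<le> C * x powr s * complementary \<Phi> t"
    unfolding lower_type_def by auto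
  have p1: "complementary \<Phi> 1 > 0" using assms(2) by (auto simp: proper_complementary_def)
  have "complementary \<Phi> 1 / C * t powr s \<le> complementary \<Phi> t" if "t \<ge> 1" for t
  proof -
    have "complementary \<Phi> 1 \<le> C * (1/t) powr s * complementary \<Phi> t"
      using C(2)[of "1/t" t] that by simp
    also have "(1/t) powr s = 1 / t powr s" using that by (simp add: powr_divide)
    finally show ?thesis using C(1) that by (simp add: field_simps)
  qed
  then show ?thesis using that[of "complementary \<Phi> 1 / C"] p1 C(1) by auto
qed

lemma young_inv_apply:
  assumes "young \<phi>" "0 \<le> w"
  shows "young_inv \<phi> (\<phi> w) = w"
  unfolding young_inv_def
proof (rule cInf_eq_minimum)
  show "w \<in> {s. 0 \<le> s \<and> \<phi> w \<le> \<phi> s}" using assms by auto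
  show "w \<le> x" if "x \<in> {s. 0 \<le> s \<and> \<phi> w \<le> \<phi> s}" for x
    using that young_less[OF assms(1), of x w] by (force simp: not_less[symmetric])
qed

lemma young_inv_ge:
  assumes "filterlim \<phi> at_top at_top" "\<And>s. 0 \<le> s \<Longrightarrow> z \<le> \<phi> s \<Longrightarrow> l \<le> s"
  shows "l \<le> young_inv \<phi> z"
  unfolding young_inv_def
proof (rule cInf_greatest)
  have "eventually (\<lambda>s. z \<le> \<phi> s \<and> 0 \<le> s) at_top"
    using assms(1) by (intro eventually_conj eventually_ge_at_top) (auto simp: filterlim_at_top)
  then show "{s. 0 \<le> s \<and> z \<le> \<phi> s} \<noteq> {}"
    by (auto simp: eventually_at_top_linorder)
qed (use assms in auto)

lemma young_inv_le:
  assumes "0 \<le> s" "z \<le> \<phi> s"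
  shows "young_inv \<phi> z \<le> s"
  unfolding young_inv_def by (rule cInf_lower) (use assms in \<open>auto intro: bdd_belowI[of _ 0]\<close>)

text \<open>Since \<eta> increases, the integrand on \<open>{T..2 * T}\<close> is at least
  \<open>\<eta> T / (2 * T) powr p / (2 * T)\<close>, so this interval alone contributes a fixed
  multiple of \<open>\<eta> T / T powr p\<close> to a finite integral. The 1 added to
  \<open>J\<close> makes the constant positive.\<close>

lemma B_class_power_bound:
  assumes "young \<eta>" "\<eta> \<in> B_class p" "p > 0"
  obtains c C where "c > 0" "C > 0" "\<And>t. c \<le> t \<Longrightarrow> \<eta> t \<le> C * t powr p"
proof -
  from assms(2) obtain c where c: "c > 0"
    and fin: "(\<integral>\<^sup>+t\<in>{c..}. ennreal (\<eta> t / t powr p / t) \<partial>lborel) < \<infinity>" (is "?I < _")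
    unfolding B_class_def by auto
  define J where "J = enn2real ?I"
  have J: "?I = ennreal J" using fin by (simp add: J_def)
  have J0: "J \<ge> 0" by (simp add: J_def)
  have "\<eta> T \<le> (2 powr (p+1) * (J + 1)) * T powr p" if T: "c \<le> T" for T
  proof -
    have T0: "T > 0" using c T by simp
    define k where "k = \<eta> T / (2*T) powr p / (2*T)"
    have k0: "k \<ge> 0" using young_nonneg[OF assms(1), of T] T0 by (simp add: k_def)
    have "ennreal (k * T) = (\<integral>\<^sup>+t\<in>{T..2*T}. ennreal k \<partial>lborel)"
      using T0 k0 by (subst nn_integral_cmult_indicator) (auto simp: ennreal_mult')
    also have "\<dots> \<le> ?I"
    proof (intro nn_integral_mono)
      fix t
      show "ennreal k * indicator {T..2*T} t \<le> ennreal (\<eta> t / t powr p / t) * indicator {c..} t"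
      proof (cases "t \<in> {T..2*T}")
        case True
        then have t: "T \<le> t" "t \<le> 2*T" "0 < t" using T0 by auto
        have "k \<le> \<eta> t / t powr p / t"
          unfolding k_def
          using t T0 young_mono[OF assms(1), of T t] young_nonneg[OF assms(1), of T] assms(3)
          by (intro frac_le divide_nonneg_nonneg powr_mono2) auto
        then show ?thesis using True T by (auto intro: ennreal_leI)
      qed auto
    qed
    finally have "k * T \<le> J" unfolding J using J0 by simp
    moreover have "k * T = \<eta> T / (T powr p * 2 powr (p+1))"
      using T0 by (simp add: k_def powr_mult powr_add)
    ultimately have "\<eta> T / (T powr p * 2 powr (p+1)) \<le> J" by simp
    then have "\<eta> T \<le> J * (T powr p * 2 powr (p+1))"
      using T0 by (subst (asm) pos_divide_le_eq) auto
    also have "\<dots> \<le> (J+1) * (T powr p * 2 powr (p+1))"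
      by (intro mult_right_mono) auto
    finally show ?thesis by (simp add: algebra_simps)
  qed
  then show ?thesis using that[of c "2 powr (p+1) * (J + 1)"] c J0 by auto
qed

text \<open>Inversion of the power bound. The threshold \<open>z1\<close> is at least
  \<open>\<eta> b\<close>, so that every \<open>s\<close> with \<open>z \<le> \<eta> s\<close> lies
  in the range where the bound holds.\<close>

lemma young_inv_B_class:
  assumes "young \<eta>" "\<eta> \<in> B_class p" "p > 0"
  obtains c z1 where "c > 0" "z1 \<ge> 1" "\<And>z. z1 \<le> z \<Longrightarrow> c * z powr (1/p) \<le> young_inv \<eta> z"
proof -
  obtain b C where b: "b > 0" "C > 0" "\<And>t. b \<le> t \<Longrightarrow> \<eta> t \<le> C * t powr p"
    using B_class_power_bound[OF assms] by blast
  define z1 where "z1 = max 1 (\<eta> b)"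
  have "(1/C) powr (1/p) * z powr (1/p) \<le> young_inv \<eta> z" if z: "z1 \<le> z" for z
  proof (rule young_inv_ge)
    show "filterlim \<eta> at_top at_top" using assms(1) by (simp add: young_def)
    fix s :: real assume s: "0 \<le> s" "z \<le> \<eta> s"
    have z0: "z \<ge> 1" using z by (simp add: z1_def)
    have "b \<le> s"
    proof (rule ccontr)
      assume "\<not> b \<le> s"
      then have "\<eta> s < \<eta> b" using young_less[OF assms(1)] s by auto
      then show False using s z by (simp add: z1_def)
    qed
    then have "z \<le> C * s powr p" using b(3)[of s] s by linarith
    then have "z / C \<le> s powr p" using b by (simp add: field_simps)
    then have "(z/C) powr (1/p) \<le> (s powr p) powr (1/p)"
      using z0 b assms(3) by (intro powr_mono2) auto
    then show "(1/C) powr (1/p) * z powr (1/p) \<le> s"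
      using s assms(3) b z0 by (simp add: powr_powr powr_divide)
  qed
  then show ?thesis using that[of "(1/C) powr (1/p)" z1] b by (auto simp: z1_def)
qed

text \<open>The bump condition and \<open>\<eta> \<in> B\<^bsub>p'\<^esub>\<close> first force \<open>\<phi>\<close> to grow faster than \<open>w\<^sup>p\<close>; inserting
  this into the bump condition again shows that \<open>\<phi>\<^sub>p\<close> dominates the complementary function of \<open>\<Phi>\<close>
  with a power to spare.\<close>

lemma power_gap:
  assumes Y: "young \<Phi>" "proper_complementary \<Phi>"
    and sr: "1 < s" "s < r" "upper_type (complementary \<Phi>) r" "lower_type (complementary \<Phi>) s"
    and p: "1 < p" "p < conj_exp r"
    and e: "young \<eta>" "young \<phi>" "\<eta> \<in> B_class (conj_exp p)"
    and b: "\<exists>c>0. \<forall>z\<ge>z0. young_inv \<eta> z * young_inv \<phi> z \<le> c * young_inv (complementary \<Phi>) z"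
  obtains \<epsilon> C where "\<epsilon> > 0" "C > 0"
    "\<And>y. 0 \<le> y \<Longrightarrow> complementary \<Phi> (y powr (1 + \<epsilon>)) \<le> C * (1 + \<phi> (y powr (1/p)))"
proof -
  define pp where "pp = conj_exp p"
  \<comment> \<open>This is \<open>p < r'\<close> read for the conjugate exponents, since
    conjugation reverses the order.\<close>
  have ppr: "pp > r"
  proof -
    have "p * (r - 1) < r" using p sr by (simp add: conj_exp_def field_simps)
    then have "r * (p - 1) < p" by (simp add: algebra_simps)
    then show ?thesis using p by (simp add: pp_def conj_exp_def field_simps)
  qed
  have pp1: "1 / pp = 1 - 1 / p" using p by (simp add: pp_def conj_exp_def field_simps)
  have pp0: "pp > 0" "pp > 1" using ppr sr by auto
  obtain c1 z1 where c1: "c1 > 0" "z1 \<ge> 1" "\<And>z. z1 \<le> z \<Longrightarrow> c1 * z powr (1/pp) \<le> young_inv \<eta> z"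
    using young_inv_B_class[OF e(1,3)] pp0 by (auto simp: pp_def)
  obtain c2 where c2: "c2 > 0" "\<And>z. z0 \<le> z \<Longrightarrow>
      young_inv \<eta> z * young_inv \<phi> z \<le> c2 * young_inv (complementary \<Phi>) z"
    using b by auto
  obtain cs where cs: "cs > 0" "\<And>t. 1 \<le> t \<Longrightarrow> cs * t powr s \<le> complementary \<Phi> t"
    using complementary_lower_bound[OF Y sr(4)] by blast
  obtain Cr where Cr: "Cr > 0" "\<And>x t. 1 \<le> x \<Longrightarrow> 0 \<le> t \<Longrightarrow>
    complementary \<Phi> (x * t) \<le> Cr * x powr r * complementary \<Phi> t"
    using complementary_upper[OF sr(3)] by blast
  \<comment> \<open>Half of the constant that the bump condition suggests: the factor 2 leaves the
    strict inequality from which \<open>key\<close> gets its contradiction.\<close>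
  define c3 where "c3 = c1 / (2 * c2)"
  have c3: "c3 > 0" using c1 c2 by (simp add: c3_def)
  have "eventually (\<lambda>w. max z0 z1 \<le> \<phi> w \<and> 1 \<le> w \<and> 1 / c3 \<le> w) at_top"
  proof (intro eventually_conj eventually_ge_at_top)
    have "filterlim \<phi> at_top at_top" using e(2) by (simp add: young_def)
    then show "\<forall>\<^sub>F w in at_top. max z0 z1 \<le> \<phi> w" unfolding filterlim_at_top by blast
  qed
  then obtain w0 where w0: "\<And>w. w0 \<le> w \<Longrightarrow> max z0 z1 \<le> \<phi> w \<and> 1 \<le> w \<and> 1 / c3 \<le> w"
    by (auto simp: eventually_at_top_linorder)
  \<comment> \<open>The bump condition at \<open>z = \<phi> w\<close>, where the inverse of \<phi>
    equals \<open>w\<close> and that of \<eta> is at least \<open>c1 * z powr (1/pp)\<close>. If the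
    complementary function exceeded \<open>\<phi> w\<close> at this point, its inverse at
    \<open>z\<close> would be too small.\<close>
  have key: "complementary \<Phi> (c3 * (\<phi> w powr (1/pp) * w)) \<le> \<phi> w" if w: "w0 \<le> w" for w
  proof (rule ccontr)
    have w1: "w \<ge> 1" "\<phi> w \<ge> z0" "\<phi> w \<ge> z1" using w0[OF w] by auto
    then have ph: "\<phi> w \<ge> 1" using c1 by auto
    assume "\<not> ?thesis"
    then have "young_inv (complementary \<Phi>) (\<phi> w) \<le> c3 * (\<phi> w powr (1/pp) * w)"
      using w1 c3 by (intro young_inv_le) auto
    then have "c2 * young_inv (complementary \<Phi>) (\<phi> w) \<le> c1 / 2 * (\<phi> w powr (1/pp) * w)"
      using c2(1) by (simp add: c3_def field_simps)
    moreover have "c1 * \<phi> w powr (1/pp) * w \<le> young_inv \<eta> (\<phi> w) * young_inv \<phi> (\<phi> w)"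
      using w1 c1(3)[of "\<phi> w"] by (simp add: young_inv_apply[OF e(2)] mult_right_mono)
    moreover have "c1 * \<phi> w powr (1/pp) * w > 0" using c1 ph w1 by auto
    ultimately show False using c2(2)[OF w1(2)] by simp
  qed
  \<comment> \<open>Lower type \<open>s\<close> in \<open>key\<close> bounds \<open>w powr s\<close>
    by a multiple of \<open>\<phi> w powr (1 - s/pp)\<close>, which is growth of \<phi> at least
    like \<open>w powr m\<close>. As \<open>s > 1\<close>, \<open>1/m\<close> is less than
    \<open>1 - 1/pp = 1/p\<close>, hence \<open>m > p\<close>.\<close>
  define m where "m = 1 / (1/s - 1/pp)"
  have spp: "1/s - 1/pp > 0" using ppr sr pp0 by (simp add: field_simps)
  have mp: "m > p"
  proof -
    have "1/s - 1/pp < 1/p" using sr by (simp add: pp1)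
    then show ?thesis using spp p by (simp add: m_def field_simps)
  qed
  have mid: "s / (1 - s / pp) = m"
    using sr pp0 spp by (simp add: m_def field_simps)
  have s1: "1 - s/pp > 0" using ppr sr pp0 by (simp add: field_simps)
  define c4 where "c4 = (cs * c3 powr s) powr (1 / (1 - s/pp))"
  have c4: "c4 > 0" using cs c3 by (simp add: c4_def)
  have low: "c4 * w powr m \<le> \<phi> w" if w: "w0 \<le> w" for w
  proof -
    have w1: "w \<ge> 1" "\<phi> w \<ge> z0" "\<phi> w \<ge> z1" "c3 * w \<ge> 1" using w0[OF w] c3 by (auto simp: field_simps)
    then have ph: "\<phi> w \<ge> 1" using c1 by auto
    then have ph1: "\<phi> w powr (1/pp) \<ge> 1" using pp0 by (intro ge_one_powr_ge_zero) auto
    have "1 \<le> (c3 * w) * \<phi> w powr (1/pp)"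
      using mult_mono[of 1 "c3 * w" 1 "\<phi> w powr (1/pp)"] w1 ph1 by auto
    then have "cs * (c3 * (\<phi> w powr (1/pp) * w)) powr s \<le> \<phi> w"
      using key[OF w] cs(2)[of "c3 * (\<phi> w powr (1/pp) * w)"] by (simp add: ac_simps)
    also have "(c3 * (\<phi> w powr (1/pp) * w)) powr s = c3 powr s * w powr s * \<phi> w powr (s/pp)"
      using c3 w1 ph by (simp add: powr_mult powr_powr)
    finally have "(cs * c3 powr s) * w powr s \<le> \<phi> w / \<phi> w powr (s/pp)"
      using ph by (simp add: field_simps)
    also have "\<dots> = \<phi> w powr (1 - s/pp)" using ph by (simp add: powr_diff)
    finally have "((cs * c3 powr s) * w powr s) powr (1/(1 - s/pp)) \<le> (\<phi> w powr (1 - s/pp)) powr (1/(1 - s/pp))"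
      using s1 cs c3 by (intro powr_mono2) auto
    moreover have "(\<phi> w powr (1 - s/pp)) powr (1/(1 - s/pp)) = \<phi> w"
      using s1 ph pp0 by (simp only: powr_powr) auto
    ultimately show ?thesis
      using s1 ph cs c3 w1 by (simp add: powr_mult powr_powr c4_def mid)
  qed
  \<comment> \<open>With \<open>\<phi> w \<ge> c4 * w powr m\<close> the argument in
    \<open>key\<close> is at least a multiple of \<open>w powr (1 + m/pp)\<close>, which is
    \<open>y powr (1 + \<epsilon>)\<close> for \<open>w = y powr (1/p)\<close>. Growth of order
    exactly \<open>p\<close> would give the exponent 1, so \<open>m > p\<close> is the gain.\<close>
  define \<epsilon> where "\<epsilon> = (1 + m/pp)/p - 1"
  have eps: "\<epsilon> > 0"
  proof -
    have "p = 1 + p / pp" using p pp1 by (simp add: field_simps)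
    also have "\<dots> < 1 + m/pp" using mp pp0 by (simp add: divide_strict_right_mono)
    finally show ?thesis using p by (simp add: \<epsilon>_def field_simps)
  qed
  define c5 where "c5 = c3 * c4 powr (1/pp)"
  have c5: "c5 > 0" using c3 c4 by (simp add: c5_def)
  \<comment> \<open>The constant \<open>c5\<close> may be below 1; the upper type \<open>r\<close>
    removes it at the cost \<open>b5 powr r\<close>.\<close>
  define b5 where "b5 = max 1 (1 / c5)"
  have b5: "b5 \<ge> 1" "b5 * c5 \<ge> 1" using c5 by (auto simp: b5_def max_def field_simps)
  define y0 where "y0 = (max w0 1) powr p"
  have big: "complementary \<Phi> (y powr (1+\<epsilon>)) \<le> Cr * b5 powr r * \<phi> (y powr (1/p))" if y: "y \<ge> y0" for y
  proof -
    define w where "w = y powr (1/p)"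
    have y1: "y \<ge> 1"
    proof -
      have "y0 \<ge> 1" unfolding y0_def using p by (intro ge_one_powr_ge_zero) auto
      then show ?thesis using y by simp
    qed
    have "w \<ge> y0 powr (1/p)" unfolding w_def using y p y0_def by (intro powr_mono2) auto
    moreover have "y0 powr (1/p) = max w0 1" using p by (simp add: y0_def powr_powr)
    ultimately have w: "w \<ge> w0" "w \<ge> 1" by auto
    have yw: "y powr (1+\<epsilon>) = w powr (1 + m/pp)" using p
      by (simp add: w_def powr_powr \<epsilon>_def)
    have "c5 * w powr (1 + m/pp) = c3 * ((c4 * w powr m) powr (1/pp) * w)"
      using w c4 by (simp add: c5_def powr_mult powr_powr powr_add)
    also have "\<dots> \<le> c3 * (\<phi> w powr (1/pp) * w)"
      using low[OF w(1)] c3 w c4 pp0 by (intro mult_left_mono mult_right_mono powr_mono2) auto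
    finally have le: "c5 * w powr (1 + m/pp) \<le> c3 * (\<phi> w powr (1/pp) * w)" .
    have "complementary \<Phi> (w powr (1 + m/pp)) \<le> complementary \<Phi> (b5 * (c5 * w powr (1 + m/pp)))"
      using mult_right_mono[OF b5(2), of "w powr (1 + m/pp)"] by (intro complementary_mono[OF Y]) (auto simp: mult_ac)
    also have "\<dots> \<le> Cr * b5 powr r * complementary \<Phi> (c5 * w powr (1 + m/pp))"
      using b5 c5 by (intro Cr(2)) auto
    also have "\<dots> \<le> Cr * b5 powr r * complementary \<Phi> (c3 * (\<phi> w powr (1/pp) * w))"
      using Cr(1) le c5 by (intro mult_left_mono complementary_mono[OF Y]) auto
    also have "\<dots> \<le> Cr * b5 powr r * \<phi> w"
      using Cr(1) key[OF w(1)] by (intro mult_left_mono) auto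
    finally show ?thesis by (simp add: yw w_def)
  qed
  define C where "C = Cr * b5 powr r + complementary \<Phi> (y0 powr (1+\<epsilon>))"
  have nn: "complementary \<Phi> (y0 powr (1+\<epsilon>)) \<ge> 0" using complementary_nonneg[OF Y] by auto
  have C: "C > 0" using Cr(1) b5 nn by (auto simp: C_def intro!: add_pos_nonneg)
  have "complementary \<Phi> (y powr (1 + \<epsilon>)) \<le> C * (1 + \<phi> (y powr (1/p)))" if y: "0 \<le> y" for y
  proof -
    have f0: "\<phi> (y powr (1/p)) \<ge> 0" using young_nonneg[OF e(2)] by auto
    show ?thesis
    proof (cases "y \<ge> y0")
      case True
      have "Cr * b5 powr r * \<phi> (y powr (1/p)) \<le> C * (1 + \<phi> (y powr (1/p)))"
        using f0 nn Cr(1) by (intro mult_mono) (auto simp: C_def)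
      then show ?thesis using big[OF True] by linarith
    next
      case False
      then have "complementary \<Phi> (y powr (1 + \<epsilon>)) \<le> complementary \<Phi> (y0 powr (1 + \<epsilon>))"
        using y eps by (intro complementary_mono[OF Y] powr_mono2) auto
      also have "\<dots> \<le> C * 1" using Cr(1) by (simp add: C_def)
      also have "\<dots> \<le> C * (1 + \<phi> (y powr (1/p)))" using C f0 by (intro mult_left_mono) auto
      finally show ?thesis .
    qed
  qed
  then show ?thesis using that eps C by blast
qed

text \<open>Let \<open>m\<close> be the maximum of 1, \<open>x\<close> and
  \<open>z powr \<theta>\<close>, where \<open>\<theta> = 1/(2*a)\<close>. If \<open>y\<close> is at
  least \<open>m powr (2/\<epsilon>)\<close>, the two outer factors are at most
  \<open>y powr (\<epsilon>/2)\<close> each and the gap applies. Otherwise the whole product is at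
  most a power of \<open>m\<close>, and the upper type turns it into \<open>m powr N\<close>. Now
  \<open>a \<ge> N\<close> pays for \<open>x\<close> and \<open>\<theta> * N \<le> \<beta>\<close>
  pays for \<open>z\<close>; both hold once \<open>a\<close> is large.\<close>

lemma three_factor_bound:
  fixes \<Psi> f :: "real \<Rightarrow> real"
  assumes mono: "\<And>a b. 0 \<le> a \<Longrightarrow> a \<le> b \<Longrightarrow> \<Psi> a \<le> \<Psi> b" and nn: "\<And>a. 0 \<le> a \<Longrightarrow> 0 \<le> \<Psi> a"
    and up: "0 < r" "0 < Cr" "\<And>x t. 1 \<le> x \<Longrightarrow> 0 \<le> t \<Longrightarrow> \<Psi> (x * t) \<le> Cr * x powr r * \<Psi> t"
    and gap: "0 < \<epsilon>" "0 < C" "\<And>y. 0 \<le> y \<Longrightarrow> \<Psi> (y powr (1 + \<epsilon>)) \<le> C * (1 + f y)"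
    and f: "\<And>y. 0 \<le> y \<Longrightarrow> 0 \<le> f y" and \<beta>: "0 < \<beta>"
  obtains a D where "1 \<le> a" "0 < D"
    "\<And>x y z. 0 \<le> x \<Longrightarrow> 0 \<le> y \<Longrightarrow> 0 \<le> z \<Longrightarrow>
      \<Psi> (x * y powr (1 - 1/(2*a)) * z powr (1/(2*a))) \<le> D * (1 + x powr a + (1 + f y) * max 1 z powr \<beta>)"
proof -
  define M where "M = 2 / \<epsilon>"
  have M: "M > 0" using gap by (simp add: M_def)
  define N where "N = r * (M + 2)"
  have N: "N > 0" using up M by (simp add: N_def)
  define a where "a = max 1 (max N (N / (2*\<beta>)))"
  have a: "a \<ge> 1" "a \<ge> N" "a \<ge> N / (2*\<beta>)" by (auto simp: a_def)
  define \<theta> where "\<theta> = 1 / (2*a)"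
  have \<theta>: "0 < \<theta>" "\<theta> < 1" "\<theta> * N \<le> \<beta>" using a \<beta> by (auto simp: \<theta>_def field_simps)
  define D where "D = C + Cr * \<Psi> 1"
  have D: "D > 0" using gap up nn[of 1] by (auto simp: D_def intro!: add_pos_nonneg)
  have "\<Psi> (x * y powr (1 - \<theta>) * z powr \<theta>) \<le> D * (1 + x powr a + (1 + f y) * max 1 z powr \<beta>)"
    if x: "0 \<le> x" and y: "0 \<le> y" and z: "0 \<le> z" for x y z
  proof -
    define m where "m = max 1 (max x (z powr \<theta>))"
    have m: "m \<ge> 1" "x \<le> m" "z powr \<theta> \<le> m" by (auto simp: m_def)
    define Z where "Z = max 1 z powr \<beta>"
    have z1: "Z \<ge> 1" unfolding Z_def using \<beta> by (intro ge_one_powr_ge_zero) auto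
    have fy: "0 \<le> f y" using f y by auto
    show ?thesis
    proof (cases "m powr M \<le> y")
      case True
      have "1 \<le> m powr M" using m M by (intro ge_one_powr_ge_zero) auto
      then have y1: "y \<ge> 1" using True by simp
      have my: "m \<le> y powr (1/M)"
      proof -
        have "(m powr M) powr (1/M) \<le> y powr (1/M)" using True M by (intro powr_mono2) auto
        then show ?thesis using m M by (simp add: powr_powr)
      qed
      have "x * y powr (1 - \<theta>) * z powr \<theta> \<le> y powr (1/M) * y powr 1 * y powr (1/M)"
        using m my x y1 \<theta> by (intro mult_mono powr_mono) (auto intro: order.trans)
      also have "\<dots> = y powr (1 + \<epsilon>)" by (simp only: powr_add[symmetric]) (simp add: M_def add_divide_distrib add.commute)
      finally have "\<Psi> (x * y powr (1 - \<theta>) * z powr \<theta>) \<le> \<Psi> (y powr (1 + \<epsilon>))"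
        using x by (intro mono) auto
      also have "\<dots> \<le> C * (1 + f y)" using gap y by auto
      also have "\<dots> \<le> D * (1 + x powr a + (1 + f y) * Z)"
      proof (rule mult_mono)
        have "(1 + f y) * 1 \<le> (1 + f y) * Z" using z1 fy by (intro mult_left_mono) auto
        moreover have "0 \<le> 1 + x powr a" by (simp add: add_nonneg_nonneg)
        ultimately have "0 + (1 + f y) * 1 \<le> (1 + x powr a) + (1 + f y) * Z" by (intro add_mono)
        then show "1 + f y \<le> 1 + x powr a + (1 + f y) * Z" by simp
      qed (use D up nn[of 1] fy in \<open>auto simp: D_def\<close>)
      finally show ?thesis unfolding Z_def .
    next
      case False
      have "x * y powr (1 - \<theta>) * z powr \<theta> \<le> m * (m powr M) powr 1 * m"
      proof (intro mult_mono)
        have "y powr (1-\<theta>) \<le> (m powr M) powr (1-\<theta>)" using False y \<theta> by (intro powr_mono2) auto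
        also have "\<dots> \<le> (m powr M) powr 1" using m M \<theta>
          by (intro powr_mono ge_one_powr_ge_zero) auto
        finally show "y powr (1 - \<theta>) \<le> (m powr M) powr 1" .
      qed (use m x in auto)
      also have "\<dots> = m powr (M + 2) * 1" using m by (simp add: powr_add power2_eq_square)
      finally have "\<Psi> (x * y powr (1 - \<theta>) * z powr \<theta>) \<le> \<Psi> (m powr (M+2) * 1)"
        using x by (intro mono) auto
      also have "\<dots> \<le> Cr * (m powr (M+2)) powr r * \<Psi> 1"
        using m M by (intro up(3) ge_one_powr_ge_zero) auto
      also have "\<dots> = Cr * \<Psi> 1 * m powr N" by (simp add: powr_powr N_def mult_ac)
      also have "\<dots> \<le> D * (1 + x powr a + (1 + f y) * Z)"
      proof (rule mult_mono)
        have g: "Z \<le> (1 + f y) * Z"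
          using fy z1 by (intro order.trans[OF _ mult_right_mono[of 1 "1 + f y"]]) auto
        have xa: "0 \<le> x powr a" by simp
        have "m = 1 \<or> m = x \<or> m = z powr \<theta>" unfolding m_def by linarith
        then consider "m = 1" | "m = x" | "m = z powr \<theta>" by blast
        then show "m powr N \<le> 1 + x powr a + (1 + f y) * Z"
        proof cases
          case 1 then show ?thesis using xa g z1 by simp
        next
          case 2
          then have "m powr N \<le> x powr a" using m a by (auto intro: powr_mono)
          then show ?thesis using g z1 by linarith
        next
          case 3
          have "z \<ge> 1"
          proof (rule ccontr)
            assume "\<not> z \<ge> 1"
            then have "z powr \<theta> < 1 powr \<theta>" using z \<theta> by (intro powr_less_mono2) auto
            then show False using m(1) 3 by simp
          qed
          with 3 have "m powr N \<le> Z" using \<theta> by (auto simp: powr_powr Z_def intro!: powr_mono)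
          then show ?thesis using g xa by linarith
        qed
      qed (use D gap up nn[of 1] in \<open>auto simp: D_def\<close>)
      finally show ?thesis unfolding Z_def .
    qed
  qed
  then show ?thesis using that a(1) D unfolding \<theta>_def by blast
qed

lemma set_integrable_bounded_mult:
  fixes h :: "'a \<Rightarrow> 'b::{banach, second_countable_topology, real_normed_field}" and w :: "'a \<Rightarrow> real"
  assumes [measurable]: "h \<in> borel_measurable M" and b: "AE x in M. x \<in> A \<longrightarrow> norm (h x) \<le> C"
    and w: "set_integrable M A w"
  shows "set_integrable M A (\<lambda>x. h x * of_real (w x))"
proof -
  have w'[measurable]: "(\<lambda>x. indicator A x *\<^sub>R w x) \<in> borel_measurable M"
    using w by (auto simp: set_integrable_def)
  have eq: "indicator A x *\<^sub>R (h x * of_real (w x)) = h x * of_real (indicator A x *\<^sub>R w x)" for x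
    by (simp add: scaleR_conv_of_real indicator_def)
  have "integrable M (\<lambda>x. h x * of_real (indicator A x *\<^sub>R w x))"
  proof (rule Bochner_Integration.integrable_bound)
    show "integrable M (\<lambda>x. C * (indicator A x *\<^sub>R w x))"
      using w by (auto simp: set_integrable_def)
    show "AE x in M. norm (h x * of_real (indicator A x *\<^sub>R w x)) \<le> norm (C * (indicator A x *\<^sub>R w x))"
      using b by eventually_elim
        (auto simp: norm_mult indicator_def abs_mult intro!: mult_right_mono intro: order.trans[OF _ abs_ge_self])
  qed measurable
  then show ?thesis by (simp add: set_integrable_def eq)
qed

lemma set_integral_AE_pos:
  fixes w :: "real ^ 'n \<Rightarrow> real"
  assumes "A \<in> sets lebesgue" "set_integrable lebesgue A w" "AE x in lebesgue. x \<in> A \<longrightarrow> 0 < w x"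
    and "emeasure lebesgue A \<noteq> 0"
  shows "0 < (LINT x:A|lebesgue. w x)"
proof -
  have nn: "AE x in lebesgue. 0 \<le> indicator A x *\<^sub>R w x"
    using assms(3) by eventually_elim (auto simp: indicator_def)
  have "0 \<le> (LINT x:A|lebesgue. w x)"
    unfolding set_lebesgue_integral_def using nn by (rule integral_nonneg_AE)
  moreover have "(LINT x:A|lebesgue. w x) \<noteq> 0"
  proof
    assume "(LINT x:A|lebesgue. w x) = 0"
    then have "AE x in lebesgue. indicator A x *\<^sub>R w x = 0"
      using integral_nonneg_eq_0_iff_AE[OF assms(2)[unfolded set_integrable_def] nn]
      by (simp add: set_lebesgue_integral_def)
    then have "AE x in lebesgue. x \<notin> A"
      using assms(3) by eventually_elim (auto simp: indicator_def)
    then have "emeasure lebesgue A = 0"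
      using assms(1) AE_iff_measurable[of A lebesgue "\<lambda>x. x \<notin> A"] by simp
    then show False using assms(4) by simp
  qed
  ultimately show ?thesis by simp
qed

section \<open>Maximal dyadic cubes with a given property\<close>

text \<open>Along the chain of dyadic cubes through each point of \<open>X\<close> the first one
  with \<open>P\<close> is kept. These are the maximal cubes with \<open>P\<close>, among all
  generations from 0 on, that meet \<open>X\<close>.\<close>

definition stopping_cubes ::
  "real ^ 'n \<Rightarrow> real \<Rightarrow> ((real ^ 'n) set \<Rightarrow> bool) \<Rightarrow> (real ^ 'n) set \<Rightarrow> (real ^ 'n) set set" where
  "stopping_cubes a l P X =
     {dcube a l k x | k x. x \<in> X \<and> P (dcube a l k x) \<and> (\<forall>j<k. \<not> P (dcube a l j x))}"

lemma stopping_cubesE: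
  assumes "Q \<in> stopping_cubes a l P X"
  obtains k x where "x \<in> X" "Q = dcube a l k x" "P Q" "\<And>j. j < k \<Longrightarrow> \<not> P (dcube a l j x)"
  using assms unfolding stopping_cubes_def by blast

lemma dcube_eq_lower: "z \<in> dcube a l k x \<Longrightarrow> j \<le> k \<Longrightarrow> dcube a l j z = dcube a l j x"
  using dcube_mono[of j k a l x] dcube_eq by blast

text \<open>Dyadic cubes that meet are nested, and a chain that ends in the finer one would already
  have stopped at the coarser one.\<close>

lemma stopping_cubes_disjoint: "disjoint (stopping_cubes a l P X)"
proof -
  have aux: "k2 \<le> k1"
    if "z \<in> dcube a l k1 x1" "z \<in> dcube a l k2 x2" "P (dcube a l k1 x1)"
      "\<And>j. j < k2 \<Longrightarrow> \<not> P (dcube a l j x2)" for k1 k2 x1 x2 z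
  proof (rule ccontr)
    assume n: "\<not> k2 \<le> k1"
    then have "dcube a l k1 z = dcube a l k1 x2" using dcube_eq_lower[OF that(2)] by auto
    moreover have "dcube a l k1 z = dcube a l k1 x1" using dcube_eq[OF that(1)] .
    ultimately show False using that(3) that(4)[of k1] n by auto
  qed
  have "Q1 = Q2" if Q: "Q1 \<in> stopping_cubes a l P X" "Q2 \<in> stopping_cubes a l P X" "z \<in> Q1" "z \<in> Q2" for Q1 Q2 z
  proof -
    obtain k1 x1 where 1: "Q1 = dcube a l k1 x1" "P Q1" "\<And>j. j < k1 \<Longrightarrow> \<not> P (dcube a l j x1)"
      using stopping_cubesE[OF Q(1)] by metis
    obtain k2 x2 where 2: "Q2 = dcube a l k2 x2" "P Q2" "\<And>j. j < k2 \<Longrightarrow> \<not> P (dcube a l j x2)"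
      using stopping_cubesE[OF Q(2)] by metis
    have z: "z \<in> dcube a l k1 x1" "z \<in> dcube a l k2 x2" using Q 1(1) 2(1) by auto
    have "k1 = k2"
      using aux[OF z] aux[OF z(2,1)] 1 2 by (metis order_antisym)
    then show ?thesis using dcube_eq[OF z(1)] dcube_eq[OF z(2)] 1(1) 2(1) by simp
  qed
  then show ?thesis unfolding pairwise_def disjnt_def by blast
qed

lemma stopping_cubes_hcube:
  assumes "0 < l" "Q \<in> stopping_cubes a l P X"
  obtains b k where "Q = hcube b (l / 2 ^ k)"
  using assms stopping_cubesE dcube_is_hcube by metis

lemma stopping_cubes_countable:
  assumes "0 < l"
  shows "countable (stopping_cubes a l P X)"
proof (rule countable_disjoint_nonempty_interior_subsets[OF stopping_cubes_disjoint])
  fix Q assume "Q \<in> stopping_cubes a l P X" "interior Q = {}"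
  moreover obtain b k where "Q = hcube b (l / 2 ^ k)" using stopping_cubes_hcube[OF assms calculation(1)] .
  ultimately have "box b (b + vec (l / 2 ^ k)) = {}"
    using interior_maximal[OF box_subset_hcube open_box] by blast
  moreover have "box b (b + vec (l / 2 ^ k)) \<noteq> {}" using assms by (simp add: interval_ne_empty_cart)
  ultimately show "Q = {}" by simp
qed

lemma stopping_cubes_sets: "0 < l \<Longrightarrow> stopping_cubes a l P X \<subseteq> sets lebesgue"
  by (auto elim!: stopping_cubesE)

lemma stopping_cubes_cover:
  assumes "x \<in> X" "P (dcube a l k x)"
  shows "x \<in> \<Union> (stopping_cubes a l P X)"
proof -
  define k0 where "k0 = (LEAST k. P (dcube a l k x))"
  have "P (dcube a l k0 x)" using LeastI[of "\<lambda>k. P (dcube a l k x)", OF assms(2)] by (simp add: k0_def)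
  moreover have "\<not> P (dcube a l j x)" if "j < k0" for j
    using not_less_Least[of j "\<lambda>k. P (dcube a l k x)"] that by (simp add: k0_def)
  ultimately have "dcube a l k0 x \<in> stopping_cubes a l P X"
    using assms(1) unfolding stopping_cubes_def by blast
  then show ?thesis by (meson UnionI dcube_self)
qed

lemma ex_dcube_subset_open:
  assumes "0 < l" "open U" "x \<in> U"
  obtains k where "dcube a l k (x :: real ^ 'n) \<subseteq> U"
proof -
  obtain e where e: "e > 0" "ball x e \<subseteq> U" using assms by (meson openE)
  have "(\<lambda>k. real CARD('n) * l * (1/2) ^ k) \<longlonglongrightarrow> real CARD('n) * l * 0"
    by (intro tendsto_intros) auto
  then have "eventually (\<lambda>k. real CARD('n) * l * (1/2) ^ k < e) sequentially"
    using e by (intro order_tendstoD) auto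
  then obtain k where k: "real CARD('n) * l * (1/2) ^ k < e"
    by (auto simp: eventually_sequentially)
  have "dcube a l k x \<subseteq> ball x e"
    using dcube_norm_diff[OF assms(1), of _ a k x] k
    by (force simp: dist_norm norm_minus_commute power_divide mem_ball)
  then show ?thesis using e that by blast
qed

subsection \<open>Calderon--Zygmund decomposition\<close>

text \<open>The decomposition is relative to the measure \<open>w dx\<close> and serves twice: for
  \<open>f\<close> with \<open>w = v\<close>, and for the test function with \<open>w = 1\<close> in
  the local bound.\<close>

locale calderon_zygmund =
  fixes a :: "real ^ 'n" and l :: real and w :: "real ^ 'n \<Rightarrow> real" and f :: "real ^ 'n \<Rightarrow> complex"
    and B D :: real
  assumes l: "0 < l" and w: "set_integrable lebesgue (hcube a l) w"
    and w_pos: "AE x in lebesgue. x \<in> hcube a l \<longrightarrow> 0 < w x"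
    and f_meas [measurable]: "f \<in> borel_measurable lebesgue" and f_bound: "\<And>x. norm (f x) \<le> B"
    and D1: "1 \<le> D"
    and doubling: "\<And>k x. x \<in> hcube a l \<Longrightarrow>
      (LINT y:dcube a l k x|lebesgue. w y) \<le> D * (LINT y:dcube a l (Suc k) x|lebesgue. w y)"
begin

definition "W A = (LINT x:A|lebesgue. w x)"
definition "F A = (LINT x:A|lebesgue. norm (f x) * w x)"
definition "stops lam A \<longleftrightarrow> lam * W A < F A"
definition "S lam = stopping_cubes a l (stops lam) (hcube a l)"
text \<open>The good part at height \<open>lam\<close>: on each stopping cube the mean of
  \<open>f\<close> with respect to \<open>w dx\<close>, elsewhere \<open>f\<close> itself. The
  stopping cubes are disjoint, so the description singles out one cube.\<close>

definition "g lam x = (if x \<in> \<Union> (S lam)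
  then let Q = THE Q. Q \<in> S lam \<and> x \<in> Q in (LINT y:Q|lebesgue. f y * of_real (w y)) / of_real (W Q) else f x)"

lemma w_subset: "A \<in> sets lebesgue \<Longrightarrow> A \<subseteq> hcube a l \<Longrightarrow> set_integrable lebesgue A w"
  using set_integrable_subset[OF w] .

lemma fw_integrable:
  "A \<in> sets lebesgue \<Longrightarrow> A \<subseteq> hcube a l \<Longrightarrow> set_integrable lebesgue A (\<lambda>x. f x * of_real (w x))"
  using f_bound by (intro set_integrable_bounded_mult[where C=B] w_subset) auto

lemma nfw_integrable:
  "A \<in> sets lebesgue \<Longrightarrow> A \<subseteq> hcube a l \<Longrightarrow> set_integrable lebesgue A (\<lambda>x. norm (f x) * w x)"
  using f_bound set_integrable_bounded_mult[of "\<lambda>x. norm (f x)" lebesgue A B w] w_subset by auto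

lemma W_nonneg:
  assumes "A \<subseteq> hcube a l"
  shows "0 \<le> W A"
  unfolding W_def set_lebesgue_integral_def
proof (rule integral_nonneg_AE)
  show "AE x in lebesgue. 0 \<le> indicator A x *\<^sub>R w x"
    using w_pos assms by (auto elim!: eventually_mono simp: indicator_def subset_iff)
qed

lemma F_mono:
  assumes "A \<subseteq> A'" "A' \<subseteq> hcube a l" "A \<in> sets lebesgue" "A' \<in> sets lebesgue"
  shows "F A \<le> F A'"
  unfolding F_def set_lebesgue_integral_def
proof (rule integral_mono_AE)
  show "AE x in lebesgue. indicator A x *\<^sub>R (norm (f x) * w x) \<le> indicator A' x *\<^sub>R (norm (f x) * w x)"
    using w_pos assms by (auto elim!: eventually_mono simp: indicator_def subset_iff)
qed (use nfw_integrable assms in \<open>auto simp: set_integrable_def\<close>)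

lemma W_dcube_pos:
  assumes "x \<in> hcube a l"
  shows "0 < W (dcube a l k x)"
  unfolding W_def
proof (rule set_integral_AE_pos)
  obtain b where b: "dcube a l k x = hcube b (l / 2 ^ k)" using dcube_is_hcube[OF l] .
  show "emeasure lebesgue (dcube a l k x) \<noteq> 0"
    using l by (simp add: b emeasure_hcube del: emeasure_completion)
  show "set_integrable lebesgue (dcube a l k x) w"
    using dcube_subset[OF l assms] l by (intro w_subset) auto
  show "AE y in lebesgue. y \<in> dcube a l k x \<longrightarrow> 0 < w y"
    using w_pos dcube_subset[OF l assms] by (auto elim!: eventually_mono)
qed (use l in auto)

lemma S_disjoint: "disjoint (S lam)"
  and S_countable: "countable (S lam)"
  and S_sets: "S lam \<subseteq> sets lebesgue"
  unfolding S_def by (fact stopping_cubes_disjoint stopping_cubes_countable[OF l] stopping_cubes_sets[OF l])+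

lemma S_E:
  assumes "Q \<in> S lam"
  obtains k x where "x \<in> hcube a l" "Q = dcube a l k x" "stops lam Q" "\<And>j. j < k \<Longrightarrow> \<not> stops lam (dcube a l j x)"
  using stopping_cubesE[OF assms[unfolded S_def]] by metis

lemma S_subset: "Q \<in> S lam \<Longrightarrow> Q \<subseteq> hcube a l"
  using dcube_subset[OF l] by (auto elim!: S_E)

lemma S_W_pos: "Q \<in> S lam \<Longrightarrow> 0 < W Q"
  using W_dcube_pos by (auto elim!: S_E)

lemma S_stops: "Q \<in> S lam \<Longrightarrow> lam * W Q < F Q"
  by (auto elim!: S_E simp: stops_def)

lemma S_hcube:
  assumes "Q \<in> S lam"
  obtains b h where "0 < h" "h \<le> l" "Q = hcube b h"
proof -
  obtain k x where "Q = dcube a l k x" using assms by (auto elim: S_E)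
  moreover obtain b where "dcube a l k x = hcube b (l / 2 ^ k)" using dcube_is_hcube[OF l] .
  ultimately show ?thesis using that[of "l / 2 ^ k" b] l by (simp add: field_simps)
qed

lemma Union_S_sets [measurable]: "\<Union> (S lam) \<in> sets lebesgue"
  using S_countable S_sets by (intro sets.countable_Union) auto

text \<open>Outer regularity takes the place of differentiation of integrals. Let \<open>N\<close>
  be the set where the bound fails. A dyadic cube through a point of \<open>N\<close> has not
  stopped, so covering \<open>N\<close> by such cubes inside an open neighbourhood \<open>V\<close>
  gives \<open>F N \<le> lam * W V\<close>. Shrinking the neighbourhoods gives
  \<open>F N \<le> lam * W N\<close>, whereas on \<open>N\<close> the integrand of \<open>F\<close>
  is strictly above \<open>lam * w\<close>; so \<open>N\<close> is null.\<close>

lemma AE_bound_off_S: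
  assumes "0 \<le> lam"
  shows "AE x in lebesgue. x \<in> hcube a l - \<Union> (S lam) \<longrightarrow> norm (f x) \<le> lam"
proof -
  define N where "N = {x \<in> hcube a l - \<Union> (S lam). lam < norm (f x)}"
  have N_sets: "N \<in> sets lebesgue"
  proof -
    have "N = (hcube a l - \<Union> (S lam)) \<inter> {x \<in> space lebesgue. lam < norm (f x)}" by (auto simp: N_def)
    also have "\<dots> \<in> sets lebesgue" by measurable
    finally show ?thesis .
  qed
  have NQ: "N \<subseteq> hcube a l" by (auto simp: N_def)
  have "\<exists>U. open U \<and> N \<subseteq> U \<and> emeasure lebesgue (U - N) < ennreal (1 / Suc m)" for m
    using sets_lebesgue_outer_open[OF N_sets, of "1 / Suc m"] by (metis divide_pos_pos of_nat_0_less_iff zero_less_Suc zero_less_one)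
  then obtain U where U: "\<And>m. open (U m)" "\<And>m. N \<subseteq> U m" "\<And>m. emeasure lebesgue (U m - N) < ennreal (1 / Suc m)"
    by metis
  \<comment> \<open>Intersections make the neighbourhoods decrease, as continuity from above
    requires.\<close>
  define O' where "O' m = (\<Inter>j\<le>m. U j)" for m
  define V where "V m = O' m \<inter> hcube a l" for m
  have O_open: "open (O' m)" for m using U by (auto simp: O'_def)
  have V_sets: "V m \<in> sets lebesgue" for m using O_open[of m] by (auto simp: V_def)
  have claim: "F N \<le> lam * W (V m)" for m
  proof -
    define C where "C = stopping_cubes a l (\<lambda>A. A \<subseteq> O' m) N"
    have C_sets: "\<Union>C \<in> sets lebesgue"
      using stopping_cubes_countable[OF l, of a "\<lambda>A. A \<subseteq> O' m" N] stopping_cubes_sets[OF l, of a "\<lambda>A. A \<subseteq> O' m" N]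
      unfolding C_def by (intro sets.countable_Union) auto
    have NC: "N \<subseteq> \<Union>C"
    proof
      fix x assume x: "x \<in> N"
      then have "x \<in> O' m" using U by (auto simp: O'_def)
      then obtain k where "dcube a l k x \<subseteq> O' m" using ex_dcube_subset_open[OF l O_open] by metis
      then show "x \<in> \<Union>C" unfolding C_def by (intro stopping_cubes_cover[OF x])
    qed
    have CQ: "\<Union>C \<subseteq> V m"
      using dcube_subset[OF l] NQ unfolding C_def V_def by (fastforce elim!: stopping_cubesE)
    have CQ': "\<Union>C \<subseteq> hcube a l" using CQ by (auto simp: V_def)
    have "F N \<le> F (\<Union>C)" using NC CQ' C_sets N_sets by (intro F_mono)
    also have "\<dots> \<le> (LINT x:\<Union>C|lebesgue. lam * w x)"
      unfolding F_def
    proof (rule set_integral_countable_Union_mono)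
      fix Q assume "Q \<in> C"
      then obtain k x where Q: "x \<in> N" "Q = dcube a l k x" unfolding C_def by (metis stopping_cubesE)
      have "\<not> stops lam Q"
        using Q stopping_cubes_cover[of x "hcube a l" "stops lam" a l k] by (auto simp: N_def S_def)
      then show "(LINT x:Q|lebesgue. norm (f x) * w x) \<le> (LINT x:Q|lebesgue. lam * w x)"
        by (simp add: stops_def F_def W_def not_less)
    qed (use CQ' C_sets stopping_cubes_disjoint stopping_cubes_countable[OF l] stopping_cubes_sets[OF l]
        nfw_integrable w_subset in \<open>auto simp: C_def dest: subsetD[OF stopping_cubes_sets[OF l]]\<close>)
    also have "\<dots> = lam * W (\<Union>C)" by (simp add: W_def)
    also have "\<dots> \<le> lam * W (V m)"
      unfolding W_def set_lebesgue_integral_def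
    proof (intro mult_left_mono[OF _ assms] integral_mono_AE)
      show "AE x in lebesgue. indicator (\<Union>C) x *\<^sub>R w x \<le> indicator (V m) x *\<^sub>R w x"
        using w_pos CQ by (auto elim!: eventually_mono simp: indicator_def V_def subset_iff)
      show "integrable lebesgue (\<lambda>x. indicat_real (\<Union>C) x *\<^sub>R w x)"
        using w_subset[OF C_sets CQ'] by (simp add: set_integrable_def)
      show "integrable lebesgue (\<lambda>x. indicat_real (V m) x *\<^sub>R w x)"
        using w_subset[OF V_sets[of m]] by (simp add: set_integrable_def V_def)
    qed
    finally show ?thesis .
  qed
  have "(\<lambda>m. W (V m)) \<longlonglongrightarrow> W (\<Inter>m. V m)"
    unfolding W_def
  proof (rule set_integral_cont_down)
    show "decseq V" by (auto simp: decseq_def V_def O'_def)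
    show "set_integrable lebesgue (V 0) w" using V_sets by (intro w_subset) (auto simp: V_def)
  qed (use V_sets in auto)
  moreover have "W (\<Inter>m. V m) = W N"
    unfolding W_def
  proof (rule set_integral_cong_set)
    have VN: "(\<Inter>m. V m) - N \<in> null_sets lebesgue"
    proof -
      have s: "(\<Inter>m. V m) - N \<in> sets lebesgue" using V_sets N_sets by auto
      have "emeasure lebesgue ((\<Inter>m. V m) - N) \<le> ennreal (1 / Suc m)" for m
      proof -
        have "U m - N \<in> sets lebesgue" using U(1)[of m] N_sets by auto
        then have "emeasure lebesgue ((\<Inter>m. V m) - N) \<le> emeasure lebesgue (U m - N)"
          by (intro emeasure_mono) (auto simp: V_def O'_def)
        then show ?thesis using U(3)[of m] by (meson order.strict_trans1 less_imp_le)
      qed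
      moreover have "(\<lambda>m. ennreal (1 / Suc m)) \<longlonglongrightarrow> ennreal 0"
        by (intro tendsto_ennrealI LIMSEQ_Suc[OF lim_1_over_n])
      ultimately have "emeasure lebesgue ((\<Inter>m. V m) - N) \<le> ennreal 0"
        by (intro LIMSEQ_le_const) auto
      then show ?thesis using s by (auto simp: null_sets_def)
    qed
    have "N \<subseteq> (\<Inter>m. V m)" using U NQ by (auto simp: V_def O'_def)
    then show "AE x in lebesgue. (x \<in> N) = (x \<in> (\<Inter>m. V m))"
      using AE_not_in[OF VN] by (auto elim!: eventually_mono)
    have "set_integrable lebesgue (\<Inter>m. V m) w"
    proof (rule w_subset)
      show "(\<Inter>m. V m) \<in> sets lebesgue" using V_sets by auto
      show "(\<Inter>m. V m) \<subseteq> hcube a l" by (auto simp: V_def)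
    qed
    then show "set_borel_measurable lebesgue (\<Inter>m. V m) w" "set_borel_measurable lebesgue N w"
      using w_subset[OF N_sets NQ] by (auto simp: set_integrable_def set_borel_measurable_def)
  qed
  ultimately have "(\<lambda>m. lam * W (V m)) \<longlonglongrightarrow> lam * W N" by (auto intro: tendsto_mult_left)
  then have "F N \<le> lam * W N" using claim by (intro LIMSEQ_le_const) auto
  then have le: "(LINT x:N|lebesgue. (norm (f x) * w x - lam * w x)) \<le> 0"
    using nfw_integrable[OF N_sets NQ] w_subset[OF N_sets NQ] by (simp add: F_def W_def)
  have int: "set_integrable lebesgue N (\<lambda>x. norm (f x) * w x - lam * w x)"
    using nfw_integrable[OF N_sets NQ] w_subset[OF N_sets NQ] by auto
  have "emeasure lebesgue N = 0"
  proof (rule ccontr)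
    assume "emeasure lebesgue N \<noteq> 0"
    moreover have "AE x in lebesgue. x \<in> N \<longrightarrow> 0 < norm (f x) * w x - lam * w x"
      using w_pos by eventually_elim (auto simp: N_def)
    ultimately show False using set_integral_AE_pos[OF N_sets int] le by simp
  qed
  then have "AE x in lebesgue. x \<notin> N" using N_sets by (intro AE_not_in) auto
  then show ?thesis by eventually_elim (auto simp: N_def)
qed

lemma g_on_S:
  assumes "Q \<in> S lam" "x \<in> Q"
  shows "g lam x = (LINT y:Q|lebesgue. f y * of_real (w y)) / of_real (W Q)"
proof -
  have "(THE Q. Q \<in> S lam \<and> x \<in> Q) = Q"
    using assms S_disjoint[of lam] by (intro the_equality) (auto simp: pairwise_def disjnt_def)
  then show ?thesis using assms by (auto simp: g_def)
qed

lemma g_off_S: "x \<notin> \<Union> (S lam) \<Longrightarrow> g lam x = f x"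
  by (simp add: g_def)

lemma g_measurable [measurable]: "g lam \<in> borel_measurable lebesgue"
proof (rule measurable_piecewise_restrict[where C="insert (- \<Union> (S lam)) (S lam)"])
  show "countable (insert (- \<Union> (S lam)) (S lam))" using S_countable by simp
  show "\<Omega> \<inter> space lebesgue \<in> sets lebesgue" if "\<Omega> \<in> insert (- \<Union> (S lam)) (S lam)" for \<Omega>
    using that S_sets by (auto simp: Compl_eq_Diff_UNIV intro!: sets.compl_sets[of _ lebesgue, simplified])
  show "g lam \<in> borel_measurable (restrict_space lebesgue \<Omega>)" if "\<Omega> \<in> insert (- \<Union> (S lam)) (S lam)" for \<Omega>
    using that
  proof
    assume \<Omega>: "\<Omega> = - \<Union> (S lam)"
    have "f \<in> borel_measurable (restrict_space lebesgue \<Omega>)" by (intro measurable_restrict_space1) measurable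
    then show ?thesis
      by (subst measurable_cong[of _ _ f]) (auto simp: \<Omega> g_off_S space_restrict_space)
  next
    assume \<Omega>: "\<Omega> \<in> S lam"
    then show ?thesis
      by (subst measurable_cong[of _ _ "\<lambda>_. (LINT y:\<Omega>|lebesgue. f y * of_real (w y)) / of_real (W \<Omega>)"])
        (auto simp: g_on_S space_restrict_space)
  qed
qed auto

lemma stops_mono: "A \<subseteq> hcube a l \<Longrightarrow> lam \<le> mu \<Longrightarrow> stops mu A \<Longrightarrow> stops lam A"
  using W_nonneg[of A] mult_right_mono[of lam mu "W A"] by (auto simp: stops_def)

text \<open>A cube that stops at \<open>mu\<close> also meets the criterion at the lower height
  \<open>lam\<close>, so every chain stops at \<open>lam\<close> no later than at
  \<open>mu\<close>.\<close>

lemma S_refines: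
  assumes "lam \<le> mu" "Q \<in> S lam" "R \<in> S mu" "R \<inter> Q \<noteq> {}"
  shows "R \<subseteq> Q"
proof -
  obtain k x where Q: "x \<in> hcube a l" "Q = dcube a l k x" "\<And>j. j < k \<Longrightarrow> \<not> stops lam (dcube a l j x)"
    using assms(2) by (metis S_E)
  obtain k' x' where R: "x' \<in> hcube a l" "R = dcube a l k' x'" "stops mu R"
    using assms(3) by (metis S_E)
  obtain z where z: "z \<in> R" "z \<in> Q" using assms(4) by blast
  have Rz: "R = dcube a l k' z" using R dcube_eq z by metis
  have "k \<le> k'"
  proof (rule ccontr)
    assume n: "\<not> k \<le> k'"
    then have "R = dcube a l k' x" using Rz dcube_eq_lower[of z a l k x k'] z Q by auto
    then show False using Q(3)[of k'] n R(3) stops_mono[OF S_subset[OF assms(3)] assms(1)] by auto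
  qed
  then show ?thesis using Rz dcube_mono dcube_eq z Q(2) by metis
qed

lemma Union_S_mono:
  assumes "lam \<le> mu" shows "\<Union> (S mu) \<subseteq> \<Union> (S lam)"
proof
  fix x assume "x \<in> \<Union> (S mu)"
  then obtain Q where Q: "Q \<in> S mu" "x \<in> Q" by auto
  then obtain k y where k: "y \<in> hcube a l" "Q = dcube a l k y" "stops mu Q" by (metis S_E)
  have "x \<in> hcube a l" using S_subset Q by auto
  moreover have "Q = dcube a l k x" using k Q dcube_eq by metis
  moreover have "stops lam Q" using stops_mono[OF S_subset assms] Q k by auto
  ultimately show "x \<in> \<Union> (S lam)" unfolding S_def by (metis stopping_cubes_cover)
qed

text \<open>The root does not stop, so a stopping cube has a parent, which has not stopped; doubling
  passes from the parent to the cube.\<close>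

lemma S_F_le:
  assumes "\<not> stops lam (hcube a l)" "0 \<le> lam" "Q \<in> S lam"
  shows "F Q \<le> D * lam * W Q"
proof -
  obtain k x where Q: "x \<in> hcube a l" "Q = dcube a l k x" "stops lam Q" "\<And>j. j < k \<Longrightarrow> \<not> stops lam (dcube a l j x)"
    using assms(3) by (metis S_E)
  have "k \<noteq> 0" using Q assms(1) dcube_zero[OF l] by (metis)
  then obtain j where k: "k = Suc j" using not0_implies_Suc by blast
  let ?P = "dcube a l j x"
  have "F Q \<le> F ?P"
    using dcube_mono[of j k a l x] dcube_subset[OF l Q(1)] l unfolding Q(2) by (intro F_mono) (auto simp: k)
  also have "\<dots> \<le> lam * W ?P" using Q(4)[of j] k by (auto simp: stops_def)
  also have "\<dots> \<le> lam * (D * W Q)"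
    using doubling[OF Q(1), of j] assms(2) unfolding Q(2) k W_def by (intro mult_left_mono) auto
  finally show ?thesis by (simp add: mult_ac)
qed

lemma g_AE_bound:
  assumes "\<not> stops lam (hcube a l)" "0 \<le> lam"
  shows "AE x in lebesgue. x \<in> hcube a l \<longrightarrow> norm (g lam x) \<le> D * lam"
proof -
  have "norm (g lam x) \<le> D * lam" if x: "x \<in> Q" and Q: "Q \<in> S lam" for x Q
  proof -
    have QQ: "Q \<subseteq> hcube a l" "Q \<in> sets lebesgue" using S_subset[OF Q] S_sets Q by auto
    have "norm (LINT y:Q|lebesgue. f y * of_real (w y)) \<le> (LINT y|lebesgue. norm (indicator Q y *\<^sub>R (f y * of_real (w y))))"
      unfolding set_lebesgue_integral_def by (rule integral_norm_bound)
    also have "\<dots> = F Q"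
      unfolding F_def set_lebesgue_integral_def
    proof (rule integral_cong_AE)
      show "AE x in lebesgue. norm (indicat_real Q x *\<^sub>R (f x * of_real (w x))) = indicat_real Q x *\<^sub>R (norm (f x) * w x)"
        using w_pos QQ by (auto elim!: eventually_mono simp: indicator_def norm_mult subset_iff)
      show "(\<lambda>x. norm (indicat_real Q x *\<^sub>R (f x * complex_of_real (w x)))) \<in> borel_measurable lebesgue"
        using fw_integrable[OF QQ(2,1)] unfolding set_integrable_def
        by (intro measurable_compose[OF borel_measurable_integrable borel_measurable_norm]) simp_all
      show "(\<lambda>x. indicat_real Q x *\<^sub>R (norm (f x) * w x)) \<in> borel_measurable lebesgue"
        using nfw_integrable[OF QQ(2,1)] unfolding set_integrable_def by auto
    qed
    also have "\<dots> \<le> D * lam * W Q" by (rule S_F_le[OF assms Q])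
    finally show ?thesis
      using S_W_pos[OF Q] unfolding g_on_S[OF Q x] by (simp add: norm_divide field_simps)
  qed
  note on_S = this
  have lamD: "lam \<le> D * lam" using D1 assms(2) mult_right_mono[of 1 D lam] by simp
  show ?thesis
    using AE_bound_off_S[OF assms(2)]
  proof eventually_elim
    case (elim x)
    show ?case
    proof (cases "x \<in> \<Union> (S lam)")
      case True then show ?thesis using on_S by blast
    next
      case False then show ?thesis using elim lamD g_off_S[OF False] by auto
    qed
  qed
qed

text \<open>By \<open>S_refines\<close> the cubes of the higher height that meet \<open>Q\<close>
  lie inside it, and replacing \<open>f\<close> by its means on them preserves the integral. Hence
  two good parts differ by a function of mean zero, with respect to \<open>w dx\<close>, on every
  cube of the lower height: this is the cancellation in the telescoping sums.\<close>

lemma g_integral: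
  assumes "lam \<le> mu" "Q \<in> S lam" "\<not> stops mu (hcube a l)" "0 \<le> mu"
  shows "(LINT x:Q|lebesgue. g mu x * of_real (w x)) = (LINT x:Q|lebesgue. f x * of_real (w x))"
proof -
  define R where "R = {R \<in> S mu. R \<subseteq> Q}"
  have QQ: "Q \<subseteq> hcube a l" "Q \<in> sets lebesgue" using S_subset[OF assms(2)] S_sets assms(2) by auto
  have RS: "countable R" "disjoint R" "R \<subseteq> sets lebesgue" "\<Union>R \<subseteq> Q"
    using S_countable[of mu] S_disjoint[of mu] S_sets[of mu] unfolding R_def
    by (auto intro: countable_subset[of _ "S mu"] simp: pairwise_def)
  have Rs: "\<Union>R \<in> sets lebesgue" using RS by (intro sets.countable_Union) auto
  have split: "Q - \<Union>R = Q - \<Union> (S mu)" using S_refines[OF assms(1,2)] unfolding R_def by blast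
  have gi: "set_integrable lebesgue A (\<lambda>x. g mu x * of_real (w x))" if "A \<in> sets lebesgue" "A \<subseteq> hcube a l" for A
  proof (rule set_integrable_bounded_mult[where C="D * mu"])
    show "AE x in lebesgue. x \<in> A \<longrightarrow> norm (g mu x) \<le> D * mu"
      using g_AE_bound[OF assms(3,4)] that by (auto elim!: eventually_mono)
  qed (use that w_subset in auto)
  have "(LINT x:Q|lebesgue. h x) = (LINT x:Q - \<Union>R|lebesgue. h x) + (LINT x:\<Union>R|lebesgue. h x)"
    if "\<And>A. A \<in> sets lebesgue \<Longrightarrow> A \<subseteq> hcube a l \<Longrightarrow> set_integrable lebesgue A h" for h :: "real ^ 'n \<Rightarrow> complex"
  proof -
    have "(LINT x:(Q - \<Union>R) \<union> \<Union>R|lebesgue. h x) = (LINT x:Q - \<Union>R|lebesgue. h x) + (LINT x:\<Union>R|lebesgue. h x)"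
      using QQ RS Rs by (intro set_integral_Un that) auto
    moreover have "(Q - \<Union>R) \<union> \<Union>R = Q" using RS by auto
    ultimately show ?thesis by simp
  qed
  note s = this
  have 1: "(LINT x:Q - \<Union>R|lebesgue. g mu x * of_real (w x)) = (LINT x:Q - \<Union>R|lebesgue. f x * of_real (w x))"
    unfolding split using QQ by (intro set_lebesgue_integral_cong) (auto simp: g_off_S)
  have 2: "(LINT x:\<Union>R|lebesgue. g mu x * of_real (w x)) = (LINT x:\<Union>R|lebesgue. f x * of_real (w x))"
  proof (rule set_integral_countable_Union_cong[OF RS(1-3)])
    show "set_integrable lebesgue (\<Union>R) (\<lambda>x. g mu x * of_real (w x))"
      "set_integrable lebesgue (\<Union>R) (\<lambda>x. f x * of_real (w x))"
      using gi fw_integrable Rs RS(4) QQ by auto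
    fix P assume "P \<in> R"
    then have P: "P \<in> S mu" "P \<in> sets lebesgue" using RS by (auto simp: R_def)
    define c where "c = (LINT y:P|lebesgue. f y * of_real (w y)) / of_real (W P)"
    have "(LINT x:P|lebesgue. g mu x * of_real (w x)) = (LINT x:P|lebesgue. c * of_real (w x))"
      using P by (intro set_lebesgue_integral_cong) (auto simp: g_on_S c_def)
    also have "\<dots> = c * of_real (W P)"
      by (simp add: W_def set_integral_complex_of_real)
    also have "\<dots> = (LINT x:P|lebesgue. f x * of_real (w x))"
      using S_W_pos[OF P(1)] by (simp add: c_def)
    finally show "(LINT x:P|lebesgue. g mu x * of_real (w x)) = (LINT x:P|lebesgue. f x * of_real (w x))" .
  qed
  show ?thesis using s[OF gi] s[OF fw_integrable] 1 2 by simp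
qed

end

subsection \<open>Square-integrable functions\<close>

lemma L2_measurable [measurable_dest]: "f \<in> L2 \<Longrightarrow> f \<in> borel_measurable lebesgue"
  by (simp add: L2_def)

lemma L2_integrable: "f \<in> L2 \<Longrightarrow> integrable lebesgue (\<lambda>x. (norm (f x))\<^sup>2)"
  by (simp add: L2_def)

lemma L2_norm_nonneg: "0 \<le> L2_norm f"
  by (simp add: L2_norm_def)

lemma L2_norm_sq: "(L2_norm f)\<^sup>2 = (LINT x|lebesgue. (norm (f x))\<^sup>2)"
  by (simp add: L2_norm_def)

lemma L2_dominated:
  assumes [measurable]: "f \<in> borel_measurable lebesgue" and g: "integrable lebesgue g"
    and "AE x in lebesgue. (norm (f x))\<^sup>2 \<le> g x"
  shows "f \<in> L2"
proof -
  have "integrable lebesgue (\<lambda>x. (norm (f x))\<^sup>2)"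
    by (rule Bochner_Integration.integrable_bound[OF g])
      (use assms(3) in \<open>auto elim!: eventually_mono intro: order.trans[OF _ abs_ge_self]\<close>)
  then show ?thesis by (simp add: L2_def)
qed

lemma L2_add:
  assumes "f \<in> L2" "g \<in> L2"
  shows "(\<lambda>x. f x + g x) \<in> L2"
proof (rule L2_dominated)
  show "integrable lebesgue (\<lambda>x. 2 * (norm (f x))\<^sup>2 + 2 * (norm (g x))\<^sup>2)"
    using assms by (auto simp: L2_def)
  have "(norm (f x + g x))\<^sup>2 \<le> 2 * (norm (f x))\<^sup>2 + 2 * (norm (g x))\<^sup>2" for x
  proof -
    have "(norm (f x + g x))\<^sup>2 \<le> (norm (f x) + norm (g x))\<^sup>2"
      by (intro power_mono norm_triangle_ineq) auto
    also have "\<dots> \<le> 2 * (norm (f x))\<^sup>2 + 2 * (norm (g x))\<^sup>2"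
      using zero_le_power2[of "norm (f x) - norm (g x)"] by (simp add: power2_eq_square algebra_simps)
    finally show ?thesis .
  qed
  then show "AE x in lebesgue. (norm (f x + g x))\<^sup>2 \<le> 2 * (norm (f x))\<^sup>2 + 2 * (norm (g x))\<^sup>2" by simp
qed (use assms in measurable)

lemma L2_scale: "f \<in> L2 \<Longrightarrow> (\<lambda>x. c * f x) \<in> L2"
  by (auto simp: L2_def norm_mult power_mult_distrib)

lemma L2_diff: "f \<in> L2 \<Longrightarrow> g \<in> L2 \<Longrightarrow> (\<lambda>x. f x - g x) \<in> L2"
  using L2_add[of f "\<lambda>x. (-1) * g x"] L2_scale[of g "-1"] by simp

lemma L2_restrict:
  assumes "f \<in> L2" "A \<in> sets lebesgue"
  shows "(\<lambda>x. indicator A x * f x) \<in> L2"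
  by (rule L2_dominated[OF _ L2_integrable[OF assms(1)]])
    (use assms in \<open>auto simp: indicator_def intro!: borel_measurable_times L2_measurable\<close>)

lemma L2_boundedI:
  assumes [measurable]: "f \<in> borel_measurable lebesgue" and A: "A \<in> lmeasurable"
    and "0 \<le> B" "AE x in lebesgue. norm (f x) \<le> B * indicator A x"
  shows "f \<in> L2" "L2_norm f \<le> B * sqrt (measure lebesgue A)"
proof -
  have int: "integrable lebesgue (\<lambda>x. B\<^sup>2 * indicator A x)"
    using A by (intro integrable_mult_right) (auto simp: fmeasurable_def)
  have ae: "AE x in lebesgue. (norm (f x))\<^sup>2 \<le> B\<^sup>2 * indicator A x"
    using assms(4)
  proof eventually_elim
    case (elim x)
    then have "(norm (f x))\<^sup>2 \<le> (B * indicator A x)\<^sup>2" by (intro power_mono) auto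
    then show ?case by (auto simp: indicator_def)
  qed
  show L: "f \<in> L2" by (rule L2_dominated[OF _ int ae]) measurable
  have "(LINT x|lebesgue. (norm (f x))\<^sup>2) \<le> (LINT x|lebesgue. B\<^sup>2 * indicator A x)"
    by (rule integral_mono_AE[OF L2_integrable[OF L] int ae])
  also have "\<dots> = B\<^sup>2 * measure lebesgue A" using A by (simp add: fmeasurable_def)
  finally have "L2_norm f \<le> sqrt (B\<^sup>2 * measure lebesgue A)"
    unfolding L2_norm_def by (rule real_sqrt_le_mono)
  then show "L2_norm f \<le> B * sqrt (measure lebesgue A)"
    using assms(3) by (simp add: real_sqrt_mult)
qed

lemma L2_mult_integrable:
  assumes "f \<in> L2" "g \<in> L2"
  shows "integrable lebesgue (\<lambda>x. f x * g x)"
proof (rule Bochner_Integration.integrable_bound)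
  show "integrable lebesgue (\<lambda>x. (norm (f x))\<^sup>2 + (norm (g x))\<^sup>2)"
    using assms by (auto simp: L2_def)
  have "norm (f x) * norm (g x) \<le> (norm (f x))\<^sup>2 + (norm (g x))\<^sup>2" for x
  proof -
    have "2 * (norm (f x) * norm (g x)) \<le> (norm (f x))\<^sup>2 + (norm (g x))\<^sup>2"
      using zero_le_power2[of "norm (f x) - norm (g x)"] by (simp add: power2_eq_square algebra_simps)
    moreover have "0 \<le> norm (f x) * norm (g x)" by simp
    ultimately show ?thesis by linarith
  qed
  then show "AE x in lebesgue. norm (f x * g x) \<le> norm ((norm (f x))\<^sup>2 + (norm (g x))\<^sup>2)"
    by (auto simp: norm_mult)
qed (use assms in measurable)

lemma L2_Cauchy_Schwarz:
  assumes "f \<in> L2" "g \<in> L2"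
  shows "norm (LINT x|lebesgue. f x * g x) \<le> L2_norm f * L2_norm g"
proof -
  have "norm (LINT x|lebesgue. f x * g x) \<le> (L2_norm f + e) * (L2_norm g + e)" if "e > 0" for e
  proof -
    \<comment> \<open>The weight that balances the two squares; \<open>e\<close> keeps numerator and
      denominator positive.\<close>
    define t where "t = (L2_norm g + e) / (L2_norm f + e)"
    have p: "L2_norm f + e > 0" "L2_norm g + e > 0"
      using that L2_norm_nonneg[of f] L2_norm_nonneg[of g] by auto
    then have t: "t > 0" by (simp add: t_def)
    have "norm (LINT x|lebesgue. f x * g x) \<le> (LINT x|lebesgue. norm (f x * g x))"
      by (rule integral_norm_bound)
    also have "\<dots> \<le> (LINT x|lebesgue. (t * (norm (f x))\<^sup>2 + (norm (g x))\<^sup>2 / t) / 2)"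
    proof (rule integral_mono)
      show "integrable lebesgue (\<lambda>x. norm (f x * g x))"
        by (intro integrable_norm L2_mult_integrable assms)
      show "integrable lebesgue (\<lambda>x. (t * (norm (f x))\<^sup>2 + (norm (g x))\<^sup>2 / t) / 2)"
        using assms by (auto simp: L2_def)
      fix x
      have "0 \<le> (t * norm (f x) - norm (g x))\<^sup>2 / t" using t by simp
      also have "\<dots> = t * (norm (f x))\<^sup>2 + (norm (g x))\<^sup>2 / t - 2 * (norm (f x) * norm (g x))"
        using t by (simp add: power2_eq_square field_simps)
      finally show "norm (f x * g x) \<le> (t * (norm (f x))\<^sup>2 + (norm (g x))\<^sup>2 / t) / 2"
        by (simp add: norm_mult)
    qed
    also have "\<dots> = (t * (L2_norm f)\<^sup>2 + (L2_norm g)\<^sup>2 / t) / 2"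
      using assms by (simp add: L2_norm_sq L2_def)
    also have "\<dots> \<le> (t * (L2_norm f + e)\<^sup>2 + (L2_norm g + e)\<^sup>2 / t) / 2"
      using t that L2_norm_nonneg[of f] L2_norm_nonneg[of g]
      by (intro divide_right_mono add_mono mult_left_mono power_mono) auto
    also have "\<dots> = (L2_norm f + e) * (L2_norm g + e)"
      using p by (simp add: t_def power2_eq_square)
    finally show ?thesis .
  qed
  note le = this
  have "((\<lambda>e. (L2_norm f + e) * (L2_norm g + e)) \<longlongrightarrow> (L2_norm f + 0) * (L2_norm g + 0)) (at_right 0)"
    by (intro tendsto_intros)
  then have "norm (LINT x|lebesgue. f x * g x) \<le> (L2_norm f + 0) * (L2_norm g + 0)"
  proof (rule tendsto_lowerbound)
    show "\<forall>\<^sub>F e in at_right 0. norm (LINT x|lebesgue. f x * g x) \<le> (L2_norm f + e) * (L2_norm g + e)"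
      using eventually_at_right_less[of "0::real"] by (rule eventually_mono) (use le in blast)
  qed simp
  then show ?thesis by simp
qed

subsection \<open>The pairing of \<open>T f\<close> with a test function\<close>

locale L2_operator =
  fixes T :: "(real ^ 'n \<Rightarrow> complex) \<Rightarrow> real ^ 'n \<Rightarrow> complex" and Bt :: real
  assumes T_L2: "f \<in> L2 \<Longrightarrow> T f \<in> L2"
    and T_add: "f \<in> L2 \<Longrightarrow> g \<in> L2 \<Longrightarrow> AE x in lebesgue. T (\<lambda>y. f y + g y) x = T f x + T g x"
    and T_scale: "f \<in> L2 \<Longrightarrow> AE x in lebesgue. T (\<lambda>y. c * f y) x = c * T f x"
    and T_bound: "f \<in> L2 \<Longrightarrow> L2_norm (T f) \<le> Bt * L2_norm f" and Bt: "0 \<le> Bt"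
begin

text \<open>Bilinear, with no conjugation: the phase of \<open>T f\<close> is carried by
  \<open>h\<close>.\<close>

definition "pair f h = (LINT x|lebesgue. T f x * h x)"

lemma pair_add:
  assumes "f \<in> L2" "g \<in> L2" "h \<in> L2"
  shows "pair (\<lambda>x. f x + g x) h = pair f h + pair g h"
proof -
  note [measurable] = L2_measurable[OF T_L2[OF L2_add[OF assms(1,2)]]] L2_measurable[OF T_L2[OF assms(1)]]
    L2_measurable[OF T_L2[OF assms(2)]] L2_measurable[OF assms(3)]
  have "pair (\<lambda>x. f x + g x) h = (LINT x|lebesgue. T f x * h x + T g x * h x)"
    unfolding pair_def
  proof (rule integral_cong_AE)
    show "AE x in lebesgue. T (\<lambda>x. f x + g x) x * h x = T f x * h x + T g x * h x"
      using T_add[OF assms(1,2)] by eventually_elim (simp add: algebra_simps)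
  qed measurable
  also have "\<dots> = pair f h + pair g h"
    unfolding pair_def using assms T_L2 by (intro Bochner_Integration.integral_add L2_mult_integrable) auto
  finally show ?thesis .
qed

lemma pair_scale:
  assumes "f \<in> L2" "h \<in> L2"
  shows "pair (\<lambda>x. c * f x) h = c * pair f h"
proof -
  note [measurable] = L2_measurable[OF T_L2[OF L2_scale[OF assms(1), of c]]] L2_measurable[OF T_L2[OF assms(1)]]
    L2_measurable[OF assms(2)]
  have "pair (\<lambda>x. c * f x) h = (LINT x|lebesgue. c * (T f x * h x))"
    unfolding pair_def
  proof (rule integral_cong_AE)
    show "AE x in lebesgue. T (\<lambda>x. c * f x) x * h x = c * (T f x * h x)"
      using T_scale[OF assms(1), of c] by eventually_elim (simp add: algebra_simps)
  qed measurable
  then show ?thesis by (simp add: pair_def)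
qed

lemma pair_diff:
  assumes "f \<in> L2" "g \<in> L2" "h \<in> L2"
  shows "pair (\<lambda>x. f x - g x) h = pair f h - pair g h"
  using pair_add[OF assms(1) L2_scale[OF assms(2), of "-1"] assms(3)] pair_scale[OF assms(2,3), of "-1"]
  by simp

lemma pair_add_right:
  assumes "f \<in> L2" "g \<in> L2" "h \<in> L2"
  shows "pair f (\<lambda>x. g x + h x) = pair f g + pair f h"
  unfolding pair_def distrib_left using assms T_L2
  by (intro Bochner_Integration.integral_add L2_mult_integrable) auto

lemma pair_bound:
  assumes "f \<in> L2" "h \<in> L2"
  shows "norm (pair f h) \<le> Bt * L2_norm f * L2_norm h"
  unfolding pair_def
  using L2_Cauchy_Schwarz[OF T_L2[OF assms(1)] assms(2)] T_bound[OF assms(1)]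
    mult_right_mono[OF T_bound[OF assms(1)] L2_norm_nonneg[of h]] by linarith

lemma pair_cong_AE:
  assumes "f \<in> L2" "g \<in> L2" "h \<in> L2" "AE x in lebesgue. f x = g x"
  shows "pair f h = pair g h"
proof -
  have "(LINT x|lebesgue. (norm (f x - g x))\<^sup>2) = 0"
    using assms(4) by (intro integral_eq_zero_AE) (auto elim: eventually_mono)
  then have "L2_norm (\<lambda>x. f x - g x) = 0" by (simp add: L2_norm_def)
  then have "norm (pair (\<lambda>x. f x - g x) h) \<le> 0"
    using pair_bound[OF L2_diff[OF assms(1,2)] assms(3)] by simp
  then show ?thesis using pair_diff[OF assms(1-3)] by simp
qed

lemma pair_finite_Union:
  assumes "finite F" "disjoint F" "F \<subseteq> sets lebesgue" "b \<in> L2" "h \<in> L2"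
  shows "pair (\<lambda>x. indicator (\<Union>F) x * b x) h = (\<Sum>Q\<in>F. pair (\<lambda>x. indicator Q x * b x) h)"
  using assms(1-3)
proof (induction F)
  case empty
  show ?case using pair_scale[OF assms(4,5), of 0] by simp
next
  case (insert Q F)
  have "Q \<inter> P = {}" if "P \<in> F" for P
  proof -
    have "Q \<noteq> P" using insert.hyps(2) that by metis
    then show ?thesis using pairwiseD[OF insert.prems(1), of Q P] that by (simp add: disjnt_def)
  qed
  then have "Q \<inter> \<Union>F = {}" by auto
  then have eq: "(\<lambda>x. indicator (\<Union>(insert Q F)) x * b x)
      = (\<lambda>x. indicator Q x * b x + indicator (\<Union>F) x * b x)"
    by (auto simp: fun_eq_iff indicator_def)
  have Q: "Q \<in> sets lebesgue" and FF: "F \<subseteq> sets lebesgue" using insert.prems(2) by auto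
  have U: "\<Union>F \<in> sets lebesgue" by (rule sets.finite_Union[OF insert.hyps(1) FF])
  then have "pair (\<lambda>x. indicator (\<Union>(insert Q F)) x * b x) h
      = pair (\<lambda>x. indicator Q x * b x) h + pair (\<lambda>x. indicator (\<Union>F) x * b x) h"
    unfolding eq by (intro pair_add L2_restrict assms(4,5) Q U)
  also have "pair (\<lambda>x. indicator (\<Union>F) x * b x) h = (\<Sum>Q\<in>F. pair (\<lambda>x. indicator Q x * b x) h)"
    by (rule insert.IH[OF _ FF]) (use insert.prems(1) in \<open>simp add: pairwise_insert\<close>)
  finally show ?case using insert.hyps by simp
qed

text \<open>Linearity of \<open>T\<close> covers finite sums only. The partial sums miss
  \<open>b\<close> by a tail whose L2 norm tends to 0, and the L2 bound of \<open>T\<close> makes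
  its contribution vanish.\<close>

lemma pair_countable_Union_bound:
  assumes "countable S" "disjoint S" "S \<subseteq> sets lebesgue" "b \<in> L2" "h \<in> L2"
    and off: "\<And>x. x \<notin> \<Union>S \<Longrightarrow> b x = 0"
    and \<beta>: "\<And>Q. Q \<in> S \<Longrightarrow> norm (pair (\<lambda>x. indicator Q x * b x) h) \<le> \<beta> Q"
    and M: "\<And>F. finite F \<Longrightarrow> F \<subseteq> S \<Longrightarrow> (\<Sum>Q\<in>F. \<beta> Q) \<le> M"
  shows "norm (pair b h) \<le> M"
proof (cases "S = {}")
  case True
  then have "b = (\<lambda>x. 0 * b x)" using off by auto
  then have "pair b h = 0" using pair_scale[OF assms(4,5), of 0] by simp
  then show ?thesis using M[of "{}"] by simp
next
  case False
  define A where "A = from_nat_into S"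
  define U where "U = (\<lambda>n. \<Union>(A ` {..<n}))"
  have AS: "A n \<in> S" for n using from_nat_into[OF False] by (simp add: A_def)
  have ran: "range A = S" using range_from_nat_into[OF False assms(1)] by (simp add: A_def)
  have inc: "incseq U" unfolding U_def by (intro incseq_SucI UN_mono) auto
  have UU: "(\<Union>n. U n) = \<Union>S" unfolding ran[symmetric] U_def by (auto simp: lessThan_Suc)
  have Us: "U n \<in> sets lebesgue" for n using AS assms(3) by (auto simp: U_def)
  have US: "\<Union>S \<in> sets lebesgue" using assms(1,3) by (intro sets.countable_Union) auto
  have part: "norm (pair (\<lambda>x. indicator (U n) x * b x) h) \<le> M" for n
  proof -
    have F: "finite (A ` {..<n})" "A ` {..<n} \<subseteq> S" using AS by auto
    have "disjoint (A ` {..<n})" using pairwise_subset[OF assms(2) F(2)] .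
    then have "pair (\<lambda>x. indicator (U n) x * b x) h = (\<Sum>Q\<in>A ` {..<n}. pair (\<lambda>x. indicator Q x * b x) h)"
      unfolding U_def by (intro pair_finite_Union F(1) assms(4,5) subset_trans[OF F(2) assms(3)])
    also have "norm \<dots> \<le> (\<Sum>Q\<in>A ` {..<n}. \<beta> Q)"
      using F(2) by (intro sum_norm_le \<beta>) blast
    finally have "norm (pair (\<lambda>x. indicator (U n) x * b x) h) \<le> (\<Sum>Q\<in>A ` {..<n}. \<beta> Q)" .
    then show ?thesis using M[OF F] by simp
  qed
  have bL: "integrable lebesgue (\<lambda>x. (norm (b x))\<^sup>2)" using assms(4) by (rule L2_integrable)
  define r where "r n = (\<lambda>x. b x - indicator (U n) x * b x)" for n
  have rL: "r n \<in> L2" for n unfolding r_def by (intro L2_diff L2_restrict assms Us)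
  have "(\<lambda>n. LINT x:U n|lebesgue. (norm (b x))\<^sup>2) \<longlonglongrightarrow> (LINT x:(\<Union>n. U n)|lebesgue. (norm (b x))\<^sup>2)"
  proof (rule set_integral_cont_up)
    show "set_integrable lebesgue (\<Union>n. U n) (\<lambda>x. (norm (b x))\<^sup>2)"
      unfolding UU set_integrable_def using integrable_mult_indicator[OF US bL] by simp
  qed (use Us inc in auto)
  moreover have "(LINT x:(\<Union>n. U n)|lebesgue. (norm (b x))\<^sup>2) = (LINT x|lebesgue. (norm (b x))\<^sup>2)"
    unfolding UU set_lebesgue_integral_def by (rule Bochner_Integration.integral_cong) (use off in \<open>auto simp: indicator_def\<close>)
  moreover have "(LINT x|lebesgue. (norm (r n x))\<^sup>2) = (LINT x|lebesgue. (norm (b x))\<^sup>2) - (LINT x:U n|lebesgue. (norm (b x))\<^sup>2)" for n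
  proof -
    have "(LINT x|lebesgue. (norm (r n x))\<^sup>2) = (LINT x|lebesgue. (norm (b x))\<^sup>2 - indicator (U n) x *\<^sub>R (norm (b x))\<^sup>2)"
      by (rule Bochner_Integration.integral_cong) (auto simp: r_def indicator_def)
    also have "\<dots> = (LINT x|lebesgue. (norm (b x))\<^sup>2) - (LINT x:U n|lebesgue. (norm (b x))\<^sup>2)"
      unfolding set_lebesgue_integral_def
      by (rule Bochner_Integration.integral_diff[OF bL integrable_mult_indicator[OF Us bL]])
    finally show ?thesis .
  qed
  ultimately have "(\<lambda>n. LINT x|lebesgue. (norm (r n x))\<^sup>2) \<longlonglongrightarrow> (LINT x|lebesgue. (norm (b x))\<^sup>2) - (LINT x|lebesgue. (norm (b x))\<^sup>2)"
    by (simp only: tendsto_diff[OF tendsto_const])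
  then have "(\<lambda>n. L2_norm (r n)) \<longlonglongrightarrow> sqrt 0"
    unfolding L2_norm_def by (intro tendsto_real_sqrt) simp
  then have lim: "(\<lambda>n. M + Bt * L2_norm (r n) * L2_norm h) \<longlonglongrightarrow> M + Bt * sqrt 0 * L2_norm h"
    by (intro tendsto_intros)
  have "norm (pair b h) \<le> M + Bt * L2_norm (r n) * L2_norm h" for n
  proof -
    have "pair b h = pair (\<lambda>x. r n x + indicator (U n) x * b x) h" by (simp add: r_def)
    also have "\<dots> = pair (r n) h + pair (\<lambda>x. indicator (U n) x * b x) h"
      by (intro pair_add rL L2_restrict assms Us)
    finally have "norm (pair b h) \<le> norm (pair (r n) h) + norm (pair (\<lambda>x. indicator (U n) x * b x) h)"
      by (metis norm_triangle_ineq)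
    then show ?thesis using pair_bound[OF rL assms(5), of n] part[of n] by linarith
  qed
  then have "norm (pair b h) \<le> M + Bt * sqrt 0 * L2_norm h" by (intro LIMSEQ_le_const[OF lim]) auto
  then show ?thesis by simp
qed

end

lemma L2_bounded_linear_operator:
  assumes "L2_bounded_linear T"
  obtains Bt where "L2_operator T Bt"
proof -
  from assms have "\<exists>B. \<forall>f\<in>L2. L2_norm (T f) \<le> B * L2_norm f"
    unfolding L2_bounded_linear_def by (elim conjE)
  then obtain B where B: "\<And>f. f \<in> L2 \<Longrightarrow> L2_norm (T f) \<le> B * L2_norm f" by blast
  have "L2_operator T (max B 0)"
  proof
    fix f :: "real ^ 'a \<Rightarrow> complex" assume f: "f \<in> L2"
    show "L2_norm (T f) \<le> max B 0 * L2_norm f"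
      using B[OF f] mult_right_mono[of B "max B 0" "L2_norm f"] L2_norm_nonneg[of f] by auto
  qed (use assms in \<open>auto simp: L2_bounded_linear_def\<close>)
  then show ?thesis using that by blast
qed

subsection \<open>The Hoermander condition\<close>

lemma nonneg_mono_measurable:
  fixes h :: "real \<Rightarrow> real"
  assumes "\<And>a b. 0 \<le> a \<Longrightarrow> a \<le> b \<Longrightarrow> h a \<le> h b"
    and g: "g \<in> borel_measurable M" "\<And>x. 0 \<le> g x"
  shows "(\<lambda>x. h (g x)) \<in> borel_measurable M"
proof -
  have "mono (\<lambda>t. h (max 0 t))" by (rule monoI) (auto intro!: assms(1))
  then have "(\<lambda>t. h (max 0 t)) \<in> borel_measurable borel" by (rule borel_measurable_mono)
  from measurable_compose[OF g(1) this] show ?thesis using g(2) by (simp add: max_absorb2)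
qed

lemma young_measurable:
  "young \<phi> \<Longrightarrow> g \<in> borel_measurable M \<Longrightarrow> (\<And>x. 0 \<le> g x) \<Longrightarrow> (\<lambda>x. \<phi> (g x)) \<in> borel_measurable M"
  by (rule nonneg_mono_measurable[of \<phi>]) (auto intro: young_mono)

lemma complementary_measurable:
  "young \<Phi> \<Longrightarrow> proper_complementary \<Phi> \<Longrightarrow> g \<in> borel_measurable M \<Longrightarrow> (\<And>x. 0 \<le> g x) \<Longrightarrow>
    (\<lambda>x. complementary \<Phi> (g x)) \<in> borel_measurable M"
  by (rule nonneg_mono_measurable[of "complementary \<Phi>"]) (auto intro: complementary_mono)

lemma weighted_one: "A \<in> sets lebesgue \<Longrightarrow> weighted (\<lambda>_. 1) A = emeasure lebesgue A"
  by (simp add: weighted_def del: emeasure_completion)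

lemma ennreal_le_mult_Inf:
  fixes X :: ennreal
  assumes "\<And>t. t \<in> A \<Longrightarrow> X \<le> ennreal c * t" and "0 < c"
  shows "X \<le> ennreal c * Inf A"
proof -
  have c: "ennreal c \<noteq> 0" "ennreal c \<noteq> top" using assms(2) by auto
  have "X / ennreal c \<le> Inf A"
  proof (rule Inf_greatest)
    fix t assume "t \<in> A"
    then have "X / ennreal c \<le> (ennreal c * t) / ennreal c" by (intro divide_right_mono_ennreal assms(1))
    also have "\<dots> = t"
      using c by (metis ennreal_mult_divide_eq mult.commute)
    finally show "X / ennreal c \<le> t" .
  qed
  then have "ennreal c * (X / ennreal c) \<le> ennreal c * Inf A" by (rule mult_left_mono) simp
  also have "ennreal c * (X / ennreal c) = X"
    using c by (metis ennreal_mult_divide_eq ennreal_times_divide mult.commute)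
  finally show ?thesis .
qed

lemma emeasure_lborel_ball_vec:
  "0 \<le> r \<Longrightarrow> emeasure lborel (ball (c :: real ^ 'n) r) = ennreal (unit_ball_vol (real CARD('n)) * r ^ CARD('n))"
  by (simp add: emeasure_ball)

text \<open>Young's inequality with two free scales: \<open>mu\<close> comes from the modular bound
  for \<open>H\<close>, and any \<open>lam\<close> admissible in the Luxemburg norm of
  \<open>g\<close> serves for the other factor. The infimum over \<open>lam\<close> then restores
  the norm.\<close>

lemma annulus_pairing:
  fixes g :: "real ^ 'n \<Rightarrow> complex"
  assumes Y: "young \<Phi>" "proper_complementary \<Phi>"
    and g [measurable]: "g \<in> borel_measurable borel" and H [measurable]: "H \<in> borel_measurable borel"
    and H0: "\<And>x. 0 \<le> H x" and mu: "0 < mu" and D: "0 \<le> D" and s: "0 < s"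
    and le: "(\<integral>\<^sup>+x\<in>ball 0 (2 * s). ennreal (complementary \<Phi> (H x / mu)) \<partial>lborel)
        \<le> ennreal D * emeasure lborel (ball (0 :: real ^ 'n) (2 * s))"
  shows "(\<integral>\<^sup>+x\<in>{x. s < norm x \<and> norm x < 2 * s}. ennreal (norm (g x) * H x) \<partial>lborel)
      \<le> ennreal ((1 + D) * mu * (unit_ball_vol (real CARD('n)) * (2 * s) ^ CARD('n))) * annular_lux \<Phi> s g"
proof -
  define V where "V = unit_ball_vol (real CARD('n)) * (2 * s) ^ CARD('n)"
  have V: "V > 0" using s by (simp add: V_def)
  have eV: "emeasure lborel (ball (0 :: real ^ 'n) (2 * s)) = ennreal V"
    using emeasure_lborel_ball_vec[of "2 * s"] s by (simp add: V_def)
  define gg where "gg = (\<lambda>x. indicat_real {x. s < norm x \<and> norm x \<le> 2 * s} x *\<^sub>R g x)"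
  have gg [measurable]: "gg \<in> borel_measurable borel" unfolding gg_def by measurable
  show ?thesis
    unfolding annular_lux_def luxemburg_def gg_def[symmetric] V_def[symmetric]
  proof (rule ennreal_le_mult_Inf)
    show "0 < (1 + D) * mu * V" using D mu V by auto
    fix t assume "t \<in> {ennreal lam |lam. 0 < lam \<and> (\<integral>\<^sup>+x\<in>ball 0 (2 * s). ennreal (\<Phi> (norm (gg x) / lam) * 1) \<partial>lebesgue)
      / weighted (\<lambda>_. 1) (ball (0 :: real ^ 'n) (2 * s)) \<le> 1}"
    then obtain lam where lam: "t = ennreal lam" "0 < lam"
      and adm: "(\<integral>\<^sup>+x\<in>ball 0 (2 * s). ennreal (\<Phi> (norm (gg x) / lam)) \<partial>lborel) / ennreal V \<le> 1"
      by (auto simp: weighted_one eV nn_integral_completion)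
    have m1: "(\<lambda>x. \<Phi> (norm (gg x) / lam)) \<in> borel_measurable borel"
      using lam(2) by (intro young_measurable[OF Y(1)]) auto
    have m2: "(\<lambda>x. complementary \<Phi> (H x / mu)) \<in> borel_measurable borel"
      using mu H0 by (intro complementary_measurable[OF Y]) auto
    have m3: "ball (0 :: real ^ 'n) (2 * s) \<in> sets borel" by simp
    note [measurable] = m1 m2 m3
    have "(\<integral>\<^sup>+x\<in>ball 0 (2 * s). ennreal (\<Phi> (norm (gg x) / lam)) \<partial>lborel) \<le> ennreal V"
    proof -
      have "(\<integral>\<^sup>+x\<in>ball 0 (2 * s). ennreal (\<Phi> (norm (gg x) / lam)) \<partial>lborel) / ennreal V * ennreal V \<le> 1 * ennreal V"
        by (intro mult_right_mono adm) simp
      then show ?thesis using V by (simp add: ennreal_divide_times ennreal_mult_divide_eq)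
    qed
    then have "(\<integral>\<^sup>+x\<in>ball 0 (2 * s). ennreal (\<Phi> (norm (gg x) / lam)) \<partial>lborel)
        + (\<integral>\<^sup>+x\<in>ball 0 (2 * s). ennreal (complementary \<Phi> (H x / mu)) \<partial>lborel) \<le> ennreal V + ennreal D * ennreal V"
      using le unfolding eV by (rule add_mono)
    also have "\<dots> = ennreal ((1 + D) * V)"
      using V D by (simp add: ennreal_mult[symmetric] ennreal_plus[symmetric] algebra_simps del: ennreal_plus)
    finally have sum: "(\<integral>\<^sup>+x\<in>ball 0 (2 * s). ennreal (\<Phi> (norm (gg x) / lam)) \<partial>lborel)
        + (\<integral>\<^sup>+x\<in>ball 0 (2 * s). ennreal (complementary \<Phi> (H x / mu)) \<partial>lborel) \<le> ennreal ((1 + D) * V)" .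
    have "(\<integral>\<^sup>+x\<in>{x. s < norm x \<and> norm x < 2 * s}. ennreal (norm (g x) * H x) \<partial>lborel)
      \<le> (\<integral>\<^sup>+x. ennreal (lam * mu) * (ennreal (\<Phi> (norm (gg x) / lam)) * indicator (ball 0 (2 * s)) x
          + ennreal (complementary \<Phi> (H x / mu)) * indicator (ball 0 (2 * s)) x) \<partial>lborel)"
    proof (rule nn_integral_mono)
      fix x :: "real ^ 'n"
      show "ennreal (norm (g x) * H x) * indicator {x. s < norm x \<and> norm x < 2 * s} x
        \<le> ennreal (lam * mu) * (ennreal (\<Phi> (norm (gg x) / lam)) * indicator (ball 0 (2 * s)) x
          + ennreal (complementary \<Phi> (H x / mu)) * indicator (ball 0 (2 * s)) x)"
      proof (cases "s < norm x \<and> norm x < 2 * s")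
        case True
        then have gx: "gg x = g x" by (simp add: gg_def)
        have nn: "0 \<le> \<Phi> (norm (g x) / lam)" "0 \<le> complementary \<Phi> (H x / mu)"
          using young_nonneg[OF Y(1)] complementary_nonneg[OF Y] lam mu H0 by auto
        have "norm (g x) * H x = lam * mu * ((norm (g x) / lam) * (H x / mu))"
          using lam mu by simp
        also have "\<dots> \<le> lam * mu * (\<Phi> (norm (g x) / lam) + complementary \<Phi> (H x / mu))"
          using lam mu H0 by (intro mult_left_mono young_inequality[OF Y]) auto
        finally have "ennreal (norm (g x) * H x) \<le> ennreal (lam * mu * (\<Phi> (norm (g x) / lam) + complementary \<Phi> (H x / mu)))"
          by (rule ennreal_leI)
        also have "\<dots> = ennreal (lam * mu) * (ennreal (\<Phi> (norm (g x) / lam)) + ennreal (complementary \<Phi> (H x / mu)))"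
          using nn lam mu by (simp add: ennreal_mult ennreal_plus)
        finally show ?thesis using True by (simp add: gx)
      qed auto
    qed
    also have "\<dots> = ennreal (lam * mu) * ((\<integral>\<^sup>+x\<in>ball 0 (2 * s). ennreal (\<Phi> (norm (gg x) / lam)) \<partial>lborel)
        + (\<integral>\<^sup>+x\<in>ball 0 (2 * s). ennreal (complementary \<Phi> (H x / mu)) \<partial>lborel))"
      by (simp add: nn_integral_cmult nn_integral_add)
    also have "\<dots> \<le> ennreal (lam * mu) * ennreal ((1 + D) * V)" by (intro mult_left_mono sum) simp
    also have "\<dots> = ennreal ((1 + D) * mu * V) * t"
      using lam mu D V by (simp add: ennreal_mult[symmetric] mult_ac)
    finally show "(\<integral>\<^sup>+x\<in>{x. s < norm x \<and> norm x < 2 * s}. ennreal (norm (g x) * H x) \<partial>lborel) \<le> ennreal ((1 + D) * mu * V) * t" .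
  qed
qed

lemma AE_norm_neq: "AE x in lborel. norm (x :: real ^ 'n) \<noteq> c"
proof -
  have "sphere (0 :: real ^ 'n) c \<in> null_sets lebesgue"
    using negligible_sphere by (simp add: negligible_iff_null_sets)
  then have "AE x in lebesgue. x \<notin> sphere (0 :: real ^ 'n) c" by (rule AE_not_in)
  then show ?thesis by (simp add: AE_completion_iff)
qed

lemma nn_integral_lborel_translate:
  fixes b :: "'a :: euclidean_space"
  assumes [measurable]: "h \<in> borel_measurable borel"
  shows "(\<integral>\<^sup>+x. h (b + x) \<partial>lborel) = (\<integral>\<^sup>+x. h x \<partial>lborel)"
  by (subst (2) lborel_distr_plus[symmetric, of b]) (simp add: nn_integral_distr)

lemma nn_integral_lborel_reflect:
  fixes b :: "'a :: euclidean_space"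
  assumes [measurable]: "h \<in> borel_measurable borel"
  shows "(\<integral>\<^sup>+x. h (b - x) \<partial>lborel) = (\<integral>\<^sup>+x. h x \<partial>lborel)"
  by (subst (2) lborel_affine[of "-1" b]) (simp_all add: nn_integral_density nn_integral_distr)

locale hoermander_kernel =
  fixes \<Phi> :: "real \<Rightarrow> real" and K :: "real ^ 'n \<Rightarrow> complex" and c0 CK :: real
  assumes Y: "young \<Phi>" "proper_complementary \<Phi>"
    and K_borel [measurable]: "K \<in> borel_measurable borel" and c0: "1 \<le> c0" and CK: "0 < CK"
    and K_hoer: "\<And>y R. c0 * norm y < R \<Longrightarrow>
     (\<Sum>k. ennreal ((2 ^ Suc k * R) ^ CARD('n)) *
          annular_lux \<Phi> (2 ^ Suc k * R) (\<lambda>x. K (x - y) - K x)) \<le> ennreal CK"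
begin

text \<open>\<open>CK\<close> times the volume of the ball of radius 2. The remaining power of
  \<open>s\<close> in the volume of \<open>ball 0 (2 * s)\<close> is the one that the Hoermander sum
  carries.\<close>

definition "hc = CK * (unit_ball_vol (real CARD('n)) * 2 ^ CARD('n))"

lemma hc_pos: "0 < hc"
  using CK by (simp add: hc_def)

text \<open>The exterior of the ball of radius \<open>2 * R\<close> is cut into the annuli of the
  Hoermander sum, whose first inner radius is \<open>2 * R\<close>. One scale \<open>mu\<close> with
  a modular bound uniform over all the balls makes the annular estimates summable.\<close>

lemma hoermander_pairing:
  assumes H [measurable]: "H \<in> borel_measurable borel" and H0: "\<And>x. 0 \<le> H x"
    and mu: "0 < mu" and D: "0 \<le> D" and R: "c0 * norm y < R"
    and le: "\<And>k::nat. (\<integral>\<^sup>+x\<in>ball 0 (2 * (2 ^ Suc k * R)). ennreal (complementary \<Phi> (H x / mu)) \<partial>lborel)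
        \<le> ennreal D * emeasure lborel (ball (0 :: real ^ 'n) (2 * (2 ^ Suc k * R)))"
  shows "(\<integral>\<^sup>+x\<in>{x. 2 * R < norm x}. ennreal (norm (K (x - y) - K x) * H x) \<partial>lborel)
      \<le> ennreal (hc * (1 + D) * mu)"
proof -
  have R0: "0 < R" using R c0 by (smt (verit) mult_nonneg_nonneg norm_ge_zero)
  define s where "s k = 2 ^ Suc k * R" for k :: nat
  have s0: "0 < s k" for k using R0 by (simp add: s_def)
  define A where "A k = {x :: real ^ 'n. s k < norm x \<and> norm x < 2 * s k}" for k
  define g where "g x = K (x - y) - K x" for x
  have [measurable]: "g \<in> borel_measurable borel" unfolding g_def by measurable
  have [measurable]: "A k \<in> sets borel" for k unfolding A_def by measurable
  define c where "c = (1 + D) * mu * (unit_ball_vol (real CARD('n)) * 2 ^ CARD('n))"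
  have c: "0 \<le> c" using D mu by (simp add: c_def)
  \<comment> \<open>The annuli of \<open>annulus_pairing\<close> are open at the outer sphere, so
    they cover the exterior only up to these spheres, a null set.\<close>
  have ae: "AE x in lborel. \<forall>k. norm (x :: real ^ 'n) \<noteq> 2 * s k"
    by (subst AE_all_countable) (intro allI AE_norm_neq)
  have "(\<integral>\<^sup>+x\<in>{x. 2 * R < norm x}. ennreal (norm (g x) * H x) \<partial>lborel)
      \<le> (\<integral>\<^sup>+x. (\<Sum>k. ennreal (norm (g x) * H x) * indicator (A k) x) \<partial>lborel)"
  proof (rule nn_integral_mono_AE, use ae in eventually_elim)
    case (elim x)
    show ?case
    proof (cases "2 * R < norm x")
      case True
      have "\<exists>k. norm x \<le> 2 * s k"
      proof -
        obtain k :: nat where "norm x / R < 2 ^ k" using real_arch_pow[of 2 "norm x / R"] by auto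
        then have "norm x < 2 ^ k * R" using R0 by (simp add: field_simps)
        also have "\<dots> \<le> 2 * s k" using R0 by (simp add: s_def)
        finally show ?thesis by (intro exI[of _ k]) auto
      qed
      define k where "k = (LEAST k. norm x \<le> 2 * s k)"
      have k: "norm x \<le> 2 * s k" unfolding k_def by (rule LeastI_ex) fact
      have "s k < norm x"
      proof (cases k)
        case 0 then show ?thesis using True by (simp add: s_def)
      next
        case (Suc j)
        then have "\<not> norm x \<le> 2 * s j" using not_less_Least[of j "\<lambda>k. norm x \<le> 2 * s k"] by (simp add: k_def)
        then show ?thesis using Suc by (simp add: s_def)
      qed
      then have "x \<in> A k" using k elim[rule_format, of k] by (simp add: A_def)
      define G where "G = (\<lambda>k. ennreal (norm (g x) * H x) * indicator (A k) x)"
      have "(\<Sum>j\<in>{k}. G j) \<le> (\<Sum>j. G j)" by (rule sum_le_suminf) auto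
      then have "G k \<le> (\<Sum>j. G j)" by simp
      then have "ennreal (norm (g x) * H x) * indicator (A k) x \<le> (\<Sum>k. ennreal (norm (g x) * H x) * indicator (A k) x)"
        unfolding G_def .
      then show ?thesis using \<open>x \<in> A k\<close> True by simp
    qed simp
  qed
  also have "\<dots> = (\<Sum>k. \<integral>\<^sup>+x\<in>A k. ennreal (norm (g x) * H x) \<partial>lborel)"
    by (rule nn_integral_suminf) measurable
  also have "\<dots> \<le> (\<Sum>k. ennreal c * (ennreal (s k ^ CARD('n)) * annular_lux \<Phi> (s k) g))"
  proof (rule suminf_le)
    fix k
    have "(\<integral>\<^sup>+x\<in>A k. ennreal (norm (g x) * H x) \<partial>lborel)
      \<le> ennreal ((1 + D) * mu * (unit_ball_vol (real CARD('n)) * (2 * s k) ^ CARD('n))) * annular_lux \<Phi> (s k) g"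
      unfolding A_def by (rule annulus_pairing[OF Y _ H H0 mu D s0]) (use le[of k] in \<open>auto simp: s_def\<close>)
    also have "(1 + D) * mu * (unit_ball_vol (real CARD('n)) * (2 * s k) ^ CARD('n)) = c * s k ^ CARD('n)"
      by (simp add: c_def power_mult_distrib)
    finally show "(\<integral>\<^sup>+x\<in>A k. ennreal (norm (g x) * H x) \<partial>lborel) \<le> ennreal c * (ennreal (s k ^ CARD('n)) * annular_lux \<Phi> (s k) g)"
      using c s0[of k] by (simp add: ennreal_mult mult.assoc)
  qed auto
  also have "\<dots> = ennreal c * (\<Sum>k. ennreal (s k ^ CARD('n)) * annular_lux \<Phi> (s k) g)"
    by (rule ennreal_suminf_cmult)
  also have "\<dots> \<le> ennreal c * ennreal CK"
    using K_hoer[OF R] unfolding s_def g_def by (intro mult_left_mono) auto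
  also have "\<dots> = ennreal (hc * (1 + D) * mu)"
    using c CK by (simp add: ennreal_mult[symmetric] hc_def c_def mult_ac)
  finally show ?thesis by (simp add: g_def)
qed

text \<open>The case \<open>H = 1\<close>: the ordinary Hoermander condition in L1, with
  \<open>complementary \<Phi> 1\<close> as the modular bound.\<close>

lemma hoermander_L1:
  assumes R: "c0 * norm y < R"
  shows "(\<integral>\<^sup>+x\<in>{x. 2 * R < norm x}. ennreal (norm (K (x - y) - K x)) \<partial>lborel)
      \<le> ennreal (hc * (1 + complementary \<Phi> 1))"
  using hoermander_pairing[of "\<lambda>_. 1" 1 "complementary \<Phi> 1" y R] R complementary_nonneg[OF Y, of 1]
  by (simp add: nn_integral_cmult_indicator)

end

locale singular_integral = L2_operator T Bt + hoermander_kernel \<Phi> K c0 CK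
  for T :: "(real ^ 'n \<Rightarrow> complex) \<Rightarrow> real ^ 'n \<Rightarrow> complex" and Bt \<Phi> K c0 CK +
  assumes K_rep: "has_kernel T K"
begin

text \<open>The radius \<open>rho * l\<close> is such that the Hoermander condition applies to the differences of any two
  points of a cube of side \<open>l\<close> as soon as the third point lies outside the ball of this radius.\<close>

definition "rho = (2 * c0 + 3) * real CARD('n)"
definition "hc1 = hc * (1 + complementary \<Phi> 1)"

lemma n_pos: "1 \<le> real CARD('n)"
  using zero_less_card_finite[where 'a='n] by linarith

lemma rho_gt: "2 * ((c0 + 1) * real CARD('n)) + real CARD('n) \<le> rho" "real CARD('n) < rho" "0 < rho"
proof -
  show *: "2 * ((c0 + 1) * real CARD('n)) + real CARD('n) \<le> rho"
    by (simp add: rho_def algebra_simps)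
  have "0 < 2 * ((c0 + 1) * real CARD('n))" using c0 n_pos by simp
  then show "real CARD('n) < rho" "0 < rho" using * n_pos by linarith+
qed

lemma hc1_nonneg: "0 \<le> hc1"
  using hc_pos complementary_nonneg[OF Y, of 1] by (simp add: hc1_def)

lemma kernel_AE:
  assumes "d \<in> L2" "compact (support d)"
  shows "AE x in lebesgue. x \<notin> support d \<longrightarrow> integrable lebesgue (\<lambda>y. K (x - y) * d y) \<and>
           T d x = (LINT y|lebesgue. K (x - y) * d y)"
  using K_rep assms unfolding has_kernel_def by blast

text \<open>The cancellation is in \<open>e\<close>, not in \<open>d\<close>: as \<open>K\<close> is a convolution kernel, the same condition
  controls its differences in \<open>x\<close>, and the adjoint of \<open>T\<close> is not needed.\<close>

lemma smooth_pair:
  assumes l: "0 < l" and d: "d \<in> L2" "compact (support d)" and Bd: "0 \<le> Bd" "AE x in lebesgue. norm (d x) \<le> Bd"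
    and off: "\<And>y. norm (y - b) \<le> rho * l \<Longrightarrow> d y = 0"
    and e [measurable]: "e \<in> borel_measurable lebesgue" and Be: "0 \<le> Be"
      "AE x in lebesgue. norm (e x) \<le> Be * indicator (hcube b l) x" and e0: "(LINT x|lebesgue. e x) = 0"
  shows "norm (pair d e) \<le> Bd * Be * l ^ CARD('n) * hc1"
proof -
  define Q where "Q = hcube b l"
  define R where "R = (c0 + 1) * real CARD('n) * l"
  define good where "good x \<longleftrightarrow> integrable lebesgue (\<lambda>y. K (x - y) * d y) \<and> T d x = (LINT y|lebesgue. K (x - y) * d y)" for x
  have Qs: "Q \<in> sets lebesgue" by (simp add: Q_def)
  have Qb: "norm (x - b) \<le> real CARD('n) * l" if "x \<in> Q" for x
    using hcube_norm_diff[of x b l b] corner_in_hcube[OF l, of b] that by (simp add: Q_def)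
  have supp: "x \<notin> support d" if "x \<in> Q" for x
  proof -
    have "support d \<subseteq> {y. rho * l \<le> norm (y - b)}"
      unfolding support_def
    proof (rule closure_minimal)
      show "{x. d x \<noteq> 0} \<subseteq> {y. rho * l \<le> norm (y - b)}" using off by (auto intro: ccontr)
      show "closed {y. rho * l \<le> norm (y - b)}" by (intro closed_Collect_le continuous_intros)
    qed
    moreover have "norm (x - b) < rho * l"
      using Qb[OF that] mult_strict_right_mono[OF rho_gt(2) l] by linarith
    ultimately show ?thesis by auto
  qed
  have gAE: "AE x in lebesgue. x \<in> Q \<longrightarrow> good x"
    using kernel_AE[OF d] by eventually_elim (auto simp: good_def supp)
  \<comment> \<open>The kernel representation holds almost everywhere only, so the point of
    reference is some point of \<open>Q\<close> where it holds, rather than the corner.\<close>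
  obtain x0 where x0: "x0 \<in> Q" "good x0"
  proof (rule ccontr)
    assume "\<not> thesis"
    then have no: "\<forall>x\<in>Q. \<not> good x" using that by blast
    have "AE x in lebesgue. x \<notin> Q" using gAE by (rule eventually_mono) (use no in auto)
    then have "emeasure lebesgue Q = 0" using Qs AE_iff_measurable[of Q lebesgue "\<lambda>x. x \<notin> Q"] by simp
    then show False using l by (simp add: Q_def emeasure_hcube del: emeasure_completion)
  qed
  have diff: "norm (T d x - T d x0) \<le> Bd * hc1" if x: "x \<in> Q" "good x" for x
  proof -
    have int: "integrable lebesgue (\<lambda>y. K (x - y) * d y - K (x0 - y) * d y)"
      using x x0 by (auto simp: good_def)
    \<comment> \<open>With \<open>w = x0 - y\<close> the difference
      \<open>K (x - y) - K (x0 - y)\<close> becomes \<open>K (w - (x0 - x)) - K w\<close>, the form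
      in the Hoermander condition.\<close>
    define G where "G w = ennreal (norm (K (w - (x0 - x)) - K w)) * indicator {w. 2 * R < norm w} w" for w
    have Gm [measurable]: "G \<in> borel_measurable borel" unfolding G_def by measurable
    have "norm (x0 - x) \<le> real CARD('n) * l" using hcube_norm_diff[of x0 b l x] x x0 by (simp add: Q_def)
    then have "c0 * norm (x0 - x) \<le> c0 * (real CARD('n) * l)" using c0 by (intro mult_left_mono) auto
    also have "\<dots> < R" using l n_pos by (simp add: R_def algebra_simps)
    finally have R: "c0 * norm (x0 - x) < R" .
    have "ennreal (norm (T d x - T d x0)) = ennreal (norm (LINT y|lebesgue. K (x - y) * d y - K (x0 - y) * d y))"
      using x x0 by (simp add: good_def)
    also have "\<dots> \<le> (\<integral>\<^sup>+y. ennreal (norm (K (x - y) * d y - K (x0 - y) * d y)) \<partial>lebesgue)"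
      by (rule integral_norm_bound_ennreal[OF int])
    also have "\<dots> \<le> (\<integral>\<^sup>+y. ennreal Bd * G (x0 - y) \<partial>lebesgue)"
    proof (rule nn_integral_mono_AE, use Bd(2) in eventually_elim)
      case (elim y)
      show ?case
      proof (cases "d y = 0")
        case False
        then have "rho * l < norm (y - b)" using off[of y] by linarith
        moreover have "2 * R + real CARD('n) * l \<le> rho * l"
          using mult_right_mono[OF rho_gt(1), of l] l by (simp add: R_def algebra_simps)
        moreover have "norm (y - b) \<le> norm (x0 - y) + norm (x0 - b)"
          using norm_triangle_ineq4[of "x0 - b" "x0 - y"] by simp
        ultimately have far: "2 * R < norm (x0 - y)" using Qb[OF x0(1)] by linarith
        have "norm (K (x - y) * d y - K (x0 - y) * d y) = norm (K (x - y) - K (x0 - y)) * norm (d y)"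
          by (simp add: norm_mult[symmetric] algebra_simps)
        also have "\<dots> \<le> norm (K (x - y) - K (x0 - y)) * Bd" using elim by (intro mult_left_mono) auto
        finally have "ennreal (norm (K (x - y) * d y - K (x0 - y) * d y)) \<le> ennreal Bd * ennreal (norm (K (x - y) - K (x0 - y)))"
          using Bd by (subst ennreal_mult[symmetric]) (auto simp: mult_ac intro: ennreal_leI)
        then show ?thesis using far by (simp add: G_def)
      qed simp
    qed
    also have "\<dots> = ennreal Bd * (\<integral>\<^sup>+y. G (x0 - y) \<partial>lborel)"
      unfolding nn_integral_completion by (rule nn_integral_cmult) measurable
    also have "(\<integral>\<^sup>+y. G (x0 - y) \<partial>lborel) = (\<integral>\<^sup>+w. G w \<partial>lborel)"
      by (rule nn_integral_lborel_reflect) measurable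
    also have "\<dots> \<le> ennreal hc1"
      using hoermander_L1[OF R] by (simp add: G_def hc1_def)
    finally have "ennreal (norm (T d x - T d x0)) \<le> ennreal Bd * ennreal hc1"
      by (simp add: mult_left_mono)
    then show ?thesis
      using Bd hc1_nonneg by (simp add: ennreal_mult[symmetric])
  qed
  have eL: "e \<in> L2"
    by (rule L2_boundedI(1)[OF e hcube_lmeasurable Be])
  have eint: "integrable lebesgue e"
  proof (rule Bochner_Integration.integrable_bound)
    show "integrable lebesgue (\<lambda>x. Be * indicat_real (hcube b l) x)"
      using hcube_lmeasurable[of b l] by (intro integrable_mult_right) (auto simp: fmeasurable_def)
    show "AE x in lebesgue. norm (e x) \<le> norm (Be * indicat_real (hcube b l) x)"
      using Be(2) by eventually_elim (rule order.trans, assumption, simp)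
  qed measurable
  have i1: "integrable lebesgue (\<lambda>x. T d x * e x)" by (rule L2_mult_integrable[OF T_L2[OF d(1)] eL])
  have i2: "integrable lebesgue (\<lambda>x. (T d x - T d x0) * e x)"
    using Bochner_Integration.integrable_diff[OF i1 integrable_mult_right[OF eint, of "T d x0"]]
    by (simp add: algebra_simps)
  have "pair d e = (LINT x|lebesgue. T d x * e x) - (LINT x|lebesgue. T d x0 * e x)"
    using e0 by (simp add: pair_def)
  also have "\<dots> = (LINT x|lebesgue. (T d x - T d x0) * e x)"
    using Bochner_Integration.integral_diff[OF i1 integrable_mult_right[OF eint, of "T d x0"]]
    by (simp add: algebra_simps)
  finally have "norm (pair d e) \<le> (LINT x|lebesgue. norm ((T d x - T d x0) * e x))"
    by (metis integral_norm_bound)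
  also have "\<dots> \<le> (LINT x|lebesgue. (Bd * hc1 * Be) * indicator Q x)"
  proof (rule integral_mono_AE)
    show "AE x in lebesgue. norm ((T d x - T d x0) * e x) \<le> (Bd * hc1 * Be) * indicator Q x"
      using gAE Be(2)
    proof eventually_elim
      case (elim x)
      show ?case
      proof (cases "x \<in> Q")
        case True
        then show ?thesis using elim diff[of x] Be(1) Bd(1) hc1_nonneg by (auto simp: norm_mult Q_def intro!: mult_mono)
      qed (use elim in \<open>auto simp: Q_def\<close>)
    qed
    show "integrable lebesgue (\<lambda>x. (Bd * hc1 * Be) * indicat_real Q x)"
      using hcube_lmeasurable[of b l] by (intro integrable_mult_right) (auto simp: fmeasurable_def Q_def)
  qed (use i2 in auto)
  also have "\<dots> = Bd * Be * l ^ CARD('n) * hc1"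
    using l by (simp add: Q_def measure_hcube del: measure_completion)
  finally show ?thesis .
qed

text \<open>As \<open>d\<close> has mean zero, \<open>K (x - b)\<close> may be subtracted under the
  integral. After Fubini the inner integral over \<open>x\<close> is, for each \<open>y\<close> in
  the cube, a Hoermander pairing with \<open>h\<close> recentred at \<open>b\<close>, and the L1
  norm of \<open>d\<close> factors out.\<close>

lemma far_bound:
  fixes h :: "real ^ 'n \<Rightarrow> real"
  assumes l: "0 < l" and d [measurable]: "d \<in> borel_measurable lebesgue" and Bd: "0 \<le> Bd" "AE x in lebesgue. norm (d x) \<le> Bd"
    and off: "\<And>x. x \<notin> hcube b l \<Longrightarrow> d x = 0" and d0: "(LINT x|lebesgue. d x) = 0"
    and h: "h \<in> borel_measurable lebesgue" "\<And>x. 0 \<le> h x" and mu: "0 < mu" and D: "0 \<le> D"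
    and le: "\<And>r. l \<le> r \<Longrightarrow> (\<integral>\<^sup>+x\<in>ball b r. ennreal (complementary \<Phi> (h x / mu)) \<partial>lebesgue)
        \<le> ennreal D * emeasure lebesgue (ball b r)"
  shows "(\<integral>\<^sup>+x\<in>{x. rho * l < norm (x - b)}. ennreal (norm (T d x) * h x) \<partial>lebesgue)
    \<le> ennreal ((LINT x|lebesgue. norm (d x)) * hc * (1 + D) * mu)"
proof -
  define Q where "Q = hcube b l"
  define R where "R = (c0 + 1) * real CARD('n) * l"
  have Qb: "norm (x - b) \<le> real CARD('n) * l" if "x \<in> Q" for x
    using hcube_norm_diff[of x b l b] corner_in_hcube[OF l, of b] that by (simp add: Q_def)
  have R0: "l \<le> R" "0 < R" "2 * R \<le> rho * l"
  proof -
    have "1 * l \<le> ((c0 + 1) * real CARD('n)) * l"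
      using c0 n_pos l mult_mono[of 1 "c0 + 1" 1 "real CARD('n)"] by (intro mult_right_mono) auto
    then show "l \<le> R" "0 < R" using l by (auto simp: R_def)
    have "2 * R + real CARD('n) * l \<le> rho * l"
      using mult_right_mono[OF rho_gt(1), of l] l by (simp add: R_def algebra_simps)
    then show "2 * R \<le> rho * l" using l n_pos by (smt (verit) mult_nonneg_nonneg)
  qed
  have AEb: "AE x in lebesgue. norm (d x) \<le> Bd * indicator (hcube b l) x"
    using Bd(2) by eventually_elim (use off in \<open>auto simp: indicator_def\<close>)
  have dL: "d \<in> L2" by (rule L2_boundedI(1)[OF d hcube_lmeasurable Bd(1) AEb])
  have dint: "integrable lebesgue d"
  proof (rule Bochner_Integration.integrable_bound)
    show "integrable lebesgue (\<lambda>x. Bd * indicat_real (hcube b l) x)"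
      using hcube_lmeasurable[of b l] by (intro integrable_mult_right) (auto simp: fmeasurable_def)
    show "AE x in lebesgue. norm (d x) \<le> norm (Bd * indicat_real (hcube b l) x)"
      using AEb by eventually_elim (rule order.trans, assumption, simp)
  qed measurable
  have sub: "support d \<subseteq> cbox b (b + vec l)"
    unfolding support_def using off hcube_subset_cbox[of b l] by (intro closure_minimal) auto
  then have comp: "compact (support d)"
    using bounded_subset[OF bounded_cbox sub] by (auto simp: compact_eq_bounded_closed support_def)
  \<comment> \<open>Fubini is applied on \<open>lborel\<close> and needs a jointly measurable
    integrand, so \<open>h\<close>, and below \<open>norm (d x)\<close>, are replaced by Borel
    functions equal to them almost everywhere.\<close>
  obtain h1 where h1 [measurable]: "h1 \<in> borel_measurable lborel" and test_fun: "AE x in lborel. h x = h1 x"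
    using completion_ex_borel_measurable_real[OF h(1)] by blast
  define k where "k x = max 0 (h1 x)" for x
  have k [measurable]: "k \<in> borel_measurable borel" using h1 unfolding k_def by simp
  have k0: "0 \<le> k x" for x by (simp add: k_def)
  have hk: "AE x in lebesgue. h x = k x"
    using AE_completion[OF test_fun] by eventually_elim (use h(2) in \<open>auto simp: k_def max_def\<close>, metis order_antisym)
  have kle: "(\<integral>\<^sup>+w\<in>ball 0 r. ennreal (complementary \<Phi> (k (b + w) / mu)) \<partial>lborel)
      \<le> ennreal D * emeasure lborel (ball (0 :: real ^ 'n) r)" if "l \<le> r" for r
  proof -
    have [measurable]: "(\<lambda>x. complementary \<Phi> (k x / mu)) \<in> borel_measurable borel"
      using mu k0 by (intro complementary_measurable[OF Y]) auto
    have [measurable]: "ball b r \<in> sets borel" by simp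
    have "(\<integral>\<^sup>+w\<in>ball 0 r. ennreal (complementary \<Phi> (k (b + w) / mu)) \<partial>lborel)
        = (\<integral>\<^sup>+w. (\<lambda>x. ennreal (complementary \<Phi> (k x / mu)) * indicator (ball b r) x) (b + w) \<partial>lborel)"
      by (rule nn_integral_cong) (simp add: indicator_def dist_norm)
    also have "\<dots> = (\<integral>\<^sup>+x\<in>ball b r. ennreal (complementary \<Phi> (k x / mu)) \<partial>lborel)"
      by (rule nn_integral_lborel_translate) measurable
    also have "\<dots> = (\<integral>\<^sup>+x\<in>ball b r. ennreal (complementary \<Phi> (k x / mu)) \<partial>lebesgue)"
      by (simp add: nn_integral_completion)
    also have "\<dots> = (\<integral>\<^sup>+x\<in>ball b r. ennreal (complementary \<Phi> (h x / mu)) \<partial>lebesgue)"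
      using hk by (intro nn_integral_cong_AE) (auto elim!: eventually_mono)
    also have "\<dots> \<le> ennreal D * emeasure lborel (ball b r)" using le[OF that] by simp
    also have "emeasure lborel (ball b r) = emeasure lborel (ball (0 :: real ^ 'n) r)"
      using l that by (simp add: emeasure_lborel_ball_vec)
    finally show ?thesis .
  qed
  have nd: "(\<lambda>x. norm (d x)) \<in> borel_measurable lebesgue" by measurable
  obtain dn1 where dn1 [measurable]: "dn1 \<in> borel_measurable lborel" and dd: "AE x in lborel. norm (d x) = dn1 x"
    using completion_ex_borel_measurable_real[OF nd] by blast
  define dn where "dn x = (if x \<in> Q then max 0 (dn1 x) else 0)" for x
  have Qbor [measurable]: "Q \<in> sets borel" using hcube_borel by (simp add: Q_def)
  have dn [measurable]: "dn \<in> borel_measurable borel" using dn1 unfolding dn_def by simp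
  have dn0: "0 \<le> dn x" "x \<notin> Q \<Longrightarrow> dn x = 0" for x by (simp_all add: dn_def)
  have dnd: "AE x in lebesgue. norm (d x) = dn x"
    using AE_completion[OF dd] by eventually_elim (use off in \<open>auto simp: dn_def Q_def max_def\<close>, metis norm_ge_zero order_antisym)
  define E where "E = hc * (1 + D) * mu"
  have E0: "0 \<le> E" using hc_pos D mu by (simp add: E_def)
  define G where "G x y = ennreal (norm (K (x - y) - K (x - b)) * k x) * indicator {x. rho * l < norm (x - b)} x * ennreal (dn y)" for x y
  have [measurable]: "case_prod G \<in> borel_measurable (lborel \<Otimes>\<^sub>M lborel)" unfolding G_def by measurable
  have inner: "(\<integral>\<^sup>+x. G x y \<partial>lborel) \<le> ennreal E * ennreal (dn y)" for y
  proof (cases "y \<in> Q")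
    case True
    have "c0 * norm (y - b) \<le> c0 * (real CARD('n) * l)" using c0 Qb[OF True] by (intro mult_left_mono) auto
    also have "\<dots> < R" using l n_pos by (simp add: R_def algebra_simps)
    finally have R: "c0 * norm (y - b) < R" .
    have "(\<integral>\<^sup>+x. G x y \<partial>lborel) = (\<integral>\<^sup>+w. G (b + w) y \<partial>lborel)"
      by (rule nn_integral_lborel_translate[symmetric]) measurable
    also have "\<dots> \<le> (\<integral>\<^sup>+w. ennreal (norm (K (w - (y - b)) - K w) * k (b + w)) * indicator {w. 2 * R < norm w} w * ennreal (dn y) \<partial>lborel)"
      using R0(3) by (intro nn_integral_mono) (auto simp: G_def indicator_def algebra_simps)
    also have "\<dots> = (\<integral>\<^sup>+w\<in>{w. 2 * R < norm w}. ennreal (norm (K (w - (y - b)) - K w) * k (b + w)) \<partial>lborel) * ennreal (dn y)"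
      by (rule nn_integral_multc) measurable
    finally have "(\<integral>\<^sup>+x. G x y \<partial>lborel) \<le> \<dots>" .
    also have "(\<integral>\<^sup>+w\<in>{w. 2 * R < norm w}. ennreal (norm (K (w - (y - b)) - K w) * k (b + w)) \<partial>lborel) \<le> ennreal E"
      unfolding E_def
    proof (rule hoermander_pairing[OF _ _ mu D R])
      fix j :: nat
      have "R \<le> 2 * (2 ^ Suc j * R)" using R0(2) one_le_power[of "2::real" "Suc j"] by (simp add: mult_le_cancel_right1)
      then show "(\<integral>\<^sup>+x\<in>ball 0 (2 * (2 ^ Suc j * R)). ennreal (complementary \<Phi> (k (b + x) / mu)) \<partial>lborel)
        \<le> ennreal D * emeasure lborel (ball (0 :: real ^ 'n) (2 * (2 ^ Suc j * R)))"
        using R0(1) by (intro kle) linarith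
    qed (use k0 in \<open>auto\<close>)
    finally show ?thesis by (simp add: mult_right_mono)
  qed (simp add: G_def dn0)
  have "(\<integral>\<^sup>+x\<in>{x. rho * l < norm (x - b)}. ennreal (norm (T d x) * h x) \<partial>lebesgue)
    \<le> (\<integral>\<^sup>+x. (\<integral>\<^sup>+y. G x y \<partial>lborel) \<partial>lebesgue)"
  proof (rule nn_integral_mono_AE, use kernel_AE[OF dL comp] hk in eventually_elim)
    case (elim x)
    show ?case
    proof (cases "rho * l < norm (x - b)")
      case True
      have "x \<notin> support d"
      proof
        assume "x \<in> support d"
        then have "x \<in> cbox b (b + vec l)" using sub by auto
        then have x: "\<And>i. b $ i \<le> x $ i \<and> x $ i \<le> b $ i + l" by (simp add: mem_box_cart)
        have "norm (x - b) \<le> (\<Sum>i\<in>UNIV. \<bar>(x - b) $ i\<bar>)" by (rule norm_le_l1_cart)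
        also have "\<dots> \<le> (\<Sum>i\<in>(UNIV::'n set). l)"
        proof (rule sum_mono)
          fix i show "\<bar>(x - b) $ i\<bar> \<le> l" using x[of i] by auto
        qed
        finally have "norm (x - b) \<le> real CARD('n) * l" by simp
        moreover have "real CARD('n) * l < rho * l" using rho_gt(2) l by simp
        ultimately show False using True by linarith
      qed
      then have rep: "integrable lebesgue (\<lambda>y. K (x - y) * d y)" "T d x = (LINT y|lebesgue. K (x - y) * d y)"
        using elim by auto
      have int: "integrable lebesgue (\<lambda>y. K (x - y) * d y - K (x - b) * d y)"
        using rep dint by auto
      have "T d x = (LINT y|lebesgue. K (x - y) * d y - K (x - b) * d y)"
        using rep dint d0 by simp
      then have "ennreal (norm (T d x)) \<le> (\<integral>\<^sup>+y. ennreal (norm (K (x - y) * d y - K (x - b) * d y)) \<partial>lebesgue)"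
        using integral_norm_bound_ennreal[OF int] by simp
      also have "\<dots> = (\<integral>\<^sup>+y. ennreal (norm (K (x - y) - K (x - b))) * ennreal (dn y) \<partial>lebesgue)"
      proof (rule nn_integral_cong_AE, use dnd in eventually_elim)
        case (elim y)
        have "norm (K (x - y) * d y - K (x - b) * d y) = norm (K (x - y) - K (x - b)) * norm (d y)"
          by (simp add: norm_mult[symmetric] algebra_simps)
        then show ?case using elim dn0(1)[of y] by (simp add: ennreal_mult)
      qed
      finally have "ennreal (norm (T d x)) * ennreal (k x) \<le> (\<integral>\<^sup>+y. ennreal (norm (K (x - y) - K (x - b))) * ennreal (dn y) \<partial>lborel) * ennreal (k x)"
        unfolding nn_integral_completion by (rule mult_right_mono) simp
      also have "\<dots> = (\<integral>\<^sup>+y. ennreal (norm (K (x - y) - K (x - b))) * ennreal (dn y) * ennreal (k x) \<partial>lborel)"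
        by (rule nn_integral_multc[symmetric]) measurable
      also have "\<dots> = (\<integral>\<^sup>+y. G x y \<partial>lborel)"
        using True k0 by (intro nn_integral_cong) (simp add: G_def ennreal_mult mult_ac)
      finally show ?thesis using True elim k0 by (simp add: ennreal_mult)
    qed simp
  qed
  also have "\<dots> = (\<integral>\<^sup>+x. \<integral>\<^sup>+y. G x y \<partial>lborel \<partial>lborel)"
    by (rule nn_integral_completion)
  also have "\<dots> = (\<integral>\<^sup>+y. \<integral>\<^sup>+x. G x y \<partial>lborel \<partial>lborel)"
    by (rule lborel_pair.Fubini'[symmetric]) measurable
  also have "\<dots> \<le> (\<integral>\<^sup>+y. ennreal E * ennreal (dn y) \<partial>lborel)"
    by (rule nn_integral_mono) (rule inner)
  also have "\<dots> = ennreal E * (\<integral>\<^sup>+y. ennreal (dn y) \<partial>lebesgue)"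
    unfolding nn_integral_completion by (rule nn_integral_cmult) measurable
  also have "(\<integral>\<^sup>+y. ennreal (dn y) \<partial>lebesgue) = (\<integral>\<^sup>+y. ennreal (norm (d y)) \<partial>lebesgue)"
    using dnd by (intro nn_integral_cong_AE) (auto elim: eventually_mono)
  also have "\<dots> = ennreal (LINT y|lebesgue. norm (d y))"
    by (rule nn_integral_eq_integral) (use dint in auto)
  also have "ennreal E * ennreal (LINT y|lebesgue. norm (d y)) = ennreal ((LINT x|lebesgue. norm (d x)) * hc * (1 + D) * mu)"
    using E0 by (simp add: ennreal_mult[symmetric] E_def mult_ac)
  finally show ?thesis .
qed

lemma far_pair:
  fixes h :: "real ^ 'n \<Rightarrow> complex"
  assumes l: "0 < l" and d: "d \<in> borel_measurable lebesgue" and Bd: "0 \<le> Bd" "AE x in lebesgue. norm (d x) \<le> Bd"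
    and off: "\<And>x. x \<notin> hcube b l \<Longrightarrow> d x = 0" and d0: "(LINT x|lebesgue. d x) = 0"
    and h: "h \<in> L2" "\<And>x. norm (x - b) \<le> rho * l \<Longrightarrow> h x = 0" and mu: "0 < mu" and D: "0 \<le> D"
    and le: "\<And>r. l \<le> r \<Longrightarrow> (\<integral>\<^sup>+x\<in>ball b r. ennreal (complementary \<Phi> (norm (h x) / mu)) \<partial>lebesgue)
        \<le> ennreal D * emeasure lebesgue (ball b r)"
  shows "norm (pair d h) \<le> (LINT x|lebesgue. norm (d x)) * hc * (1 + D) * mu"
proof -
  have AEb: "AE x in lebesgue. norm (d x) \<le> Bd * indicator (hcube b l) x"
    using Bd(2) by eventually_elim (use off in \<open>auto simp: indicator_def\<close>)
  have dL: "d \<in> L2" by (rule L2_boundedI(1)[OF d hcube_lmeasurable Bd(1) AEb])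
  have "ennreal (norm (pair d h)) \<le> (\<integral>\<^sup>+x. ennreal (norm (T d x * h x)) \<partial>lebesgue)"
    unfolding pair_def by (rule integral_norm_bound_ennreal[OF L2_mult_integrable[OF T_L2[OF dL] h(1)]])
  also have "\<dots> = (\<integral>\<^sup>+x\<in>{x. rho * l < norm (x - b)}. ennreal (norm (T d x) * norm (h x)) \<partial>lebesgue)"
    by (intro nn_integral_cong) (auto simp: indicator_def norm_mult not_less h(2))
  also have "\<dots> \<le> ennreal ((LINT x|lebesgue. norm (d x)) * hc * (1 + D) * mu)"
    by (rule far_bound[OF l d Bd off d0 _ _ mu D le]) (use L2_measurable[OF h(1)] in auto)
  finally show ?thesis using hc_pos D mu by (simp add: ennreal_le_iff)
qed

end

subsection \<open>Local estimates\<close>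

lemma truncation_bound:
  fixes t tau s :: real
  assumes "0 \<le> t" "0 < tau" "1 < s"
  shows "t \<le> tau + tau powr (1 - s) * t powr s"
proof (cases "t \<le> tau")
  case True
  have "0 \<le> tau powr (1 - s) * t powr s" by simp
  then show ?thesis using True by linarith
next
  case False
  then have "t powr (1 - s) \<le> tau powr (1 - s)" using assms by (intro powr_mono2') auto
  then have "t powr (1 - s) * t powr s \<le> tau powr (1 - s) * t powr s" by (intro mult_right_mono) auto
  moreover have "t powr (1 - s) * t powr s = t" using False assms by (simp add: powr_add[symmetric])
  ultimately show ?thesis using assms by linarith
qed

lemma set_integrable_bounded:
  fixes h :: "real ^ 'n \<Rightarrow> real"
  assumes "h \<in> borel_measurable lebesgue" "\<And>x. \<bar>h x\<bar> \<le> B" "A \<in> lmeasurable"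
  shows "set_integrable lebesgue A h"
proof -
  have "set_integrable lebesgue A (\<lambda>x. h x * of_real 1)"
  proof (rule set_integrable_bounded_mult[where C=B])
    show "set_integrable lebesgue A (\<lambda>_. 1 :: real)"
      using assms(3) by (simp add: set_integrable_def lmeasurable_iff_integrable)
  qed (use assms in auto)
  then show ?thesis by simp
qed

context L2_operator
begin

text \<open>Here the sum is in the test function and \<open>T\<close> is applied once, so countable
  additivity of the integral of \<open>T b * h\<close> is enough.\<close>

lemma pair_right_countable_bound:
  assumes "countable S" "disjoint S" "S \<subseteq> sets lebesgue" "b \<in> L2" "h \<in> L2"
    and off: "\<And>x. x \<notin> \<Union>S \<Longrightarrow> h x = 0"
    and \<beta>: "\<And>Q. Q \<in> S \<Longrightarrow> norm (pair b (\<lambda>x. indicator Q x * h x)) \<le> \<beta> Q"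
    and M: "\<And>F. finite F \<Longrightarrow> F \<subseteq> S \<Longrightarrow> (\<Sum>Q\<in>F. \<beta> Q) \<le> M"
  shows "norm (pair b h) \<le> M"
proof (cases "S = {}")
  case True
  then have "h = (\<lambda>x. 0)" using off by auto
  then have "pair b h = 0" by (simp add: pair_def)
  then show ?thesis using M[of "{}"] by simp
next
  case False
  have US: "\<Union>S \<in> sets lebesgue" using assms(1,3) by (intro sets.countable_Union) auto
  have int: "integrable lebesgue (\<lambda>x. T b x * h x)" by (rule L2_mult_integrable[OF T_L2[OF assms(4)] assms(5)])
  have "set_integrable lebesgue (\<Union>S) (\<lambda>x. T b x * h x)"
    using integrable_mult_indicator[OF US int] by (simp add: set_integrable_def)
  then have lim: "(\<lambda>n. \<Sum>Q\<in>from_nat_into S ` {..<n}. LINT x:Q|lebesgue. T b x * h x) \<longlonglongrightarrow> (LINT x:\<Union>S|lebesgue. T b x * h x)"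
    by (rule set_integral_countable_Union_tendsto[OF assms(1) False assms(2,3)])
  have "(LINT x:\<Union>S|lebesgue. T b x * h x) = pair b h"
    unfolding pair_def set_lebesgue_integral_def
    by (rule Bochner_Integration.integral_cong) (use off in \<open>auto simp: indicator_def\<close>)
  then have lim': "(\<lambda>n. norm (\<Sum>Q\<in>from_nat_into S ` {..<n}. LINT x:Q|lebesgue. T b x * h x)) \<longlonglongrightarrow> norm (pair b h)"
    using tendsto_norm[OF lim] by simp
  have "norm (\<Sum>Q\<in>from_nat_into S ` {..<n}. LINT x:Q|lebesgue. T b x * h x) \<le> M" for n
  proof -
    have F: "finite (from_nat_into S ` {..<n})" "from_nat_into S ` {..<n} \<subseteq> S"
      using from_nat_into[OF False] by auto
    have "norm (\<Sum>Q\<in>from_nat_into S ` {..<n}. LINT x:Q|lebesgue. T b x * h x) \<le> (\<Sum>Q\<in>from_nat_into S ` {..<n}. \<beta> Q)"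
    proof (rule sum_norm_le)
      fix Q assume "Q \<in> from_nat_into S ` {..<n}"
      then have Q: "Q \<in> S" using F by blast
      have "(LINT x:Q|lebesgue. T b x * h x) = pair b (\<lambda>x. indicator Q x * h x)"
        unfolding pair_def set_lebesgue_integral_def
        by (rule Bochner_Integration.integral_cong) (auto simp: indicator_def)
      then show "norm (LINT x:Q|lebesgue. T b x * h x) \<le> \<beta> Q" using \<beta>[OF Q] by simp
    qed
    then show ?thesis using M[OF F] by linarith
  qed
  then show ?thesis by (intro LIMSEQ_le_const2[OF lim']) auto
qed

end

context singular_integral
begin

text \<open>The cube of side \<open>kap * l\<close> whose corner is moved back by
  \<open>rho * l\<close> in every coordinate contains the ball of radius \<open>rho * l\<close>
  about the old corner as well as the old cube.\<close>

definition "kap = 2 * rho + 1"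

text \<open>The first summand is the L2 estimate at the lowest height of the test function; the
  second is the geometric sum over the atoms at the greater heights, convergent for
  \<open>s > 1\<close>.\<close>

definition "loc_const s = Bt * 2 * 2 ^ CARD('n) * sqrt (kap ^ CARD('n)) +
  6 * 2 ^ CARD('n) * (Bt * sqrt (unit_ball_vol (real CARD('n)) * rho ^ CARD('n)) + hc1) * kap ^ CARD('n) / (1 - 2 powr (1 - s))"

lemma kap_pos: "0 < kap"
  using rho_gt(3) by (simp add: kap_def)

text \<open>Inside the ball of radius \<open>rho * l\<close> the L2 bound of \<open>T\<close>
  suffices, as the ball and the cube have comparable volume; outside it the mean zero of
  \<open>e\<close> makes \<open>smooth_pair\<close> available.\<close>

lemma cube_atom_pair:
  assumes d: "d \<in> L2" "compact (support d)" and Bd: "0 \<le> Bd" "AE x in lebesgue. norm (d x) \<le> Bd"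
    and l: "0 < l" and e: "e \<in> borel_measurable lebesgue" and Be: "0 \<le> Be"
      "AE x in lebesgue. norm (e x) \<le> Be * indicator (hcube b l) x" and e0: "(LINT x|lebesgue. e x) = 0"
  shows "norm (pair d e) \<le> Bd * Be * (Bt * sqrt (unit_ball_vol (real CARD('n)) * rho ^ CARD('n)) + hc1) * l ^ CARD('n)"
proof -
  define N where "N = cball b (rho * l)"
  define V where "V = unit_ball_vol (real CARD('n)) * rho ^ CARD('n)"
  have Ns: "N \<in> sets lebesgue" "-N \<in> sets lebesgue" by (auto simp: N_def)
  define d1 where "d1 x = indicator N x * d x" for x
  define d2 where "d2 x = indicator (-N) x * d x" for x
  have L: "d1 \<in> L2" "d2 \<in> L2" unfolding d1_def d2_def by (intro L2_restrict d Ns)+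
  have eL: "e \<in> L2" "L2_norm e \<le> Be * sqrt (l ^ CARD('n))"
    using L2_boundedI[OF e hcube_lmeasurable Be] l by (auto simp: measure_hcube simp del: measure_completion)
  have "pair d e = pair (\<lambda>x. d1 x + d2 x) e"
    by (rule arg_cong[of _ _ "\<lambda>d. pair d e"]) (auto simp: d1_def d2_def indicator_def)
  also have "\<dots> = pair d1 e + pair d2 e" by (rule pair_add[OF L eL(1)])
  finally have split: "norm (pair d e) \<le> norm (pair d1 e) + norm (pair d2 e)" by (simp add: norm_triangle_ineq)
  have "norm (pair d1 e) \<le> Bt * (Bd * sqrt (V * l ^ CARD('n))) * (Be * sqrt (l ^ CARD('n)))"
  proof -
    have "L2_norm d1 \<le> Bd * sqrt (measure lebesgue N)"
    proof (rule L2_boundedI(2))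
      show "AE x in lebesgue. norm (d1 x) \<le> Bd * indicator N x"
        using Bd(2) by eventually_elim (auto simp: d1_def indicator_def)
    qed (use Bd L(1) in \<open>auto simp: N_def intro: L2_measurable\<close>)
    also have "measure lebesgue N = V * l ^ CARD('n)"
      unfolding N_def V_def using rho_gt(3) l by (simp add: content_cball power_mult_distrib)
    finally have "Bt * L2_norm d1 * L2_norm e \<le> Bt * (Bd * sqrt (V * l ^ CARD('n))) * (Be * sqrt (l ^ CARD('n)))"
      using Bt Be(1) Bd(1) eL L2_norm_nonneg rho_gt(3) l by (intro mult_mono mult_left_mono mult_nonneg_nonneg) (auto simp: V_def)
    then show ?thesis using pair_bound[OF L(1) eL(1)] by linarith
  qed
  also have "\<dots> = Bd * Be * (Bt * sqrt V) * l ^ CARD('n)"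
    using l by (simp add: real_sqrt_mult mult_ac)
  finally have 1: "norm (pair d1 e) \<le> Bd * Be * (Bt * sqrt V) * l ^ CARD('n)" .
  have 2: "norm (pair d2 e) \<le> Bd * Be * l ^ CARD('n) * hc1"
  proof (rule smooth_pair[OF l L(2) _ Bd(1) _ _ e Be e0])
    have "support d2 \<subseteq> support d"
      unfolding support_def by (intro closure_mono) (auto simp: d2_def)
    then show "compact (support d2)"
      using d(2) by (metis support_def closed_closure compact_Int_closed inf.absorb_iff2)
    show "AE x in lebesgue. norm (d2 x) \<le> Bd"
      using Bd by (auto elim!: eventually_mono simp: d2_def indicator_def)
    show "d2 y = 0" if "norm (y - b) \<le> rho * l" for y
      using that by (simp add: d2_def N_def dist_norm norm_minus_commute)
  qed
  show ?thesis using split 1 2 by (simp add: V_def algebra_simps)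
qed

text \<open>The test function is decomposed at its own heights. This replaces the \<open>L\<^sup>p\<close> bounds of \<open>T\<close>.\<close>

lemma local_bound:
  assumes l: "0 < l" and d: "d \<in> borel_measurable lebesgue" and Bd: "0 \<le> Bd" "AE x in lebesgue. norm (d x) \<le> Bd"
    and off: "\<And>x. x \<notin> hcube b l \<Longrightarrow> d x = 0"
    and h [measurable]: "h \<in> borel_measurable lebesgue" and Bh: "\<And>x. norm (h x) \<le> Bh"
    and hoff: "\<And>x. x \<notin> hcube a (kap * l) \<Longrightarrow> h x = 0"
    and s: "1 < s" and mu: "0 < mu"
    and hs: "(LINT x:hcube a (kap * l)|lebesgue. norm (h x) powr s) \<le> mu powr s * (kap * l) ^ CARD('n)"
  shows "norm (pair d h) \<le> loc_const s * Bd * l ^ CARD('n) * mu"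
proof -
  define L where "L = kap * l"
  have L: "0 < L" using l kap_pos by (simp add: L_def)
  define N where "N = CARD('n)"
  define Q where "Q = hcube a L"
  have Qm: "measure lebesgue Q = L ^ N" using L by (simp add: Q_def N_def measure_hcube del: measure_completion)
  have AEb: "AE x in lebesgue. norm (d x) \<le> Bd * indicator (hcube b l) x"
    using Bd(2) by eventually_elim (use off in \<open>auto simp: indicator_def\<close>)
  have dL: "d \<in> L2" "L2_norm d \<le> Bd * sqrt (l ^ N)"
    using L2_boundedI[OF d hcube_lmeasurable Bd(1) AEb] l by (auto simp: measure_hcube N_def simp del: measure_completion)
  have dc: "compact (support d)"
  proof -
    have "support d \<subseteq> cbox b (b + vec l)"
      unfolding support_def using off hcube_subset_cbox[of b l] by (intro closure_minimal) auto
    then show ?thesis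
      using bounded_subset[OF bounded_cbox] by (auto simp: compact_eq_bounded_closed support_def)
  qed
  have one: "set_integrable lebesgue A (\<lambda>_. 1 :: real)" if "A \<in> lmeasurable" for A :: "(real ^ 'n) set"
    using that by (simp add: set_integrable_def lmeasurable_iff_integrable)
  have lint1: "(LINT x:A|lebesgue. (1::real)) = measure lebesgue A" if "A \<in> sets lebesgue" for A :: "(real ^ 'n) set"
    using that by (simp add: set_lebesgue_integral_def)
  interpret Z: calderon_zygmund a L "\<lambda>_. 1" h Bh "2 ^ N"
  proof
    fix k x
    have "measure lebesgue (dcube a L k x) = (L / 2 ^ k) ^ N" for k
    proof -
      obtain c where "dcube a L k x = hcube c (L / 2 ^ k)" using dcube_is_hcube[OF L] .
      then show ?thesis using L by (simp add: measure_hcube N_def del: measure_completion)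
    qed
    then show "(LINT y:dcube a L k x|lebesgue. 1) \<le> 2 ^ N * (LINT y:dcube a L (Suc k) x|lebesgue. (1::real))"
      using L by (simp add: lint1 power_mult_distrib[symmetric] del: measure_completion)
  qed (use L Bh one in auto)
  have ZW: "Z.W A = measure lebesgue A" if "A \<in> sets lebesgue" for A
    using lint1[OF that] by (simp add: Z.W_def)
  have hp: "set_integrable lebesgue A (\<lambda>x. norm (h x) powr s)" if "A \<in> lmeasurable" for A
  proof (rule set_integrable_bounded[OF _ _ that])
    show "\<bar>norm (h x) powr s\<bar> \<le> Bh powr s" for x
      using Bh s by (auto intro!: powr_mono2)
  qed measurable
  have Fle: "Z.F A \<le> tau * measure lebesgue A + tau powr (1 - s) * (LINT x:A|lebesgue. norm (h x) powr s)"
    if A: "A \<in> lmeasurable" "A \<subseteq> Q" and tau: "0 < tau" for A tau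
  proof -
    have "Z.F A \<le> (LINT x:A|lebesgue. tau * 1 + tau powr (1 - s) * norm (h x) powr s)"
      unfolding Z.F_def
    proof (rule set_integral_mono)
      show "set_integrable lebesgue A (\<lambda>x. norm (h x) * 1)"
        using A by (intro Z.nfw_integrable) (auto simp: Q_def fmeasurable_def)
      show "set_integrable lebesgue A (\<lambda>x. tau * 1 + tau powr (1 - s) * norm (h x) powr s)"
        by (rule set_integral_add(1)[OF set_integrable_mult_right[OF one[OF A(1)]] set_integrable_mult_right[OF hp[OF A(1)]]])
      show "norm (h x) * 1 \<le> tau * 1 + tau powr (1 - s) * norm (h x) powr s" for x
        using truncation_bound[OF _ tau s, of "norm (h x)"] by simp
    qed
    also have "\<dots> = (LINT x:A|lebesgue. tau * 1) + (LINT x:A|lebesgue. tau powr (1 - s) * norm (h x) powr s)"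
      by (rule set_integral_add(2)[OF set_integrable_mult_right[OF one[OF A(1)]] set_integrable_mult_right[OF hp[OF A(1)]]])
    also have "\<dots> = tau * measure lebesgue A + tau powr (1 - s) * (LINT x:A|lebesgue. norm (h x) powr s)"
      using A(1) lint1[of A] by (simp only: set_integral_mult_right fmeasurableD)
    finally show ?thesis .
  qed
  \<comment> \<open>By \<open>truncation_bound\<close> at \<open>mu\<close> the mean of
    \<open>norm (h x)\<close> on the root is at most \<open>2 * mu\<close>, so the root does not
    stop even at the lowest height.\<close>
  define m where "m i = 2 * mu * 2 ^ i" for i :: nat
  have m0: "0 < m i" for i using mu by (simp add: m_def)
  have mS: "m i \<le> m (Suc i)" for i using mu by (simp add: m_def)
  have m_le: "m 0 \<le> m i" for i using mu one_le_power[of "2::real" i] by (simp add: m_def)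
  have nstop: "\<not> Z.stops (m i) (hcube a L)" for i
  proof -
    have "Z.F Q \<le> mu * measure lebesgue Q + mu powr (1 - s) * (LINT x:Q|lebesgue. norm (h x) powr s)"
      by (rule Fle) (use mu in \<open>auto simp: Q_def\<close>)
    also have "\<dots> \<le> mu * L ^ N + mu powr (1 - s) * (mu powr s * L ^ N)"
      unfolding Qm using hs by (intro add_left_mono mult_left_mono) (auto simp: Q_def L_def N_def)
    finally have "Z.F Q \<le> mu * L ^ N + mu powr (1 - s) * (mu powr s * L ^ N)" .
    also have "mu powr (1 - s) * (mu powr s * L ^ N) = mu * L ^ N"
      using mu by (simp add: mult.assoc[symmetric] powr_add[symmetric])
    finally have "Z.F Q \<le> m 0 * Z.W Q" using Qm ZW[of Q] by (simp add: m_def Q_def)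
    then have "\<not> Z.stops (m 0) (hcube a L)" by (simp add: Z.stops_def Q_def)
    then show ?thesis using Z.stops_mono[of "hcube a L" "m 0" "m i"] m_le[of i] by auto
  qed
  define q where "q = 2 powr (1 - s)"
  have q: "0 < q" "q < 1" using s by (auto simp: q_def intro!: powr_less_one)
  \<comment> \<open>Truncation at half the height lets \<open>tau * measure lebesgue R\<close> be
    subtracted from both sides of the stopping criterion; a Chebyshev bound by the integral of
    \<open>norm (h x) powr s\<close> remains. It decays like \<open>(2 ^ i) powr (- s)\<close>, of
    which \<open>(1/2) ^ i\<close> compensates the height and \<open>q ^ i\<close> is the
    gain.\<close>
  have size: "(\<Sum>R\<in>F. measure lebesgue R) \<le> (1/2) ^ i * q ^ i * L ^ N" if F: "finite F" "F \<subseteq> Z.S (m i)" for F i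
  proof -
    define tau where "tau = mu * 2 ^ i"
    have tau: "0 < tau" "m i = 2 * tau" using mu by (auto simp: tau_def m_def)
    have FR: "disjoint F" "F \<subseteq> sets lebesgue" "\<Union>F \<subseteq> Q"
      using pairwise_subset[OF Z.S_disjoint F(2)] Z.S_sets[of "m i"] Z.S_subset[of _ "m i"] F(2) by (auto simp: Q_def)
    have lm: "R \<in> lmeasurable" if "R \<in> F" for R
      using Z.S_hcube[of R "m i"] that F(2) by (metis hcube_lmeasurable subsetD)
    have "measure lebesgue R \<le> tau powr (- s) * (LINT x:R|lebesgue. norm (h x) powr s)" if R: "R \<in> F" for R
    proof -
      have RS: "R \<in> Z.S (m i)" "R \<in> sets lebesgue" using R F(2) FR(2) by blast+
      have "m i * measure lebesgue R < Z.F R" using Z.S_stops[OF RS(1)] unfolding ZW[OF RS(2)] .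
      also have "Z.F R \<le> tau * measure lebesgue R + tau powr (1 - s) * (LINT x:R|lebesgue. norm (h x) powr s)"
        by (rule Fle[OF lm[OF R] _ tau(1)]) (use FR(3) R in blast)
      finally have "tau * measure lebesgue R \<le> tau powr (1 - s) * (LINT x:R|lebesgue. norm (h x) powr s)"
        using tau by simp
      then have "measure lebesgue R \<le> tau powr (1 - s) / tau * (LINT x:R|lebesgue. norm (h x) powr s)"
        using tau by (simp add: field_simps)
      also have "tau powr (1 - s) / tau = tau powr (- s)" using tau by (simp add: powr_diff powr_minus field_simps)
      finally show ?thesis .
    qed
    then have "(\<Sum>R\<in>F. measure lebesgue R) \<le> (\<Sum>R\<in>F. tau powr (- s) * (LINT x:R|lebesgue. norm (h x) powr s))"
      by (rule sum_mono)
    also have "\<dots> = tau powr (- s) * (\<Sum>R\<in>F. LINT x:R|lebesgue. norm (h x) powr s)"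
      by (simp add: sum_distrib_left)
    also have "(\<Sum>R\<in>F. LINT x:R|lebesgue. norm (h x) powr s) = (LINT x:(\<Union>R\<in>F. R)|lebesgue. norm (h x) powr s)"
    proof (rule set_integral_finite_Union[symmetric, OF F(1)])
      show "disjoint_family_on (\<lambda>R. R) F"
        using FR(1) by (simp add: disjoint_family_on_def pairwise_def disjnt_def)
    qed (use hp lm in \<open>auto simp: fmeasurable_def\<close>)
    also have "\<dots> \<le> (LINT x:Q|lebesgue. norm (h x) powr s)"
      unfolding set_lebesgue_integral_def
    proof (rule integral_mono)
      have "(\<Union>R\<in>F. R) \<in> lmeasurable" using F(1) lm by (intro fmeasurable.finite_UN) auto
      from hp[OF this] show "integrable lebesgue (\<lambda>x. indicat_real (\<Union>R\<in>F. R) x *\<^sub>R norm (h x) powr s)"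
        by (simp add: set_integrable_def)
      show "integrable lebesgue (\<lambda>x. indicat_real Q x *\<^sub>R norm (h x) powr s)"
        using hp[of Q] by (simp add: set_integrable_def Q_def)
    qed (use FR(3) in \<open>auto simp: indicator_def\<close>)
    also have "\<dots> \<le> mu powr s * L ^ N" using hs by (simp add: Q_def L_def N_def)
    finally have "(\<Sum>R\<in>F. measure lebesgue R) \<le> tau powr (- s) * (mu powr s * L ^ N)"
      by (simp add: mult_left_mono)
    also have "tau powr (- s) * (mu powr s * L ^ N) = (2 ^ i) powr (- s) * L ^ N"
      using mu by (simp add: tau_def powr_mult powr_minus field_simps)
    also have "(2 ^ i) powr (- s) = (1/2) ^ i * q ^ i"
    proof -
      have "(2::real) powr (- s) = 1/2 * q" by (simp add: q_def powr_diff powr_minus field_simps)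
      moreover have "((2::real) ^ i) powr (- s) = (2 powr (- s)) ^ i"
        by (simp add: powr_realpow[symmetric] powr_powr mult.commute)
      ultimately show ?thesis by (simp only: power_mult_distrib)
    qed
    finally show ?thesis .
  qed
  have gmeas: "Z.g lam \<in> borel_measurable lebesgue" for lam by (rule Z.g_measurable)
  have goff: "Z.g lam x = 0" if "x \<notin> Q" for lam x
  proof -
    have "x \<notin> \<Union> (Z.S lam)" using that Z.S_subset by (auto simp: Q_def)
    then show ?thesis using Z.g_off_S[of x lam] hoff that by (simp add: Q_def L_def)
  qed
  have gb: "AE x in lebesgue. norm (Z.g (m i) x) \<le> (2 ^ N * m i) * indicator Q x" for i
    using Z.g_AE_bound[OF nstop, of i] m0[of i] by (auto elim!: eventually_mono simp: indicator_def goff Q_def less_imp_le)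
  have gL: "Z.g (m i) \<in> L2" "L2_norm (Z.g (m i)) \<le> (2 ^ N * m i) * sqrt (L ^ N)" for i
    using L2_boundedI[OF gmeas, of Q "2 ^ N * m i"] gb[of i] m0[of i] Qm by (auto simp: Q_def less_imp_le)
  define Ca where "Ca = Bt * sqrt (unit_ball_vol (real CARD('n)) * rho ^ CARD('n)) + hc1"
  have Ca: "0 \<le> Ca" using Bt hc1_nonneg rho_gt(3) by (auto simp: Ca_def intro!: add_nonneg_nonneg mult_nonneg_nonneg)
  define C2 where "C2 = Bd * (6 * 2 ^ N * mu) * Ca * L ^ N"
  have C2: "0 \<le> C2" using Bd mu Ca L by (simp add: C2_def)
  \<comment> \<open>On each stopping cube of the lower height the difference has mean zero and is at
    most \<open>3 * 2 ^ N * m i\<close>, hence is an atom for \<open>cube_atom_pair\<close>.\<close>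
  have step: "norm (pair d (\<lambda>x. Z.g (m (Suc i)) x - Z.g (m i) x)) \<le> C2 * q ^ i" for i
  proof -
    define e where "e x = Z.g (m (Suc i)) x - Z.g (m i) x" for x
    have em [measurable]: "e \<in> borel_measurable lebesgue" unfolding e_def using gmeas by measurable
    have eL: "e \<in> L2" unfolding e_def by (intro L2_diff gL)
    have eb: "AE x in lebesgue. norm (e x) \<le> 3 * 2 ^ N * m i"
      using gb[of i] gb[of "Suc i"]
    proof eventually_elim
      case (elim x)
      have "norm (e x) \<le> norm (Z.g (m (Suc i)) x) + norm (Z.g (m i) x)"
        unfolding e_def by (rule norm_triangle_ineq4)
      also have "\<dots> \<le> 2 ^ N * m (Suc i) + 2 ^ N * m i"
        using elim m0[of i] m0[of "Suc i"] by (intro add_mono order.trans[OF elim(1)] order.trans[OF elim(2)]) (auto simp: indicator_def)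
      also have "\<dots> = 3 * 2 ^ N * m i" by (simp add: m_def)
      finally show ?case .
    qed
    have "norm (pair d e) \<le> Bd * (3 * 2 ^ N * m i) * Ca * ((1/2) ^ i * q ^ i * L ^ N)"
    proof (rule pair_right_countable_bound[OF Z.S_countable Z.S_disjoint Z.S_sets dL(1) eL])
      show "e x = 0" if "x \<notin> \<Union> (Z.S (m i))" for x
      proof -
        have "x \<notin> \<Union> (Z.S (m (Suc i)))" using that Z.Union_S_mono[OF mS[of i]] by blast
        from Z.g_off_S[OF this] Z.g_off_S[OF that] show ?thesis by (simp add: e_def)
      qed
      fix R assume R: "R \<in> Z.S (m i)"
      obtain c l' where c: "0 < l'" "R = hcube c l'" using Z.S_hcube[OF R] by metis
      have Rs: "R \<in> sets lebesgue" using R Z.S_sets by auto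
      have RQ: "R \<subseteq> hcube a L" by (rule Z.S_subset[OF R])
      have gi: "set_integrable lebesgue R (Z.g (m j))" for j
      proof -
        have "set_integrable lebesgue R (\<lambda>x. Z.g (m j) x * of_real 1)"
        proof (rule set_integrable_bounded_mult[OF gmeas])
          show "AE x in lebesgue. x \<in> R \<longrightarrow> norm (Z.g (m j) x) \<le> 2 ^ N * m j"
            using gb[of j] RQ by (auto elim!: eventually_mono simp: Q_def indicator_def subset_iff split: if_splits)
        qed (use one[of R] c in auto)
        then show ?thesis by simp
      qed
      show "norm (pair d (\<lambda>x. indicator R x * e x)) \<le> Bd * (3 * 2 ^ N * m i) * Ca * measure lebesgue R"
      proof -
        have "norm (pair d (\<lambda>x. indicator R x * e x)) \<le> Bd * (3 * 2 ^ N * m i) * Ca * l' ^ CARD('n)"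
          unfolding Ca_def
        proof (rule cube_atom_pair[OF dL(1) dc Bd c(1)])
          show "(\<lambda>x. indicator R x * e x) \<in> borel_measurable lebesgue" using Rs by measurable
          show "AE x in lebesgue. norm (indicator R x * e x) \<le> (3 * 2 ^ N * m i) * indicator (hcube c l') x"
            using eb by eventually_elim (auto simp: c indicator_def)
          have "(LINT x|lebesgue. indicator R x * e x) = (LINT x:R|lebesgue. Z.g (m (Suc i)) x - Z.g (m i) x)"
            unfolding set_lebesgue_integral_def
            by (rule Bochner_Integration.integral_cong) (auto simp: e_def indicator_def)
          also have "\<dots> = (LINT x:R|lebesgue. Z.g (m (Suc i)) x) - (LINT x:R|lebesgue. Z.g (m i) x)"
            by (rule set_integral_diff(2)[OF gi gi])
          also have "\<dots> = 0"
            using Z.g_integral[OF mS R nstop] Z.g_integral[OF order.refl R nstop] m0 by (simp add: less_imp_le)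
          finally show "(LINT x|lebesgue. indicator R x * e x) = 0" .
        qed (use m0[of i] in simp)
        moreover have "measure lebesgue R = l' ^ CARD('n)" using c by (simp add: measure_hcube del: measure_completion)
        ultimately show ?thesis by simp
      qed
    next
      fix F assume F: "finite F" "F \<subseteq> Z.S (m i)"
      have "(\<Sum>R\<in>F. Bd * (3 * 2 ^ N * m i) * Ca * measure lebesgue R) = Bd * (3 * 2 ^ N * m i) * Ca * (\<Sum>R\<in>F. measure lebesgue R)"
        by (simp add: sum_distrib_left)
      also have "\<dots> \<le> Bd * (3 * 2 ^ N * m i) * Ca * ((1/2) ^ i * q ^ i * L ^ N)"
        using size[OF F] Bd(1) m0[of i] Ca by (intro mult_left_mono mult_nonneg_nonneg) auto
      finally show "(\<Sum>R\<in>F. Bd * (3 * 2 ^ N * m i) * Ca * measure lebesgue R) \<le> Bd * (3 * 2 ^ N * m i) * Ca * ((1/2) ^ i * q ^ i * L ^ N)" .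
    qed
    also have "\<dots> = C2 * q ^ i" by (simp add: C2_def m_def power_divide)
    also have "e = (\<lambda>x. Z.g (m (Suc i)) x - Z.g (m i) x)" by (simp add: e_def fun_eq_iff)
    finally show ?thesis .
  qed
  have tel: "norm (pair d (Z.g (m j))) \<le> norm (pair d (Z.g (m 0))) + (\<Sum>i<j. C2 * q ^ i)" for j
  proof (induction j)
    case (Suc j)
    have "pair d (Z.g (m (Suc j))) = pair d (\<lambda>x. Z.g (m j) x + (Z.g (m (Suc j)) x - Z.g (m j) x))" by simp
    also have "\<dots> = pair d (Z.g (m j)) + pair d (\<lambda>x. Z.g (m (Suc j)) x - Z.g (m j) x)"
      by (intro pair_add_right dL gL L2_diff)
    finally have "norm (pair d (Z.g (m (Suc j)))) \<le> norm (pair d (Z.g (m j))) + norm (pair d (\<lambda>x. Z.g (m (Suc j)) x - Z.g (m j) x))"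
      by (metis norm_triangle_ineq)
    then show ?case using Suc step[of j] by simp
  qed simp
  obtain j where j: "Bh \<le> m j"
  proof -
    obtain j :: nat where "Bh / (2 * mu) < 2 ^ j" using real_arch_pow[of 2 "Bh / (2 * mu)"] by auto
    then have "Bh \<le> m j" using mu by (simp add: m_def field_simps)
    then show ?thesis using that by blast
  qed
  \<comment> \<open>Above the bound of \<open>h\<close> no cube stops and the good part is
    \<open>h\<close> itself, so the telescoping sum is finite.\<close>
  have "Z.S (m j) = {}"
  proof (rule ccontr)
    assume "Z.S (m j) \<noteq> {}"
    then obtain R where R: "R \<in> Z.S (m j)" by blast
    have RR: "R \<in> sets lebesgue" "R \<subseteq> hcube a L" using R Z.S_sets Z.S_subset by auto
    have "Z.F R \<le> (LINT x:R|lebesgue. Bh * 1)"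
      unfolding Z.F_def
      by (rule set_integral_mono[OF Z.nfw_integrable[OF RR] set_integrable_mult_right[OF Z.w_subset[OF RR]]])
        (use Bh in auto)
    also have "\<dots> = Bh * Z.W R" unfolding Z.W_def by (rule set_integral_mult_right)
    also have "\<dots> \<le> m j * Z.W R" using j Z.S_W_pos[OF R] by (intro mult_right_mono) auto
    finally show False using Z.S_stops[OF R] by simp
  qed
  then have "Z.g (m j) = h" using Z.g_off_S by (auto simp: fun_eq_iff)
  then have "norm (pair d h) \<le> norm (pair d (Z.g (m 0))) + (\<Sum>i<j. C2 * q ^ i)" using tel[of j] by simp
  also have "(\<Sum>i<j. C2 * q ^ i) \<le> C2 / (1 - q)"
  proof -
    have "(\<Sum>i<j. C2 * q ^ i) = C2 * (\<Sum>i<j. q ^ i)" by (simp add: sum_distrib_left)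
    also have "\<dots> \<le> C2 * (1 / (1 - q))"
      using q C2 by (intro mult_left_mono) (simp_all add: sum_gp_strict divide_right_mono)
    finally show ?thesis by simp
  qed
  also have "norm (pair d (Z.g (m 0))) \<le> Bt * (Bd * sqrt (l ^ N)) * ((2 ^ N * m 0) * sqrt (L ^ N))"
  proof -
    have "Bt * L2_norm d * L2_norm (Z.g (m 0)) \<le> Bt * (Bd * sqrt (l ^ N)) * ((2 ^ N * m 0) * sqrt (L ^ N))"
      using Bt Bd(1) dL gL L2_norm_nonneg l by (intro mult_mono mult_left_mono mult_nonneg_nonneg) auto
    then show ?thesis using pair_bound[OF dL(1) gL(1)] by (meson order.trans)
  qed
  also have "Bt * (Bd * sqrt (l ^ N)) * ((2 ^ N * m 0) * sqrt (L ^ N)) + C2 / (1 - q)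
      = loc_const s * Bd * l ^ CARD('n) * mu"
  proof -
    have "sqrt (L ^ N) = sqrt (kap ^ N) * sqrt (l ^ N)" by (simp add: L_def power_mult_distrib real_sqrt_mult)
    then have 1: "Bt * (Bd * sqrt (l ^ N)) * ((2 ^ N * m 0) * sqrt (L ^ N)) = (Bt * 2 * 2 ^ N * sqrt (kap ^ N)) * Bd * (sqrt (l ^ N) * sqrt (l ^ N)) * mu"
      by (simp add: m_def)
    have 2: "C2 / (1 - q) = (6 * 2 ^ N * Ca * kap ^ N / (1 - q)) * Bd * l ^ N * mu"
      by (simp add: C2_def L_def power_mult_distrib)
    show ?thesis unfolding 1 2 loc_const_def using l by (simp add: Ca_def q_def N_def distrib_right)
  qed
  finally show ?thesis by simp
qed

end

subsection \<open>Weights\<close>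

lemma locally_integrable_measurable:
  fixes w :: "real ^ 'n \<Rightarrow> real"
  assumes "locally_integrable w"
  shows "w \<in> borel_measurable lebesgue"
proof (rule borel_measurable_LIMSEQ_metric)
  fix n :: nat
  have "set_integrable lebesgue (cball 0 (real n)) w"
    using assms by (simp add: locally_integrable_def)
  then show "(\<lambda>x. indicat_real (cball 0 (real n)) x *\<^sub>R w x) \<in> borel_measurable lebesgue"
    unfolding set_integrable_def by (rule borel_measurable_integrable)
next
  fix x :: "real ^ 'n"
  obtain n :: nat where n: "norm x \<le> real n" using real_arch_simple by blast
  have "eventually (\<lambda>m. indicat_real (cball 0 (real m)) x *\<^sub>R w x = w x) sequentially"
    using eventually_ge_at_top[of n] by eventually_elim (use n in auto)
  then show "(\<lambda>m. indicat_real (cball 0 (real m)) x *\<^sub>R w x) \<longlonglongrightarrow> w x"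
    by (rule tendsto_eventually)
qed

lemma cube_sets [simp]: "B \<in> cubes \<Longrightarrow> B \<in> sets lebesgue"
  by (auto simp: cubes_def)

lemma cube_compact: "B \<in> cubes \<Longrightarrow> compact B"
  by (auto simp: cubes_def)

lemma cube_lmeasurable: "B \<in> cubes \<Longrightarrow> B \<in> lmeasurable"
  by (intro lmeasurable_compact cube_compact)

lemma cube_measure_pos: "B \<in> cubes \<Longrightarrow> 0 < measure lebesgue B"
  by (auto simp: cubes_iff measure_cbox_cube simp del: measure_completion)

lemma cube_emeasure: "B \<in> cubes \<Longrightarrow> emeasure lebesgue B = ennreal (measure lebesgue B)"
  using cube_lmeasurable[of B] by (simp add: emeasure_eq_measure2 del: emeasure_completion measure_completion)

lemma cbox_in_cubes: "0 < h \<Longrightarrow> cbox b (b + vec h) \<in> cubes"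
  by (auto simp: cubes_def)

lemma hcube_subset_imp_cbox:
  assumes "hcube c h \<subseteq> hcube b l" "0 < h"
  shows "cbox c (c + vec h) \<subseteq> cbox b (b + vec (l :: real))"
proof -
  have "box c (c + vec h) \<subseteq> cbox b (b + vec l)"
    using box_subset_hcube[of c h] assms(1) hcube_subset_cbox[of b l] by blast
  then have "closure (box c (c + vec h)) \<subseteq> cbox b (b + vec l)"
    by (rule closure_minimal) (rule closed_cbox)
  moreover have "box c (c + vec h) \<noteq> {}" using assms(2) by (simp add: interval_ne_empty_cart)
  ultimately show ?thesis by (simp add: closure_box)
qed

text \<open>\<open>RH_inf\<close> and the Muckenhoupt condition with one common constant. Here
  \<beta> stands for \<open>q' - 1\<close>, so that \<open>v powr (- \<beta>)\<close> is the weight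
  of the Luxemburg averages, and the Muckenhoupt condition has been raised to the power
  \<beta>.\<close>

locale mixed_weight =
  fixes v :: "real ^ 'n \<Rightarrow> real" and \<beta> A :: real
  assumes v_loc: "locally_integrable v" and v_pos: "AE x in lebesgue. 0 < v x"
    and \<beta>: "0 < \<beta>" and A1: "1 \<le> A"
    and om_int: "\<And>B. B \<in> cubes \<Longrightarrow> set_integrable lebesgue B (\<lambda>x. v x powr (- \<beta>))"
    and v_sup: "\<And>B. B \<in> cubes \<Longrightarrow> AE x in lebesgue. x \<in> B \<longrightarrow> v x \<le> A * avg v B"
    and Aq: "\<And>B. B \<in> cubes \<Longrightarrow> avg (\<lambda>x. v x powr (- \<beta>)) B * avg v B powr \<beta> \<le> A"
begin

lemma v_meas [measurable]: "v \<in> borel_measurable lebesgue"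
  by (rule locally_integrable_measurable[OF v_loc])

lemma v_int: "B \<in> cubes \<Longrightarrow> set_integrable lebesgue B v"
  using v_loc cube_compact by (auto simp: locally_integrable_def)

lemma V_pos:
  assumes "B \<in> cubes" shows "0 < avg v B"
proof -
  have "0 < (LINT x:B|lebesgue. v x)"
    using assms cube_measure_pos[OF assms] v_pos
    by (intro set_integral_AE_pos v_int) (auto simp: cube_emeasure ennreal_eq_0_iff simp del: emeasure_completion measure_completion elim!: eventually_mono)
  then show ?thesis using cube_measure_pos[OF assms] by (simp add: avg_def)
qed

lemma int_v: "B \<in> cubes \<Longrightarrow> (LINT x:B|lebesgue. v x) = avg v B * measure lebesgue B"
  using cube_measure_pos[of B] by (simp add: avg_def)

lemma int_om_le:
  assumes "B \<in> cubes"
  shows "(LINT x:B|lebesgue. v x powr (- \<beta>)) \<le> A * measure lebesgue B * avg v B powr (- \<beta>)"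
proof -
  have "(LINT x:B|lebesgue. v x powr (- \<beta>)) / measure lebesgue B * avg v B powr \<beta> \<le> A"
    using Aq[OF assms] by (simp add: avg_def)
  then show ?thesis using cube_measure_pos[OF assms] V_pos[OF assms]
    by (simp add: powr_minus field_simps)
qed

lemma V_mono:
  assumes "Q \<in> cubes" "B \<in> cubes" "Q \<subseteq> B"
  shows "avg v Q \<le> A * avg v B"
proof -
  have "(LINT x:Q|lebesgue. v x) \<le> (LINT x:Q|lebesgue. A * avg v B)"
  proof (rule set_integral_mono_AE[OF v_int[OF assms(1)]])
    show "set_integrable lebesgue Q (\<lambda>x. A * avg v B)"
      using cube_lmeasurable[OF assms(1)] by (simp add: set_integrable_def lmeasurable_iff_integrable)
    show "AE x\<in>Q in lebesgue. v x \<le> A * avg v B"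
      using v_sup[OF assms(2)] assms(3) by (auto elim!: eventually_mono)
  qed
  also have "\<dots> = A * avg v B * measure lebesgue Q"
    using cube_sets[OF assms(1)] by (simp add: set_lebesgue_integral_def)
  finally show ?thesis
    using cube_measure_pos[OF assms(1)] unfolding int_v[OF assms(1)] by (simp del: measure_completion)
qed

definition "dbl N0 = 2 * (2 * A * N0) powr (1 / \<beta>)"

text \<open>The Muckenhoupt condition on \<open>B\<close> prevents \<open>v\<close> from being small
  on most of \<open>Q\<close>. The inequality \<open>pt\<close> bounds 1 by a multiple of
  \<open>v\<close> plus a multiple of \<open>v powr (- \<beta>)\<close>; after integration over
  \<open>Q\<close> the second part is at most half the measure of \<open>Q\<close>, so the first is
  at least the other half.\<close>

lemma V_doubling:
  assumes "Q \<in> cubes" "B \<in> cubes" "Q \<subseteq> B" "measure lebesgue B \<le> N0 * measure lebesgue Q" "1 \<le> N0"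
  shows "avg v B \<le> dbl N0 * avg v Q"
proof -
  \<comment> \<open>Chosen so that \<open>A * N0 * \<delta> powr \<beta> = 1/2\<close>.\<close>
  define \<delta> where "\<delta> = (2 * A * N0) powr (- 1 / \<beta>)"
  define VB where "VB = avg v B"
  define q where "q = measure lebesgue Q"
  have q: "0 < q" unfolding q_def by (rule cube_measure_pos[OF assms(1)])
  have VB: "0 < VB" unfolding VB_def by (rule V_pos[OF assms(2)])
  have \<delta>: "0 < \<delta>" using A1 assms(5) by (simp add: \<delta>_def)
  have \<delta>\<beta>: "\<delta> powr \<beta> = 1 / (2 * A * N0)"
  proof -
    have "- 1 / \<beta> * \<beta> = - 1" using \<beta> by simp
    then show ?thesis using A1 assms(5) by (simp only: \<delta>_def powr_powr) (simp add: powr_minus divide_simps)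
  qed
  have omQ: "set_integrable lebesgue Q (\<lambda>x. v x powr (- \<beta>))" by (rule om_int[OF assms(1)])
  have pt: "1 \<le> t / (\<delta> * VB) + (\<delta> * VB) powr \<beta> * t powr (- \<beta>)" if t: "0 < t" for t
  proof -
    define y where "y = t / (\<delta> * VB)"
    have y: "0 < y" using t \<delta> VB by (simp add: y_def)
    have "y powr (- \<beta>) = (\<delta> * VB) powr \<beta> * t powr (- \<beta>)"
      using t \<delta> VB by (simp add: y_def powr_divide powr_minus field_simps)
    moreover have "1 \<le> y + y powr (- \<beta>)"
    proof (cases "1 \<le> y")
      case True
      then show ?thesis using y by (simp add: add_increasing2)
    next
      case False
      then have "1 powr (- \<beta>) \<le> y powr (- \<beta>)" using y \<beta> by (intro powr_mono2') auto
      then show ?thesis using y by simp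
    qed
    ultimately show ?thesis by (simp add: y_def)
  qed
  have "q = (LINT x:Q|lebesgue. 1)"
    using cube_sets[OF assms(1)] by (simp add: set_lebesgue_integral_def q_def)
  also have "\<dots> \<le> (LINT x:Q|lebesgue. v x / (\<delta> * VB) + (\<delta> * VB) powr \<beta> * v x powr (- \<beta>))"
  proof (rule set_integral_mono_AE)
    show "set_integrable lebesgue Q (\<lambda>_. 1 :: real)"
      using cube_lmeasurable[OF assms(1)] by (simp add: set_integrable_def lmeasurable_iff_integrable)
    show "set_integrable lebesgue Q (\<lambda>x. v x / (\<delta> * VB) + (\<delta> * VB) powr \<beta> * v x powr (- \<beta>))"
      by (intro set_integral_add(1) set_integrable_divide set_integrable_mult_right v_int[OF assms(1)] omQ)
    show "AE x\<in>Q in lebesgue. 1 \<le> v x / (\<delta> * VB) + (\<delta> * VB) powr \<beta> * v x powr (- \<beta>)"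
      using v_pos by (auto elim!: eventually_mono intro!: pt)
  qed
  also have "\<dots> = (LINT x:Q|lebesgue. v x / (\<delta> * VB)) + (LINT x:Q|lebesgue. (\<delta> * VB) powr \<beta> * v x powr (- \<beta>))"
    by (intro set_integral_add(2) set_integrable_divide set_integrable_mult_right v_int[OF assms(1)] omQ)
  also have "\<dots> = avg v Q * q / (\<delta> * VB) + (\<delta> * VB) powr \<beta> * (LINT x:Q|lebesgue. v x powr (- \<beta>))"
    by (simp add: int_v[OF assms(1)] q_def del: measure_completion)
  also have "(LINT x:Q|lebesgue. v x powr (- \<beta>)) \<le> (LINT x:B|lebesgue. v x powr (- \<beta>))"
    unfolding set_lebesgue_integral_def
    by (rule integral_mono) (use om_int[OF assms(2)] omQ assms(3) in \<open>auto simp: set_integrable_def indicator_def\<close>)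
  also have "\<dots> \<le> A * measure lebesgue B * VB powr (- \<beta>)" unfolding VB_def by (rule int_om_le[OF assms(2)])
  also have "\<dots> \<le> A * (N0 * q) * VB powr (- \<beta>)"
    using assms(4) A1 by (intro mult_right_mono mult_left_mono) (auto simp: q_def)
  finally have "q \<le> avg v Q * q / (\<delta> * VB) + (\<delta> * VB) powr \<beta> * (A * (N0 * q) * VB powr (- \<beta>))"
    by (simp add: mult_left_mono)
  also have "(\<delta> * VB) powr \<beta> * (A * (N0 * q) * VB powr (- \<beta>)) = q / 2"
    using \<delta> VB \<delta>\<beta> A1 assms(5) by (simp add: powr_mult powr_minus field_simps)
  finally have "q * (1 / 2) \<le> q * (avg v Q / (\<delta> * VB))" by (simp add: mult.commute)
  then have "1 / 2 \<le> avg v Q / (\<delta> * VB)" using q by (subst (asm) mult_le_cancel_left_pos)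
  then have "VB \<le> 2 / \<delta> * avg v Q" using \<delta> VB by (simp add: field_simps)
  moreover have "2 / \<delta> = dbl N0" using A1 assms(5) by (simp add: \<delta>_def dbl_def powr_minus field_simps)
  ultimately show ?thesis by (simp add: VB_def)
qed

lemma dbl_pos: "1 \<le> N0 \<Longrightarrow> 0 < dbl N0"
  using A1 by (simp add: dbl_def)

lemma int_hcube:
  assumes "0 < h"
  shows "(LINT x:hcube b h|lebesgue. v x) = avg v (cbox b (b + vec h)) * h ^ CARD('n)"
  using set_integral_cbox_hcube[OF v_int[OF cbox_in_cubes[OF assms]]] int_v[OF cbox_in_cubes[OF assms]] assms
  by (simp add: measure_cbox_cube del: measure_completion)

lemma dyadic_doubling:
  assumes l: "0 < l"
  shows "(LINT y:dcube a l k x|lebesgue. v y) \<le> 2 ^ CARD('n) * dbl (2 ^ CARD('n)) * (LINT y:dcube a l (Suc k) x|lebesgue. v y)"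
proof -
  obtain b where b: "dcube a l k x = hcube b (l / 2 ^ k)" using dcube_is_hcube[OF l] .
  obtain c where c: "dcube a l (Suc k) x = hcube c (l / 2 ^ Suc k)" using dcube_is_hcube[OF l] .
  let ?B = "cbox b (b + vec (l / 2 ^ k))" and ?Q = "cbox c (c + vec (l / 2 ^ Suc k))"
  have p: "0 < l / 2 ^ k" "0 < l / 2 ^ Suc k" using l by auto
  have e: "(l / 2 ^ k) ^ CARD('n) = 2 ^ CARD('n) * (l / 2 ^ Suc k) ^ CARD('n)"
    by (simp add: power_mult_distrib[symmetric])
  have "?Q \<subseteq> ?B"
    using dcube_mono[of k "Suc k" a l x] b c p by (intro hcube_subset_imp_cbox) auto
  then have "avg v ?B \<le> dbl (2 ^ CARD('n)) * avg v ?Q"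
    using p e by (intro V_doubling cbox_in_cubes) (auto simp: measure_cbox_cube simp del: measure_completion)
  then have "avg v ?B * (l / 2 ^ k) ^ CARD('n) \<le> dbl (2 ^ CARD('n)) * avg v ?Q * (l / 2 ^ k) ^ CARD('n)"
    using p by (intro mult_right_mono) auto
  then show ?thesis unfolding b c int_hcube[OF p(1)] int_hcube[OF p(2)] e by (simp add: mult_ac)
qed

lemma set_nn_integral_om:
  assumes "B \<in> cubes"
  shows "(\<integral>\<^sup>+x\<in>B. ennreal (v x powr (- \<beta>)) \<partial>lebesgue) = ennreal (LINT x:B|lebesgue. v x powr (- \<beta>))"
proof -
  have "(\<integral>\<^sup>+x\<in>B. ennreal (v x powr (- \<beta>)) \<partial>lebesgue) = (\<integral>\<^sup>+x. ennreal (indicator B x *\<^sub>R v x powr (- \<beta>)) \<partial>lebesgue)"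
    by (intro nn_integral_cong) (simp add: indicator_def)
  also have "\<dots> = ennreal (LINT x:B|lebesgue. v x powr (- \<beta>))"
    unfolding set_lebesgue_integral_def
    by (rule nn_integral_eq_integral) (use om_int[OF assms] in \<open>auto simp: set_integrable_def\<close>)
  finally show ?thesis .
qed

lemma om_pos:
  assumes "B \<in> cubes"
  shows "0 < (LINT x:B|lebesgue. v x powr (- \<beta>))"
  using assms cube_measure_pos[OF assms] v_pos
  by (intro set_integral_AE_pos om_int) (auto simp: cube_emeasure ennreal_eq_0_iff simp del: emeasure_completion measure_completion elim!: eventually_mono)

text \<open>The norm lies strictly below \<open>L\<close>, so some admissible scale is at most
  \<open>L\<close>, and monotonicity of \<open>F\<close> gives the modular at \<open>L\<close>
  whether or not the infimum is attained. The mass of \<open>v powr (- \<beta>)\<close> is then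
  replaced by its Muckenhoupt bound.\<close>

lemma luxemburg_modular:
  fixes u :: "real ^ 'n \<Rightarrow> real"
  assumes B: "B \<in> cubes" and u: "\<And>x. 0 \<le> u x" and L: "0 < L"
    and F: "\<And>a b. 0 \<le> a \<Longrightarrow> a \<le> b \<Longrightarrow> F a \<le> F b"
    and lux: "luxemburg F B (\<lambda>x. v x powr (- \<beta>)) u < ennreal L"
  shows "(\<integral>\<^sup>+x\<in>B. ennreal (F (u x / L) * v x powr (- \<beta>)) \<partial>lebesgue)
    \<le> ennreal (A * measure lebesgue B * avg v B powr (- \<beta>))"
proof -
  define W where "W = (LINT x:B|lebesgue. v x powr (- \<beta>))"
  have W: "0 < W" "weighted (\<lambda>x. v x powr (- \<beta>)) B = ennreal W"
    using om_pos[OF B] set_nn_integral_om[OF B] by (simp_all add: W_def weighted_def)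
  obtain l where l: "0 < l" "ennreal l < ennreal L"
    and adm: "(\<integral>\<^sup>+y\<in>B. ennreal (F (norm (u y) / l) * v y powr (- \<beta>)) \<partial>lebesgue) / ennreal W \<le> 1"
    using lux unfolding luxemburg_def Inf_less_iff W(2) by auto
  have lL: "l \<le> L" using l by (simp add: ennreal_less_iff)
  have "(\<integral>\<^sup>+x\<in>B. ennreal (F (u x / L) * v x powr (- \<beta>)) \<partial>lebesgue)
      \<le> (\<integral>\<^sup>+x\<in>B. ennreal (F (norm (u x) / l) * v x powr (- \<beta>)) \<partial>lebesgue)"
    using l(1) lL u L by (intro nn_integral_mono mult_right_mono ennreal_leI F frac_le) auto
  also have "\<dots> \<le> ennreal W"
  proof -
    have "(\<integral>\<^sup>+y\<in>B. ennreal (F (norm (u y) / l) * v y powr (- \<beta>)) \<partial>lebesgue) / ennreal W * ennreal W \<le> 1 * ennreal W"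
      by (intro mult_right_mono adm) simp
    then show ?thesis using W(1) by (simp add: ennreal_divide_times ennreal_mult_divide_eq)
  qed
  also have "\<dots> \<le> ennreal (A * measure lebesgue B * avg v B powr (- \<beta>))"
    unfolding W_def by (intro ennreal_leI int_om_le B)
  finally show ?thesis .
qed

text \<open>By \<open>RH_inf\<close>, \<open>v\<close> is at most \<open>A * avg v B\<close> on
  \<open>B\<close>, so the weight \<open>v powr (- \<beta>)\<close>, normalised by these constants,
  is at least 1. Unweighted integrals of nonnegative functions over \<open>B\<close> are therefore
  at most weighted ones.\<close>

lemma AE_ratio:
  assumes "B \<in> cubes"
  shows "AE x in lebesgue. x \<in> B \<longrightarrow> 0 < v x \<and> 1 \<le> A powr \<beta> * avg v B powr \<beta> * v x powr (- \<beta>)"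
  using v_sup[OF assms] v_pos
proof eventually_elim
  case (elim x)
  show ?case
  proof
    assume "x \<in> B"
    then have "v x powr \<beta> \<le> (A * avg v B) powr \<beta>" using elim \<beta> by (intro powr_mono2) auto
    also have "\<dots> = A powr \<beta> * avg v B powr \<beta>" using A1 V_pos[OF assms] by (simp add: powr_mult)
    finally show "0 < v x \<and> 1 \<le> A powr \<beta> * avg v B powr \<beta> * v x powr (- \<beta>)"
      using elim by (simp add: powr_minus field_simps)
  qed
qed

text \<open>The factor \<open>avg v B powr (- \<beta>)\<close> of the Muckenhoupt bound cancels
  against the normalisation, which leaves a multiple of the measure of \<open>B\<close>.\<close>

lemma modular_unweighted:
  fixes g :: "real ^ 'n \<Rightarrow> real"
  assumes B: "B \<in> cubes" and g: "g \<in> borel_measurable lebesgue" "\<And>x. 0 \<le> g x" and C: "0 \<le> C"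
    and le: "(\<integral>\<^sup>+x\<in>B. ennreal (g x * v x powr (- \<beta>)) \<partial>lebesgue) \<le> ennreal (C * measure lebesgue B * avg v B powr (- \<beta>))"
  shows "(\<integral>\<^sup>+x\<in>B. ennreal (g x * (A powr \<beta> * avg v B powr \<beta> * v x powr (- \<beta>))) \<partial>lebesgue) \<le> ennreal (A powr \<beta> * C * measure lebesgue B)"
proof -
  note [measurable] = g(1) and Bs [measurable] = cube_sets[OF B]
  define c where "c = A powr \<beta> * avg v B powr \<beta>"
  have c: "0 \<le> c" by (simp add: c_def)
  have "(\<integral>\<^sup>+x\<in>B. ennreal (g x * (A powr \<beta> * avg v B powr \<beta> * v x powr (- \<beta>))) \<partial>lebesgue)
      = (\<integral>\<^sup>+x. ennreal c * (ennreal (g x * v x powr (- \<beta>)) * indicator B x) \<partial>lebesgue)"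
    using c g by (intro nn_integral_cong) (simp add: c_def[symmetric] ennreal_mult[symmetric] mult_ac indicator_def)
  also have "\<dots> = ennreal c * (\<integral>\<^sup>+x\<in>B. ennreal (g x * v x powr (- \<beta>)) \<partial>lebesgue)"
    by (rule nn_integral_cmult) measurable
  also have "\<dots> \<le> ennreal c * ennreal (C * measure lebesgue B * avg v B powr (- \<beta>))"
    by (intro mult_left_mono le) simp
  also have "\<dots> = ennreal (A powr \<beta> * C * measure lebesgue B)"
    using V_pos[OF B] c C by (simp add: ennreal_mult[symmetric] c_def powr_minus field_simps del: measure_completion)
  finally show ?thesis .
qed

end

lemma mixed_weightI:
  assumes v: "v \<in> RH_inf" "v \<in> A_class q" and q: "1 < q"
  obtains A where "mixed_weight v (conj_exp q - 1) A"
proof -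
  define \<beta> where "\<beta> = conj_exp q - 1"
  have \<beta>: "\<beta> = 1 / (q - 1)" "0 < \<beta>" "1 - conj_exp q = - \<beta>" using q by (auto simp: \<beta>_def conj_exp_def field_simps)
  have w: "locally_integrable v" "AE x in lebesgue. 0 < v x" using v by (auto simp: RH_inf_def weight_def)
  from v(1) obtain C1 where C1: "C1 > 0" "\<And>B. B \<in> cubes \<Longrightarrow> esssup (lebesgue_on B) (\<lambda>x. ereal (v x)) \<le> ereal (C1 * avg v B)"
    unfolding RH_inf_def by blast
  from v(2) obtain C2 where C2: "C2 > 0" "\<And>B. B \<in> cubes \<Longrightarrow> set_integrable lebesgue B (\<lambda>x. v x powr (- \<beta>))"
      "\<And>B. B \<in> cubes \<Longrightarrow> avg v B * avg (\<lambda>x. v x powr (- \<beta>)) B powr (q - 1) \<le> C2"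
    unfolding A_class_def \<beta>(3) by blast
  define A where "A = max 1 (max C1 (C2 powr \<beta>))"
  have A: "1 \<le> A" "C1 \<le> A" "C2 powr \<beta> \<le> A" by (auto simp: A_def)
  have nn: "0 \<le> avg v B" if "B \<in> cubes" for B
  proof -
    have "0 \<le> (LINT x:B|lebesgue. v x)"
      unfolding set_lebesgue_integral_def
      by (rule integral_nonneg_AE) (use w(2) in \<open>auto elim!: eventually_mono simp: indicator_def\<close>)
    then show ?thesis by (simp add: avg_def)
  qed
  have "mixed_weight v \<beta> A"
  proof
    fix B :: "(real ^ 'a) set" assume B: "B \<in> cubes"
    have "AE x in lebesgue_on B. ereal (v x) \<le> esssup (lebesgue_on B) (\<lambda>x. ereal (v x))" by (rule esssup_AE)
    then have "AE x in lebesgue_on B. v x \<le> A * avg v B"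
    proof eventually_elim
      case (elim x)
      then have "ereal (v x) \<le> ereal (C1 * avg v B)" using C1(2)[OF B] by (rule order.trans)
      then have "v x \<le> C1 * avg v B" by simp
      also have "\<dots> \<le> A * avg v B" using A(2) nn[OF B] by (rule mult_right_mono)
      finally show ?case .
    qed
    then show "AE x in lebesgue. x \<in> B \<longrightarrow> v x \<le> A * avg v B"
      using cube_sets[OF B] by (subst (asm) AE_restrict_space_iff) auto
    have om: "0 \<le> avg (\<lambda>x. v x powr (- \<beta>)) B"
      by (simp add: avg_def set_lebesgue_integral_def)
    have "(avg v B * avg (\<lambda>x. v x powr (- \<beta>)) B powr (q - 1)) powr \<beta> \<le> C2 powr \<beta>"
      using C2(3)[OF B] \<beta>(2) nn[OF B] by (intro powr_mono2) auto
    also have "(avg v B * avg (\<lambda>x. v x powr (- \<beta>)) B powr (q - 1)) powr \<beta> = avg v B powr \<beta> * avg (\<lambda>x. v x powr (- \<beta>)) B"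
      using nn[OF B] om q by (simp add: powr_mult powr_powr \<beta>(1))
    finally show "avg (\<lambda>x. v x powr (- \<beta>)) B * avg v B powr \<beta> \<le> A" using A(3) by (simp add: mult.commute)
  qed (use w \<beta> A C2 in auto)
  then show ?thesis using that by (simp add: \<beta>_def)
qed

subsection \<open>The maximal operator\<close>

lemma nn_integral_power_layer:
  assumes "0 \<le> m"
  shows "(\<integral>\<^sup>+t. ennreal (2 * t) * indicator {0<..<m} t \<partial>lborel) = ennreal (m\<^sup>2)"
proof -
  have "(\<integral>\<^sup>+t. ennreal (2 * t) * indicator {0<..<m} t \<partial>lborel) = (\<integral>\<^sup>+t. ennreal (2 * t) * indicator {0..m} t \<partial>lborel)"
    using AE_lborel_singleton[of 0] AE_lborel_singleton[of m]
    by (intro nn_integral_cong_AE) (auto elim!: eventually_elim2 simp: indicator_def)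
  also have "\<dots> = ennreal (m\<^sup>2 - 0\<^sup>2)"
    by (rule nn_integral_FTC_Icc) (use assms in \<open>auto intro!: derivative_eq_intros\<close>)
  finally show ?thesis by simp
qed

text \<open>The volume of a ball of radius \<open>5 * n\<close>: a cube of side 1 lies in the ball
  of radius \<open>n\<close> about its corner, and 5 is the dilation in Vitali's covering.\<close>

definition max_const :: "nat \<Rightarrow> real" where
  "max_const n = unit_ball_vol (real n) * (5 * real n) ^ n"

lemma max_const_nonneg: "0 \<le> max_const n"
  by (simp add: max_const_def)

text \<open>Where \<open>G \<le> t / 2\<close> it contributes at most \<open>t / 2\<close> to the
  mean over \<open>B\<close>, so the part of \<open>G\<close> above \<open>t / 2\<close> already has
  mean above \<open>t / 2\<close>. This truncation is what makes the later integration over all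
  levels converge. Vitali's selection of disjoint balls does the rest; a finite family with its
  covering cubes stands for the set where the maximal function is large.\<close>

lemma maximal_weak_type:
  fixes G :: "real ^ 'n \<Rightarrow> real"
  assumes G [measurable]: "G \<in> borel_measurable lebesgue" and G0: "\<And>x. 0 \<le> G x" and Gint: "integrable lebesgue G"
    and F: "finite F" "disjoint F" "F \<subseteq> lmeasurable" and t: "0 < t"
    and cover: "\<And>Q. Q \<in> F \<Longrightarrow> \<exists>B\<in>cubes. Q \<subseteq> B \<and> t * measure lebesgue B < (LINT x:B|lebesgue. G x)"
  shows "(\<Sum>Q\<in>F. measure lebesgue Q) \<le> 2 * max_const CARD('n) / t * (LINT x|lebesgue. G x * indicator {x. t / 2 < G x} x)"
proof -
  define n where "n = CARD('n)"
  have n1: "1 \<le> real n" using zero_less_card_finite[where 'a='n] unfolding n_def by linarith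
  define H where "H x = G x * indicator {x. t / 2 < G x} x" for x
  have Hm [measurable]: "H \<in> borel_measurable lebesgue" unfolding H_def by measurable
  have H0: "0 \<le> H x" for x using G0 by (simp add: H_def)
  have Hint: "integrable lebesgue H"
    by (rule Bochner_Integration.integrable_bound[OF Gint Hm]) (use G0 in \<open>auto simp: H_def indicator_def\<close>)
  have "\<exists>b h. 0 < h \<and> Q \<subseteq> cbox b (b + vec h) \<and> t * h ^ n < (LINT x:cbox b (b + vec h)|lebesgue. G x)"
    if Q: "Q \<in> F" for Q
  proof -
    obtain b h where "0 < h" "Q \<subseteq> cbox b (b + vec h)"
        "t * measure lebesgue (cbox b (b + vec h)) < (LINT x:cbox b (b + vec h)|lebesgue. G x)"
      using cover[OF Q] unfolding Bex_def cubes_iff by blast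
    then show ?thesis
      by (intro exI[of _ b] exI[of _ h]) (simp add: measure_cbox_cube n_def del: measure_completion)
  qed
  then obtain b h where bh: "\<And>Q. Q \<in> F \<Longrightarrow> 0 < h Q"
      "\<And>Q. Q \<in> F \<Longrightarrow> Q \<subseteq> cbox (b Q) (b Q + vec (h Q))"
      "\<And>Q. Q \<in> F \<Longrightarrow> t * h Q ^ n < (LINT x:cbox (b Q) (b Q + vec (h Q))|lebesgue. G x)"
    by metis
  define r where "r Q = real n * h Q" for Q
  have r: "0 < r Q" if "Q \<in> F" for Q using bh(1)[OF that] n1 by (simp add: r_def)
  have sub: "cbox (b Q) (b Q + vec (h Q)) \<subseteq> cball (b Q) (r Q)" if Q: "Q \<in> F" for Q
  proof
    fix x assume "x \<in> cbox (b Q) (b Q + vec (h Q))"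
    then have x: "b Q $ i \<le> x $ i \<and> x $ i \<le> b Q $ i + h Q" for i by (simp add: mem_box_cart)
    have "norm (x - b Q) \<le> (\<Sum>i\<in>UNIV. \<bar>(x - b Q) $ i\<bar>)" by (rule norm_le_l1_cart)
    also have "\<dots> \<le> (\<Sum>i\<in>(UNIV::'n set). h Q)"
    proof (rule sum_mono)
      fix i show "\<bar>(x - b Q) $ i\<bar> \<le> h Q" using x[of i] by auto
    qed
    finally show "x \<in> cball (b Q) (r Q)" by (simp add: r_def n_def dist_norm norm_minus_commute)
  qed
  define ib where "ib Q = (LINT x:cball (b Q) (r Q)|lebesgue. H x)" for Q
  have hle: "h Q ^ n \<le> 2 / t * ib Q" if Q: "Q \<in> F" for Q
  proof -
    let ?B = "cbox (b Q) (b Q + vec (h Q))"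
    have Gi: "set_integrable lebesgue ?B G" "set_integrable lebesgue ?B H" "set_integrable lebesgue (cball (b Q) (r Q)) H"
      using integrable_mult_indicator[OF _ Gint] integrable_mult_indicator[OF _ Hint] by (auto simp: set_integrable_def)
    have ci: "set_integrable lebesgue ?B (\<lambda>x. t / 2)"
      by (auto simp: set_integrable_def lmeasurable_iff_integrable[symmetric])
    have "(LINT x:?B|lebesgue. G x) \<le> (LINT x:?B|lebesgue. t / 2 + H x)"
      by (rule set_integral_mono[OF Gi(1) set_integral_add(1)[OF ci Gi(2)]]) (use t in \<open>auto simp: H_def indicator_def\<close>)
    also have "\<dots> = (LINT x:?B|lebesgue. t / 2) + (LINT x:?B|lebesgue. H x)"
      by (rule set_integral_add(2)[OF ci Gi(2)])
    also have "(LINT x:?B|lebesgue. t / 2) = t / 2 * h Q ^ n"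
      using bh(1)[OF Q] by (simp add: set_lebesgue_integral_def measure_cbox_cube n_def del: measure_completion)
    also have "(LINT x:?B|lebesgue. H x) \<le> ib Q"
      unfolding ib_def set_lebesgue_integral_def
      by (rule integral_mono) (use Gi sub[OF Q] H0 in \<open>auto simp: set_integrable_def indicator_def\<close>)
    finally have "t * h Q ^ n \<le> t / 2 * h Q ^ n + ib Q" using bh(3)[OF Q] by simp
    then show ?thesis using t by (simp add: field_simps)
  qed
  obtain C where C: "C \<subseteq> F" "pairwise (\<lambda>i j. disjnt (cball (b i) (r i)) (cball (b j) (r j))) C"
      "\<And>i. i \<in> F \<Longrightarrow> \<exists>j. j \<in> C \<and> \<not> disjnt (cball (b i) (r i)) (cball (b j) (r j)) \<and> cball (b i) (r i) \<subseteq> ball (b j) (5 * r j)"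
  proof (rule Vitali_covering_lemma_cballs_balls[of F r "Max (insert 0 (r ` F))" b])
    show "0 < r i \<and> r i \<le> Max (insert 0 (r ` F))" if "i \<in> F" for i
      using r[OF that] that F(1) by (auto intro!: Max_ge)
  qed (use that in blast)
  have fC: "finite C" using C(1) F(1) by (rule finite_subset)
  have "(\<Sum>Q\<in>F. measure lebesgue Q) = measure lebesgue (\<Union>F)"
    using F by (subst measure_Union'[symmetric]) (auto simp del: measure_completion simp: pairwise_def)
  also have "\<dots> \<le> measure lebesgue (\<Union>j\<in>C. ball (b j) (5 * r j))"
  proof (rule measure_mono_fmeasurable)
    show "\<Union>F \<subseteq> (\<Union>j\<in>C. ball (b j) (5 * r j))"
    proof
      fix x assume "x \<in> \<Union>F"
      then obtain Q where Q: "Q \<in> F" "x \<in> Q" by auto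
      then have "x \<in> cball (b Q) (r Q)" using bh(2) sub by blast
      then show "x \<in> (\<Union>j\<in>C. ball (b j) (5 * r j))" using C(3)[OF Q(1)] by blast
    qed
    show "\<Union>F \<in> sets lebesgue" using F by (intro sets.finite_Union) (auto simp: fmeasurable_def)
    show "(\<Union>j\<in>C. ball (b j) (5 * r j)) \<in> lmeasurable" using fC by (intro fmeasurable.finite_UN) auto
  qed
  also have "\<dots> \<le> (\<Sum>j\<in>C. measure lebesgue (ball (b j) (5 * r j)))"
    by (rule measure_UNION_le[OF fC]) auto
  also have "\<dots> \<le> (\<Sum>j\<in>C. 2 * max_const n / t * ib j)"
  proof (rule sum_mono)
    fix j assume j: "j \<in> C"
    then have jF: "j \<in> F" using C(1) by blast
    have "measure lebesgue (ball (b j) (5 * r j)) = max_const n * h j ^ n"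
      using r[OF jF] by (simp add: content_ball max_const_def r_def n_def power_mult_distrib)
    also have "\<dots> \<le> max_const n * (2 / t * ib j)" by (rule mult_left_mono[OF hle[OF jF] max_const_nonneg])
    finally show "measure lebesgue (ball (b j) (5 * r j)) \<le> 2 * max_const n / t * ib j" by (simp add: mult_ac)
  qed
  also have "\<dots> = 2 * max_const n / t * (\<Sum>j\<in>C. ib j)" by (simp add: sum_distrib_left)
  also have "(\<Sum>j\<in>C. ib j) = (LINT x:(\<Union>j\<in>C. cball (b j) (r j))|lebesgue. H x)"
    unfolding ib_def
  proof (rule set_integral_finite_Union[symmetric, OF fC])
    show "disjoint_family_on (\<lambda>j. cball (b j) (r j)) C"
      using C(2) by (simp add: disjoint_family_on_def pairwise_def disjnt_def)
    show "set_integrable lebesgue (cball (b j) (r j)) H" for j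
      using integrable_mult_indicator[OF _ Hint] by (auto simp: set_integrable_def)
  qed auto
  also have "\<dots> \<le> (LINT x|lebesgue. H x)"
    unfolding set_lebesgue_integral_def
  proof (rule integral_mono)
    show "integrable lebesgue (\<lambda>x. indicat_real (\<Union>j\<in>C. cball (b j) (r j)) x *\<^sub>R H x)"
      using fC by (intro integrable_mult_indicator Hint) auto
  qed (use Hint H0 in \<open>auto simp: indicator_def\<close>)
  finally show ?thesis using t max_const_nonneg[of n] by (simp add: H_def n_def mult_left_mono divide_right_mono)
qed

text \<open>A discrete form of the strong type \<open>(2,2)\<close> of the maximal operator: the weak type inequality
  is integrated over all levels.\<close>

lemma maximal_strong_type:
  fixes G :: "real ^ 'n \<Rightarrow> real"
  assumes G: "G \<in> borel_measurable borel" and G0: "\<And>x. 0 \<le> G x" and Gint: "integrable lebesgue G"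
    and G2: "integrable lebesgue (\<lambda>x. (G x)\<^sup>2)"
    and F: "finite F" "disjoint F" "F \<subseteq> lmeasurable" and m: "\<And>Q. Q \<in> F \<Longrightarrow> 0 \<le> m Q"
    and cover: "\<And>Q t. Q \<in> F \<Longrightarrow> 0 < t \<Longrightarrow> t < m Q \<Longrightarrow>
       \<exists>B\<in>cubes. Q \<subseteq> B \<and> t * measure lebesgue B < (LINT x:B|lebesgue. G x)"
  shows "(\<Sum>Q\<in>F. measure lebesgue Q * (m Q)\<^sup>2) \<le> 8 * max_const CARD('n) * (LINT x|lebesgue. (G x)\<^sup>2)"
proof -
  note [measurable] = G
  have Gl [measurable]: "G \<in> borel_measurable lebesgue" using G by (intro measurable_completion) simp
  define c where "c = max_const CARD('n)"
  have c: "0 \<le> c" by (simp add: c_def max_const_nonneg)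
  have lay: "ennreal (measure lebesgue Q * (m Q)\<^sup>2) = (\<integral>\<^sup>+t. ennreal (2 * t * measure lebesgue Q) * indicator {0<..<m Q} t \<partial>lborel)"
    if "Q \<in> F" for Q
  proof -
    have "ennreal (measure lebesgue Q * (m Q)\<^sup>2) = ennreal (measure lebesgue Q) * (\<integral>\<^sup>+t. ennreal (2 * t) * indicator {0<..<m Q} t \<partial>lborel)"
      unfolding nn_integral_power_layer[OF m[OF that]] by (simp add: ennreal_mult del: measure_completion)
    also have "\<dots> = (\<integral>\<^sup>+t. ennreal (measure lebesgue Q) * (ennreal (2 * t) * indicator {0<..<m Q} t) \<partial>lborel)"
      by (rule nn_integral_cmult[symmetric]) measurable
    also have "\<dots> = (\<integral>\<^sup>+t. ennreal (2 * t * measure lebesgue Q) * indicator {0<..<m Q} t \<partial>lborel)"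
      by (rule nn_integral_cong) (auto simp: indicator_def ennreal_mult[symmetric] mult_ac simp del: measure_completion)
    finally show ?thesis .
  qed
  have "ennreal (\<Sum>Q\<in>F. measure lebesgue Q * (m Q)\<^sup>2) = (\<Sum>Q\<in>F. ennreal (measure lebesgue Q * (m Q)\<^sup>2))"
    by (rule sum_ennreal[symmetric]) auto
  also have "\<dots> = (\<integral>\<^sup>+t. (\<Sum>Q\<in>F. ennreal (2 * t * measure lebesgue Q) * indicator {0<..<m Q} t) \<partial>lborel)"
    by (subst nn_integral_sum) (auto simp: lay simp del: measure_completion)
  \<comment> \<open>The factor \<open>1 / t\<close> of the weak type bound cancels against the
    \<open>2 * t\<close> of the layers. In the remaining region \<open>0 < t < 2 * G x\<close> the
    integral over \<open>t\<close> supplies the second factor \<open>G x\<close>.\<close>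
  also have "\<dots> \<le> (\<integral>\<^sup>+t. (\<integral>\<^sup>+x. ennreal (4 * c * G x) * indicator {(t, x). 0 < t \<and> t < 2 * G x} (t, x) \<partial>lborel) \<partial>lborel)"
  proof (rule nn_integral_mono)
    fix t :: real
    show "(\<Sum>Q\<in>F. ennreal (2 * t * measure lebesgue Q) * indicator {0<..<m Q} t)
      \<le> (\<integral>\<^sup>+x. ennreal (4 * c * G x) * indicator {(t, x). 0 < t \<and> t < 2 * G x} (t, x) \<partial>lborel)"
    proof (cases "0 < t")
      case t: True
      define Ft where "Ft = {Q \<in> F. t < m Q}"
      have "(\<Sum>Q\<in>F. ennreal (2 * t * measure lebesgue Q) * indicator {0<..<m Q} t) = (\<Sum>Q\<in>Ft. ennreal (2 * t * measure lebesgue Q))"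
        by (rule sum.mono_neutral_cong_right) (use F(1) t in \<open>auto simp: Ft_def simp del: measure_completion\<close>)
      also have "\<dots> = ennreal (2 * t * (\<Sum>Q\<in>Ft. measure lebesgue Q))"
        using t by (subst sum_ennreal) (auto simp: sum_distrib_left simp del: measure_completion)
      also have "\<dots> \<le> ennreal (2 * t * (2 * c / t * (LINT x|lebesgue. G x * indicator {x. t / 2 < G x} x)))"
      proof (intro ennreal_leI mult_left_mono)
        show "(\<Sum>Q\<in>Ft. measure lebesgue Q) \<le> 2 * c / t * (LINT x|lebesgue. G x * indicator {x. t / 2 < G x} x)"
          unfolding c_def
        proof (rule maximal_weak_type[OF Gl G0 Gint _ _ _ t])
          show "disjoint Ft" using F(2) by (rule pairwise_subset) (auto simp: Ft_def)
          show "\<exists>B\<in>cubes. Q \<subseteq> B \<and> t * measure lebesgue B < (LINT x:B|lebesgue. G x)" if "Q \<in> Ft" for Q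
            by (rule cover) (use that t in \<open>auto simp: Ft_def\<close>)
        qed (use F in \<open>auto simp: Ft_def\<close>)
      qed (use t in auto)
      also have "2 * t * (2 * c / t * (LINT x|lebesgue. G x * indicator {x. t / 2 < G x} x)) = (LINT x|lebesgue. 4 * c * (G x * indicator {x. t / 2 < G x} x))"
        using t by simp
      also have "ennreal \<dots> = (\<integral>\<^sup>+x. ennreal (4 * c * (G x * indicator {x. t / 2 < G x} x)) \<partial>lebesgue)"
      proof (rule nn_integral_eq_integral[symmetric])
        show "integrable lebesgue (\<lambda>x. 4 * c * (G x * indicator {x. t / 2 < G x} x))"
          by (intro integrable_mult_right Bochner_Integration.integrable_bound[OF Gint]) (auto simp: indicator_def G0)
      qed (use c G0 in \<open>auto simp: indicator_def\<close>)
      also have "\<dots> = (\<integral>\<^sup>+x. ennreal (4 * c * G x) * indicator {(t, x). 0 < t \<and> t < 2 * G x} (t, x) \<partial>lborel)"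
        unfolding nn_integral_completion by (rule nn_integral_cong) (use t in \<open>auto simp: indicator_def\<close>)
      finally show ?thesis .
    qed (auto simp: indicator_def intro!: sum.neutral)
  qed
  also have "\<dots> = (\<integral>\<^sup>+x. (\<integral>\<^sup>+t. ennreal (4 * c * G x) * indicator {(t, x). 0 < t \<and> t < 2 * G x} (t, x) \<partial>lborel) \<partial>lborel)"
  proof (rule pair_sigma_finite.Fubini'[symmetric])
    show "pair_sigma_finite (lborel :: real measure) (lborel :: (real ^ 'n) measure)" ..
    show "(\<lambda>(t, x). ennreal (4 * c * G x) * indicator {(t, x). 0 < t \<and> t < 2 * G x} (t, x)) \<in> borel_measurable (lborel \<Otimes>\<^sub>M lborel)"
      by measurable
  qed
  also have "\<dots> = (\<integral>\<^sup>+x. ennreal (8 * c * (G x)\<^sup>2) \<partial>lborel)"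
  proof (rule nn_integral_cong)
    fix x
    have "(\<integral>\<^sup>+t. ennreal (4 * c * G x) * indicator {(t, x). 0 < t \<and> t < 2 * G x} (t, x) \<partial>lborel)
      = (\<integral>\<^sup>+t. ennreal (4 * c * G x) * indicator {0<..<2 * G x} t \<partial>lborel)"
      by (rule nn_integral_cong) (auto simp: indicator_def)
    also have "\<dots> = ennreal (4 * c * G x) * ennreal (2 * G x)"
      using G0[of x] by (subst nn_integral_cmult_indicator) auto
    also have "\<dots> = ennreal (8 * c * (G x)\<^sup>2)"
      using G0[of x] c by (simp add: ennreal_mult[symmetric] power2_eq_square mult_ac)
    finally show "(\<integral>\<^sup>+t. ennreal (4 * c * G x) * indicator {(t, x). 0 < t \<and> t < 2 * G x} (t, x) \<partial>lborel) = ennreal (8 * c * (G x)\<^sup>2)" .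
  qed
  also have "\<dots> = (\<integral>\<^sup>+x. ennreal (8 * c * (G x)\<^sup>2) \<partial>lebesgue)" by (simp add: nn_integral_completion)
  also have "\<dots> = ennreal (LINT x|lebesgue. 8 * c * (G x)\<^sup>2)"
    by (rule nn_integral_eq_integral) (use G2 c in auto)
  finally have "(\<Sum>Q\<in>F. measure lebesgue Q * (m Q)\<^sup>2) \<le> (LINT x|lebesgue. 8 * c * (G x)\<^sup>2)"
    using c by (subst (asm) ennreal_le_iff) (auto intro!: integral_nonneg_AE)
  then show ?thesis by (simp add: c_def)
qed

subsection \<open>Orlicz averages of the weight\<close>

lemma set_nn_integral_bound4:
  fixes g1 g2 g3 g4 :: "'a \<Rightarrow> real"
  assumes [measurable]: "g1 \<in> borel_measurable M" "g2 \<in> borel_measurable M" "g3 \<in> borel_measurable M"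
      "g4 \<in> borel_measurable M" "B \<in> sets M"
    and nn: "\<And>x. 0 \<le> g1 x" "\<And>x. 0 \<le> g2 x" "\<And>x. 0 \<le> g3 x" "\<And>x. 0 \<le> g4 x" and D: "0 \<le> D"
    and c: "0 \<le> c1" "0 \<le> c2" "0 \<le> c3" "0 \<le> c4"
    and le: "(\<integral>\<^sup>+x\<in>B. ennreal (g1 x) \<partial>M) \<le> ennreal c1" "(\<integral>\<^sup>+x\<in>B. ennreal (g2 x) \<partial>M) \<le> ennreal c2"
      "(\<integral>\<^sup>+x\<in>B. ennreal (g3 x) \<partial>M) \<le> ennreal c3" "(\<integral>\<^sup>+x\<in>B. ennreal (g4 x) \<partial>M) \<le> ennreal c4"
    and h: "AE x in M. x \<in> B \<longrightarrow> h x \<le> D * (g1 x + g2 x + g3 x + g4 x)"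
  shows "(\<integral>\<^sup>+x\<in>B. ennreal (h x) \<partial>M) \<le> ennreal (D * (c1 + c2 + c3 + c4))"
proof -
  have "(\<integral>\<^sup>+x\<in>B. ennreal (h x) \<partial>M) \<le> (\<integral>\<^sup>+x. ennreal D * (ennreal (g1 x) * indicator B x + ennreal (g2 x) * indicator B x
      + ennreal (g3 x) * indicator B x + ennreal (g4 x) * indicator B x) \<partial>M)"
  proof (rule nn_integral_mono_AE, use h in eventually_elim)
    case (elim x)
    show ?case
    proof (cases "x \<in> B")
      case True
      then have "ennreal (h x) \<le> ennreal (D * (g1 x + g2 x + g3 x + g4 x))" using elim by (intro ennreal_leI) auto
      also have "\<dots> = ennreal D * (ennreal (g1 x) + ennreal (g2 x) + ennreal (g3 x) + ennreal (g4 x))"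
        using nn D by (simp add: ennreal_mult ennreal_plus)
      finally show ?thesis using True by simp
    qed simp
  qed
  also have "\<dots> = ennreal D * ((\<integral>\<^sup>+x\<in>B. ennreal (g1 x) \<partial>M) + (\<integral>\<^sup>+x\<in>B. ennreal (g2 x) \<partial>M)
      + (\<integral>\<^sup>+x\<in>B. ennreal (g3 x) \<partial>M) + (\<integral>\<^sup>+x\<in>B. ennreal (g4 x) \<partial>M))"
    by (simp add: nn_integral_cmult nn_integral_add)
  also have "\<dots> \<le> ennreal D * (ennreal c1 + ennreal c2 + ennreal c3 + ennreal c4)"
    by (intro mult_left_mono add_mono le) simp
  also have "\<dots> = ennreal (D * (c1 + c2 + c3 + c4))"
    using c D by (simp add: ennreal_mult ennreal_plus)
  finally show ?thesis .
qed

lemma ball_subset_cube: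
  "ball b r \<subseteq> cbox (b - vec r :: real ^ 'n) ((b - vec r) + vec (2 * r))"
proof
  fix x assume "x \<in> ball b r"
  then have *: "\<bar>(x - b) $ i\<bar> < r" for i
    using component_le_norm_cart[of "x - b" i] by (simp add: dist_norm norm_minus_commute)
  show "x \<in> cbox (b - vec r) ((b - vec r) + vec (2 * r))"
    unfolding mem_box_cart
  proof (intro allI conjI)
    fix i
    have "\<bar>x $ i - b $ i\<bar> < r" using *[of i] by simp
    then show "(b - vec r) $ i \<le> x $ i" "x $ i \<le> (b - vec r + vec (2 * r)) $ i" by auto
  qed
qed

text \<open>In the application \<open>F\<close> is \<open>\<phi>\<^sub>p\<close>, \<open>\<beta>\<close> is \<open>q' - 1\<close>, and \<open>three\<close>, \<open>Cu\<close>, \<open>D8\<close> and \<open>cs\<close> are all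
  that is used of the growth conditions on the Young functions.\<close>

locale mixed_estimate = singular_integral T Bt \<Phi> K c0 CK + mixed_weight v \<beta> A
  for T :: "(real ^ 'n \<Rightarrow> complex) \<Rightarrow> real ^ 'n \<Rightarrow> complex" and Bt \<Phi> K c0 CK
    and v :: "real ^ 'n \<Rightarrow> real" and \<beta> A +
  fixes F :: "real \<Rightarrow> real" and u :: "real ^ 'n \<Rightarrow> real" and a D3 Cu D8 s cs :: real
  assumes F_mono: "\<And>x y. 0 \<le> x \<Longrightarrow> x \<le> y \<Longrightarrow> F x \<le> F y" and F_nonneg: "\<And>x. 0 \<le> x \<Longrightarrow> 0 \<le> F x"
    and u_loc: "locally_integrable u" and u0: "\<And>x. 0 \<le> u x"
    and a: "1 \<le> a" and D3: "0 < D3"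
    and three: "\<And>x y z. 0 \<le> x \<Longrightarrow> 0 \<le> y \<Longrightarrow> 0 \<le> z \<Longrightarrow>
      complementary \<Phi> (x * y powr (1 - 1/(2 * a)) * z powr (1/(2 * a))) \<le> D3 * (1 + x powr a + (1 + F y) * max 1 z powr \<beta>)"
    and Cu: "0 < Cu" "\<And>y. 0 \<le> y \<Longrightarrow> y \<le> Cu * (1 + F y)"
    and D8: "0 < D8" "\<And>y. 0 \<le> y \<Longrightarrow> complementary \<Phi> y \<le> D8 * (1 + F y)"
    and s: "1 < s" and cs: "0 < cs" "\<And>t. 1 \<le> t \<Longrightarrow> cs * t powr s \<le> complementary \<Phi> t"
begin

lemma u_meas [measurable]: "u \<in> borel_measurable lebesgue"
  by (rule locally_integrable_measurable[OF u_loc])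

definition "om x = v x powr (- \<beta>)"
definition "\<theta> = 1 / (2 * a)"
definition "Ab = A powr \<beta> * A"
text \<open>The weight \<open>v powr (- \<beta>)\<close> normalised on \<open>B\<close>: almost
  everywhere at least 1 there by \<open>AE_ratio\<close>, with mean at most \<open>Ab\<close> by the
  Muckenhoupt condition.\<close>

definition "Z B x = A powr \<beta> * avg v B powr \<beta> * v x powr (- \<beta>)"

lemma \<theta>: "0 < \<theta>" "\<theta> \<le> 1/2"
  using a by (auto simp: \<theta>_def field_simps)

lemma Ab_nonneg: "0 \<le> Ab"
  using A1 by (simp add: Ab_def)

lemma Z_meas [measurable]: "Z B \<in> borel_measurable lebesgue"
  unfolding Z_def by measurable

lemma Z_nonneg: "0 \<le> Z B x"
  by (simp add: Z_def)

lemma Fu_meas: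
  assumes "0 < L"
  shows "(\<lambda>x. F (u x / L)) \<in> borel_measurable lebesgue"
  by (rule nonneg_mono_measurable[of F]) (use F_mono u0 assms in auto)

lemma Z_modular:
  assumes "B \<in> cubes"
  shows "(\<integral>\<^sup>+x\<in>B. ennreal (Z B x) \<partial>lebesgue) \<le> ennreal (Ab * measure lebesgue B)"
proof -
  have "(\<integral>\<^sup>+x\<in>B. ennreal (1 * v x powr (- \<beta>)) \<partial>lebesgue) \<le> ennreal (A * measure lebesgue B * avg v B powr (- \<beta>))"
    using set_nn_integral_om[OF assms] int_om_le[OF assms] by (simp add: ennreal_leI del: measure_completion)
  from modular_unweighted[OF assms _ _ _ this] A1 show ?thesis
    by (simp add: Z_def Ab_def mult_ac del: measure_completion)
qed

lemma F_modular:
  assumes "B \<in> cubes" "0 < L" "luxemburg F B om u < ennreal L"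
  shows "(\<integral>\<^sup>+x\<in>B. ennreal (F (u x / L) * Z B x) \<partial>lebesgue) \<le> ennreal (Ab * measure lebesgue B)"
proof -
  have "(\<integral>\<^sup>+x\<in>B. ennreal (F (u x / L) * v x powr (- \<beta>)) \<partial>lebesgue) \<le> ennreal (A * measure lebesgue B * avg v B powr (- \<beta>))"
    using assms(3) unfolding om_def by (intro luxemburg_modular assms(1,2) u0 F_mono)
  from modular_unweighted[OF assms(1) Fu_meas[OF assms(2)] _ _ this] A1 F_nonneg u0 assms(2) show ?thesis
    by (simp add: Z_def Ab_def mult_ac del: measure_completion)
qed

lemma one_modular: "B \<in> cubes \<Longrightarrow> (\<integral>\<^sup>+x\<in>B. ennreal 1 \<partial>lebesgue) \<le> ennreal (measure lebesgue B)"
  by (simp add: cube_emeasure[symmetric] del: measure_completion emeasure_completion)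

definition "orlicz_const = D3 * (2 + 2 * Ab)"
definition "average_const = Cu * (1 + Ab)"
definition "modular_const = D8 * (1 + Ab)"

lemma orlicz_consts_nonneg: "0 < orlicz_const" "0 < average_const" "0 < modular_const"
  using D3 Cu D8 Ab_nonneg by (auto simp: orlicz_const_def average_const_def modular_const_def intro!: mult_pos_pos add_pos_nonneg)

lemma u_average:
  assumes B: "B \<in> cubes" "0 < L" "luxemburg F B om u < ennreal L"
  shows "(\<integral>\<^sup>+x\<in>B. ennreal (u x) \<partial>lebesgue) \<le> ennreal (average_const * L * measure lebesgue B)"
proof -
  have "(\<integral>\<^sup>+x\<in>B. ennreal (u x) \<partial>lebesgue) \<le> ennreal ((Cu * L) * (measure lebesgue B + Ab * measure lebesgue B + 0 + 0))"
  proof (rule set_nn_integral_bound4[where ?g1.0="\<lambda>_. 1" and ?g2.0="\<lambda>x. F (u x / L) * Z B x" and ?g3.0="\<lambda>_. 0" and ?g4.0="\<lambda>_. 0"])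
    show "AE x in lebesgue. x \<in> B \<longrightarrow> u x \<le> Cu * L * (1 + F (u x / L) * Z B x + 0 + 0)"
      using AE_ratio[OF B(1)]
    proof eventually_elim
      case (elim x)
      show ?case
      proof
        assume "x \<in> B"
        then have Z: "1 \<le> Z B x" using elim by (simp add: Z_def)
        have y: "0 \<le> u x / L" using u0 B(2) by simp
        have "u x = L * (u x / L)" using B(2) by simp
        also have "\<dots> \<le> L * (Cu * (1 + F (u x / L)))" using Cu(2)[OF y] B(2) by (intro mult_left_mono) auto
        also have "\<dots> \<le> L * (Cu * (1 + F (u x / L) * Z B x))"
          using B(2) Cu(1) mult_left_mono[OF Z F_nonneg[OF y]] by (intro mult_left_mono add_left_mono) auto
        finally show "u x \<le> Cu * L * (1 + F (u x / L) * Z B x + 0 + 0)" by (simp add: mult_ac)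
      qed
    qed
    show "(\<lambda>x. F (u x / L) * Z B x) \<in> borel_measurable lebesgue" using Fu_meas[OF B(2)] by measurable
  qed (use one_modular[OF B(1)] F_modular[OF B] B u0 Cu Ab_nonneg F_nonneg Z_nonneg in auto)
  also have "(Cu * L) * (measure lebesgue B + Ab * measure lebesgue B + 0 + 0) = average_const * L * measure lebesgue B"
    by (simp add: average_const_def algebra_simps del: measure_completion)
  finally show ?thesis .
qed

text \<open>\<open>D8\<close> compares the complementary function with \<open>F\<close>, and the
  factor \<open>Z B x \<ge> 1\<close> turns the unweighted modular into the weighted one that the
  Luxemburg norm controls. This is the input for the bad part.\<close>

lemma orlicz_L:
  assumes B: "B \<in> cubes" "0 < L" "luxemburg F B om u < ennreal L" and h: "\<And>x. norm (h x) \<le> u x"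
  shows "(\<integral>\<^sup>+x\<in>B. ennreal (complementary \<Phi> (norm (h x) / L)) \<partial>lebesgue) \<le> ennreal (modular_const * measure lebesgue B)"
proof -
  have "(\<integral>\<^sup>+x\<in>B. ennreal (complementary \<Phi> (norm (h x) / L)) \<partial>lebesgue) \<le> ennreal (D8 * (measure lebesgue B + Ab * measure lebesgue B + 0 + 0))"
  proof (rule set_nn_integral_bound4[where ?g1.0="\<lambda>_. 1" and ?g2.0="\<lambda>x. F (u x / L) * Z B x" and ?g3.0="\<lambda>_. 0" and ?g4.0="\<lambda>_. 0"])
    show "AE x in lebesgue. x \<in> B \<longrightarrow> complementary \<Phi> (norm (h x) / L) \<le> D8 * (1 + F (u x / L) * Z B x + 0 + 0)"
      using AE_ratio[OF B(1)]
    proof eventually_elim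
      case (elim x)
      show ?case
      proof
        assume "x \<in> B"
        then have Z: "1 \<le> Z B x" using elim by (simp add: Z_def)
        have y: "0 \<le> u x / L" using u0 B(2) by simp
        have "complementary \<Phi> (norm (h x) / L) \<le> complementary \<Phi> (u x / L)"
          using h B(2) by (intro complementary_mono[OF Y] divide_right_mono) auto
        also have "\<dots> \<le> D8 * (1 + F (u x / L))" by (rule D8(2)[OF y])
        also have "\<dots> \<le> D8 * (1 + F (u x / L) * Z B x)"
          using D8(1) mult_left_mono[OF Z F_nonneg[OF y]] by (intro mult_left_mono add_left_mono) auto
        finally show "complementary \<Phi> (norm (h x) / L) \<le> D8 * (1 + F (u x / L) * Z B x + 0 + 0)" by simp
      qed
    qed
    show "(\<lambda>x. F (u x / L) * Z B x) \<in> borel_measurable lebesgue" using Fu_meas[OF B(2)] by measurable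
  qed (use one_modular[OF B(1)] F_modular[OF B] B u0 D8 Ab_nonneg F_nonneg Z_nonneg in auto)
  also have "D8 * (measure lebesgue B + Ab * measure lebesgue B + 0 + 0) = modular_const * measure lebesgue B"
    by (simp add: modular_const_def algebra_simps del: measure_completion)
  finally show ?thesis .
qed

text \<open>The test function is split as \<open>u = (u v)\<^sup>\<theta> \<cdot> u\<^bsup>1-\<theta>\<^esup> \<cdot> v\<^bsup>-\<theta>\<^esup>\<close>; the three factors are
  controlled by a maximal function, by the Luxemburg norm and by the Muckenhoupt condition.\<close>

definition "mscale m L V = m powr (1 / a) * L powr (1 - \<theta>) * V powr (- \<theta>)"

lemma mscale_pos: "0 < m \<Longrightarrow> 0 < L \<Longrightarrow> 0 < V \<Longrightarrow> 0 < mscale m L V"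
  by (simp add: mscale_def)

text \<open>On \<open>E\<close> the quotient by \<open>mscale\<close> splits exactly into
  \<open>(G x / m) powr (1/a)\<close>, \<open>(u x / L) powr (1 - \<theta>)\<close> and
  \<open>(V / v x) powr \<theta>\<close>, the three arguments of \<open>three\<close>. The resulting
  terms are linear in \<open>G\<close>, governed by the Luxemburg norm, or governed by
  \<open>Z B\<close>. Admitting every \<open>V \<le> A * avg v B\<close> lets one value, taken from
  a small cube, serve for all cubes that contain it.\<close>

lemma orlicz_cube:
  assumes B: "B \<in> cubes" "0 < L" "luxemburg F B om u < ennreal L"
    and m: "0 < m" "(\<integral>\<^sup>+x\<in>B. ennreal (G x) \<partial>lebesgue) \<le> ennreal (m * measure lebesgue B)"
    and V: "0 < V" "V \<le> A * avg v B"
    and G [measurable]: "G \<in> borel_measurable lebesgue" and G0: "\<And>x. 0 \<le> G x"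
    and Gh: "AE x in lebesgue. G x = sqrt (u x * v x) * indicator E x"
    and h: "\<And>x. norm (h x) = u x * indicator E x"
  shows "(\<integral>\<^sup>+x\<in>B. ennreal (complementary \<Phi> (norm (h x) / mscale m L V)) \<partial>lebesgue) \<le> ennreal (orlicz_const * measure lebesgue B)"
proof -
  have "(\<integral>\<^sup>+x\<in>B. ennreal (complementary \<Phi> (norm (h x) / mscale m L V)) \<partial>lebesgue)
    \<le> ennreal (D3 * (measure lebesgue B + measure lebesgue B + Ab * measure lebesgue B + Ab * measure lebesgue B))"
  proof (rule set_nn_integral_bound4[where ?g1.0="\<lambda>_. 1" and ?g2.0="\<lambda>x. G x / m" and ?g3.0="Z B" and ?g4.0="\<lambda>x. F (u x / L) * Z B x"])
    show "AE x in lebesgue. x \<in> B \<longrightarrow> complementary \<Phi> (norm (h x) / mscale m L V) \<le> D3 * (1 + G x / m + Z B x + F (u x / L) * Z B x)"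
      using AE_ratio[OF B(1)] Gh
    proof eventually_elim
      case (elim x)
      show ?case
      proof
        assume x: "x \<in> B"
        then have Z: "1 \<le> Z B x" and vx: "0 < v x" using elim by (auto simp: Z_def)
        have y: "0 \<le> u x / L" using u0 B(2) by simp
        have g: "0 \<le> G x / m" using G0 m by simp
        show "complementary \<Phi> (norm (h x) / mscale m L V) \<le> D3 * (1 + G x / m + Z B x + F (u x / L) * Z B x)"
        proof (cases "x \<in> E \<and> u x \<noteq> 0")
          case False
          then have "norm (h x) = 0" using h[of x] by auto
          then show ?thesis using complementary_zero[OF Y] D3 g Z F_nonneg[OF y] Z_nonneg[of B x]
            by (auto intro!: mult_nonneg_nonneg add_nonneg_nonneg)
        next
          case True
          then have ux: "0 < u x" using u0[of x] by linarith
          have Gx: "G x = sqrt (u x * v x)" and hx: "norm (h x) = u x" using elim(2) True h[of x] by auto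
          have Gp: "(G x / m) powr (1 / a) = (u x) powr \<theta> * (v x) powr \<theta> / m powr (1 / a)"
            unfolding Gx using ux vx m a
            by (simp add: powr_half_sqrt[symmetric] powr_divide powr_powr powr_mult \<theta>_def)
          have "u x = u x powr \<theta> * u x powr (1 - \<theta>)" using ux by (simp add: powr_add[symmetric])
          then have eq: "u x / mscale m L V = (G x / m) powr (1 / a) * (u x / L) powr (1 - \<theta>) * (V / v x) powr \<theta>"
            unfolding Gp mscale_def using ux vx m B(2) V(1)
            by (simp add: powr_divide powr_minus divide_simps)
          have Ga: "((G x / m) powr (1 / a)) powr a = G x / m" using g a G0[of x] m(1) by (simp add: powr_powr)
          have zb: "max 1 (V / v x) powr \<beta> \<le> Z B x"
          proof (cases "V / v x \<le> 1")
            case True then show ?thesis using Z by (simp add: max_def)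
          next
            case False
            have "(V / v x) powr \<beta> \<le> (A * avg v B / v x) powr \<beta>"
              using V vx \<beta> by (intro powr_mono2 divide_right_mono) auto
            also have "\<dots> = Z B x" using vx A1 V_pos[OF B(1)] by (simp add: Z_def powr_mult powr_divide powr_minus field_simps)
            finally show ?thesis using False by (simp add: max_def)
          qed
          have "complementary \<Phi> (norm (h x) / mscale m L V)
            \<le> D3 * (1 + ((G x / m) powr (1 / a)) powr a + (1 + F (u x / L)) * max 1 (V / v x) powr \<beta>)"
            unfolding hx eq \<theta>_def using y V vx by (intro three) auto
          also have "\<dots> \<le> D3 * (1 + G x / m + (1 + F (u x / L)) * Z B x)"
            unfolding Ga using D3 zb F_nonneg[OF y] by (intro mult_left_mono add_left_mono) auto
          finally show ?thesis by (simp add: algebra_simps)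
        qed
      qed
    qed
    show "(\<lambda>x. F (u x / L) * Z B x) \<in> borel_measurable lebesgue" using Fu_meas[OF B(2)] by measurable
    show "(\<integral>\<^sup>+x\<in>B. ennreal (G x / m) \<partial>lebesgue) \<le> ennreal (measure lebesgue B)"
    proof -
      have Bs [measurable]: "B \<in> sets lebesgue" by (rule cube_sets[OF B(1)])
      have "(\<integral>\<^sup>+x\<in>B. ennreal (G x / m) \<partial>lebesgue) = (\<integral>\<^sup>+x. ennreal (1 / m) * (ennreal (G x) * indicator B x) \<partial>lebesgue)"
        using m(1) G0 by (intro nn_integral_cong) (simp add: ennreal_mult[symmetric] indicator_def)
      also have "\<dots> = ennreal (1 / m) * (\<integral>\<^sup>+x\<in>B. ennreal (G x) \<partial>lebesgue)" by (rule nn_integral_cmult) measurable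
      also have "\<dots> \<le> ennreal (1 / m) * ennreal (m * measure lebesgue B)" by (intro mult_left_mono m(2)) simp
      also have "\<dots> = ennreal (measure lebesgue B)" using m(1) by (simp add: ennreal_mult[symmetric] del: measure_completion)
      finally show ?thesis .
    qed
  qed (use one_modular[OF B(1)] Z_modular[OF B(1)] F_modular[OF B] B u0 D3 Ab_nonneg F_nonneg Z_nonneg G0 m(1) in auto)
  also have "D3 * (measure lebesgue B + measure lebesgue B + Ab * measure lebesgue B + Ab * measure lebesgue B) = orlicz_const * measure lebesgue B"
    by (simp add: orlicz_const_def algebra_simps del: measure_completion)
  finally show ?thesis .
qed

definition "star b l = hcube (b - vec (rho * l)) (kap * l)"
text \<open>The ratio of the volume of a cube circumscribed about a ball to that of the
  ball.\<close>

definition "bcst = 2 ^ CARD('n) / unit_ball_vol (real CARD('n))"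

lemma bcst_pos: "0 < bcst"
  by (simp add: bcst_def)

lemma star_cube:
  assumes "0 < l"
  shows "cbox b (b + vec l) \<subseteq> star b l" "\<And>x. norm (x - b) \<le> rho * l \<Longrightarrow> x \<in> star b l"
proof -
  have r: "0 < rho * l" "kap * l = 2 * (rho * l) + l" using rho_gt(3) assms by (auto simp: kap_def algebra_simps)
  show "cbox b (b + vec l) \<subseteq> star b l"
  proof
    fix x assume "x \<in> cbox b (b + vec l)"
    then have "b $ i \<le> x $ i \<and> x $ i \<le> b $ i + l" for i by (simp add: mem_box_cart)
    then have "b $ i - rho * l \<le> x $ i \<and> x $ i < b $ i - rho * l + kap * l" for i
      using r by (smt (verit))
    then show "x \<in> star b l" by (simp add: star_def hcube_def)
  qed
  fix x assume x: "norm (x - b) \<le> rho * l"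
  have "\<bar>x $ i - b $ i\<bar> \<le> rho * l" for i using component_le_norm_cart[of "x - b" i] x by simp
  then have "b $ i - rho * l \<le> x $ i \<and> x $ i < b $ i - rho * l + kap * l" for i
    using r assms by (smt (verit))
  then show "x \<in> star b l" by (simp add: star_def hcube_def)
qed

lemma ball_modular:
  assumes l: "0 < l" and D: "0 \<le> D"
    and le: "\<And>B. B \<in> cubes \<Longrightarrow> cbox b (b + vec l) \<subseteq> B \<Longrightarrow> (\<integral>\<^sup>+x\<in>B. ennreal (g x) \<partial>lebesgue) \<le> ennreal (D * measure lebesgue B)"
    and r: "l \<le> r"
  shows "(\<integral>\<^sup>+x\<in>ball b r. ennreal (g x) \<partial>lebesgue) \<le> ennreal (D * bcst) * emeasure lebesgue (ball (b :: real ^ 'n) r)"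
proof -
  define B where "B = cbox (b - vec r) ((b - vec r) + vec (2 * r))"
  have B: "B \<in> cubes" unfolding B_def using l r by (intro cbox_in_cubes) auto
  have mB: "measure lebesgue B = (2 * r) ^ CARD('n)"
    unfolding B_def using l r by (intro measure_cbox_cube) auto
  have sub: "cbox b (b + vec l) \<subseteq> B" unfolding B_def using l r by (auto simp: mem_box_cart) (smt (verit))+
  have "(\<integral>\<^sup>+x\<in>ball b r. ennreal (g x) \<partial>lebesgue) \<le> (\<integral>\<^sup>+x\<in>B. ennreal (g x) \<partial>lebesgue)"
    using ball_subset_cube[of b r] by (intro nn_integral_mono) (auto simp: B_def indicator_def)
  also have "\<dots> \<le> ennreal (D * measure lebesgue B)" by (rule le[OF B sub])
  also have "\<dots> = ennreal (D * bcst) * ennreal (unit_ball_vol (real CARD('n)) * r ^ CARD('n))"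
    using D l r less_imp_neq[OF unit_ball_vol_pos[of "real CARD('n)"]] by (simp add: mB bcst_def ennreal_mult[symmetric] power_mult_distrib del: measure_completion)
  also have "ennreal (unit_ball_vol (real CARD('n)) * r ^ CARD('n)) = emeasure lebesgue (ball b r)"
    using emeasure_lborel_ball_vec[of r b] l r by simp
  finally show ?thesis .
qed

definition "atom_const = loc_const s * (1 + orlicz_const / cs) powr (1 / s) + hc * (1 + orlicz_const * bcst)"

lemma loc_const_nonneg: "0 \<le> loc_const s"
proof -
  have q: "2 powr (1 - s) < (1::real)" using s by (intro powr_less_one) auto
  show ?thesis unfolding loc_const_def using Bt hc1_nonneg rho_gt(3) kap_pos q
    by (intro add_nonneg_nonneg divide_nonneg_nonneg mult_nonneg_nonneg) auto
qed

lemma atom_const_nonneg: "0 \<le> atom_const"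
  unfolding atom_const_def using loc_const_nonneg hc_pos orlicz_consts_nonneg bcst_pos by (intro add_nonneg_nonneg mult_nonneg_nonneg) auto

text \<open>The test function is split at the dilate. Far away, the cancellation of \<open>d\<close>
  meets the modular of \<open>h\<close> on large balls. On the dilate \<open>local_bound\<close>
  needs a mean of \<open>norm (h x) powr s\<close>, which the growth \<open>cs * t powr s\<close> of
  the complementary function provides. The second alternative in \<open>zero\<close> is for the
  root, where the last term of the telescoping sum has no cancellation.\<close>

lemma atom_pair:
  fixes h :: "real ^ 'n \<Rightarrow> complex"
  assumes l: "0 < l" and L: "0 < L" "\<And>B. B \<in> cubes \<Longrightarrow> cbox b (b + vec l) \<subseteq> B \<Longrightarrow> luxemburg F B om u < ennreal L"
    and m: "0 < m" "\<And>B. B \<in> cubes \<Longrightarrow> cbox b (b + vec l) \<subseteq> B \<Longrightarrow> (\<integral>\<^sup>+x\<in>B. ennreal (G x) \<partial>lebesgue) \<le> ennreal (m * measure lebesgue B)"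
    and G: "G \<in> borel_measurable lebesgue" "\<And>x. 0 \<le> G x"
      "AE x in lebesgue. G x = sqrt (u x * v x) * indicator E x"
    and h: "h \<in> L2" "\<And>x. norm (h x) = u x * indicator E x" "\<And>x. norm (h x) \<le> Bh"
    and d: "d \<in> borel_measurable lebesgue" and Bd: "0 \<le> Bd" "AE x in lebesgue. norm (d x) \<le> Bd"
    and off: "\<And>x. x \<notin> hcube b l \<Longrightarrow> d x = 0"
    and zero: "(LINT x|lebesgue. d x) = 0 \<or> (\<forall>x. x \<notin> star b l \<longrightarrow> h x = 0)"
  shows "norm (pair d h) \<le> atom_const * Bd * l ^ CARD('n) * mscale m L (avg v (cbox b (b + vec l)))"
proof -
  define Qb where "Qb = cbox b (b + vec l)"
  have Qb: "Qb \<in> cubes" unfolding Qb_def by (rule cbox_in_cubes[OF l])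
  define mu where "mu = mscale m L (avg v Qb)"
  have mu: "0 < mu" unfolding mu_def by (rule mscale_pos[OF m(1) L(1) V_pos[OF Qb]])
  have orl: "(\<integral>\<^sup>+x\<in>B. ennreal (complementary \<Phi> (norm (h x) / mu)) \<partial>lebesgue) \<le> ennreal (orlicz_const * measure lebesgue B)"
    if B: "B \<in> cubes" "Qb \<subseteq> B" for B
    unfolding mu_def using B L m V_pos[OF Qb] V_mono[OF Qb B(1) B(2)]
    by (intro orlicz_cube[OF B(1) L(1) _ m(1) _ _ _ G h(2)]) (auto simp: Qb_def)
  note hm [measurable] = L2_measurable[OF h(1)]
  have Ss: "star b l \<in> sets lebesgue" "- star b l \<in> sets lebesgue" by (simp_all add: star_def Compl_in_sets_lebesgue)
  define h1 where "h1 x = indicator (star b l) x * h x" for x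
  define h2 where "h2 x = indicator (- star b l) x * h x" for x
  have hL: "h1 \<in> L2" "h2 \<in> L2" unfolding h1_def h2_def by (intro L2_restrict h Ss)+
  have AEb: "AE x in lebesgue. norm (d x) \<le> Bd * indicator (hcube b l) x"
    using Bd(2) by eventually_elim (use off in \<open>auto simp: indicator_def\<close>)
  have dL: "d \<in> L2" by (rule L2_boundedI(1)[OF d hcube_lmeasurable Bd(1) AEb])
  have "pair d h = pair d (\<lambda>x. h1 x + h2 x)"
    by (rule arg_cong[of _ _ "pair d"]) (auto simp: h1_def h2_def indicator_def)
  also have "\<dots> = pair d h1 + pair d h2" by (rule pair_add_right[OF dL hL])
  finally have split: "norm (pair d h) \<le> norm (pair d h1) + norm (pair d h2)" by (simp add: norm_triangle_ineq)
  \<comment> \<open>The modular bounds the mean of \<open>(norm (h x) / mu) powr s\<close> by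
    \<open>1 + orlicz_const / cs\<close>; its root of order \<open>s\<close> enters the
    scale.\<close>
  define mu' where "mu' = mu * (1 + orlicz_const / cs) powr (1 / s)"
  have "0 < 1 + orlicz_const / cs" using orlicz_consts_nonneg(1) cs(1) by (intro add_pos_pos) auto
  then have mu': "0 < mu'" using mu by (simp add: mu'_def)
  have one: "norm (pair d h1) \<le> loc_const s * Bd * l ^ CARD('n) * mu'"
  proof (rule local_bound[OF l d Bd off _ _ _ s mu'])
    show "h1 \<in> borel_measurable lebesgue" by (rule L2_measurable[OF hL(1)])
    show "norm (h1 x) \<le> max 0 Bh" for x using h(3)[of x] by (auto simp: h1_def indicator_def)
    show "h1 x = 0" if "x \<notin> hcube (b - vec (rho * l)) (kap * l)" for x using that by (simp add: h1_def star_def)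
    define Sb where "Sb = cbox (b - vec (rho * l)) ((b - vec (rho * l)) + vec (kap * l))"
    have kl: "0 < kap * l" using l kap_pos by simp
    have Sb: "Sb \<in> cubes" "measure lebesgue Sb = (kap * l) ^ CARD('n)" "star b l \<subseteq> Sb"
      unfolding Sb_def star_def using kl hcube_subset_cbox
      by (auto intro!: cbox_in_cubes measure_cbox_cube simp del: measure_completion)
    have QS: "Qb \<subseteq> Sb" using star_cube(1)[OF l, of b] Sb(3) by (auto simp: Qb_def)
    have m1: "(\<lambda>x. complementary \<Phi> (norm (h x) / mu)) \<in> borel_measurable lebesgue"
      using mu by (intro complementary_measurable[OF Y]) auto
    have "(\<integral>\<^sup>+x\<in>Sb. ennreal (norm (h x) powr s) \<partial>lebesgue)
      \<le> ennreal (mu powr s * (measure lebesgue Sb + orlicz_const / cs * measure lebesgue Sb + 0 + 0))"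
    proof (rule set_nn_integral_bound4[where ?g1.0="\<lambda>_. 1" and ?g2.0="\<lambda>x. complementary \<Phi> (norm (h x) / mu) / cs" and ?g3.0="\<lambda>_. 0" and ?g4.0="\<lambda>_. 0"])
      show "AE x in lebesgue. x \<in> Sb \<longrightarrow> norm (h x) powr s \<le> mu powr s * (1 + complementary \<Phi> (norm (h x) / mu) / cs + 0 + 0)"
      proof (rule AE_I2, rule impI)
        fix x
        define y where "y = norm (h x) / mu"
        have y: "0 \<le> y" using mu by (simp add: y_def)
        have P: "0 \<le> complementary \<Phi> y" by (rule complementary_nonneg[OF Y y])
        have "y powr s \<le> 1 + complementary \<Phi> y / cs"
        proof (cases "1 \<le> y")
          case True
          then have "y powr s \<le> complementary \<Phi> y / cs" using cs by (simp add: field_simps)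
          then show ?thesis by linarith
        next
          case False
          then have "y powr s \<le> 1 powr s" using y s by (intro powr_mono2) auto
          then show ?thesis using P cs by (simp add: add_increasing2)
        qed
        then have "mu powr s * y powr s \<le> mu powr s * (1 + complementary \<Phi> y / cs)" by (intro mult_left_mono) auto
        moreover have "mu powr s * y powr s = norm (h x) powr s" using mu by (simp add: y_def powr_divide)
        ultimately show "norm (h x) powr s \<le> mu powr s * (1 + complementary \<Phi> (norm (h x) / mu) / cs + 0 + 0)"
          by (simp add: y_def)
      qed
      show "(\<lambda>x. complementary \<Phi> (norm (h x) / mu) / cs) \<in> borel_measurable lebesgue" using m1 by measurable
      show "(\<integral>\<^sup>+x\<in>Sb. ennreal (complementary \<Phi> (norm (h x) / mu) / cs) \<partial>lebesgue) \<le> ennreal (orlicz_const / cs * measure lebesgue Sb)"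
      proof -
        have nnP: "0 \<le> complementary \<Phi> (norm (h x) / mu)" for x using mu by (intro complementary_nonneg[OF Y]) auto
        have Sbm [measurable]: "Sb \<in> sets lebesgue" by (rule cube_sets[OF Sb(1)])
        note [measurable] = m1
        have "(\<integral>\<^sup>+x\<in>Sb. ennreal (complementary \<Phi> (norm (h x) / mu) / cs) \<partial>lebesgue)
          = (\<integral>\<^sup>+x. ennreal (1 / cs) * (ennreal (complementary \<Phi> (norm (h x) / mu)) * indicator Sb x) \<partial>lebesgue)"
          using cs(1) nnP by (intro nn_integral_cong) (simp add: ennreal_mult[symmetric] indicator_def)
        also have "\<dots> = ennreal (1 / cs) * (\<integral>\<^sup>+x\<in>Sb. ennreal (complementary \<Phi> (norm (h x) / mu)) \<partial>lebesgue)"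
          by (rule nn_integral_cmult) measurable
        also have "\<dots> \<le> ennreal (1 / cs) * ennreal (orlicz_const * measure lebesgue Sb)" by (intro mult_left_mono orl Sb QS) simp
        also have "\<dots> = ennreal (orlicz_const / cs * measure lebesgue Sb)"
          using cs(1) orlicz_consts_nonneg(1) by (simp add: ennreal_mult[symmetric] del: measure_completion)
        finally show ?thesis .
      qed
    qed (use one_modular[OF Sb(1)] Sb(1) cs mu orlicz_consts_nonneg(1) complementary_nonneg[OF Y] in \<open>auto simp del: measure_completion\<close>)
    also have "mu powr s * (measure lebesgue Sb + orlicz_const / cs * measure lebesgue Sb + 0 + 0) = mu' powr s * (kap * l) ^ CARD('n)"
    proof -
      have "mu' powr s = mu powr s * (1 + orlicz_const / cs)"
        using mu s orlicz_consts_nonneg(1) cs(1) by (simp add: mu'_def powr_mult powr_powr add_pos_pos)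
      then show ?thesis by (simp add: Sb(2) algebra_simps del: measure_completion)
    qed
    finally have le: "(\<integral>\<^sup>+x\<in>Sb. ennreal (norm (h x) powr s) \<partial>lebesgue) \<le> ennreal (mu' powr s * (kap * l) ^ CARD('n))" .
    have int: "set_integrable lebesgue (star b l) (\<lambda>x. norm (h1 x) powr s)"
    proof (rule set_integrable_bounded)
      show "(\<lambda>x. norm (h1 x) powr s) \<in> borel_measurable lebesgue" using L2_measurable[OF hL(1)] by measurable
      show "\<bar>norm (h1 x) powr s\<bar> \<le> max 0 Bh powr s" for x
        using h(3)[of x] s by (auto simp: h1_def indicator_def intro!: powr_mono2)
    qed (simp add: star_def)
    have "ennreal (LINT x:star b l|lebesgue. norm (h1 x) powr s) = (\<integral>\<^sup>+x. ennreal (indicator (star b l) x *\<^sub>R norm (h1 x) powr s) \<partial>lebesgue)"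
      unfolding set_lebesgue_integral_def
      by (rule nn_integral_eq_integral[symmetric]) (use int in \<open>auto simp: set_integrable_def\<close>)
    also have "\<dots> \<le> (\<integral>\<^sup>+x\<in>Sb. ennreal (norm (h x) powr s) \<partial>lebesgue)"
      using Sb(3) by (intro nn_integral_mono) (auto simp: indicator_def h1_def)
    also note le
    finally show "(LINT x:hcube (b - vec (rho * l)) (kap * l)|lebesgue. norm (h1 x) powr s) \<le> mu' powr s * (kap * l) ^ CARD('n)"
      using kl by (subst (asm) ennreal_le_iff) (auto simp: star_def)
  qed
  have two: "norm (pair d h2) \<le> (Bd * l ^ CARD('n)) * hc * (1 + orlicz_const * bcst) * mu"
  proof (cases "\<forall>x. x \<notin> star b l \<longrightarrow> h x = 0")
    case True
    then have "h2 = (\<lambda>x. 0)" by (auto simp: h2_def fun_eq_iff indicator_def)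
    then have "norm (pair d h2) = 0" by (simp add: pair_def)
    moreover have "0 \<le> (Bd * l ^ CARD('n)) * hc * (1 + orlicz_const * bcst) * mu"
      using Bd l hc_pos orlicz_consts_nonneg bcst_pos mu by (intro mult_nonneg_nonneg) auto
    ultimately show ?thesis by linarith
  next
    case False
    then have d0: "(LINT x|lebesgue. d x) = 0" using zero by blast
    have "norm (pair d h2) \<le> (LINT x|lebesgue. norm (d x)) * hc * (1 + orlicz_const * bcst) * mu"
    proof (rule far_pair[OF l d Bd off d0 hL(2) _ mu])
      show "h2 x = 0" if "norm (x - b) \<le> rho * l" for x
        using star_cube(2)[OF l that] by (simp add: h2_def)
      show "0 \<le> orlicz_const * bcst" using orlicz_consts_nonneg bcst_pos by simp
      fix r assume r: "l \<le> r"
      have "(\<integral>\<^sup>+x\<in>ball b r. ennreal (complementary \<Phi> (norm (h2 x) / mu)) \<partial>lebesgue)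
        \<le> (\<integral>\<^sup>+x\<in>ball b r. ennreal (complementary \<Phi> (norm (h x) / mu)) \<partial>lebesgue)"
        using mu by (intro nn_integral_mono mult_right_mono ennreal_leI complementary_mono[OF Y] divide_right_mono)
          (auto simp: h2_def indicator_def)
      also have "\<dots> \<le> ennreal (orlicz_const * bcst) * emeasure lebesgue (ball b r)"
        using orlicz_consts_nonneg(1) orl by (intro ball_modular[OF l _ _ r]) (auto simp: Qb_def)
      finally show "(\<integral>\<^sup>+x\<in>ball b r. ennreal (complementary \<Phi> (norm (h2 x) / mu)) \<partial>lebesgue)
        \<le> ennreal (orlicz_const * bcst) * emeasure lebesgue (ball b r)" .
    qed
    also have "(LINT x|lebesgue. norm (d x)) \<le> Bd * l ^ CARD('n)"
    proof -
      have i: "integrable lebesgue (\<lambda>x. Bd * indicat_real (hcube b l) x)"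
        using hcube_lmeasurable[of b l] by (intro integrable_mult_right) (simp add: lmeasurable_iff_integrable)
      have "(LINT x|lebesgue. norm (d x)) \<le> (LINT x|lebesgue. Bd * indicator (hcube b l) x)"
      proof (rule integral_mono_AE[OF _ i AEb])
        show "integrable lebesgue (\<lambda>x. norm (d x))"
          by (rule Bochner_Integration.integrable_bound[OF i])
            (use d AEb in \<open>auto elim!: eventually_mono intro: order.trans[OF _ abs_ge_self]\<close>)
      qed
      then show ?thesis using l by (simp add: measure_hcube del: measure_completion)
    qed
    finally show ?thesis using hc_pos orlicz_consts_nonneg bcst_pos mu by (simp add: mult_right_mono)
  qed
  have "norm (pair d h) \<le> loc_const s * Bd * l ^ CARD('n) * mu' + (Bd * l ^ CARD('n)) * hc * (1 + orlicz_const * bcst) * mu"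
    using split one two by linarith
  also have "\<dots> = atom_const * Bd * l ^ CARD('n) * mu" by (simp add: atom_const_def mu'_def algebra_simps)
  finally show ?thesis by (simp add: mu_def Qb_def)
qed

definition "dyadic_const = 2 ^ CARD('n) * dbl (2 ^ CARD('n))"
definition "star_const = A * average_const * kap ^ CARD('n) * dbl (kap ^ CARD('n))"
definition "bad_const = (1 + dyadic_const) * hc * (1 + modular_const * bcst)"
text \<open>Twice the constant \<open>8 * max_const\<close> of the maximal inequality plus 2, from
  \<open>(x + y)^2 \<le> 2 * x^2 + 2 * y^2\<close> applied to the supremum of means and the constant
  added to it.\<close>

definition "mean_const = 16 * max_const CARD('n) + 2"
definition "vth = \<theta> / (1 - \<theta>)"
text \<open>An atom is a difference of good parts at heights \<open>lam\<close> and at most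
  \<open>2 * lam\<close>, hence the 3; \<open>dyadic_const\<close> bounds the good parts and
  \<open>A\<close> the weight on the cube.\<close>

definition "level_const = 3 * atom_const * dyadic_const * A"
text \<open>With weight \<open>\<eta> * sqrt 2 ^ i\<close> at height \<open>t / 2 ^ i\<close> the
  two terms of the mean inequality decay with the ratios \<open>q1\<close> and
  \<open>q2\<close>.\<close>

definition "q1 = sqrt 2 powr (- vth)"
definition "q2 = 1 / sqrt (2::real)"
text \<open>Makes the series with ratio \<open>q2\<close> sum to at most half of the quantity to be
  absorbed. The added 1 keeps the denominator positive when \<open>level_const\<close> is 0.\<close>

definition "\<eta> = (1 - q2) / (2 * (level_const + 1) * mean_const)"
definition "good_const = level_const * \<eta> powr (- vth) / (1 - q1)"
text \<open>In order: the case of a stopping root, the dilates, and the bad and good parts. The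
  factor 2 is the price of the absorption, and the final 1 ensures positivity.\<close>

definition "weak_const = A * average_const + star_const + 2 * (bad_const + good_const) + 1"

end

subsection \<open>The exceptional set\<close>

lemma set_integral_finite_Union_le:
  fixes g :: "'a \<Rightarrow> real"
  assumes "finite I" "\<And>i. i \<in> I \<Longrightarrow> A i \<in> sets M" "set_integrable M (\<Union>i\<in>I. A i) g" "AE x in M. x \<in> (\<Union>i\<in>I. A i) \<longrightarrow> 0 \<le> g x"
  shows "(LINT x:(\<Union>i\<in>I. A i)|M. g x) \<le> (\<Sum>i\<in>I. LINT x:A i|M. g x)"
proof -
  have Ai: "set_integrable M (A i) g" if "i \<in> I" for i
    using that assms(2) by (intro set_integrable_subset[OF assms(3)]) auto
  have "(LINT x:(\<Union>i\<in>I. A i)|M. g x) \<le> (LINT x|M. (\<Sum>i\<in>I. indicator (A i) x *\<^sub>R g x))"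
    unfolding set_lebesgue_integral_def
  proof (rule integral_mono_AE)
    show "integrable M (\<lambda>x. indicat_real (\<Union>i\<in>I. A i) x *\<^sub>R g x)" using assms(3) by (simp add: set_integrable_def)
    show "integrable M (\<lambda>x. \<Sum>i\<in>I. indicat_real (A i) x *\<^sub>R g x)"
      using Ai by (intro Bochner_Integration.integrable_sum) (simp add: set_integrable_def)
    show "AE x in M. indicat_real (\<Union>i\<in>I. A i) x *\<^sub>R g x \<le> (\<Sum>i\<in>I. indicat_real (A i) x *\<^sub>R g x)"
      using assms(4)
    proof eventually_elim
      case (elim x)
      show ?case
      proof (cases "x \<in> (\<Union>i\<in>I. A i)")
        case True
        then obtain i where i: "i \<in> I" "x \<in> A i" by blast
        have "indicat_real (A i) x *\<^sub>R g x \<le> (\<Sum>i\<in>I. indicat_real (A i) x *\<^sub>R g x)"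
          by (rule member_le_sum[OF i(1)]) (use elim True assms(1) in auto)
        then show ?thesis using i True by simp
      next
        case False
        then have "(\<Sum>i\<in>I. indicat_real (A i) x *\<^sub>R g x) = 0" by (intro sum.neutral) auto
        then show ?thesis using False by simp
      qed
    qed
  qed
  also have "\<dots> = (\<Sum>i\<in>I. LINT x:A i|M. g x)"
    unfolding set_lebesgue_integral_def using Ai by (intro Bochner_Integration.integral_sum) (simp add: set_integrable_def)
  finally show ?thesis .
qed

lemma set_integral_countable_Union_le:
  fixes g :: "'a \<Rightarrow> real"
  assumes "countable S" "\<And>i. i \<in> S \<Longrightarrow> A i \<in> sets M" "set_integrable M (\<Union>i\<in>S. A i) g"
    and "AE x in M. x \<in> (\<Union>i\<in>S. A i) \<longrightarrow> 0 \<le> g x"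
    and "\<And>F. finite F \<Longrightarrow> F \<subseteq> S \<Longrightarrow> (\<Sum>i\<in>F. LINT x:A i|M. g x) \<le> c"
  shows "(LINT x:(\<Union>i\<in>S. A i)|M. g x) \<le> c"
proof (cases "S = {}")
  case True
  then show ?thesis using assms(5)[of "{}"] by (simp add: set_lebesgue_integral_def)
next
  case False
  define I where "I n = from_nat_into S ` {..<n}" for n
  have I: "finite (I n)" "I n \<subseteq> S" for n using from_nat_into[OF False] by (auto simp: I_def)
  have UI: "(\<Union>n. \<Union>i\<in>I n. A i) = (\<Union>i\<in>S. A i)"
  proof -
    have "(\<Union>n. I n) = S"
      using range_from_nat_into[OF False assms(1)] by (auto simp: I_def)
    then show ?thesis by blast
  qed
  have "(\<lambda>n. LINT x:(\<Union>i\<in>I n. A i)|M. g x) \<longlonglongrightarrow> (LINT x:(\<Union>n. \<Union>i\<in>I n. A i)|M. g x)"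
  proof (rule set_integral_cont_up)
    show "(\<Union>i\<in>I n. A i) \<in> sets M" for n using I[of n] assms(2) by (intro sets.finite_UN) auto
    show "incseq (\<lambda>n. \<Union>i\<in>I n. A i)" unfolding I_def by (intro incseq_SucI UN_mono) auto
    show "set_integrable M (\<Union>n. \<Union>i\<in>I n. A i) g" using assms(3) by (simp add: UI)
  qed
  moreover have "(LINT x:(\<Union>i\<in>I n. A i)|M. g x) \<le> c" for n
  proof -
    have "set_integrable M (\<Union>i\<in>I n. A i) g"
      using I[of n] assms(2) by (intro set_integrable_subset[OF assms(3)] sets.finite_UN) auto
    then have "(LINT x:(\<Union>i\<in>I n. A i)|M. g x) \<le> (\<Sum>i\<in>I n. LINT x:A i|M. g x)"
      using I[of n] assms(2,4) by (intro set_integral_finite_Union_le) (auto elim!: eventually_mono)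
    then show ?thesis using assms(5)[OF I] by (rule order.trans)
  qed
  ultimately show ?thesis unfolding UI by (intro LIMSEQ_le_const2) auto
qed

lemma mult_cnj_sgn: "z * cnj (sgn z) = complex_of_real (norm z)"
proof (cases "z = 0")
  case False
  have "z * cnj (sgn z) = (z * cnj z) / complex_of_real (norm z)"
    by (simp add: sgn_div_norm scaleR_conv_of_real divide_inverse mult_ac)
  also have "z * cnj z = complex_of_real ((norm z)\<^sup>2)" by (rule complex_norm_square[symmetric])
  also have "complex_of_real ((norm z)\<^sup>2) / complex_of_real (norm z) = complex_of_real (norm z)"
    using False by (simp add: power2_eq_square)
  finally show ?thesis .
qed simp

text \<open>The powers of \<open>sg\<close> moved into the two factors cancel in the product; then
  each base is replaced by the sum of both, and the exponents add up to 1.\<close>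

lemma weighted_mean_le:
  fixes x y \<theta> sg :: real
  assumes "0 \<le> x" "0 \<le> y" "0 < \<theta>" "\<theta> < 1" "0 < sg"
  shows "x powr (1 - \<theta>) * y powr \<theta> \<le> sg powr (- \<theta> / (1 - \<theta>)) * x + sg * y"
proof -
  define X where "X = sg powr (- \<theta> / (1 - \<theta>)) * x"
  define Y where "Y = sg * y"
  have XY: "0 \<le> X" "0 \<le> Y" using assms by (auto simp: X_def Y_def)
  have "X powr (1 - \<theta>) * Y powr \<theta> = (sg powr (- \<theta>) * sg powr \<theta>) * (x powr (1 - \<theta>) * y powr \<theta>)"
    using assms by (simp add: X_def Y_def powr_mult powr_powr)
  also have "\<dots> = x powr (1 - \<theta>) * y powr \<theta>" using assms by (simp add: powr_add[symmetric])
  finally have "x powr (1 - \<theta>) * y powr \<theta> = X powr (1 - \<theta>) * Y powr \<theta>" ..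
  also have "\<dots> \<le> (X + Y) powr (1 - \<theta>) * (X + Y) powr \<theta>"
    using XY assms by (intro mult_mono powr_mono2) auto
  also have "\<dots> = X + Y" using XY by (simp add: powr_add[symmetric])
  finally show ?thesis by (simp add: X_def Y_def)
qed

context mixed_estimate
begin

lemma dyadic_const_ge: "1 \<le> dyadic_const"
proof -
  have "1 \<le> (2 * A * 2 ^ CARD('n)) powr (1 / \<beta>)"
  proof (rule ge_one_powr_ge_zero)
    have "1 * 1 \<le> (2 * A) * 2 ^ CARD('n)" using A1 by (intro mult_mono) auto
    then show "1 \<le> 2 * A * 2 ^ CARD('n)" by simp
  qed (use \<beta> in simp)
  then have "1 * 1 \<le> 2 ^ CARD('n) * dbl (2 ^ CARD('n))" unfolding dbl_def by (intro mult_mono) auto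
  then show ?thesis by (simp add: dyadic_const_def)
qed

lemma kap_ge: "1 \<le> kap ^ CARD('n)"
  using rho_gt(3) by (intro one_le_power) (simp add: kap_def)

lemma star_const_nonneg: "0 \<le> star_const"
  unfolding star_const_def using A1 orlicz_consts_nonneg kap_ge dbl_pos[OF kap_ge] kap_pos by (intro mult_nonneg_nonneg) auto

lemma bad_const_nonneg: "0 \<le> bad_const"
  using dyadic_const_ge hc_pos orlicz_consts_nonneg bcst_pos by (simp add: bad_const_def)

lemma vth_pos: "0 < vth"
  using \<theta> by (simp add: vth_def)

lemma level_const_nonneg: "0 \<le> level_const"
  using atom_const_nonneg dyadic_const_ge A1 by (simp add: level_const_def)

lemma mean_const_pos: "0 < mean_const"
  using max_const_nonneg[of "CARD('n)"] by (simp add: mean_const_def)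

lemma q12: "0 < q1" "q1 < 1" "0 < q2" "q2 < 1"
proof -
  show "0 < q1" "0 < q2" by (auto simp: q1_def q2_def)
  show "q2 < 1" by (simp add: q2_def)
  have "sqrt 2 powr (- vth) < sqrt 2 powr 0" using vth_pos by (intro powr_less_mono) auto
  then show "q1 < 1" by (simp add: q1_def)
qed

lemma \<eta>_pos: "0 < \<eta>"
  using q12 level_const_nonneg mean_const_pos by (simp add: \<eta>_def)

lemma good_const_nonneg: "0 \<le> good_const"
  using level_const_nonneg q12 by (simp add: good_const_def)

lemma weak_const_pos: "0 < weak_const"
proof -
  have "0 \<le> A * average_const" using A1 orlicz_consts_nonneg by simp
  then show ?thesis using star_const_nonneg bad_const_nonneg good_const_nonneg by (simp add: weak_const_def)
qed

lemma uv_cube_le: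
  assumes B: "B \<in> cubes" "0 < L" "luxemburg F B om u < ennreal L" and S: "S \<in> sets lebesgue" "S \<subseteq> B"
  shows "set_integrable lebesgue S (\<lambda>x. u x * v x)"
    and "(LINT x:S|lebesgue. u x * v x) \<le> A * avg v B * (average_const * L * measure lebesgue B)"
proof -
  have ui: "set_integrable lebesgue B u" using u_loc cube_compact[OF B(1)] by (auto simp: locally_integrable_def)
  have vb: "AE x in lebesgue. x \<in> B \<longrightarrow> 0 \<le> v x \<and> v x \<le> A * avg v B"
    using v_pos v_sup[OF B(1)] by eventually_elim auto
  have AV: "0 \<le> A * avg v B" using A1 V_pos[OF B(1)] by simp
  have "set_integrable lebesgue B (\<lambda>x. v x * of_real (u x))"
    by (rule set_integrable_bounded_mult[OF v_meas _ ui, where C="A * avg v B"]) (use vb in \<open>auto elim!: eventually_mono\<close>)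
  then have uvB: "set_integrable lebesgue B (\<lambda>x. u x * v x)" by (simp add: mult.commute)
  then show uvS: "set_integrable lebesgue S (\<lambda>x. u x * v x)" using S by (rule set_integrable_subset)
  have "(LINT x:S|lebesgue. u x * v x) \<le> (LINT x:B|lebesgue. (A * avg v B) * u x)"
    unfolding set_lebesgue_integral_def
  proof (rule integral_mono_AE)
    show "integrable lebesgue (\<lambda>x. indicat_real S x *\<^sub>R (u x * v x))" using uvS by (simp add: set_integrable_def)
    show "integrable lebesgue (\<lambda>x. indicat_real B x *\<^sub>R (A * avg v B * u x))"
      using set_integrable_mult_right[OF ui, of "A * avg v B"] by (simp add: set_integrable_def)
    show "AE x in lebesgue. indicat_real S x *\<^sub>R (u x * v x) \<le> indicat_real B x *\<^sub>R (A * avg v B * u x)"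
      using vb
    proof eventually_elim
      case (elim x)
      show ?case
      proof (cases "x \<in> B")
        case True
        have "u x * v x \<le> A * avg v B * u x" using elim True u0[of x] by (simp add: mult.commute mult_left_mono)
        then show ?thesis using True u0[of x] AV by (auto simp: indicator_def)
      qed (use S in \<open>auto simp: indicator_def\<close>)
    qed
  qed
  also have "\<dots> = A * avg v B * (LINT x:B|lebesgue. u x)" by simp
  also have "(LINT x:B|lebesgue. u x) \<le> average_const * L * measure lebesgue B"
  proof -
    have "ennreal (LINT x:B|lebesgue. u x) = (\<integral>\<^sup>+x. ennreal (indicator B x *\<^sub>R u x) \<partial>lebesgue)"
      unfolding set_lebesgue_integral_def
      by (rule nn_integral_eq_integral[symmetric]) (use ui u0 in \<open>auto simp: set_integrable_def\<close>)
    also have "\<dots> = (\<integral>\<^sup>+x\<in>B. ennreal (u x) \<partial>lebesgue)" by (intro nn_integral_cong) (simp add: indicator_def)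
    also have "\<dots> \<le> ennreal (average_const * L * measure lebesgue B)" by (rule u_average[OF B])
    finally show ?thesis using B(2) orlicz_consts_nonneg by (subst (asm) ennreal_le_iff) (auto intro!: mult_nonneg_nonneg)
  qed
  finally show "(LINT x:S|lebesgue. u x * v x) \<le> A * avg v B * (average_const * L * measure lebesgue B)"
    using AV by (simp add: mult_left_mono)
qed

end

text \<open>\<open>A0\<close> is a bounded part of the level set, \<open>X\<close> is essentially the right side of the inequality, and
  \<open>Lf Q\<close> is the infimum of \<open>M\<^sub>\<phi> u\<close> over \<open>Q\<close>, made slightly larger to be positive and to exceed the Luxemburg
  averages strictly.\<close>

locale mixed_data = mixed_estimate T Bt \<Phi> K c0 CK v \<beta> A F u a D3 Cu D8 s cs
  for T :: "(real ^ 'n \<Rightarrow> complex) \<Rightarrow> real ^ 'n \<Rightarrow> complex" and Bt \<Phi> and K :: "real ^ 'n \<Rightarrow> complex" and c0 CK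
    and v :: "real ^ 'n \<Rightarrow> real" and \<beta> A F and u :: "real ^ 'n \<Rightarrow> real" and a D3 Cu D8 s cs +
  fixes a0 :: "real ^ 'n" and l0 :: real and f :: "real ^ 'n \<Rightarrow> complex" and Bf t X R0 :: real
    and Lf :: "(real ^ 'n) set \<Rightarrow> real" and A0 :: "(real ^ 'n) set"
  assumes l0: "0 < l0" and f_meas [measurable]: "f \<in> borel_measurable lebesgue" and f_bound: "\<And>x. norm (f x) \<le> Bf"
    and f_off: "\<And>x. x \<notin> hcube a0 l0 \<Longrightarrow> f x = 0" and t: "0 < t" and X: "0 \<le> X"
    and A0: "A0 \<in> sets lebesgue" "A0 \<subseteq> hcube a0 l0"
    and A0_level: "\<And>x. x \<in> A0 \<Longrightarrow> t * v x < norm (T (\<lambda>y. f y * complex_of_real (v y)) x)"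
    and A0_v: "\<And>x. x \<in> A0 \<Longrightarrow> 0 < v x" and A0_u: "\<And>x. x \<in> A0 \<Longrightarrow> u x \<le> R0"
    and Lf_pos: "\<And>b l. 0 < l \<Longrightarrow> hcube b l \<subseteq> hcube a0 l0 \<Longrightarrow>
      0 < (LINT x:hcube b l|lebesgue. norm (f x) * v x) \<Longrightarrow> 0 < Lf (hcube b l)"
    and Lf_lux: "\<And>b l B. 0 < l \<Longrightarrow> hcube b l \<subseteq> hcube a0 l0 \<Longrightarrow>
      0 < (LINT x:hcube b l|lebesgue. norm (f x) * v x) \<Longrightarrow> B \<in> cubes \<Longrightarrow> cbox b (b + vec l) \<subseteq> B \<Longrightarrow>
      luxemburg F B (\<lambda>x. v x powr (- \<beta>)) u < ennreal (Lf (hcube b l))"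
    and Lf_sum: "\<And>\<F>. finite \<F> \<Longrightarrow> disjoint \<F> \<Longrightarrow> (\<And>Q. Q \<in> \<F> \<Longrightarrow> (\<exists>b l. 0 < l \<and> Q = hcube b l) \<and>
      Q \<subseteq> hcube a0 l0 \<and> 0 < (LINT x:Q|lebesgue. norm (f x) * v x)) \<Longrightarrow>
      (\<Sum>Q\<in>\<F>. Lf Q * (LINT x:Q|lebesgue. norm (f x) * v x)) \<le> X"
begin

sublocale cz: calderon_zygmund a0 l0 v f Bf dyadic_const
proof
  show "set_integrable lebesgue (hcube a0 l0) v"
    by (rule set_integrable_subset[OF v_int[OF cbox_in_cubes[OF l0, of a0]] _ hcube_subset_cbox]) simp
  show "AE x in lebesgue. x \<in> hcube a0 l0 \<longrightarrow> 0 < v x" using v_pos by (auto elim!: eventually_mono)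
  show "(LINT y:dcube a0 l0 k x|lebesgue. v y) \<le> dyadic_const * (LINT y:dcube a0 l0 (Suc k) x|lebesgue. v y)" for k x
    unfolding dyadic_const_def by (rule dyadic_doubling[OF l0])
qed (use l0 f_bound dyadic_const_ge in auto)

lemma om_eq: "om = (\<lambda>x. v x powr (- \<beta>))"
  by (simp add: om_def fun_eq_iff)

definition "Vq b l = avg v (cbox b (b + vec l :: real ^ 'n))"

lemma Vq_pos: "0 < l \<Longrightarrow> 0 < Vq b l"
  unfolding Vq_def by (intro V_pos cbox_in_cubes)

lemma W_hcube: "0 < l \<Longrightarrow> cz.W (hcube b l) = Vq b l * l ^ CARD('n)"
  unfolding cz.W_def Vq_def by (rule int_hcube)

lemma v_AE_hcube:
  assumes "0 < l"
  shows "AE x in lebesgue. x \<in> hcube b l \<longrightarrow> 0 < v x \<and> v x \<le> A * Vq b l"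
  using v_pos v_sup[OF cbox_in_cubes[OF assms, of b]] hcube_subset_cbox[of b l]
  by (auto elim!: eventually_elim2 simp: Vq_def)

text \<open>What the sums use of a stopping cube, isolated so that the root can be treated alike
  when it ends the telescoping sum.\<close>

definition "heavy lam Q \<longleftrightarrow> (\<exists>b l. 0 < l \<and> Q = hcube b l) \<and> Q \<subseteq> hcube a0 l0 \<and> lam * cz.W Q < cz.F Q"

lemma heavyE:
  assumes "heavy lam Q" "0 < lam"
  obtains b l where "0 < l" "Q = hcube b l" "hcube b l \<subseteq> hcube a0 l0" "0 < cz.W Q" "0 < cz.F Q" "0 < Lf Q"
    "\<And>B. B \<in> cubes \<Longrightarrow> cbox b (b + vec l) \<subseteq> B \<Longrightarrow> luxemburg F B om u < ennreal (Lf Q)"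
proof -
  from assms(1) obtain b l where bl: "0 < l" "Q = hcube b l" and Q: "Q \<subseteq> hcube a0 l0" "lam * cz.W Q < cz.F Q"
    unfolding heavy_def by blast
  have W: "0 < cz.W Q" using W_hcube[OF bl(1)] Vq_pos[OF bl(1)] bl by simp
  then have F0: "0 < cz.F Q" using Q(2) assms(2) by (smt (verit) mult_pos_pos)
  then show ?thesis
    using that[OF bl] Q(1) W Lf_pos[OF bl(1)] Lf_lux[OF bl(1)] bl(2) by (simp add: cz.F_def om_eq)
qed

lemma S_heavy: "Q \<in> cz.S lam \<Longrightarrow> heavy lam Q"
  unfolding heavy_def using cz.S_hcube[of Q lam] cz.S_subset[of Q lam] cz.S_stops[of Q lam] by metis

lemma heavy_sum:
  assumes "finite \<F>" "disjoint \<F>" "\<And>Q. Q \<in> \<F> \<Longrightarrow> heavy lam Q" "0 < lam"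
  shows "(\<Sum>Q\<in>\<F>. Lf Q * cz.F Q) \<le> X"
  unfolding cz.F_def
proof (rule Lf_sum[OF assms(1,2)])
  fix Q assume "Q \<in> \<F>"
  then obtain b l where "0 < l" "Q = hcube b l" "hcube b l \<subseteq> hcube a0 l0" "0 < cz.F Q"
    using heavyE[OF assms(3) assms(4)] by metis
  then show "(\<exists>b l. 0 < l \<and> Q = hcube b l) \<and> Q \<subseteq> hcube a0 l0 \<and> 0 < (LINT x:Q|lebesgue. norm (f x) * v x)"
    unfolding cz.F_def by blast
qed

definition "Y E = (LINT x:E|lebesgue. u x * v x)"

lemma uv_integrable:
  assumes "E \<in> sets lebesgue" "E \<subseteq> hcube a0 l0"
  shows "set_integrable lebesgue E (\<lambda>x. u x * v x)"
proof -
  let ?B = "cbox a0 (a0 + vec l0)"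
  have B: "?B \<in> cubes" by (rule cbox_in_cubes[OF l0])
  have ui: "set_integrable lebesgue ?B u" using u_loc by (simp add: locally_integrable_def)
  have "AE x in lebesgue. x \<in> ?B \<longrightarrow> norm (v x) \<le> A * avg v ?B"
    using v_pos v_sup[OF B] by eventually_elim auto
  from set_integrable_bounded_mult[OF v_meas this ui]
  have uv: "set_integrable lebesgue ?B (\<lambda>x. u x * v x)" by (simp add: mult.commute)
  show ?thesis
    by (rule set_integrable_subset[OF uv assms(1)]) (use assms(2) hcube_subset_cbox[of a0 l0] in blast)
qed

lemma Y_nonneg: "0 \<le> Y E"
  unfolding Y_def set_lebesgue_integral_def
  by (rule integral_nonneg_AE) (use v_pos u0 in \<open>auto elim!: eventually_mono simp: indicator_def\<close>)

text \<open>If the root itself stops at \<open>t\<close>, the \<open>uv\<close>-measure of the part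
  of the level set is controlled at once by \<open>Lf\<close> and \<open>cz.F\<close> of the root,
  and no decomposition takes place.\<close>

lemma heavy_top:
  assumes "cz.stops t (hcube a0 l0)"
  shows "t * Y A0 \<le> A * average_const * X"
proof -
  have hv: "heavy t (hcube a0 l0)"
    unfolding heavy_def using assms l0 by (auto simp: cz.stops_def)
  let ?B = "cbox a0 (a0 + vec l0)" and ?Q = "hcube a0 l0"
  have B: "?B \<in> cubes" by (rule cbox_in_cubes[OF l0])
  have FQ: "0 < cz.F ?Q" using heavyE[OF hv t] by metis
  then have FQ': "0 < (LINT x:?Q|lebesgue. norm (f x) * v x)" by (simp add: cz.F_def)
  have L: "0 < Lf ?Q" by (rule Lf_pos[OF l0 order.refl FQ'])
  have lux: "luxemburg F ?B om u < ennreal (Lf ?Q)" unfolding om_eq by (rule Lf_lux[OF l0 order.refl FQ' B order.refl])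
  have "Y A0 \<le> A * avg v ?B * (average_const * Lf ?Q * measure lebesgue ?B)"
    unfolding Y_def using A0 hcube_subset_cbox[of a0 l0] by (intro uv_cube_le(2)[OF B L lux]) auto
  also have "\<dots> = A * average_const * Lf ?Q * cz.W ?Q"
    using l0 by (simp add: W_hcube Vq_def measure_cbox_cube mult_ac del: measure_completion)
  finally have "t * Y A0 \<le> A * average_const * Lf ?Q * (t * cz.W ?Q)" using t by (simp add: mult_left_mono mult_ac)
  also have "\<dots> \<le> A * average_const * Lf ?Q * cz.F ?Q"
    using assms A1 orlicz_consts_nonneg L unfolding cz.stops_def by (intro mult_left_mono) auto
  also have "\<dots> = A * average_const * (\<Sum>Q\<in>{?Q}. Lf Q * cz.F Q)" by simp
  also have "\<dots> \<le> A * average_const * X"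
    using A1 orlicz_consts_nonneg hv t by (intro mult_left_mono heavy_sum[of _ t]) auto
  finally show ?thesis .
qed

text \<open>Stopping cubes are kept as sets; a corner, and with \<open>lq\<close> a side, are chosen
  here because \<open>star\<close> takes them as arguments.\<close>

definition "bq Q = (SOME b. \<exists>h>0. Q = hcube b h)"
definition "lq Q = (SOME h. 0 < h \<and> Q = hcube (bq Q) h)"

lemma bq_lq:
  assumes "\<exists>b l. 0 < l \<and> Q = hcube b l"
  shows "0 < lq Q" "Q = hcube (bq Q) (lq Q)"
proof -
  have "\<exists>b. \<exists>h>0. Q = hcube b h" using assms by blast
  then have "\<exists>h>0. Q = hcube (bq Q) h" unfolding bq_def by (rule someI_ex)
  then have "0 < lq Q \<and> Q = hcube (bq Q) (lq Q)" unfolding lq_def by (rule someI_ex)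
  then show "0 < lq Q" "Q = hcube (bq Q) (lq Q)" by auto
qed

definition "Om = (\<Union>Q\<in>cz.S t. star (bq Q) (lq Q))"

lemma Om_sets: "Om \<in> sets lebesgue"
  unfolding Om_def using cz.S_countable by (intro sets.countable_UN') (auto simp: star_def)

text \<open>The \<open>uv\<close>-measure of a dilate is at most a multiple of
  \<open>Lf Q * cz.W Q\<close>, since \<open>Lf Q\<close> dominates the Luxemburg averages of
  \<open>u\<close> on all larger cubes and the means of \<open>v\<close> are doubling. The stopping
  criterion then trades \<open>t * cz.W Q\<close> for \<open>cz.F Q\<close>.\<close>

lemma Om_part: "t * Y (A0 \<inter> Om) \<le> star_const * X"
proof -
  have eq: "A0 \<inter> Om = (\<Union>Q\<in>cz.S t. A0 \<inter> star (bq Q) (lq Q))" by (auto simp: Om_def)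
  have "Y (A0 \<inter> Om) \<le> star_const * X / t"
    unfolding Y_def eq
  proof (rule set_integral_countable_Union_le[OF cz.S_countable])
    show "A0 \<inter> star (bq Q) (lq Q) \<in> sets lebesgue" for Q using A0(1) by (simp add: star_def)
    show "set_integrable lebesgue (\<Union>Q\<in>cz.S t. A0 \<inter> star (bq Q) (lq Q)) (\<lambda>x. u x * v x)"
      unfolding eq[symmetric] using A0 Om_sets by (intro uv_integrable) auto
    show "AE x in lebesgue. x \<in> (\<Union>Q\<in>cz.S t. A0 \<inter> star (bq Q) (lq Q)) \<longrightarrow> 0 \<le> u x * v x"
      using v_pos u0 by (auto elim!: eventually_mono)
    fix \<F> assume \<F>: "finite \<F>" "\<F> \<subseteq> cz.S t"
    have hv: "heavy t Q" if "Q \<in> \<F>" for Q using that \<F> by (intro S_heavy) auto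
    have "(\<Sum>Q\<in>\<F>. LINT x:A0 \<inter> star (bq Q) (lq Q)|lebesgue. u x * v x) \<le> (\<Sum>Q\<in>\<F>. star_const / t * (Lf Q * cz.F Q))"
    proof (rule sum_mono)
      fix Q assume Q: "Q \<in> \<F>"
      have bl: "0 < lq Q" "Q = hcube (bq Q) (lq Q)" using hv[OF Q] bq_lq by (auto simp: heavy_def)
      define b l where "b = bq Q" and "l = lq Q"
      have l: "0 < l" and Qe: "Q = hcube b l" using bl by (auto simp: b_def l_def)
      define B where "B = cbox (b - vec (rho * l)) ((b - vec (rho * l)) + vec (kap * l))"
      have kl: "0 < kap * l" using l kap_pos by simp
      have B: "B \<in> cubes" unfolding B_def by (rule cbox_in_cubes[OF kl])
      have mB: "measure lebesgue B = kap ^ CARD('n) * l ^ CARD('n)"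
        unfolding B_def using kl by (subst measure_cbox_cube) (auto simp: power_mult_distrib)
      have sB: "star b l \<subseteq> B" unfolding star_def B_def by (rule hcube_subset_cbox)
      let ?Qb = "cbox b (b + vec l)"
      have Qb: "?Qb \<in> cubes" by (rule cbox_in_cubes[OF l])
      have QB: "?Qb \<subseteq> B" using star_cube(1)[OF l] sB by blast
      have F0: "0 < cz.F Q" and W0: "0 < cz.W Q" and Q0: "Q \<subseteq> hcube a0 l0" using heavyE[OF hv[OF Q] t] by metis+
      have L: "0 < Lf Q" using Lf_pos[OF l] Q0 F0 by (simp add: Qe cz.F_def)
      have lux: "luxemburg F B om u < ennreal (Lf Q)"
        unfolding om_eq Qe by (rule Lf_lux[OF l _ _ B QB]) (use Q0 F0 in \<open>auto simp: Qe cz.F_def\<close>)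
      have "(LINT x:A0 \<inter> star b l|lebesgue. u x * v x) \<le> A * avg v B * (average_const * Lf Q * measure lebesgue B)"
        by (rule uv_cube_le(2)[OF B L lux]) (use A0 sB in \<open>auto simp: star_def\<close>)
      also have "avg v B \<le> dbl (kap ^ CARD('n)) * avg v ?Qb"
        by (rule V_doubling[OF Qb B QB _ kap_ge]) (use l mB in \<open>simp add: measure_cbox_cube del: measure_completion\<close>)
      also have "A * (dbl (kap ^ CARD('n)) * avg v ?Qb) * (average_const * Lf Q * measure lebesgue B) = star_const * Lf Q * cz.W Q"
        using l by (simp add: star_const_def mB Qe W_hcube Vq_def mult_ac del: measure_completion)
      also have "cz.W Q \<le> cz.F Q / t" using hv[OF Q] t by (simp add: heavy_def field_simps)
      finally show "(LINT x:A0 \<inter> star (bq Q) (lq Q)|lebesgue. u x * v x) \<le> star_const / t * (Lf Q * cz.F Q)"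
        using A1 orlicz_consts_nonneg L star_const_nonneg by (simp add: b_def l_def mult_left_mono mult_right_mono)
    qed
    also have "\<dots> = star_const / t * (\<Sum>Q\<in>\<F>. Lf Q * cz.F Q)" by (simp add: sum_distrib_left)
    also have "\<dots> \<le> star_const / t * X"
      using star_const_nonneg t \<F> hv pairwise_subset[OF cz.S_disjoint] by (intro mult_left_mono heavy_sum[of _ t]) auto
    finally show "(\<Sum>Q\<in>\<F>. LINT x:A0 \<inter> star (bq Q) (lq Q)|lebesgue. u x * v x) \<le> star_const * X / t" by simp
  qed
  then show ?thesis using t by (simp add: field_simps)
qed

end

subsection \<open>The bad part\<close>

context mixed_data
begin

definition "fv x = f x * complex_of_real (v x)"
definition "E = A0 - Om"
definition "test_fun x = (if x \<in> E then complex_of_real (u x) * cnj (sgn (T fv x)) else 0)"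
definition "V0 = Vq a0 l0"

lemma V0_pos: "0 < V0"
  unfolding V0_def by (rule Vq_pos[OF l0])

lemma E_sets: "E \<in> sets lebesgue" "E \<subseteq> hcube a0 l0"
  using A0 Om_sets by (auto simp: E_def)

lemma mult_v_L2:
  assumes [measurable]: "k \<in> borel_measurable lebesgue" and "0 \<le> C"
    and "AE x in lebesgue. x \<in> hcube a0 l0 \<longrightarrow> norm (k x) \<le> C" "\<And>x. x \<notin> hcube a0 l0 \<Longrightarrow> k x = 0"
  shows "(\<lambda>x. k x * complex_of_real (v x)) \<in> L2"
    and "AE x in lebesgue. norm (k x * complex_of_real (v x)) \<le> C * (A * V0)"
proof -
  have AE1: "AE x in lebesgue. norm (k x * complex_of_real (v x)) \<le> C * (A * V0) * indicator (hcube a0 l0) x"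
    using v_AE_hcube[OF l0, of a0] assms(3)
  proof eventually_elim
    case (elim x)
    show ?case
      using elim assms(2,4) by (cases "x \<in> hcube a0 l0") (auto simp: norm_mult V0_def intro!: mult_mono)
  qed
  have CA: "0 \<le> C * (A * V0)" using assms(2) A1 V0_pos by simp
  show "(\<lambda>x. k x * complex_of_real (v x)) \<in> L2"
    by (rule L2_boundedI(1)[OF _ hcube_lmeasurable CA AE1]) measurable
  show "AE x in lebesgue. norm (k x * complex_of_real (v x)) \<le> C * (A * V0)"
    using AE1
  proof eventually_elim
    case (elim x)
    then show ?case using CA by (cases "x \<in> hcube a0 l0") auto
  qed
qed

lemma fv_L2: "fv \<in> L2"
proof -
  have "0 \<le> Bf" using f_bound[of 0] norm_ge_zero[of "f 0"] by linarith
  then have "(\<lambda>x. f x * complex_of_real (v x)) \<in> L2"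
    by (rule mult_v_L2(1)[OF f_meas]) (use f_bound f_off in auto)
  then show ?thesis by (simp add: fv_def[abs_def])
qed

lemma E_nonzero:
  assumes "x \<in> E"
  shows "T fv x \<noteq> 0" "t * v x \<le> norm (T fv x)" "0 < v x"
proof -
  have x: "x \<in> A0" using assms by (simp add: E_def)
  have lev: "t * v x < norm (T fv x)" using A0_level[OF x] by (simp add: fv_def[abs_def])
  show "0 < v x" by (rule A0_v[OF x])
  then have "0 < t * v x" using t by simp
  then show "T fv x \<noteq> 0" "t * v x \<le> norm (T fv x)" using lev by auto
qed

lemma test_fun_norm: "norm (test_fun x) = u x * indicator E x"
  using E_nonzero(1)[of x] u0[of x] by (simp add: test_fun_def norm_mult norm_sgn)

lemma test_fun_measurable [measurable]: "test_fun \<in> borel_measurable lebesgue"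
proof -
  have Tm [measurable]: "T fv \<in> borel_measurable lebesgue" by (rule L2_measurable[OF T_L2[OF fv_L2]])
  have cm [measurable]: "cnj \<in> borel_measurable borel"
    by (intro borel_measurable_continuous_onI continuous_intros)
  have Em: "E \<inter> space lebesgue \<in> sets lebesgue" using E_sets by simp
  show ?thesis unfolding test_fun_def[abs_def]
    by (rule measurable_If_set[OF _ _ Em]) measurable
qed

lemma test_fun_bound: "norm (test_fun x) \<le> max 0 R0"
  using A0_u[of x] unfolding test_fun_norm by (auto simp: indicator_def E_def)

lemma test_fun_L2: "test_fun \<in> L2"
proof (rule L2_boundedI(1)[OF test_fun_measurable hcube_lmeasurable[of a0 l0], of "max 0 R0"])
  have "norm (test_fun x) \<le> max 0 R0 * indicator (hcube a0 l0) x" for x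
  proof (cases "x \<in> E")
    case True
    then have "x \<in> hcube a0 l0" using E_sets by blast
    then show ?thesis using test_fun_bound[of x] by simp
  next
    case False
    then show ?thesis by (simp add: test_fun_def)
  qed
  then show "AE x in lebesgue. norm (test_fun x) \<le> max 0 R0 * indicator (hcube a0 l0) x" by simp
qed simp

lemma pair_lower: "t * Y E \<le> norm (pair fv test_fun)"
proof -
  have TL: "T fv \<in> L2" by (rule T_L2[OF fv_L2])
  have int: "integrable lebesgue (\<lambda>x. T fv x * test_fun x)" by (rule L2_mult_integrable[OF TL test_fun_L2])
  have eq: "T fv x * test_fun x = complex_of_real (norm (T fv x) * (u x * indicator E x))" for x
    using mult_cnj_sgn[of "T fv x"] by (simp add: test_fun_def algebra_simps)
  have rint: "integrable lebesgue (\<lambda>x. norm (T fv x) * (u x * indicator E x))"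
    using int unfolding eq complex_of_real_integrable_eq .
  have "t * Y E = (LINT x|lebesgue. t * (indicator E x *\<^sub>R (u x * v x)))"
    by (simp add: Y_def set_lebesgue_integral_def)
  also have "\<dots> \<le> (LINT x|lebesgue. norm (T fv x) * (u x * indicator E x))"
  proof (rule integral_mono)
    show "integrable lebesgue (\<lambda>x. t * (indicator E x *\<^sub>R (u x * v x)))"
      using uv_integrable[OF E_sets] by (simp add: set_integrable_def)
    show "t * (indicator E x *\<^sub>R (u x * v x)) \<le> norm (T fv x) * (u x * indicator E x)" for x
      using E_nonzero(2)[of x] u0[of x] mult_right_mono[of "t * v x" "norm (T fv x)" "u x"]
      by (auto simp: indicator_def mult_ac)
  qed (rule rint)
  also have "\<dots> \<le> norm (pair fv test_fun)"
  proof -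
    have "pair fv test_fun = complex_of_real (LINT x|lebesgue. norm (T fv x) * (u x * indicator E x))"
      unfolding pair_def eq by (rule integral_complex_of_real)
    then show ?thesis by simp
  qed
  finally show ?thesis .
qed

lemma set_integral_indicator_mult:
  "(LINT x|lebesgue. indicator Q x * k x) = (LINT x:Q|lebesgue. k x :: complex)"
  unfolding set_lebesgue_integral_def by (rule Bochner_Integration.integral_cong) (auto simp: indicator_def)

lemma gv_set_integrable:
  assumes "\<not> cz.stops lam (hcube a0 l0)" "0 \<le> lam" "Q \<in> sets lebesgue" "Q \<subseteq> hcube a0 l0"
  shows "set_integrable lebesgue Q (\<lambda>x. cz.g lam x * complex_of_real (v x))"
proof (rule set_integrable_bounded_mult[OF cz.g_measurable])
  show "AE x in lebesgue. x \<in> Q \<longrightarrow> norm (cz.g lam x) \<le> dyadic_const * lam"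
    using cz.g_AE_bound[OF assms(1,2)] assms(4) by (auto elim!: eventually_mono)
qed (use cz.w_subset assms in auto)

lemma g_outside: "x \<notin> hcube a0 l0 \<Longrightarrow> cz.g lam x = 0"
proof -
  assume x: "x \<notin> hcube a0 l0"
  then have "x \<notin> \<Union> (cz.S lam)" using cz.S_subset by blast
  from cz.g_off_S[OF this] show ?thesis using f_off[OF x] by simp
qed

text \<open>On each stopping cube the bad function has mean zero and L1 norm at most a multiple of
  \<open>cz.F Q\<close>, while the test function vanishes on the dilate. So \<open>far_pair\<close>
  applies with \<open>mu = Lf Q\<close>, and the bounds \<open>Lf Q * cz.F Q\<close> sum to at most
  \<open>X\<close>.\<close>

lemma bad_part:
  assumes nt: "\<not> cz.stops t (hcube a0 l0)"
  shows "norm (pair (\<lambda>x. (f x - cz.g t x) * complex_of_real (v x)) test_fun) \<le> bad_const * X"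
proof -
  have Bf: "0 \<le> Bf" using f_bound[of 0] norm_ge_zero[of "f 0"] by linarith
  define k where "k x = f x - cz.g t x" for x
  have km [measurable]: "k \<in> borel_measurable lebesgue" unfolding k_def by measurable
  have kb: "AE x in lebesgue. x \<in> hcube a0 l0 \<longrightarrow> norm (k x) \<le> Bf + dyadic_const * t"
    using cz.g_AE_bound[OF nt less_imp_le[OF t]]
  proof eventually_elim
    case (elim x)
    show ?case using elim f_bound[of x] norm_triangle_ineq4[of "f x" "cz.g t x"] unfolding k_def by auto
  qed
  have k0: "k x = 0" if "x \<notin> hcube a0 l0" for x using that f_off[OF that] g_outside[OF that] by (simp add: k_def)
  have C0: "0 \<le> Bf + dyadic_const * t" using Bf dyadic_const_ge t by simp
  define b where "b x = k x * complex_of_real (v x)" for x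
  have bL: "b \<in> L2" and bb: "AE x in lebesgue. norm (b x) \<le> (Bf + dyadic_const * t) * (A * V0)"
    using mult_v_L2[OF km C0 kb k0] by (simp_all add: b_def[abs_def])
  have cc: "0 \<le> hc * (1 + modular_const * bcst)" using hc_pos orlicz_consts_nonneg bcst_pos by simp
  have "norm (pair b test_fun) \<le> bad_const * X"
  proof (rule pair_countable_Union_bound[OF cz.S_countable cz.S_disjoint cz.S_sets bL test_fun_L2,
        where \<beta>="\<lambda>Q. bad_const * (Lf Q * cz.F Q)"])
    show "b x = 0" if "x \<notin> \<Union> (cz.S t)" for x
      using cz.g_off_S[OF that] by (simp add: b_def k_def)
    fix Q assume Q: "Q \<in> cz.S t"
    have hv: "heavy t Q" by (rule S_heavy[OF Q])
    have bl: "0 < lq Q" "Q = hcube (bq Q) (lq Q)" using hv bq_lq by (auto simp: heavy_def)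
    define c l where "c = bq Q" and "l = lq Q"
    have l: "0 < l" and Qe: "Q = hcube c l" using bl by (auto simp: c_def l_def)
    have Q0: "Q \<subseteq> hcube a0 l0" "Q \<in> sets lebesgue" using cz.S_subset[OF Q] by (auto simp: Qe)
    have F0: "0 < cz.F Q" and W0: "0 < cz.W Q" using heavyE[OF hv t] by metis+
    have L: "0 < Lf Q" using Lf_pos[OF l] Q0 F0 by (simp add: Qe cz.F_def)
    define d where "d x = indicator Q x * b x" for x
    have dm: "d \<in> borel_measurable lebesgue" using L2_measurable[OF L2_restrict[OF bL Q0(2)]] by (simp add: d_def[abs_def])
    have d0: "(LINT x|lebesgue. d x) = 0"
    proof -
      have fi: "set_integrable lebesgue Q (\<lambda>x. f x * complex_of_real (v x))" by (rule cz.fw_integrable[OF Q0(2,1)])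
      have gi: "set_integrable lebesgue Q (\<lambda>x. cz.g t x * complex_of_real (v x))"
        by (rule gv_set_integrable[OF nt less_imp_le[OF t] Q0(2,1)])
      have "(LINT x|lebesgue. d x) = (LINT x:Q|lebesgue. f x * complex_of_real (v x) - cz.g t x * complex_of_real (v x))"
        unfolding d_def set_integral_indicator_mult by (simp add: b_def k_def left_diff_distrib)
      also have "\<dots> = 0"
        unfolding set_integral_diff(2)[OF fi gi] using cz.g_integral[OF order.refl Q nt less_imp_le[OF t]] by simp
      finally show ?thesis .
    qed
    have "norm (pair d test_fun) \<le> (LINT x|lebesgue. norm (d x)) * hc * (1 + modular_const * bcst) * Lf Q"
    proof (rule far_pair[OF l dm _ _ _ d0 test_fun_L2 _ L])
      show "0 \<le> (Bf + dyadic_const * t) * (A * V0)" using C0 A1 V0_pos by simp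
      then show "AE x in lebesgue. norm (d x) \<le> (Bf + dyadic_const * t) * (A * V0)"
        using bb by (auto elim!: eventually_mono simp: d_def indicator_def)
      show "d x = 0" if "x \<notin> hcube c l" for x using that by (simp add: d_def Qe)
      show "test_fun x = 0" if "norm (x - c) \<le> rho * l" for x
      proof -
        have "x \<in> star c l" by (rule star_cube(2)[OF l that])
        then have "x \<in> Om" using Q by (auto simp: Om_def c_def l_def)
        then show ?thesis by (simp add: test_fun_def E_def)
      qed
      show "0 \<le> modular_const * bcst" using orlicz_consts_nonneg bcst_pos by simp
      fix r assume r: "l \<le> r"
      show "(\<integral>\<^sup>+x\<in>ball c r. ennreal (complementary \<Phi> (norm (test_fun x) / Lf Q)) \<partial>lebesgue)
        \<le> ennreal (modular_const * bcst) * emeasure lebesgue (ball c r)"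
      proof (rule ball_modular[OF l _ _ r])
        show "0 \<le> modular_const" using orlicz_consts_nonneg by simp
        fix B :: "(real ^ 'n) set" assume B: "B \<in> cubes" "cbox c (c + vec l) \<subseteq> B"
        have lux: "luxemburg F B om u < ennreal (Lf Q)"
          unfolding om_eq Qe by (rule Lf_lux[OF l _ _ B]) (use Q0 F0 in \<open>auto simp: Qe cz.F_def\<close>)
        show "(\<integral>\<^sup>+x\<in>B. ennreal (complementary \<Phi> (norm (test_fun x) / Lf Q)) \<partial>lebesgue) \<le> ennreal (modular_const * measure lebesgue B)"
          by (rule orlicz_L[OF B(1) L lux]) (use u0 in \<open>simp add: test_fun_norm indicator_def\<close>)
      qed
    qed
    also have "(LINT x|lebesgue. norm (d x)) \<le> (1 + dyadic_const) * cz.F Q"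
    proof -
      have ni: "set_integrable lebesgue Q (\<lambda>x. norm (f x) * v x)" by (rule cz.nfw_integrable[OF Q0(2,1)])
      have vi: "set_integrable lebesgue Q (\<lambda>x. dyadic_const * t * v x)" using cz.w_subset[OF Q0(2,1)] by simp
      have "(LINT x|lebesgue. norm (d x)) \<le> (LINT x|lebesgue. indicator Q x *\<^sub>R (norm (f x) * v x + dyadic_const * t * v x))"
      proof (rule integral_mono_AE)
        show si: "integrable lebesgue (\<lambda>x. indicator Q x *\<^sub>R (norm (f x) * v x + dyadic_const * t * v x))"
          using set_integral_add(1)[OF ni vi] by (simp add: set_integrable_def)
        show ae: "AE x in lebesgue. norm (d x) \<le> indicator Q x *\<^sub>R (norm (f x) * v x + dyadic_const * t * v x)"
          using cz.g_AE_bound[OF nt less_imp_le[OF t]] v_pos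
        proof eventually_elim
          case (elim x)
          show ?case
          proof (cases "x \<in> Q")
            case True
            then have "norm (k x) \<le> norm (f x) + dyadic_const * t"
              using elim Q0 norm_triangle_ineq4[of "f x" "cz.g t x"] unfolding k_def by auto
            then have "norm (k x) * v x \<le> (norm (f x) + dyadic_const * t) * v x" using elim by (intro mult_right_mono) auto
            then show ?thesis using True elim by (simp add: d_def b_def norm_mult distrib_right)
          qed (simp add: d_def)
        qed
        show "integrable lebesgue (\<lambda>x. norm (d x))"
          by (rule Bochner_Integration.integrable_bound[OF si])
            (use dm ae in \<open>auto elim!: eventually_mono intro: order.trans[OF _ abs_ge_self]\<close>)
      qed
      also have "\<dots> = (LINT x:Q|lebesgue. norm (f x) * v x) + (LINT x:Q|lebesgue. dyadic_const * t * v x)"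
        unfolding set_lebesgue_integral_def[symmetric] by (rule set_integral_add(2)[OF ni vi])
      also have "\<dots> = cz.F Q + dyadic_const * (t * cz.W Q)" by (simp add: cz.F_def cz.W_def)
      also have "\<dots> \<le> cz.F Q + dyadic_const * cz.F Q"
        using hv dyadic_const_ge unfolding heavy_def by (intro add_left_mono mult_left_mono) auto
      finally show ?thesis by (simp add: algebra_simps)
    qed
    finally have "norm (pair d test_fun) \<le> (1 + dyadic_const) * cz.F Q * hc * (1 + modular_const * bcst) * Lf Q"
      using hc_pos orlicz_consts_nonneg bcst_pos L by (simp add: mult_right_mono)
    then show "norm (pair (\<lambda>x. indicator Q x * b x) test_fun) \<le> bad_const * (Lf Q * cz.F Q)"
      by (simp add: bad_const_def d_def[abs_def] mult_ac)
  next
    fix \<F> assume \<F>: "finite \<F>" "\<F> \<subseteq> cz.S t"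
    have "(\<Sum>Q\<in>\<F>. bad_const * (Lf Q * cz.F Q)) = bad_const * (\<Sum>Q\<in>\<F>. Lf Q * cz.F Q)" by (simp add: sum_distrib_left)
    also have "\<dots> \<le> bad_const * X"
      using \<F> S_heavy t cc dyadic_const_ge pairwise_subset[OF cz.S_disjoint \<F>(2)]
      by (intro mult_left_mono heavy_sum[of _ t]) (auto simp: bad_const_def mult.assoc)
    finally show "(\<Sum>Q\<in>\<F>. bad_const * (Lf Q * cz.F Q)) \<le> bad_const * X" .
  qed
  then show ?thesis by (simp add: b_def[abs_def] k_def)
qed

text \<open>Essentially, \<open>mf Q\<close> is the supremum of the means of \<open>G\<close> over
  all cubes that contain \<open>Q\<close>: one number valid for all of them, to which
  \<open>maximal_strong_type\<close> applies. \<open>G\<close> is a Borel version of the root of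
  \<open>uv\<close> on \<open>E\<close>.\<close>

lemma maximal_data:
  assumes YE: "0 < Y E"
  obtains G mf where "G \<in> borel_measurable lebesgue" "\<And>x. 0 \<le> G x"
    "AE x in lebesgue. G x = sqrt (u x * v x) * indicator E x" "\<And>Q. 0 < mf Q"
    "\<And>Q B. B \<in> cubes \<Longrightarrow> Q \<subseteq> B \<Longrightarrow> (\<integral>\<^sup>+x\<in>B. ennreal (G x) \<partial>lebesgue) \<le> ennreal (mf Q * measure lebesgue B)"
    "\<And>\<F>. finite \<F> \<Longrightarrow> disjoint \<F> \<Longrightarrow> (\<And>Q. Q \<in> \<F> \<Longrightarrow> (\<exists>b l. 0 < l \<and> Q = hcube b l) \<and> Q \<subseteq> hcube a0 l0) \<Longrightarrow>
      (\<Sum>Q\<in>\<F>. measure lebesgue Q * (mf Q)\<^sup>2) \<le> mean_const * Y E"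
proof -
  have Em [measurable]: "E \<in> sets lebesgue" by (rule E_sets)
  have "(\<lambda>x. sqrt (u x * v x) * indicator E x) \<in> borel_measurable lebesgue" by measurable
  from completion_ex_borel_measurable_real[OF this] obtain G1
    where G1: "G1 \<in> borel_measurable lborel" "AE x in lborel. sqrt (u x * v x) * indicator E x = G1 x" by blast
  define G where "G x = max 0 (G1 x)" for x
  have Gb [measurable]: "G \<in> borel_measurable borel" using G1(1) unfolding G_def by simp
  have Gl [measurable]: "G \<in> borel_measurable lebesgue" using Gb by (intro measurable_completion) simp
  have G0: "0 \<le> G x" for x by (simp add: G_def)
  have Ge: "AE x in lebesgue. G x = sqrt (u x * v x) * indicator E x"
    using AE_completion[OF G1(2)] v_pos
  proof eventually_elim
    case (elim x)
    have "0 \<le> sqrt (u x * v x)" using elim(2) u0[of x] by simp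
    then have "0 \<le> sqrt (u x * v x) * indicat_real E x" by (rule mult_nonneg_nonneg) simp
    then show ?case using elim by (simp add: G_def)
  qed
  have Gsq: "AE x in lebesgue. (G x)\<^sup>2 = indicator E x *\<^sub>R (u x * v x)"
    using Ge v_pos by eventually_elim (use u0 in \<open>auto simp: indicator_def\<close>)
  have iuv: "integrable lebesgue (\<lambda>x. indicator E x *\<^sub>R (u x * v x))"
    using uv_integrable[OF E_sets] by (simp add: set_integrable_def)
  have G2: "integrable lebesgue (\<lambda>x. (G x)\<^sup>2)" "(LINT x|lebesgue. (G x)\<^sup>2) = Y E"
  proof -
    have "integrable lebesgue (\<lambda>x. (G x)\<^sup>2) \<longleftrightarrow> integrable lebesgue (\<lambda>x. indicator E x *\<^sub>R (u x * v x))"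
      by (rule integrable_cong_AE[OF _ _ Gsq]) measurable
    then show "integrable lebesgue (\<lambda>x. (G x)\<^sup>2)" using iuv by simp
    show "(LINT x|lebesgue. (G x)\<^sup>2) = Y E"
      unfolding Y_def set_lebesgue_integral_def by (rule integral_cong_AE[OF _ _ Gsq]) measurable
  qed
  \<comment> \<open>As \<open>u\<close> is at most \<open>R0\<close> on \<open>A0\<close> and
    \<open>v\<close> is bounded on the root, \<open>G\<close> is bounded, so the suprema of its
    means are finite.\<close>
  define Gm where "Gm = sqrt (max 0 R0 * (A * V0))"
  have Gm: "0 \<le> Gm" using A1 V0_pos by (simp add: Gm_def)
  have Gle: "AE x in lebesgue. G x \<le> Gm * indicator (hcube a0 l0) x"
    using Ge v_AE_hcube[OF l0, of a0]
  proof eventually_elim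
    case (elim x)
    show ?case
    proof (cases "x \<in> E")
      case True
      then have "x \<in> hcube a0 l0" "u x \<le> max 0 R0" using E_sets A0_u[of x] by (auto simp: E_def)
      then have "u x * v x \<le> max 0 R0 * (A * V0)" using elim u0[of x] by (intro mult_mono) (auto simp: V0_def)
      then show ?thesis using elim True \<open>x \<in> hcube a0 l0\<close> by (simp add: Gm_def)
    qed (use elim Gm in \<open>auto simp: indicator_def\<close>)
  qed
  have Gint: "integrable lebesgue G"
  proof (rule Bochner_Integration.integrable_bound)
    show "integrable lebesgue (\<lambda>x. Gm * indicat_real (hcube a0 l0) x)"
      using hcube_lmeasurable[of a0 l0] by (intro integrable_mult_right) (simp add: lmeasurable_iff_integrable)
    show "AE x in lebesgue. norm (G x) \<le> norm (Gm * indicat_real (hcube a0 l0) x)"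
      using Gle by eventually_elim (use G0 in \<open>auto intro: order.trans[OF _ abs_ge_self]\<close>)
  qed measurable
  have Bint: "set_integrable lebesgue B G" if "B \<in> cubes" for B
    using integrable_mult_indicator[OF cube_sets[OF that] Gint] by (simp add: set_integrable_def)
  define av where "av B = (LINT x:B|lebesgue. G x) / measure lebesgue B" for B
  have av_le: "av B \<le> Gm" if B: "B \<in> cubes" for B
  proof -
    have "(LINT x:B|lebesgue. G x) \<le> (LINT x:B|lebesgue. Gm)"
    proof (rule set_integral_mono_AE[OF Bint[OF B]])
      show "set_integrable lebesgue B (\<lambda>x. Gm)"
        using cube_lmeasurable[OF B] by (simp add: set_integrable_def lmeasurable_iff_integrable)
      show "AE x\<in>B in lebesgue. G x \<le> Gm"
        using Gle
      proof eventually_elim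
        case (elim x)
        then show ?case using Gm by (cases "x \<in> hcube a0 l0") auto
      qed
    qed
    also have "\<dots> = Gm * measure lebesgue B"
      using cube_sets[OF B] by (simp add: set_lebesgue_integral_def)
    finally show ?thesis using cube_measure_pos[OF B] by (simp add: av_def divide_le_eq del: measure_completion)
  qed
  define m0 where "m0 Q = max 0 (Sup (av ` {B \<in> cubes. Q \<subseteq> B}))" for Q
  have m0_ge: "av B \<le> m0 Q" if "B \<in> cubes" "Q \<subseteq> B" for B Q
    unfolding m0_def using that av_le by (intro max.coboundedI2 cSup_upper) (auto intro!: bdd_aboveI2)
  \<comment> \<open>Added to make \<open>mf Q\<close> positive. The square of this constant, summed
    against the measures of disjoint cubes in the root, is at most \<open>Y E\<close>, so it costs
    no more than the maximal function does.\<close>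
  define \<epsilon> where "\<epsilon> = sqrt (Y E / l0 ^ CARD('n))"
  have eps: "0 < \<epsilon>" "\<epsilon>\<^sup>2 * l0 ^ CARD('n) = Y E" using YE l0 by (auto simp: \<epsilon>_def)
  define mf where "mf Q = m0 Q + \<epsilon>" for Q
  have mf0: "0 < mf Q" for Q using eps by (simp add: mf_def m0_def add_nonneg_pos)
  show ?thesis
  proof (rule that[OF Gl G0 Ge mf0])
    fix Q B :: "(real ^ 'n) set" assume B: "B \<in> cubes" "Q \<subseteq> B"
    have "(LINT x:B|lebesgue. G x) \<le> mf Q * measure lebesgue B"
      using m0_ge[OF B] cube_measure_pos[OF B(1)] eps(1)
      by (simp add: av_def divide_le_eq mf_def distrib_right add_increasing2 del: measure_completion)
    moreover have "(\<integral>\<^sup>+x\<in>B. ennreal (G x) \<partial>lebesgue) = ennreal (LINT x:B|lebesgue. G x)"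
    proof -
      have "(\<integral>\<^sup>+x\<in>B. ennreal (G x) \<partial>lebesgue) = (\<integral>\<^sup>+x. ennreal (indicator B x *\<^sub>R G x) \<partial>lebesgue)"
        by (intro nn_integral_cong) (simp add: indicator_def)
      also have "\<dots> = ennreal (LINT x:B|lebesgue. G x)"
        unfolding set_lebesgue_integral_def
        by (rule nn_integral_eq_integral) (use Bint[OF B(1)] G0 in \<open>auto simp: set_integrable_def\<close>)
      finally show ?thesis .
    qed
    ultimately show "(\<integral>\<^sup>+x\<in>B. ennreal (G x) \<partial>lebesgue) \<le> ennreal (mf Q * measure lebesgue B)"
      by (simp add: ennreal_leI)
  next
    fix \<F> :: "(real ^ 'n) set set"
    assume \<F>: "finite \<F>" "disjoint \<F>" "\<And>Q. Q \<in> \<F> \<Longrightarrow> (\<exists>b l. 0 < l \<and> Q = hcube b l) \<and> Q \<subseteq> hcube a0 l0"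
    have lm: "Q \<in> lmeasurable" if "Q \<in> \<F>" for Q using \<F>(3)[OF that] by auto
    have 1: "(\<Sum>Q\<in>\<F>. measure lebesgue Q * (m0 Q)\<^sup>2) \<le> 8 * max_const CARD('n) * (LINT x|lebesgue. (G x)\<^sup>2)"
    proof (rule maximal_strong_type[OF Gb G0 Gint G2(1) \<F>(1,2)])
      show "\<F> \<subseteq> lmeasurable" using lm by auto
      show "0 \<le> m0 Q" for Q by (simp add: m0_def)
      fix Q s assume Q: "Q \<in> \<F>" and s: "0 < s" "s < m0 Q"
      obtain b l where bl: "0 < l" "Q = hcube b l" using \<F>(3)[OF Q] by blast
      have ne: "av ` {B \<in> cubes. Q \<subseteq> B} \<noteq> {}"
        using cbox_in_cubes[OF bl(1), of b] hcube_subset_cbox[of b l] bl(2) by blast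
      have bd: "bdd_above (av ` {B \<in> cubes. Q \<subseteq> B})" using av_le by (auto intro!: bdd_aboveI2)
      have "s < Sup (av ` {B \<in> cubes. Q \<subseteq> B})" using s by (simp add: m0_def max_def split: if_splits)
      then obtain B where B: "B \<in> cubes" "Q \<subseteq> B" "s < av B" unfolding less_cSup_iff[OF ne bd] by blast
      then have "s * measure lebesgue B < (LINT x:B|lebesgue. G x)"
        using cube_measure_pos[OF B(1)] by (simp add: av_def pos_less_divide_eq del: measure_completion)
      then show "\<exists>B\<in>cubes. Q \<subseteq> B \<and> s * measure lebesgue B < (LINT x:B|lebesgue. G x)" using B by blast
    qed
    have 2: "(\<Sum>Q\<in>\<F>. measure lebesgue Q) \<le> l0 ^ CARD('n)"
    proof -
      have "(\<Sum>Q\<in>\<F>. measure lebesgue Q) = measure lebesgue (\<Union>\<F>)"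
        using \<F>(1,2) lm by (subst measure_Union'[symmetric]) (auto simp del: measure_completion simp: pairwise_def)
      also have "\<dots> \<le> measure lebesgue (hcube a0 l0)"
      proof (rule measure_mono_fmeasurable)
        show "\<Union>\<F> \<subseteq> hcube a0 l0" using \<F>(3) by blast
        show "\<Union>\<F> \<in> sets lebesgue" using \<F>(1) lm by (intro sets.finite_Union) (auto simp: fmeasurable_def)
      qed simp
      finally show ?thesis using l0 by (simp add: measure_hcube del: measure_completion)
    qed
    have "(\<Sum>Q\<in>\<F>. measure lebesgue Q * (mf Q)\<^sup>2) \<le> (\<Sum>Q\<in>\<F>. 2 * (measure lebesgue Q * (m0 Q)\<^sup>2) + 2 * \<epsilon>\<^sup>2 * measure lebesgue Q)"
    proof (rule sum_mono)
      fix Q assume "Q \<in> \<F>"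
      have "(mf Q)\<^sup>2 \<le> 2 * (m0 Q)\<^sup>2 + 2 * \<epsilon>\<^sup>2"
        using zero_le_power2[of "m0 Q - \<epsilon>"] unfolding mf_def by (simp add: power2_eq_square algebra_simps)
      from mult_left_mono[OF this, of "measure lebesgue Q"]
      show "measure lebesgue Q * (mf Q)\<^sup>2 \<le> 2 * (measure lebesgue Q * (m0 Q)\<^sup>2) + 2 * \<epsilon>\<^sup>2 * measure lebesgue Q"
        by (simp add: algebra_simps del: measure_completion)
    qed
    also have "\<dots> = 2 * (\<Sum>Q\<in>\<F>. measure lebesgue Q * (m0 Q)\<^sup>2) + 2 * \<epsilon>\<^sup>2 * (\<Sum>Q\<in>\<F>. measure lebesgue Q)"
      by (simp add: sum.distrib sum_distrib_left del: measure_completion)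
    also have "\<dots> \<le> 2 * (8 * max_const CARD('n) * Y E) + 2 * \<epsilon>\<^sup>2 * l0 ^ CARD('n)"
      using 1 2 unfolding G2(2) by (intro add_mono mult_left_mono) auto
    also have "\<dots> = mean_const * Y E" using eps(2) by (simp add: mean_const_def algebra_simps)
    finally show "(\<Sum>Q\<in>\<F>. measure lebesgue Q * (mf Q)\<^sup>2) \<le> mean_const * Y E" .
  qed
qed

end

subsection \<open>The good part\<close>

text \<open>\<open>mf Q\<close> stands for the infimum over \<open>Q\<close> of the maximal function of \<open>G\<close>.\<close>

locale mixed_level = mixed_data T Bt \<Phi> K c0 CK v \<beta> A F u a D3 Cu D8 s cs a0 l0 f Bf t X R0 Lf A0
  for T :: "(real ^ 'n \<Rightarrow> complex) \<Rightarrow> real ^ 'n \<Rightarrow> complex" and Bt \<Phi> and K :: "real ^ 'n \<Rightarrow> complex" and c0 CK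
    and v :: "real ^ 'n \<Rightarrow> real" and \<beta> A F and u :: "real ^ 'n \<Rightarrow> real" and a D3 Cu D8 s cs
    and a0 :: "real ^ 'n" and l0 and f :: "real ^ 'n \<Rightarrow> complex" and Bf t X R0 Lf A0 +
  fixes G :: "real ^ 'n \<Rightarrow> real" and mf :: "(real ^ 'n) set \<Rightarrow> real"
  assumes G_meas: "G \<in> borel_measurable lebesgue" and G_nonneg: "\<And>x. 0 \<le> G x"
    and G_eq: "AE x in lebesgue. G x = sqrt (u x * v x) * indicator E x" and mf_pos: "\<And>Q. 0 < mf Q"
    and mf_cube: "\<And>Q B. B \<in> cubes \<Longrightarrow> Q \<subseteq> B \<Longrightarrow> (\<integral>\<^sup>+x\<in>B. ennreal (G x) \<partial>lebesgue) \<le> ennreal (mf Q * measure lebesgue B)"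
    and mf_sum: "\<And>\<F>. finite \<F> \<Longrightarrow> disjoint \<F> \<Longrightarrow> (\<And>Q. Q \<in> \<F> \<Longrightarrow> (\<exists>b l. 0 < l \<and> Q = hcube b l) \<and> Q \<subseteq> hcube a0 l0) \<Longrightarrow>
      (\<Sum>Q\<in>\<F>. measure lebesgue Q * (mf Q)\<^sup>2) \<le> mean_const * Y E"
begin

text \<open>Up to constants the bound of \<open>atom_pair\<close> for a function of the size of the
  mean of \<open>v\<close> on \<open>Q\<close>; the first two factors together are
  \<open>cz.W Q\<close>.\<close>

definition "atom_size Q = Vq (bq Q) (lq Q) * lq Q ^ CARD('n) * mscale (mf Q) (Lf Q) (Vq (bq Q) (lq Q))"
lemma heavy_hcube:
  assumes "heavy lam Q" "0 < lam"
  shows "0 < lq Q" "hcube (bq Q) (lq Q) = Q" "Q \<subseteq> hcube a0 l0" "0 < Lf Q" "0 < cz.F Q" "lam * cz.W Q < cz.F Q"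
proof -
  have e: "\<exists>b l. 0 < l \<and> Q = hcube b l" using assms unfolding heavy_def by blast
  show "0 < lq Q" by (rule bq_lq(1)[OF e])
  show "hcube (bq Q) (lq Q) = Q" by (rule bq_lq(2)[OF e, symmetric])
  show "Q \<subseteq> hcube a0 l0" "lam * cz.W Q < cz.F Q" using assms by (auto simp: heavy_def)
  show "0 < Lf Q" "0 < cz.F Q" using heavyE[OF assms] by metis+
qed

text \<open>With \<open>1 / a = 2 * \<theta>\<close> the powers regroup into
  \<open>(cz.W Q * Lf Q) powr (1 - \<theta>)\<close> times the power \<theta> of
  \<open>measure lebesgue Q * (mf Q)^2\<close>. After \<open>weighted_mean_le\<close> separates them
  and the criterion replaces \<open>lam * cz.W Q\<close> by \<open>cz.F Q\<close>, both terms have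
  bounded sums over disjoint cubes.\<close>

lemma atom_size_le:
  assumes hv: "heavy lam Q" "0 < lam" and sg: "0 < sg"
  shows "lam * atom_size Q \<le> sg powr (- vth) * (Lf Q * cz.F Q) + lam * sg * (measure lebesgue Q * (mf Q)\<^sup>2)"
proof -
  note Q = heavy_hcube[OF hv]
  define V l m L where "V = Vq (bq Q) (lq Q)" and "l = lq Q ^ CARD('n)" and "m = mf Q" and "L = Lf Q"
  have pos: "0 < V" "0 < l" "0 < m" "0 < L"
    using Q Vq_pos[OF Q(1)] mf_pos by (auto simp: V_def l_def m_def L_def)
  have mQ: "measure lebesgue Q = l"
    using measure_hcube[of "lq Q" "bq Q"] Q(1) unfolding Q(2) l_def by simp
  have WQ: "cz.W Q = V * l" using W_hcube[OF Q(1), of "bq Q"] unfolding Q(2) V_def l_def .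
  have a\<theta>: "1 / a = 2 * \<theta>" by (simp add: \<theta>_def)
  have "atom_size Q = V * l * (m powr (2 * \<theta>) * L powr (1 - \<theta>) * V powr (- \<theta>))"
    by (simp add: atom_size_def mscale_def a\<theta> V_def l_def m_def L_def)
  also have "m powr (2 * \<theta>) = (m\<^sup>2) powr \<theta>"
  proof -
    have "m\<^sup>2 = m powr 2" using pos(3) by simp
    then show ?thesis by (simp only: powr_powr)
  qed
  also have "V * l * ((m\<^sup>2) powr \<theta> * L powr (1 - \<theta>) * V powr (- \<theta>)) = (V * l * L) powr (1 - \<theta>) * (l * m\<^sup>2) powr \<theta>"
  proof -
    have h1: "l powr (1 - \<theta>) * l powr \<theta> = l" using pos by (simp add: powr_add[symmetric])
    have h2: "V * V powr (- \<theta>) = V powr (1 - \<theta>)" using pos by (simp add: powr_diff powr_minus field_simps)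
    have e1: "(V * l * L) powr (1 - \<theta>) = V powr (1 - \<theta>) * l powr (1 - \<theta>) * L powr (1 - \<theta>)"
      using pos by (simp add: powr_mult)
    have e2: "(l * m\<^sup>2) powr \<theta> = l powr \<theta> * (m\<^sup>2) powr \<theta>" using pos by (simp add: powr_mult)
    have "V * l * ((m\<^sup>2) powr \<theta> * L powr (1 - \<theta>) * V powr (- \<theta>)) = (V * V powr (- \<theta>)) * l * L powr (1 - \<theta>) * (m\<^sup>2) powr \<theta>"
      by (simp only: mult_ac)
    also have "\<dots> = V powr (1 - \<theta>) * (l powr (1 - \<theta>) * l powr \<theta>) * L powr (1 - \<theta>) * (m\<^sup>2) powr \<theta>"
      by (simp only: h1 h2)
    also have "\<dots> = (V * l * L) powr (1 - \<theta>) * (l * m\<^sup>2) powr \<theta>" unfolding e1 e2 by (simp only: mult_ac)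
    finally show ?thesis .
  qed
  also have "\<dots> \<le> sg powr (- \<theta> / (1 - \<theta>)) * (V * l * L) + sg * (l * m\<^sup>2)"
    using pos \<theta> sg by (intro weighted_mean_le) auto
  finally have "lam * atom_size Q \<le> lam * (sg powr (- vth) * (V * l * L) + sg * (l * m\<^sup>2))"
    using hv(2) by (simp add: vth_def mult_left_mono)
  also have "\<dots> = sg powr (- vth) * (L * (lam * cz.W Q)) + lam * sg * (l * m\<^sup>2)"
    by (simp add: WQ algebra_simps)
  also have "\<dots> \<le> sg powr (- vth) * (L * cz.F Q) + lam * sg * (l * m\<^sup>2)"
    using Q(6) pos by (intro add_right_mono mult_left_mono) auto
  finally show ?thesis by (simp add: mQ m_def L_def)
qed

lemma level_sum:
  assumes "finite \<F>" "disjoint \<F>" "\<And>Q. Q \<in> \<F> \<Longrightarrow> heavy lam Q" "0 < lam" "0 < sg"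
  shows "(\<Sum>Q\<in>\<F>. lam * atom_size Q) \<le> sg powr (- vth) * X + lam * sg * (mean_const * Y E)"
proof -
  have "(\<Sum>Q\<in>\<F>. lam * atom_size Q) \<le> (\<Sum>Q\<in>\<F>. sg powr (- vth) * (Lf Q * cz.F Q) + lam * sg * (measure lebesgue Q * (mf Q)\<^sup>2))"
    using assms(3-5) by (intro sum_mono atom_size_le)
  also have "\<dots> = sg powr (- vth) * (\<Sum>Q\<in>\<F>. Lf Q * cz.F Q) + lam * sg * (\<Sum>Q\<in>\<F>. measure lebesgue Q * (mf Q)\<^sup>2)"
    by (simp add: sum.distrib sum_distrib_left del: measure_completion)
  also have "\<dots> \<le> sg powr (- vth) * X + lam * sg * (mean_const * Y E)"
  proof (intro add_mono mult_left_mono)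
    show "(\<Sum>Q\<in>\<F>. Lf Q * cz.F Q) \<le> X" by (rule heavy_sum[OF assms(1-4)])
    show "(\<Sum>Q\<in>\<F>. measure lebesgue Q * (mf Q)\<^sup>2) \<le> mean_const * Y E"
      using assms(3) by (intro mf_sum assms(1,2)) (auto simp: heavy_def)
  qed (use assms in auto)
  finally show ?thesis .
qed

lemma heavy_atom:
  assumes hv: "heavy lam Q" "0 < lam" and d: "d \<in> borel_measurable lebesgue"
    and db: "AE x in lebesgue. norm (d x) \<le> 3 * dyadic_const * lam * (A * Vq (bq Q) (lq Q))"
    and off: "\<And>x. x \<notin> Q \<Longrightarrow> d x = 0" and zero: "(LINT x|lebesgue. d x) = 0 \<or> Q = hcube a0 l0"
  shows "norm (pair d test_fun) \<le> level_const * (lam * atom_size Q)"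
proof -
  note Q = heavy_hcube[OF hv]
  define b l where "b = bq Q" and "l = lq Q"
  have l: "0 < l" and Qe: "Q = hcube b l" unfolding b_def l_def Q(2) by (rule Q(1), rule refl)
  have Bd: "0 \<le> 3 * dyadic_const * lam * (A * Vq b l)" using dyadic_const_ge hv(2) A1 Vq_pos[OF l, of b] by simp
  have "norm (pair d test_fun) \<le> atom_const * (3 * dyadic_const * lam * (A * Vq b l)) * l ^ CARD('n) * mscale (mf Q) (Lf Q) (avg v (cbox b (b + vec l)))"
  proof (rule atom_pair[OF l Q(4) _ mf_pos _ G_meas G_nonneg G_eq test_fun_L2 test_fun_norm test_fun_bound d Bd])
    show "AE x in lebesgue. norm (d x) \<le> 3 * dyadic_const * lam * (A * Vq b l)" using db by (simp add: b_def l_def)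
    show "d x = 0" if "x \<notin> hcube b l" for x using off that by (simp add: Qe)
    fix B :: "(real ^ 'n) set" assume B: "B \<in> cubes" "cbox b (b + vec l) \<subseteq> B"
    show "luxemburg F B om u < ennreal (Lf Q)"
      unfolding om_eq Qe by (rule Lf_lux[OF l _ _ B]) (use Q(3,5) in \<open>auto simp: Qe cz.F_def\<close>)
    show "(\<integral>\<^sup>+x\<in>B. ennreal (G x) \<partial>lebesgue) \<le> ennreal (mf Q * measure lebesgue B)"
      using B hcube_subset_cbox[of b l] by (intro mf_cube) (auto simp: Qe)
  next
    show "(LINT x|lebesgue. d x) = 0 \<or> (\<forall>x. x \<notin> star b l \<longrightarrow> test_fun x = 0)"
    proof (cases "Q = hcube a0 l0")
      case True
      have "test_fun x = 0" if "x \<notin> star b l" for x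
      proof -
        have "x \<notin> Q" using that star_cube(1)[OF l, of b] hcube_subset_cbox[of b l] by (auto simp: Qe)
        then show ?thesis using E_sets True by (auto simp: test_fun_def)
      qed
      then show ?thesis by blast
    qed (use zero in auto)
  qed
  also have "\<dots> = level_const * (lam * atom_size Q)"
    by (simp add: level_const_def atom_size_def b_def l_def Vq_def mult_ac)
  finally show ?thesis .
qed

lemma stops_antimono: "lam \<le> mu \<Longrightarrow> \<not> cz.stops lam (hcube a0 l0) \<Longrightarrow> \<not> cz.stops mu (hcube a0 l0)"
  using cz.stops_mono[of "hcube a0 l0" lam mu] by auto

lemma gv_L2:
  assumes "\<not> cz.stops lam (hcube a0 l0)" "0 < lam"
  shows "(\<lambda>x. cz.g lam x * complex_of_real (v x)) \<in> L2"
  by (rule mult_v_L2(1)[OF cz.g_measurable, of "dyadic_const * lam"])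
    (use cz.g_AE_bound[OF assms(1)] g_outside dyadic_const_ge assms(2) in auto)

text \<open>Outside the cubes of the lower height \<open>lam\<close> both good parts equal
  \<open>f\<close>, and on each of these cubes both have the same integral against \<open>v\<close>
  as \<open>f\<close>. The difference is thus a sum of atoms on the cubes of
  \<open>cz.S lam\<close>.\<close>

lemma good_step:
  assumes lam: "0 < lam" "lam \<le> lam'" "lam' \<le> 2 * lam" and ns: "\<not> cz.stops lam (hcube a0 l0)" and sg: "0 < sg"
  shows "norm (pair (\<lambda>x. (cz.g lam' x - cz.g lam x) * complex_of_real (v x)) test_fun)
    \<le> level_const * (sg powr (- vth) * X + lam * sg * (mean_const * Y E))"
proof -
  have lam': "0 < lam'" using lam by simp
  have ns': "\<not> cz.stops lam' (hcube a0 l0)" by (rule stops_antimono[OF lam(2) ns])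
  define e where "e x = (cz.g lam' x - cz.g lam x) * complex_of_real (v x)" for x
  have eL: "e \<in> L2"
    using L2_diff[OF gv_L2[OF ns' lam'] gv_L2[OF ns lam(1)]] by (simp add: e_def[abs_def] left_diff_distrib)
  have gb: "AE x in lebesgue. x \<in> hcube a0 l0 \<longrightarrow> norm (cz.g lam' x - cz.g lam x) \<le> 3 * dyadic_const * lam"
    using cz.g_AE_bound[OF ns less_imp_le[OF lam(1)]] cz.g_AE_bound[OF ns' less_imp_le[OF lam']]
  proof eventually_elim
    case (elim x)
    have "dyadic_const * lam' \<le> dyadic_const * (2 * lam)" using lam dyadic_const_ge by (intro mult_left_mono) auto
    then show ?case using elim norm_triangle_ineq4[of "cz.g lam' x" "cz.g lam x"] by auto
  qed
  have "norm (pair e test_fun) \<le> level_const * (sg powr (- vth) * X + lam * sg * (mean_const * Y E))"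
  proof (rule pair_countable_Union_bound[where S="cz.S lam" and \<beta>="\<lambda>Q. level_const * (lam * atom_size Q)",
        OF cz.S_countable cz.S_disjoint cz.S_sets eL test_fun_L2])
    show "e x = 0" if x: "x \<notin> \<Union> (cz.S lam)" for x
    proof -
      have "x \<notin> \<Union> (cz.S lam')" using x cz.Union_S_mono[OF lam(2)] by blast
      from cz.g_off_S[OF this] cz.g_off_S[OF x] show ?thesis by (simp add: e_def)
    qed
    fix Q assume Q: "Q \<in> cz.S lam"
    have hv: "heavy lam Q" by (rule S_heavy[OF Q])
    note H = heavy_hcube[OF hv lam(1)]
    have Qs: "Q \<in> sets lebesgue" using Q cz.S_sets by auto
    show "norm (pair (\<lambda>x. indicator Q x * e x) test_fun) \<le> level_const * (lam * atom_size Q)"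
    proof (rule heavy_atom[OF hv lam(1)])
      show "(\<lambda>x. indicator Q x * e x) \<in> borel_measurable lebesgue" by (rule L2_measurable[OF L2_restrict[OF eL Qs]])
      have "AE x in lebesgue. x \<in> Q \<longrightarrow> 0 < v x \<and> v x \<le> A * Vq (bq Q) (lq Q)"
        using v_AE_hcube[OF H(1), of "bq Q"] unfolding H(2) .
      then show "AE x in lebesgue. norm (indicator Q x * e x) \<le> 3 * dyadic_const * lam * (A * Vq (bq Q) (lq Q))"
        using gb
      proof eventually_elim
        case (elim x)
        show ?case
        proof (cases "x \<in> Q")
          case True
          then show ?thesis using elim H(3) dyadic_const_ge lam
            by (auto simp: e_def norm_mult intro!: mult_mono)
        next
          case False
          then show ?thesis using dyadic_const_ge lam A1 Vq_pos[OF H(1), of "bq Q"] by simp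
        qed
      qed
      have gi: "set_integrable lebesgue Q (\<lambda>x. cz.g lam x * complex_of_real (v x))"
        by (rule gv_set_integrable[OF ns less_imp_le[OF lam(1)] Qs H(3)])
      have gi': "set_integrable lebesgue Q (\<lambda>x. cz.g lam' x * complex_of_real (v x))"
        by (rule gv_set_integrable[OF ns' less_imp_le[OF lam'] Qs H(3)])
      have "(LINT x|lebesgue. indicator Q x * e x) = (LINT x:Q|lebesgue. cz.g lam' x * complex_of_real (v x) - cz.g lam x * complex_of_real (v x))"
        unfolding set_integral_indicator_mult by (simp add: e_def left_diff_distrib)
      also have "\<dots> = 0"
        unfolding set_integral_diff(2)[OF gi' gi]
        using cz.g_integral[OF order.refl Q ns less_imp_le[OF lam(1)]] cz.g_integral[OF lam(2) Q ns' less_imp_le[OF lam']] by simp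
      finally show "(LINT x|lebesgue. indicator Q x * e x) = 0 \<or> Q = hcube a0 l0" ..
    qed simp
  next
    fix \<F> assume \<F>: "finite \<F>" "\<F> \<subseteq> cz.S lam"
    have "(\<Sum>Q\<in>\<F>. level_const * (lam * atom_size Q)) = level_const * (\<Sum>Q\<in>\<F>. lam * atom_size Q)" by (simp add: sum_distrib_left)
    also have "\<dots> \<le> level_const * (sg powr (- vth) * X + lam * sg * (mean_const * Y E))"
      using \<F> S_heavy lam(1) sg pairwise_subset[OF cz.S_disjoint \<F>(2)]
      by (intro mult_left_mono level_const_nonneg level_sum) auto
    finally show "(\<Sum>Q\<in>\<F>. level_const * (lam * atom_size Q)) \<le> level_const * (sg powr (- vth) * X + lam * sg * (mean_const * Y E))" .
  qed
  then show ?thesis by (simp add: e_def[abs_def])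
qed

text \<open>The last good part has no partner below it, since the root stops at \<open>lam\<close>.
  It is a single function on the root without mean zero, which does no harm because the test
  function lives inside the root and so inside its dilate.\<close>

lemma good_last:
  assumes lam: "0 < lam" and ns: "\<not> cz.stops (2 * lam) (hcube a0 l0)" and st: "cz.stops lam (hcube a0 l0)" and sg: "0 < sg"
  shows "norm (pair (\<lambda>x. cz.g (2 * lam) x * complex_of_real (v x)) test_fun)
    \<le> level_const * (sg powr (- vth) * X + lam * sg * (mean_const * Y E))"
proof -
  let ?Q = "hcube a0 l0"
  have hv: "heavy lam ?Q" unfolding heavy_def using st l0 by (auto simp: cz.stops_def)
  note H = heavy_hcube[OF hv lam]
  have l2: "0 \<le> 2 * lam" using lam by simp
  have gL: "(\<lambda>x. cz.g (2 * lam) x * complex_of_real (v x)) \<in> L2" using lam by (intro gv_L2[OF ns]) simp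
  have vb: "AE x in lebesgue. x \<in> ?Q \<longrightarrow> 0 < v x \<and> v x \<le> A * Vq (bq ?Q) (lq ?Q)"
    using v_AE_hcube[OF H(1), of "bq ?Q"] unfolding H(2) .
  have "norm (pair (\<lambda>x. cz.g (2 * lam) x * complex_of_real (v x)) test_fun) \<le> level_const * (lam * atom_size ?Q)"
  proof (rule heavy_atom[OF hv lam])
    show "AE x in lebesgue. norm (cz.g (2 * lam) x * complex_of_real (v x)) \<le> 3 * dyadic_const * lam * (A * Vq (bq ?Q) (lq ?Q))"
      using vb cz.g_AE_bound[OF ns l2]
    proof eventually_elim
      case (elim x)
      have D: "dyadic_const * (2 * lam) \<le> 3 * dyadic_const * lam" using dyadic_const_ge lam by simp
      show ?case
      proof (cases "x \<in> ?Q")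
        case True
        then have "norm (cz.g (2 * lam) x) \<le> dyadic_const * (2 * lam)" using elim by blast
        then have "norm (cz.g (2 * lam) x) \<le> 3 * dyadic_const * lam" using D by (rule order.trans)
        then show ?thesis using elim True dyadic_const_ge lam by (auto simp: norm_mult intro!: mult_mono)
      next
        case False
        then show ?thesis using g_outside[OF False] dyadic_const_ge lam A1 Vq_pos[OF H(1), of "bq ?Q"] by simp
      qed
    qed
  qed (use L2_measurable[OF gL] g_outside in auto)
  also have "lam * atom_size ?Q \<le> sg powr (- vth) * X + lam * sg * (mean_const * Y E)"
    using level_sum[of "{?Q}" lam sg] hv lam sg by simp
  finally show ?thesis using level_const_nonneg by (simp add: mult_left_mono)
qed

text \<open>The right side of \<open>good_step\<close> at \<open>lam = t / 2 ^ i\<close> and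
  \<open>sg = \<eta> * sqrt 2 ^ i\<close>.\<close>

definition "level_bound i = level_const * ((\<eta> * sqrt 2 ^ i) powr (- vth) * X + t / 2 ^ i * (\<eta> * sqrt 2 ^ i) * (mean_const * Y E))"

lemma level_bound_eq: "level_bound i = level_const * \<eta> powr (- vth) * X * q1 ^ i + level_const * t * \<eta> * (mean_const * Y E) * q2 ^ i"
proof -
  have 1: "(\<eta> * sqrt 2 ^ i) powr (- vth) = \<eta> powr (- vth) * q1 ^ i"
  proof -
    have "(sqrt 2 ^ i) powr (- vth) = q1 ^ i" unfolding q1_def by (induction i) (simp_all add: powr_mult)
    then show ?thesis using \<eta>_pos by (simp add: powr_mult)
  qed
  have 2: "sqrt 2 ^ i / 2 ^ i = q2 ^ i"
  proof -
    have "sqrt 2 / 2 = q2" by (simp add: q2_def field_simps)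
    moreover have "sqrt 2 ^ i / 2 ^ i = (sqrt 2 / 2) ^ i" by (simp only: power_divide)
    ultimately show ?thesis by (simp only:)
  qed
  have "level_bound i = level_const * \<eta> powr (- vth) * X * q1 ^ i + level_const * t * \<eta> * (mean_const * Y E) * (sqrt 2 ^ i / 2 ^ i)"
    unfolding level_bound_def 1 by (simp add: algebra_simps)
  then show ?thesis unfolding 2 .
qed

lemma level_bound_sum: "(\<Sum>i<j. level_bound i) \<le> good_const * X + t * Y E / 2"
proof -
  have gs: "(\<Sum>i<j. q ^ i) \<le> 1 / (1 - q)" if "0 < q" "q < 1" for q :: real
    using that by (simp add: sum_gp_strict divide_right_mono)
  have "(\<Sum>i<j. level_bound i) = level_const * \<eta> powr (- vth) * X * (\<Sum>i<j. q1 ^ i) + level_const * t * \<eta> * (mean_const * Y E) * (\<Sum>i<j. q2 ^ i)"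
    by (simp add: level_bound_eq sum.distrib sum_distrib_left)
  also have "\<dots> \<le> level_const * \<eta> powr (- vth) * X * (1 / (1 - q1)) + level_const * t * \<eta> * (mean_const * Y E) * (1 / (1 - q2))"
    using level_const_nonneg X t \<eta>_pos mean_const_pos Y_nonneg gs[OF q12(1,2)] gs[OF q12(3,4)]
    by (intro add_mono mult_left_mono mult_nonneg_nonneg) auto
  also have "level_const * t * \<eta> * (mean_const * Y E) * (1 / (1 - q2)) = (level_const / (level_const + 1)) * (t * Y E / 2)"
  proof -
    have "\<eta> * mean_const / (1 - q2) = 1 / (2 * (level_const + 1))" using q12 mean_const_pos by (simp add: \<eta>_def)
    moreover have "level_const * t * \<eta> * (mean_const * Y E) * (1 / (1 - q2)) = level_const * t * Y E * (\<eta> * mean_const / (1 - q2))" by simp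
    ultimately have "level_const * t * \<eta> * (mean_const * Y E) * (1 / (1 - q2)) = level_const * t * Y E * (1 / (2 * (level_const + 1)))" by (simp only:)
    also have "\<dots> = (level_const / (level_const + 1)) * (t * Y E / 2)" using level_const_nonneg by (simp add: divide_simps)
    finally show ?thesis .
  qed
  also have "\<dots> \<le> 1 * (t * Y E / 2)"
    using level_const_nonneg t Y_nonneg[of E] by (intro mult_right_mono) (auto simp: divide_simps)
  finally show ?thesis by (simp add: good_const_def)
qed

lemma good_part:
  assumes ns: "\<not> cz.stops t (hcube a0 l0)" and FQ: "0 < cz.F (hcube a0 l0)"
  shows "norm (pair (\<lambda>x. cz.g t x * complex_of_real (v x)) test_fun) \<le> good_const * X + t * Y E / 2"
proof -
  define lam where "lam i = t / 2 ^ i" for i :: nat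
  have lam0: "0 < lam i" for i using t by (simp add: lam_def)
  have lamS: "lam i = 2 * lam (Suc i)" for i by (simp add: lam_def)
  \<comment> \<open>The heights tend to 0 while \<open>cz.F\<close> of the root is positive, so the
    root stops eventually and the telescoping sum is finite.\<close>
  have "\<exists>k. cz.stops (lam k) (hcube a0 l0)"
  proof -
    have "0 \<le> cz.W (hcube a0 l0)" by (rule cz.W_nonneg) simp
    obtain k :: nat where k: "t * (cz.W (hcube a0 l0) + 1) / cz.F (hcube a0 l0) < 2 ^ k"
      using real_arch_pow[of 2] by auto
    then have "t * (cz.W (hcube a0 l0) + 1) < 2 ^ k * cz.F (hcube a0 l0)" using FQ by (simp add: field_simps)
    then have "lam k * (cz.W (hcube a0 l0) + 1) < cz.F (hcube a0 l0)" by (simp add: lam_def field_simps)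
    then have "lam k * cz.W (hcube a0 l0) < cz.F (hcube a0 l0)" using lam0[of k] by (simp add: distrib_left)
    then show ?thesis by (auto simp: cz.stops_def)
  qed
  then obtain k where k: "cz.stops (lam k) (hcube a0 l0)" "\<And>j. j < k \<Longrightarrow> \<not> cz.stops (lam j) (hcube a0 l0)"
    using exists_least_iff[of "\<lambda>k. cz.stops (lam k) (hcube a0 l0)"] by blast
  have "k \<noteq> 0"
  proof
    assume "k = 0"
    then show False using k(1) ns by (simp add: lam_def)
  qed
  then obtain n where n: "k = Suc n" using not0_implies_Suc by blast
  have nsi: "\<not> cz.stops (lam i) (hcube a0 l0)" if "i \<le> n" for i using k(2)[of i] that n by simp
  define gv where "gv i x = cz.g (lam i) x * complex_of_real (v x)" for i x
  have gL: "gv i \<in> L2" if "i \<le> n" for i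
    unfolding gv_def by (rule gv_L2[OF nsi[OF that] lam0])
  have sg: "0 < \<eta> * sqrt 2 ^ i" for i using \<eta>_pos by simp
  \<comment> \<open>The step from \<open>j\<close> to \<open>Suc j\<close> is charged to the lower
    of its two heights, hence the shifted index.\<close>
  have tel: "j \<le> n \<Longrightarrow> norm (pair (gv 0) test_fun) \<le> norm (pair (gv j) test_fun) + (\<Sum>i<j. level_bound (Suc i))" for j
  proof (induction j)
    case (Suc j)
    have "pair (gv j) test_fun = pair (\<lambda>x. gv (Suc j) x + (gv j x - gv (Suc j) x)) test_fun" by simp
    also have "\<dots> = pair (gv (Suc j)) test_fun + pair (\<lambda>x. gv j x - gv (Suc j) x) test_fun"
      using Suc.prems by (intro pair_add L2_diff gL test_fun_L2) auto
    finally have "norm (pair (gv j) test_fun) \<le> norm (pair (gv (Suc j)) test_fun) + norm (pair (\<lambda>x. gv j x - gv (Suc j) x) test_fun)"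
      by (metis norm_triangle_ineq)
    moreover have "norm (pair (\<lambda>x. gv j x - gv (Suc j) x) test_fun) \<le> level_bound (Suc j)"
      using good_step[OF lam0, of "Suc j" "lam j" "\<eta> * sqrt 2 ^ Suc j"] lamS[of j] lam0[of "Suc j"] nsi[OF Suc.prems] sg[of "Suc j"]
      by (simp add: gv_def left_diff_distrib level_bound_def lam_def)
    ultimately show ?case using Suc by simp
  qed simp
  have last: "norm (pair (gv n) test_fun) \<le> level_bound (Suc n)"
    using good_last[OF lam0, of "Suc n" "\<eta> * sqrt 2 ^ Suc n"] lamS[of n] nsi[of n] k(1) n sg[of "Suc n"]
    by (simp add: gv_def[abs_def] level_bound_def lam_def)
  have "norm (pair (gv 0) test_fun) \<le> (\<Sum>i<Suc n. level_bound (Suc i))" using tel[of n] last by simp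
  also have "\<dots> \<le> (\<Sum>i<Suc (Suc n). level_bound i)"
  proof -
    have "0 \<le> level_bound 0" unfolding level_bound_def using level_const_nonneg X t \<eta>_pos mean_const_pos Y_nonneg[of E] by simp
    then show ?thesis by (simp add: sum.lessThan_Suc_shift del: sum.lessThan_Suc)
  qed
  also have "\<dots> \<le> good_const * X + t * Y E / 2" by (rule level_bound_sum)
  finally show ?thesis by (simp add: gv_def[abs_def] lam_def)
qed

lemma E_part:
  assumes ns: "\<not> cz.stops t (hcube a0 l0)"
  shows "t * Y E \<le> 2 * (bad_const + good_const) * X"
proof -
  show ?thesis
  proof (cases "0 < cz.F (hcube a0 l0)")
    case True
    have gL: "(\<lambda>x. cz.g t x * complex_of_real (v x)) \<in> L2" by (rule gv_L2[OF ns t])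
    have bL: "(\<lambda>x. (f x - cz.g t x) * complex_of_real (v x)) \<in> L2"
      using L2_diff[OF fv_L2 gL] by (simp add: fv_def left_diff_distrib)
    have "pair fv test_fun = pair (\<lambda>x. (f x - cz.g t x) * complex_of_real (v x) + cz.g t x * complex_of_real (v x)) test_fun"
      by (simp add: fv_def[abs_def] left_diff_distrib)
    also have "\<dots> = pair (\<lambda>x. (f x - cz.g t x) * complex_of_real (v x)) test_fun + pair (\<lambda>x. cz.g t x * complex_of_real (v x)) test_fun"
      by (rule pair_add[OF bL gL test_fun_L2])
    finally have "norm (pair fv test_fun) \<le> bad_const * X + (good_const * X + t * Y E / 2)"
      using norm_triangle_mono[OF bad_part[OF ns] good_part[OF ns True]] by simp
    then show ?thesis using pair_lower by (simp add: algebra_simps)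
  next
    case False
    have Q: "hcube a0 l0 \<in> sets lebesgue" by simp
    \<comment> \<open>Without mass of \<open>f\<close> the root would stop at no positive height;
      but then \<open>fv\<close> vanishes almost everywhere, and so does the pairing.\<close>
    have "(LINT x:hcube a0 l0|lebesgue. norm (f x) * v x) = 0"
    proof (rule antisym)
      show "(LINT x:hcube a0 l0|lebesgue. norm (f x) * v x) \<le> 0" using False by (simp add: cz.F_def)
      show "0 \<le> (LINT x:hcube a0 l0|lebesgue. norm (f x) * v x)"
        unfolding set_lebesgue_integral_def
        by (rule integral_nonneg_AE) (use v_pos in \<open>auto elim!: eventually_mono simp: indicator_def\<close>)
    qed
    moreover have "AE x in lebesgue. 0 \<le> indicator (hcube a0 l0) x *\<^sub>R (norm (f x) * v x)"
      using v_pos by eventually_elim (simp add: indicator_def)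
    ultimately have "AE x in lebesgue. indicator (hcube a0 l0) x *\<^sub>R (norm (f x) * v x) = 0"
      using integral_nonneg_eq_0_iff_AE cz.nfw_integrable[OF Q order.refl]
      unfolding set_lebesgue_integral_def set_integrable_def by blast
    then have fv0: "AE x in lebesgue. fv x = 0 * fv x"
    proof eventually_elim
      case (elim x)
      show ?case using elim f_off[of x] by (cases "x \<in> hcube a0 l0") (auto simp: fv_def)
    qed
    have "pair fv test_fun = pair (\<lambda>x. 0 * fv x) test_fun" by (rule pair_cong_AE[OF fv_L2 L2_scale[OF fv_L2] test_fun_L2 fv0])
    also have "\<dots> = 0" using pair_scale[OF fv_L2 test_fun_L2, of 0] by simp
    finally have "t * Y E \<le> 0" using pair_lower by simp
    also have "0 \<le> 2 * (bad_const + good_const) * X" using bad_const_nonneg good_const_nonneg X by simp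
    finally show ?thesis .
  qed
qed

end

subsection \<open>The weak type estimate\<close>

text \<open>\<open>h\<close> is an arbitrary function: it will be an integrand with two maximal
  functions, about whose measurability nothing is assumed.\<close>

lemma sum_set_nn_integral_le:
  assumes "finite \<F>" "disjoint \<F>" and s: "\<And>Q. Q \<in> \<F> \<Longrightarrow> Q \<in> sets M" and g [measurable]: "g \<in> borel_measurable M"
    and le: "\<And>Q. Q \<in> \<F> \<Longrightarrow> AE x in M. x \<in> Q \<longrightarrow> c Q * g x \<le> h x"
  shows "(\<Sum>Q\<in>\<F>. c Q * (\<integral>\<^sup>+x\<in>Q. g x \<partial>M)) \<le> (\<integral>\<^sup>+x. h x \<partial>M)"
proof -
  have "(\<Sum>Q\<in>\<F>. c Q * (\<integral>\<^sup>+x\<in>Q. g x \<partial>M)) = (\<Sum>Q\<in>\<F>. \<integral>\<^sup>+x. c Q * (g x * indicator Q x) \<partial>M)"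
    using s by (intro sum.cong refl nn_integral_cmult[symmetric] borel_measurable_times_ennreal g borel_measurable_indicator)
  also have "\<dots> = (\<integral>\<^sup>+x. (\<Sum>Q\<in>\<F>. c Q * (g x * indicator Q x)) \<partial>M)"
    using s by (intro nn_integral_sum[symmetric] borel_measurable_times_ennreal g borel_measurable_indicator borel_measurable_const)
  also have "\<dots> \<le> (\<integral>\<^sup>+x. h x \<partial>M)"
  proof (rule nn_integral_mono_AE)
    have "AE x in M. \<forall>Q\<in>\<F>. x \<in> Q \<longrightarrow> c Q * g x \<le> h x"
      using le by (intro AE_finite_allI[OF assms(1)])
    then show "AE x in M. (\<Sum>Q\<in>\<F>. c Q * (g x * indicator Q x)) \<le> h x"
    proof eventually_elim
      case (elim x)
      show ?case
      proof (cases "\<exists>Q\<in>\<F>. x \<in> Q")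
        case True
        then obtain Q where Q: "Q \<in> \<F>" "x \<in> Q" by blast
        have "x \<notin> R" if "R \<in> \<F>" "R \<noteq> Q" for R
          using disjointD[OF assms(2) that(1) Q(1) that(2)] Q(2) by blast
        then have "(\<Sum>R\<in>\<F>. c R * (g x * indicator R x)) = (\<Sum>R\<in>{Q}. c R * (g x * indicator R x))"
          using Q assms(1) by (intro sum.mono_neutral_right) auto
        then show ?thesis using elim Q by simp
      next
        case False
        then have "(\<Sum>R\<in>\<F>. c R * (g x * indicator R x)) = 0" by (intro sum.neutral) auto
        then show ?thesis by simp
      qed
    qed
  qed
  finally show ?thesis .
qed

context mixed_data
begin

lemma main_estimate: "t * (LINT x:A0|lebesgue. u x * v x) \<le> weak_const * X"
proof -
  have AD: "0 \<le> A * average_const" using A1 orlicz_consts_nonneg by simp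
  have "t * Y A0 \<le> weak_const * X"
  proof (cases "cz.stops t (hcube a0 l0)")
    case True
    have "A * average_const * X \<le> weak_const * X"
      using X star_const_nonneg bad_const_nonneg good_const_nonneg by (intro mult_right_mono) (auto simp: weak_const_def)
    then show ?thesis using heavy_top[OF True] by simp
  next
    case False
    have "t * Y E \<le> 2 * (bad_const + good_const) * X"
    proof (cases "0 < Y E")
      case True
      show ?thesis
      proof (rule maximal_data[OF True])
        fix G mf
        assume G: "G \<in> borel_measurable lebesgue" "\<And>x. 0 \<le> G x"
          "AE x in lebesgue. G x = sqrt (u x * v x) * indicator E x" "\<And>Q. 0 < mf Q"
          "\<And>Q B. B \<in> cubes \<Longrightarrow> Q \<subseteq> B \<Longrightarrow> (\<integral>\<^sup>+x\<in>B. ennreal (G x) \<partial>lebesgue) \<le> ennreal (mf Q * measure lebesgue B)"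
          "\<And>\<F>. finite \<F> \<Longrightarrow> disjoint \<F> \<Longrightarrow> (\<And>Q. Q \<in> \<F> \<Longrightarrow> (\<exists>b l. 0 < l \<and> Q = hcube b l) \<and> Q \<subseteq> hcube a0 l0) \<Longrightarrow>
            (\<Sum>Q\<in>\<F>. measure lebesgue Q * (mf Q)\<^sup>2) \<le> mean_const * Y E"
        interpret mixed_level T Bt \<Phi> K c0 CK v \<beta> A F u a D3 Cu D8 s cs a0 l0 f Bf t X R0 Lf A0 G mf
        proof
          fix \<F> :: "(real ^ 'n) set set"
          assume "finite \<F>" "disjoint \<F>" "\<And>Q. Q \<in> \<F> \<Longrightarrow> (\<exists>b l. 0 < l \<and> Q = hcube b l) \<and> Q \<subseteq> hcube a0 l0"
          then show "(\<Sum>Q\<in>\<F>. measure lebesgue Q * (mf Q)\<^sup>2) \<le> mean_const * Y E" by (rule G(6))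
        qed (rule G(1) G(2) G(3) G(4) G(5), (assumption+)?)+
        show ?thesis by (rule E_part[OF False])
      qed
    next
      case False
      then have "Y E = 0" using Y_nonneg[of E] by simp
      then show ?thesis using bad_const_nonneg good_const_nonneg X by simp
    qed
    moreover have "Y A0 = Y (A0 \<inter> Om) + Y E"
    proof -
      have "set_integrable lebesgue (A0 \<inter> Om) (\<lambda>x. u x * v x)" "set_integrable lebesgue E (\<lambda>x. u x * v x)"
        using A0 Om_sets E_sets by (auto intro!: uv_integrable)
      from set_integral_Un[OF _ this] have "Y ((A0 \<inter> Om) \<union> E) = Y (A0 \<inter> Om) + Y E"
        unfolding Y_def by (auto simp: E_def)
      moreover have "(A0 \<inter> Om) \<union> E = A0" by (auto simp: E_def)
      ultimately show ?thesis by simp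
    qed
    ultimately have "t * Y A0 \<le> (star_const + 2 * (bad_const + good_const)) * X" using Om_part by (simp add: algebra_simps)
    also have "\<dots> \<le> weak_const * X" using X AD by (intro mult_right_mono) (auto simp: weak_const_def)
    finally show ?thesis .
  qed
  then show ?thesis by (simp only: Y_def)
qed

end

context mixed_estimate
begin

text \<open>The infimum \<open>Lq Q\<close> of the Orlicz maximal function over \<open>Q\<close>
  plays two roles: it is a lower bound for the integrand on \<open>Q\<close> and an upper bound for
  the Luxemburg averages over all cubes that contain \<open>Q\<close>. So the sums required in
  \<open>mixed_data\<close> are dominated by the integral on the right.\<close>

lemma level_estimate:
  fixes f :: "real ^ 'n \<Rightarrow> complex" and Mv :: "real ^ 'n \<Rightarrow> ennreal"
  defines "Mu \<equiv> maximal_lux F (\<lambda>x. v x powr (- \<beta>)) u"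
  assumes f_meas [measurable]: "f \<in> borel_measurable lebesgue" and f_bound: "\<And>x. norm (f x) \<le> Bf"
    and l0: "0 < l0" and f_off: "\<And>x. x \<notin> hcube a0 l0 \<Longrightarrow> f x = 0" and t: "0 < t"
    and A0: "A0 \<in> sets lebesgue" "A0 \<subseteq> hcube a0 l0"
    and A0_level: "\<And>x. x \<in> A0 \<Longrightarrow> t * v x < norm (T (\<lambda>y. f y * complex_of_real (v y)) x)"
    and A0_v: "\<And>x. x \<in> A0 \<Longrightarrow> 0 < v x" and A0_u: "\<And>x. x \<in> A0 \<Longrightarrow> u x \<le> R0"
    and Mv: "AE x in lebesgue. x \<in> hcube a0 l0 \<longrightarrow> ennreal (v x / A) \<le> Mv x"
    and I0: "0 \<le> I0" and I: "(\<integral>\<^sup>+x. ennreal (norm (f x)) * Mu x * Mv x \<partial>lebesgue) = ennreal I0"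
  shows "t * (LINT x:A0|lebesgue. u x * v x) \<le> weak_const * (A * I0)"
proof -
  define FF where "FF Q = (LINT x:Q|lebesgue. norm (f x) * v x)" for Q
  define Lq where "Lq Q = (INF x\<in>Q. Mu x)" for Q
  let ?Q0 = "hcube a0 l0"
  have vb: "AE x in lebesgue. x \<in> ?Q0 \<longrightarrow> norm (f x) \<le> Bf" using f_bound by simp
  have vi: "set_integrable lebesgue ?Q0 v"
    by (rule set_integrable_subset[OF v_int[OF cbox_in_cubes[OF l0, of a0]] _ hcube_subset_cbox]) simp
  have nfm: "(\<lambda>x. norm (f x)) \<in> borel_measurable lebesgue" by measurable
  have fvi: "set_integrable lebesgue ?Q0 (\<lambda>x. norm (f x) * v x)"
    using set_integrable_bounded_mult[OF nfm _ vi, of Bf] f_bound by simp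
  have fviQ: "set_integrable lebesgue Q (\<lambda>x. norm (f x) * v x)" if "Q \<in> sets lebesgue" "Q \<subseteq> ?Q0" for Q
    by (rule set_integrable_subset[OF fvi that])
  have FF_nn: "0 \<le> FF Q" for Q
    unfolding FF_def set_lebesgue_integral_def
    by (rule integral_nonneg_AE) (use v_pos in \<open>auto elim!: eventually_mono simp: indicator_def\<close>)
  have NF: "(\<integral>\<^sup>+x\<in>Q. ennreal (norm (f x) * v x / c) \<partial>lebesgue) = ennreal (FF Q / c)"
    if Q: "Q \<in> sets lebesgue" "Q \<subseteq> ?Q0" and c: "0 < c" for Q c
  proof -
    have "(\<integral>\<^sup>+x\<in>Q. ennreal (norm (f x) * v x / c) \<partial>lebesgue) = (\<integral>\<^sup>+x. ennreal (indicator Q x *\<^sub>R (norm (f x) * v x) / c) \<partial>lebesgue)"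
      by (intro nn_integral_cong) (simp add: indicator_def)
    also have "\<dots> = ennreal (LINT x|lebesgue. indicator Q x *\<^sub>R (norm (f x) * v x) / c)"
    proof (rule nn_integral_eq_integral)
      show "integrable lebesgue (\<lambda>x. indicator Q x *\<^sub>R (norm (f x) * v x) / c)"
        using fviQ[OF Q] unfolding set_integrable_def by (rule integrable_divide)
      show "AE x in lebesgue. 0 \<le> indicator Q x *\<^sub>R (norm (f x) * v x) / c"
        using v_pos by eventually_elim (use c in \<open>simp add: indicator_def\<close>)
    qed
    finally show ?thesis by (simp add: FF_def set_lebesgue_integral_def)
  qed
  have A: "0 < A" using A1 by simp
  have key: "(\<Sum>Q\<in>\<F>. Lq Q * ennreal (FF Q / A)) \<le> ennreal I0"
    if \<F>: "finite \<F>" "disjoint \<F>" "\<And>Q. Q \<in> \<F> \<Longrightarrow> Q \<in> sets lebesgue \<and> Q \<subseteq> ?Q0" for \<F>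
  proof -
    have "(\<Sum>Q\<in>\<F>. Lq Q * ennreal (FF Q / A)) = (\<Sum>Q\<in>\<F>. Lq Q * (\<integral>\<^sup>+x\<in>Q. ennreal (norm (f x) * v x / A) \<partial>lebesgue))"
      using \<F>(3) NF[OF _ _ A] by (intro sum.cong) auto
    also have "\<dots> \<le> (\<integral>\<^sup>+x. ennreal (norm (f x)) * Mu x * Mv x \<partial>lebesgue)"
    proof (rule sum_set_nn_integral_le[OF \<F>(1,2)])
      fix Q assume Q: "Q \<in> \<F>"
      show "Q \<in> sets lebesgue" using \<F>(3)[OF Q] by simp
      show "AE x in lebesgue. x \<in> Q \<longrightarrow> Lq Q * ennreal (norm (f x) * v x / A) \<le> ennreal (norm (f x)) * Mu x * Mv x"
        using Mv v_pos
      proof eventually_elim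
        case (elim x)
        show ?case
        proof
          assume x: "x \<in> Q"
          then have "Lq Q \<le> Mu x" unfolding Lq_def by (rule INF_lower)
          moreover have "ennreal (v x / A) \<le> Mv x" using x elim \<F>(3)[OF Q] by blast
          ultimately have "Lq Q * (ennreal (norm (f x)) * ennreal (v x / A)) \<le> Mu x * (ennreal (norm (f x)) * Mv x)"
            by (intro mult_mono) auto
          moreover have "ennreal (norm (f x) * v x / A) = ennreal (norm (f x)) * ennreal (v x / A)"
            using elim A by (simp add: ennreal_mult[symmetric])
          ultimately show "Lq Q * ennreal (norm (f x) * v x / A) \<le> ennreal (norm (f x)) * Mu x * Mv x"
            by (simp add: mult_ac)
        qed
      qed
    qed measurable
    finally show ?thesis unfolding I .
  qed
  \<comment> \<open>An infinite infimum on a cube with mass of \<open>f\<close> would make the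
    integral on the right infinite.\<close>
  have Lfin: "Lq Q < top" if Q: "Q \<in> sets lebesgue" "Q \<subseteq> ?Q0" "0 < FF Q" for Q
  proof (rule ccontr)
    assume "\<not> Lq Q < top"
    then have "Lq Q = top" by (simp add: not_less top_unique)
    moreover have "ennreal (FF Q / A) \<noteq> 0" using Q(3) A by simp
    ultimately have "Lq Q * ennreal (FF Q / A) = top" by (simp add: ennreal_top_mult)
    moreover have "Lq Q * ennreal (FF Q / A) \<le> ennreal I0" using key[of "{Q}"] Q by simp
    ultimately show False by (simp add: top_unique)
  qed
  have est: "t * (LINT x:A0|lebesgue. u x * v x) \<le> weak_const * (A * I0 + \<delta> * FF ?Q0)" if \<delta>: "0 < \<delta>" for \<delta>
  proof -
    \<comment> \<open>The added constant makes \<open>Lf\<close> positive and strictly larger than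
      the averages; it is sent to 0 at the end.\<close>
    define Lf where "Lf Q = enn2real (Lq Q) + \<delta>" for Q
    interpret mixed_data T Bt \<Phi> K c0 CK v \<beta> A F u a D3 Cu D8 s cs a0 l0 f Bf t "A * I0 + \<delta> * FF ?Q0" R0 Lf A0
    proof
      show "0 \<le> A * I0 + \<delta> * FF ?Q0" using A I0 \<delta> FF_nn by simp
      show "0 < Lf (hcube b l)" for b l using \<delta> by (simp add: Lf_def add_nonneg_pos)
    next
      fix b l B assume l: "0 < l" "hcube b l \<subseteq> ?Q0" and F0: "0 < (LINT x:hcube b l|lebesgue. norm (f x) * v x)"
        and B: "B \<in> cubes" "cbox b (b + vec l) \<subseteq> B"
      have "luxemburg F B (\<lambda>x. v x powr (- \<beta>)) u \<le> Lq (hcube b l)"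
        unfolding Lq_def Mu_def maximal_lux_def
      proof (rule INF_greatest)
        fix x assume "x \<in> hcube b l"
        then have "x \<in> B" using B(2) hcube_subset_cbox[of b l] by blast
        then show "luxemburg F B (\<lambda>x. v x powr (- \<beta>)) u \<le> (SUP Q\<in>{Q \<in> cubes. x \<in> Q}. luxemburg F Q (\<lambda>x. v x powr (- \<beta>)) u)"
          using B(1) by (intro SUP_upper) simp
      qed
      also have "Lq (hcube b l) = ennreal (enn2real (Lq (hcube b l)))"
        using Lfin[of "hcube b l"] l F0 by (simp add: FF_def)
      also have "\<dots> < ennreal (Lf (hcube b l))" using \<delta> by (simp add: Lf_def ennreal_lessI add_nonneg_pos)
      finally show "luxemburg F B (\<lambda>x. v x powr (- \<beta>)) u < ennreal (Lf (hcube b l))" .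
    next
      fix \<F> assume \<F>: "finite \<F>" "disjoint \<F>" "\<And>Q. Q \<in> \<F> \<Longrightarrow> (\<exists>b l. 0 < l \<and> Q = hcube b l) \<and>
        Q \<subseteq> ?Q0 \<and> 0 < (LINT x:Q|lebesgue. norm (f x) * v x)"
      have Q: "Q \<in> sets lebesgue" "Q \<subseteq> ?Q0" "0 < FF Q" if "Q \<in> \<F>" for Q
        using \<F>(3)[OF that] by (auto simp: FF_def)
      have "ennreal (\<Sum>Q\<in>\<F>. enn2real (Lq Q) * (FF Q / A)) = (\<Sum>Q\<in>\<F>. Lq Q * ennreal (FF Q / A))"
      proof -
        have "ennreal (enn2real (Lq Q) * (FF Q / A)) = Lq Q * ennreal (FF Q / A)" if "Q \<in> \<F>" for Q
          using Lfin[OF Q[OF that]] FF_nn[of Q] A by (simp add: ennreal_mult del: times_divide_eq_right)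
        moreover have "ennreal (\<Sum>Q\<in>\<F>. enn2real (Lq Q) * (FF Q / A)) = (\<Sum>Q\<in>\<F>. ennreal (enn2real (Lq Q) * (FF Q / A)))"
          using FF_nn A by (intro sum_ennreal[symmetric]) simp
        ultimately show ?thesis by simp
      qed
      also have "\<dots> \<le> ennreal I0" using key[OF \<F>(1,2)] Q by blast
      finally have "(\<Sum>Q\<in>\<F>. enn2real (Lq Q) * (FF Q / A)) \<le> I0" using I0 by simp
      then have "(\<Sum>Q\<in>\<F>. enn2real (Lq Q) * FF Q) / A \<le> I0" by (simp add: sum_divide_distrib)
      then have 1: "(\<Sum>Q\<in>\<F>. enn2real (Lq Q) * FF Q) \<le> A * I0" using A by (simp add: divide_le_eq mult.commute)
      have "(\<Sum>Q\<in>\<F>. 1 * (\<integral>\<^sup>+x\<in>Q. ennreal (norm (f x) * v x / 1) \<partial>lebesgue))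
        \<le> (\<integral>\<^sup>+x\<in>?Q0. ennreal (norm (f x) * v x / 1) \<partial>lebesgue)"
      proof (rule sum_set_nn_integral_le[OF \<F>(1,2)])
        show "AE x in lebesgue. x \<in> Q \<longrightarrow> 1 * ennreal (norm (f x) * v x / 1) \<le> ennreal (norm (f x) * v x / 1) * indicator ?Q0 x"
          if "Q \<in> \<F>" for Q
          using Q(2)[OF that] by (intro AE_I2) (auto split: split_indicator)
      qed (use Q(1) in auto)
      then have "(\<Sum>Q\<in>\<F>. ennreal (FF Q)) \<le> ennreal (FF ?Q0)"
        using NF[OF Q(1,2) zero_less_one] NF[of ?Q0 1] by simp
      then have 2: "(\<Sum>Q\<in>\<F>. FF Q) \<le> FF ?Q0" using FF_nn by (simp add: sum_ennreal)
      have "(\<Sum>Q\<in>\<F>. Lf Q * FF Q) = (\<Sum>Q\<in>\<F>. enn2real (Lq Q) * FF Q) + \<delta> * (\<Sum>Q\<in>\<F>. FF Q)"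
        by (simp add: Lf_def distrib_right sum.distrib sum_distrib_left)
      also have "\<dots> \<le> A * I0 + \<delta> * FF ?Q0" using 1 2 \<delta> by (intro add_mono mult_left_mono) auto
      finally show "(\<Sum>Q\<in>\<F>. Lf Q * (LINT x:Q|lebesgue. norm (f x) * v x)) \<le> A * I0 + \<delta> * FF ?Q0"
        by (simp add: FF_def)
    qed (use assms in auto)
    show ?thesis by (rule main_estimate)
  qed
  have "t * (LINT x:A0|lebesgue. u x * v x) \<le> weak_const * (A * I0) + e" if e: "0 < e" for e
  proof -
    define \<delta> where "\<delta> = e / (weak_const * (FF ?Q0 + 1))"
    have p: "0 < weak_const * (FF ?Q0 + 1)" using weak_const_pos FF_nn[of ?Q0] by simp
    then have \<delta>: "0 < \<delta>" using e by (simp add: \<delta>_def)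
    have "weak_const * (\<delta> * FF ?Q0) \<le> \<delta> * (weak_const * (FF ?Q0 + 1))" using weak_const_pos \<delta> by (simp add: algebra_simps)
    also have "\<dots> = e" using p \<delta>_def by (metis nonzero_eq_divide_eq less_irrefl)
    finally show ?thesis using est[OF \<delta>] by (simp add: distrib_left)
  qed
  then show ?thesis by (rule field_le_epsilon)
qed


text \<open>\<psi> enters only through \<open>z \<le> \<psi> z\<close>, which makes its maximal
  function dominate \<open>v / A\<close>. The exhausting sets \<open>An\<close> are bounded and
  carry a bounded \<open>u\<close>, and the constant of \<open>level_estimate\<close> is the same
  for all of them.\<close>

lemma weak_type:
  fixes f :: "real ^ 'n \<Rightarrow> complex" and \<psi> :: "real \<Rightarrow> real"
  assumes f [measurable]: "f \<in> borel_measurable lebesgue" and fb: "bounded (range f)" and fs: "compact (support f)"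
    and t: "0 < t" and \<psi>: "\<And>z. 0 < z \<Longrightarrow> z \<le> \<psi> z"
  shows "weighted (\<lambda>x. u x * v x) {x. norm (T (\<lambda>y. f y * complex_of_real (v y)) x) / v x > t}
    \<le> ennreal (weak_const * A / t) * (\<integral>\<^sup>+x. ennreal (norm (f x)) * maximal_lux F (\<lambda>x. v x powr (- \<beta>)) u x *
        hl_maximal (\<lambda>y. \<psi> (v y)) x \<partial>lebesgue)"
    (is "weighted _ ?\<Omega> \<le> _ * ?I")
proof (cases "?I = \<infinity>")
  case True
  have "ennreal (weak_const * A / t) * ?I = \<infinity>"
    unfolding True using weak_const_pos A1 t by (simp add: ennreal_mult_top)
  then show ?thesis by simp
next
  case False
  define I0 where "I0 = enn2real ?I"
  have I0: "0 \<le> I0" "?I = ennreal I0" using False by (auto simp: I0_def less_top)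
  obtain Bf where Bf: "\<And>x. norm (f x) \<le> Bf" using fb by (auto simp: bounded_iff)
  obtain N0 where N0: "\<And>x. x \<in> support f \<Longrightarrow> norm x \<le> N0"
    using compact_imp_bounded[OF fs] by (auto simp: bounded_iff)
  have f0: "norm x \<le> N0" if "f x \<noteq> 0" for x
    using N0[of x] that closure_subset[of "{x. f x \<noteq> 0}"] by (auto simp: support_def)
  define Tf where "Tf = T (\<lambda>y. f y * complex_of_real (v y))"
  have in_hcube: "x \<in> hcube (vec (- N)) (2 * N)" if "norm x < N" for x :: "real ^ 'n" and N
  proof -
    have "- N \<le> x $ i \<and> x $ i < - N + 2 * N" for i
      using component_le_norm_cart[of x i] that by linarith
    then show ?thesis by (simp add: hcube_def)
  qed
  \<comment> \<open>Large enough for the cube of half side \<open>N1 n\<close> about the origin to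
    contain both the support of \<open>f\<close> and the piece \<open>An n\<close>.\<close>
  define N1 where "N1 n = real n + \<bar>N0\<bar> + 1" for n
  define Q0 :: "nat \<Rightarrow> (real ^ 'n) set" where "Q0 n = hcube (vec (- N1 n)) (2 * N1 n)" for n
  have N1: "0 < 2 * N1 n" for n by (simp add: N1_def)
  have off: "f x = 0" if "x \<notin> Q0 n" for x n
  proof (rule ccontr)
    assume "f x \<noteq> 0"
    then have "norm x < N1 n" using f0[of x] by (simp add: N1_def)
    then show False using in_hcube that by (simp add: Q0_def)
  qed
  have vB: "AE x in lebesgue. x \<in> Q0 n \<longrightarrow> 0 < v x \<and> v x \<le> A * avg v (cbox (vec (- N1 n)) (vec (- N1 n) + vec (2 * N1 n)))" for n
    using v_pos v_sup[OF cbox_in_cubes[OF N1[of n], of "vec (- N1 n)"]]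
  proof eventually_elim
    case (elim x)
    then show ?case using hcube_subset_cbox[of "vec (- N1 n)" "2 * N1 n"] by (auto simp: Q0_def)
  qed
  have "(\<lambda>y. f y * complex_of_real (v y)) \<in> L2"
  proof -
    define C where "C = Bf * (A * avg v (cbox (vec (- N1 0)) (vec (- N1 0) + vec (2 * N1 0))))"
    have Bf0: "0 \<le> Bf" using Bf[of 0] norm_ge_zero[of "f 0"] by linarith
    then have C: "0 \<le> C" using A1 V_pos[OF cbox_in_cubes[OF N1[of 0], of "vec (- N1 0)"]] by (simp add: C_def)
    have lm: "Q0 0 \<in> lmeasurable" by (simp add: Q0_def)
    have ae: "AE x in lebesgue. norm (f x * complex_of_real (v x)) \<le> C * indicator (Q0 0) x"
      using vB[of 0]
    proof eventually_elim
      case (elim x)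
      show ?case
        using elim Bf[of x] off[of x 0] Bf0 by (cases "x \<in> Q0 0") (auto simp: C_def norm_mult intro!: mult_mono)
    qed
    show ?thesis by (rule L2_boundedI(1)[OF _ lm C ae]) measurable
  qed
  then have Tfm [measurable]: "Tf \<in> borel_measurable lebesgue" unfolding Tf_def by (intro L2_measurable T_L2)
  define An where "An n = {x. t < norm (Tf x) / v x} \<inter> {x. norm x < real n} \<inter> {x. u x \<le> real n}" for n
  have An [measurable]: "An n \<in> sets lebesgue" for n
  proof -
    have "{x \<in> space lebesgue. t < norm (Tf x) / v x} \<in> sets lebesgue" by measurable
    moreover have "{x \<in> space lebesgue. u x \<le> real n} \<in> sets lebesgue" by measurable
    moreover have "{x :: real ^ 'n. norm x < real n} \<in> sets lebesgue"
    proof -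
      have "{x :: real ^ 'n. norm x < real n} = ball 0 (real n)" by auto
      then show ?thesis by simp
    qed
    ultimately show ?thesis unfolding An_def by (intro sets.Int) simp_all
  qed
  \<comment> \<open>Where \<open>v x \<le> 0\<close> the quotient is at most 0, including the
    default value 0 of a division by zero; so \<open>v\<close> is positive on the whole level
    set.\<close>
  have Av: "0 < v x" "t * v x < norm (Tf x)" if "x \<in> An n" for x n
  proof -
    have lt: "t < norm (Tf x) / v x" using that by (simp add: An_def)
    then have "0 < norm (Tf x) / v x" using t by linarith
    then show vp: "0 < v x" by (smt (verit) norm_ge_zero zero_less_divide_iff)
    show "t * v x < norm (Tf x)" using lt vp by (simp add: pos_less_divide_eq)
  qed
  have sub: "An n \<subseteq> Q0 n" for n
  proof
    fix x assume "x \<in> An n"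
    then have "norm x < real n" by (simp add: An_def)
    then have "norm x < N1 n" unfolding N1_def by linarith
    then show "x \<in> Q0 n" using in_hcube by (simp add: Q0_def)
  qed
  have Mv: "AE x in lebesgue. x \<in> Q0 n \<longrightarrow> ennreal (v x / A) \<le> hl_maximal (\<lambda>y. \<psi> (v y)) x" for n
    using vB[of n]
  proof eventually_elim
    case (elim x)
    let ?B = "cbox (vec (- N1 n)) (vec (- N1 n) + vec (2 * N1 n)) :: (real ^ 'n) set"
    have B: "?B \<in> cubes" by (rule cbox_in_cubes[OF N1])
    show ?case
    proof
      assume x: "x \<in> Q0 n"
      then have xB: "x \<in> ?B" using hcube_subset_cbox[of "vec (- N1 n)" "2 * N1 n"] by (auto simp: Q0_def)
      have "v x / A \<le> avg v ?B" using elim x A1 by (simp add: divide_le_eq mult.commute)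
      then have "ennreal (v x / A) \<le> ennreal (avg v ?B)" by (rule ennreal_leI)
      also have "\<dots> = ennreal (LINT x:?B|lebesgue. v x) / emeasure lebesgue ?B"
      proof -
        have "0 \<le> (LINT x:?B|lebesgue. v x)"
          using int_v[OF B] V_pos[OF B] cube_measure_pos[OF B] by (simp del: measure_completion)
        then show ?thesis
          using cube_measure_pos[OF B] by (simp add: avg_def cube_emeasure[OF B] divide_ennreal del: measure_completion emeasure_completion)
      qed
      also have "ennreal (LINT x:?B|lebesgue. v x) = (\<integral>\<^sup>+y. ennreal (indicator ?B y *\<^sub>R v y) \<partial>lebesgue)"
        unfolding set_lebesgue_integral_def
        by (rule nn_integral_eq_integral[symmetric])
          (use v_int[OF B] v_pos in \<open>auto simp: set_integrable_def indicator_def elim!: eventually_mono\<close>)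
      also have "\<dots> / emeasure lebesgue ?B \<le> (\<integral>\<^sup>+y\<in>?B. ennreal (norm (\<psi> (v y))) \<partial>lebesgue) / emeasure lebesgue ?B"
      proof (rule divide_right_mono_ennreal, rule nn_integral_mono_AE)
        show "AE y in lebesgue. ennreal (indicator ?B y *\<^sub>R v y) \<le> ennreal (norm (\<psi> (v y))) * indicator ?B y"
          using v_pos
        proof eventually_elim
          case (elim y)
          have "v y \<le> norm (\<psi> (v y))" using \<psi>[OF elim] by simp
          then show ?case by (cases "y \<in> ?B") (auto intro: ennreal_leI)
        qed
      qed
      also have "\<dots> \<le> hl_maximal (\<lambda>y. \<psi> (v y)) x"
        unfolding hl_maximal_def using B xB by (intro SUP_upper) simp
      finally show "ennreal (v x / A) \<le> hl_maximal (\<lambda>y. \<psi> (v y)) x" .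
    qed
  qed
  have each: "weighted (\<lambda>x. u x * v x) (An n) \<le> ennreal (weak_const * A / t) * ?I" for n
  proof -
    have "t * (LINT x:An n|lebesgue. u x * v x) \<le> weak_const * (A * I0)"
    proof (rule level_estimate[OF f Bf N1 _ t An _ _ _ _ _ I0])
      show "f x = 0" if "x \<notin> hcube (vec (- N1 n)) (2 * N1 n)" for x using off[of x n] that by (simp add: Q0_def)
      show "An n \<subseteq> hcube (vec (- N1 n)) (2 * N1 n)" using sub by (simp add: Q0_def)
      show "t * v x < norm (T (\<lambda>y. f y * complex_of_real (v y)) x)" "0 < v x" "u x \<le> real n" if "x \<in> An n" for x
        using Av[OF that] that by (auto simp: An_def Tf_def)
      show "AE x in lebesgue. x \<in> hcube (vec (- N1 n)) (2 * N1 n) \<longrightarrow> ennreal (v x / A) \<le> hl_maximal (\<lambda>y. \<psi> (v y)) x"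
        using Mv[of n] by (simp add: Q0_def)
    qed
    then have le: "(LINT x:An n|lebesgue. u x * v x) \<le> weak_const * A / t * I0" using t by (simp add: field_simps)
    have uv: "set_integrable lebesgue (An n) (\<lambda>x. u x * v x)"
    proof -
      let ?B = "cbox (vec (- N1 n)) (vec (- N1 n) + vec (2 * N1 n)) :: (real ^ 'n) set"
      have ui: "set_integrable lebesgue (Q0 n) u"
      proof (rule set_integrable_subset)
        show "set_integrable lebesgue ?B u" using u_loc by (simp add: locally_integrable_def)
      qed (use hcube_subset_cbox[of "vec (- N1 n)" "2 * N1 n"] in \<open>auto simp: Q0_def\<close>)
      have "AE x in lebesgue. x \<in> Q0 n \<longrightarrow> norm (v x) \<le> A * avg v ?B" using vB[of n] by eventually_elim auto
      from set_integrable_bounded_mult[OF v_meas this ui]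
      have "set_integrable lebesgue (Q0 n) (\<lambda>x. u x * v x)" by (simp add: mult.commute)
      then show ?thesis by (rule set_integrable_subset[OF _ An sub])
    qed
    have "weighted (\<lambda>x. u x * v x) (An n) = (\<integral>\<^sup>+x. ennreal (indicator (An n) x *\<^sub>R (u x * v x)) \<partial>lebesgue)"
      unfolding weighted_def by (intro nn_integral_cong) (simp add: indicator_def)
    also have "\<dots> = ennreal (LINT x:An n|lebesgue. u x * v x)"
      unfolding set_lebesgue_integral_def
      by (rule nn_integral_eq_integral)
        (use uv v_pos u0 in \<open>auto simp: set_integrable_def indicator_def elim!: eventually_mono\<close>)
    also have "\<dots> \<le> ennreal (weak_const * A / t * I0)" by (rule ennreal_leI[OF le])
    also have "\<dots> = ennreal (weak_const * A / t) * ?I"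
      unfolding I0(2) using weak_const_pos A1 t I0(1) by (intro ennreal_mult) auto
    finally show ?thesis .
  qed
  have inc: "incseq An"
  proof (rule incseq_SucI)
    show "An n \<subseteq> An (Suc n)" for n unfolding An_def by (auto intro: order.trans less_trans)
  qed
  have Un: "?\<Omega> = (\<Union>n. An n)"
  proof (intro equalityI subsetI)
    fix x assume x: "x \<in> ?\<Omega>"
    obtain n where n: "norm x + \<bar>u x\<bar> < real n" using reals_Archimedean2 by blast
    have "norm x < real n" "u x \<le> real n" using n norm_ge_zero[of x] by linarith+
    then have "x \<in> An n" using x by (simp add: An_def Tf_def)
    then show "x \<in> (\<Union>n. An n)" by blast
  qed (auto simp: An_def Tf_def)
  have "weighted (\<lambda>x. u x * v x) ?\<Omega> = (\<integral>\<^sup>+x. (SUP n. ennreal (u x * v x) * indicator (An n) x) \<partial>lebesgue)"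
    unfolding weighted_def Un
  proof (intro nn_integral_cong)
    fix x
    show "ennreal (u x * v x) * indicator (\<Union>n. An n) x = (SUP n. ennreal (u x * v x) * indicator (An n) x)"
    proof -
      have "(\<lambda>n. indicator (An n) x :: ennreal) \<longlonglongrightarrow> indicator (\<Union>n. An n) x" by (rule LIMSEQ_indicator_incseq[OF inc])
      moreover have "incseq (\<lambda>n. indicator (An n) x :: ennreal)"
        using inc by (auto simp: incseq_def indicator_def)
      ultimately have "(SUP n. indicator (An n) x :: ennreal) = indicator (\<Union>n. An n) x"
        using LIMSEQ_SUP LIMSEQ_unique by blast
      then show ?thesis by (simp add: SUP_mult_left_ennreal[symmetric])
    qed
  qed
  also have "\<dots> = (SUP n. weighted (\<lambda>x. u x * v x) (An n))"
    unfolding weighted_def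
  proof (rule nn_integral_monotone_convergence_SUP)
    show "incseq (\<lambda>n x. ennreal (u x * v x) * indicator (An n) x)"
      using inc by (auto simp: incseq_def le_fun_def indicator_def)
  qed measurable
  also have "\<dots> \<le> ennreal (weak_const * A / t) * ?I" by (rule SUP_least) (rule each)
  finally show ?thesis .
qed

end

section \<open>A Borel representative of the kernel\<close>

lemma AE_lebesgue_reflect:
  fixes x :: "'a::euclidean_space"
  assumes "AE z in lebesgue. P z"
  shows "AE y in lebesgue. P (x - y)"
proof -
  obtain N where N: "{z. \<not> P z} \<subseteq> N" "N \<in> null_sets lebesgue"
    using assms by (auto simp: eventually_ae_filter)
  have "negligible ((\<lambda>z. x - z) ` N)"
    by (rule negligible_differentiable_image_negligible[OF order.refl])
      (use N(2) in \<open>auto simp: negligible_iff_null_sets intro!: differentiable_on_diff\<close>)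
  moreover have "{y \<in> space lebesgue. \<not> P (x - y)} \<subseteq> (\<lambda>z. x - z) ` N"
  proof
    fix y assume "y \<in> {y \<in> space lebesgue. \<not> P (x - y)}"
    then have "x - y \<in> N" using N(1) by auto
    then show "y \<in> (\<lambda>z. x - z) ` N" by (rule rev_image_eqI) simp
  qed
  ultimately show ?thesis unfolding negligible_iff_null_sets by (rule AE_I')
qed

lemma luxemburg_cong_AE:
  assumes "AE x in lebesgue. f x = g x"
  shows "luxemburg \<phi> E w f = luxemburg \<phi> E w g"
proof -
  have "(\<integral>\<^sup>+y\<in>E. ennreal (\<phi> (norm (f y) / l) * w y) \<partial>lebesgue) = (\<integral>\<^sup>+y\<in>E. ennreal (\<phi> (norm (g y) / l) * w y) \<partial>lebesgue)" for l
    using assms by (intro nn_integral_cong_AE) (auto elim!: eventually_mono)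
  then show ?thesis by (simp add: luxemburg_def)
qed

text \<open>For Fubini the differences of translates of \<open>K\<close> have to be jointly Borel
  measurable. As \<open>K\<close> is given as measurable off the origin, its value there is first
  set to 0; by the lemmas below, a change on a null set affects neither the kernel formula nor the
  Hoermander condition.\<close>

lemma borel_kernel:
  fixes K :: "real ^ 'n \<Rightarrow> complex"
  assumes "K \<in> borel_measurable (lebesgue_on (- {0}))"
  obtains K' where "K' \<in> borel_measurable borel" "AE x in lebesgue. K x = K' x"
proof -
  define K0 where "K0 x = (if x \<in> - {0} then K x else 0)" for x
  have [measurable]: "K0 \<in> borel_measurable lebesgue"
    unfolding K0_def using assms by (intro borel_measurable_if_I) auto
  have "(\<lambda>x. Re (K0 x)) \<in> borel_measurable lebesgue" "(\<lambda>x. Im (K0 x)) \<in> borel_measurable lebesgue"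
    by measurable
  then obtain g h where g: "g \<in> borel_measurable lborel" "AE x in lborel. Re (K0 x) = g x"
    and h: "h \<in> borel_measurable lborel" "AE x in lborel. Im (K0 x) = h x"
    by (metis completion_ex_borel_measurable_real)
  show ?thesis
  proof
    have [measurable]: "g \<in> borel_measurable borel" "h \<in> borel_measurable borel" using g(1) h(1) by auto
    show "(\<lambda>x. Complex (g x) (h x)) \<in> borel_measurable borel"
      unfolding Complex_eq by measurable
    have "AE x in lborel. x \<noteq> (0 :: real ^ 'n)" by (rule AE_lborel_singleton)
    from AE_completion[OF this] AE_completion[OF g(2)] AE_completion[OF h(2)]
    show "AE x in lebesgue. K x = Complex (g x) (h x)"
      by eventually_elim (simp add: K0_def complex_eq_iff)
  qed
qed

lemma has_kernel_cong_AE: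
  fixes K :: "real ^ 'n \<Rightarrow> complex"
  assumes "has_kernel T K" and [measurable]: "K' \<in> borel_measurable borel" and K: "AE x in lebesgue. K x = K' x"
  shows "has_kernel T K'"
  unfolding has_kernel_def
proof (intro ballI impI)
  fix f :: "real ^ 'n \<Rightarrow> complex" assume f: "f \<in> L2" "compact (support f)"
  have [measurable]: "f \<in> borel_measurable lebesgue" by (rule L2_measurable[OF f(1)])
  have "AE x in lebesgue. x \<notin> support f \<longrightarrow> integrable lebesgue (\<lambda>y. K (x - y) * f y) \<and>
      T f x = (LINT y|lebesgue. K (x - y) * f y)"
    using assms(1) f by (auto simp: has_kernel_def)
  then show "AE x in lebesgue. x \<notin> support f \<longrightarrow> integrable lebesgue (\<lambda>y. K' (x - y) * f y) \<and>
      T f x = (LINT y|lebesgue. K' (x - y) * f y)"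
  proof eventually_elim
    case (elim x)
    have ae: "AE y in lebesgue. K (x - y) * f y = K' (x - y) * f y"
      using AE_lebesgue_reflect[OF K, of x] by eventually_elim simp
    have "(\<lambda>y. K' (x - y)) \<in> borel_measurable lborel" by measurable
    from measurable_completion[OF this] have [measurable]: "(\<lambda>y. K' (x - y)) \<in> borel_measurable lebesgue" .
    have m: "(\<lambda>y. K' (x - y) * f y) \<in> borel_measurable lebesgue" by measurable
    show ?case
    proof
      assume "x \<notin> support f"
      then have i: "integrable lebesgue (\<lambda>y. K (x - y) * f y)" and T: "T f x = (LINT y|lebesgue. K (x - y) * f y)"
        using elim by auto
      have m': "(\<lambda>y. K (x - y) * f y) \<in> borel_measurable lebesgue" using i by (rule borel_measurable_integrable)
      show "integrable lebesgue (\<lambda>y. K' (x - y) * f y) \<and> T f x = (LINT y|lebesgue. K' (x - y) * f y)"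
        using i T integrable_cong_AE[OF m' m ae] integral_cong_AE[OF m' m ae] by simp
    qed
  qed
qed

lemma annular_lux_cong_AE:
  assumes "AE x in lebesgue. f x = g x"
  shows "annular_lux \<Phi> s f = annular_lux \<Phi> s g"
  unfolding annular_lux_def using assms by (intro luxemburg_cong_AE) (auto elim!: eventually_mono)

lemma hoermander_cong_AE:
  fixes K :: "real ^ 'n \<Rightarrow> complex"
  assumes K: "AE x in lebesgue. K x = K' x"
  shows "annular_lux \<Phi> s (\<lambda>x. K (x - y) - K x) = annular_lux \<Phi> s (\<lambda>x. K' (x - y) - K' x)"
proof (rule annular_lux_cong_AE)
  have "AE z in lebesgue. K (- z) = K' (- z)" using AE_lebesgue_reflect[OF K, of 0] by simp
  from AE_lebesgue_reflect[OF this, of y] have "AE x in lebesgue. K (x - y) = K' (x - y)" by simp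
  then show "AE x in lebesgue. K (x - y) - K x = K' (x - y) - K' x"
    using K by eventually_elim simp
qed

text \<open>For \<open>z < 1\<close> the exponent \<open>p' + 1 - q'\<close> is at most 1, and for
  \<open>z \<ge> 1\<close> the exponent \<open>p'\<close> is at least 1; either way the power is at
  least \<open>z\<close>.\<close>

lemma Psi_ge:
  assumes "1 < p" "conj_exp p \<le> conj_exp q" "0 < z"
  shows "z \<le> Psi p q z"
proof -
  have p: "1 \<le> conj_exp p" using assms(1) by (simp add: conj_exp_def divide_simps)
  show ?thesis
  proof (cases "z < 1")
    case True
    have "z powr 1 \<le> z powr (conj_exp p + 1 - conj_exp q)"
      using assms True by (intro powr_mono') auto
    then show ?thesis using True assms(3) by (simp add: Psi_def)
  next
    case False
    have "z powr 1 \<le> z powr conj_exp p" using False p by (intro powr_mono) auto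
    then have "z \<le> z powr conj_exp p * indicat_real {1..} z" using False assms(3) by simp
    then show ?thesis by (simp add: Psi_def add_increasing)
  qed
qed

theorem theorem2:
  fixes \<Phi> \<eta> \<phi> :: "real \<Rightarrow> real"
    and r s p q z0 :: real
    and T :: "(real ^ 'n \<Rightarrow> complex) \<Rightarrow> real ^ 'n \<Rightarrow> complex"
    and K :: "real ^ 'n \<Rightarrow> complex"
    and u v :: "real ^ 'n \<Rightarrow> real"
  assumes "young \<Phi>" and "proper_complementary \<Phi>"
    and "1 < s" and "s < r"
    and "upper_type (complementary \<Phi>) r" and "lower_type (complementary \<Phi>) s"
    and "L2_bounded_linear T"
    and "K \<in> borel_measurable (lebesgue_on (- {0}))"
    and "has_kernel T K"
    and "K \<in> hoermander \<Phi>"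
    and "1 < p" and "p < conj_exp r"
    and "young \<eta>" and "young \<phi>" and "0 \<le> z0"
    and "\<eta> \<in> B_class (conj_exp p)"
    and "\<exists>c>0. \<forall>z\<ge>z0. young_inv \<eta> z * young_inv \<phi> z \<le> c * young_inv (complementary \<Phi>) z"
    and "locally_integrable u" and "\<And>x. 0 \<le> u x"
    and "q = 1 + (p - 1) / r"
    and "v \<in> RH_inf \<inter> A_class q"
  shows "\<exists>C>0. \<forall>t>0. \<forall>f :: real ^ 'n \<Rightarrow> complex.
    f \<in> borel_measurable lebesgue \<longrightarrow> bounded (range f) \<longrightarrow> compact (support f) \<longrightarrow>
      weighted (\<lambda>x. u x * v x) {x. norm (T (\<lambda>y. f y * complex_of_real (v y)) x) / v x > t}
      \<le> ennreal (C / t) *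
        (\<integral>\<^sup>+x. ennreal (norm (f x)) *
              maximal_lux (\<lambda>z. \<phi> (z powr (1 / p))) (\<lambda>y. v y powr (1 - conj_exp q)) u x *
              hl_maximal (\<lambda>y. Psi p q (v y)) x \<partial>lebesgue)"
proof -
  note Y = assms(1,2)
  let ?\<Psi> = "complementary \<Phi>"
  define F where "F z = \<phi> (z powr (1 / p))" for z
  have r: "1 < r" "0 < r" using assms(3,4) by auto
  have q: "1 < q" using assms(11,20) r by simp
  have qq: "conj_exp q = 1 + r / (p - 1)" using assms(11) r by (simp add: conj_exp_def assms(20) field_simps)
  \<comment> \<open>\<open>p' = 1 + 1/(p - 1)\<close> and \<open>q' = 1 + r/(p - 1)\<close> with
    \<open>r > 1\<close>; this order of the exponents is what \<open>Psi_ge\<close> asks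
    for.\<close>
  have pq: "conj_exp p \<le> conj_exp q"
  proof -
    have "conj_exp p = 1 + 1 / (p - 1)" using assms(11) by (simp add: conj_exp_def field_simps)
    then show ?thesis using qq assms(11) r by (simp add: divide_right_mono)
  qed
  define \<beta> where "\<beta> = conj_exp q - 1"
  have \<beta>: "0 < \<beta>" using qq assms(11) r by (simp add: \<beta>_def)
  obtain A where A: "mixed_weight v \<beta> A"
    unfolding \<beta>_def using mixed_weightI assms(21) q by blast
  interpret mixed_weight v \<beta> A by (rule A)
  obtain Bt where Bt: "L2_operator T Bt" using L2_bounded_linear_operator[OF assms(7)] .
  obtain K' where K': "K' \<in> borel_measurable borel" "AE x in lebesgue. K x = K' x" using borel_kernel[OF assms(8)] .
  obtain c0 CK where c0: "1 \<le> c0" "0 < CK" and hoer: "\<And>y R. c0 * norm y < R \<Longrightarrow>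
     (\<Sum>k. ennreal ((2 ^ Suc k * R) ^ CARD('n)) *
          annular_lux \<Phi> (2 ^ Suc k * R) (\<lambda>x. K' (x - y) - K' x)) \<le> ennreal CK"
  proof -
    define S where "S y R = (\<Sum>k. ennreal ((2 ^ Suc k * R) ^ CARD('n)) *
      annular_lux \<Phi> (2 ^ Suc k * R) (\<lambda>x. K (x - y) - K x))" for y R
    have "\<exists>c\<ge>1. \<exists>C>0. \<forall>y R. R > c * norm y \<longrightarrow> S y R \<le> ennreal C"
      using assms(10) unfolding hoermander_def mem_Collect_eq S_def .
    then obtain c C where c: "c \<ge> 1" "C > 0" and h: "\<And>y R. R > c * norm y \<Longrightarrow> S y R \<le> ennreal C"
      by blast
    show ?thesis by (rule that[OF c]) (simp only: hoermander_cong_AE[OF K'(2), symmetric] h[unfolded S_def])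
  qed
  obtain \<epsilon> C where gap: "\<epsilon> > 0" "C > 0" "\<And>y. 0 \<le> y \<Longrightarrow> ?\<Psi> (y powr (1 + \<epsilon>)) \<le> C * (1 + F y)"
    using power_gap[OF Y assms(3-6) assms(11-14,16,17)] unfolding F_def by metis
  obtain Cr where Cr: "Cr > 0" "\<And>x t. 1 \<le> x \<Longrightarrow> 0 \<le> t \<Longrightarrow> ?\<Psi> (x * t) \<le> Cr * x powr r * ?\<Psi> t"
    by (rule complementary_upper[OF assms(5)]) blast
  obtain cs where cs: "cs > 0" "\<And>t. 1 \<le> t \<Longrightarrow> cs * t powr s \<le> ?\<Psi> t"
    by (rule complementary_lower_bound[OF Y assms(6)]) blast
  have F_nonneg: "0 \<le> F y" for y unfolding F_def by (rule young_nonneg[OF assms(14)]) simp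
  have F_mono: "F x \<le> F y" if "0 \<le> x" "x \<le> y" for x y
    unfolding F_def using assms(11) that by (intro young_mono[OF assms(14)] powr_mono2) auto
  obtain a D3 where a: "1 \<le> a" "0 < D3" "\<And>x y z. 0 \<le> x \<Longrightarrow> 0 \<le> y \<Longrightarrow> 0 \<le> z \<Longrightarrow>
      ?\<Psi> (x * y powr (1 - 1/(2 * a)) * z powr (1/(2 * a))) \<le> D3 * (1 + x powr a + (1 + F y) * max 1 z powr \<beta>)"
  proof (rule three_factor_bound[where \<Psi>="?\<Psi>" and r=r and Cr=Cr and \<epsilon>=\<epsilon> and C=C and f=F and \<beta>=\<beta>])
    show "?\<Psi> x \<le> ?\<Psi> y" if "0 \<le> x" "x \<le> y" for x y by (rule complementary_mono[OF Y that])
    show "0 \<le> ?\<Psi> x" if "0 \<le> x" for x by (rule complementary_nonneg[OF Y that])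
    show "?\<Psi> (x * y) \<le> Cr * x powr r * ?\<Psi> y" if "1 \<le> x" "0 \<le> y" for x y by (rule Cr(2)[OF that])
    show "?\<Psi> (y powr (1 + \<epsilon>)) \<le> C * (1 + F y)" if "0 \<le> y" for y by (rule gap(3)[OF that])
  next
    fix a D assume "1 \<le> a" "0 < D" "\<And>x y z. 0 \<le> x \<Longrightarrow> 0 \<le> y \<Longrightarrow> 0 \<le> z \<Longrightarrow>
      ?\<Psi> (x * y powr (1 - 1/(2 * a)) * z powr (1/(2 * a))) \<le> D * (1 + x powr a + (1 + F y) * max 1 z powr \<beta>)"
    then show thesis by (rule that)
  qed (use r Cr gap F_nonneg \<beta> in auto)
  have \<Psi>1: "0 \<le> ?\<Psi> 1" by (rule complementary_nonneg[OF Y]) simp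
  \<comment> \<open>For \<open>y \<ge> 1\<close> the gap is merely weakened, as
    \<open>y \<le> y powr (1 + \<epsilon>)\<close>; for smaller \<open>y\<close> the constant
    \<open>?\<Psi> 1\<close> takes over.\<close>
  have D8: "?\<Psi> y \<le> (C + ?\<Psi> 1) * (1 + F y)" if y: "0 \<le> y" for y
  proof (cases "1 \<le> y")
    case True
    have "y powr 1 \<le> y powr (1 + \<epsilon>)" using True gap(1) by (intro powr_mono) auto
    then have "?\<Psi> y \<le> ?\<Psi> (y powr (1 + \<epsilon>))" using y by (intro complementary_mono[OF Y]) auto
    also have "\<dots> \<le> C * (1 + F y)" by (rule gap(3)[OF y])
    also have "\<dots> \<le> (C + ?\<Psi> 1) * (1 + F y)" using \<Psi>1 F_nonneg[of y] by (intro mult_right_mono) auto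
    finally show ?thesis .
  next
    case False
    then have "?\<Psi> y \<le> ?\<Psi> 1 * 1" using y by (simp add: complementary_mono[OF Y])
    also have "\<dots> \<le> (C + ?\<Psi> 1) * (1 + F y)" using \<Psi>1 F_nonneg[of y] gap(2) by (intro mult_mono) auto
    finally show ?thesis .
  qed
  \<comment> \<open>For \<open>y \<ge> 1\<close> the lower growth of the complementary function at
    \<open>y powr (1 + \<epsilon>)\<close> gives at least \<open>cs * y\<close>, since
    \<open>(1 + \<epsilon>) * s \<ge> 1\<close>, and the gap bounds the same value from
    above.\<close>
  have Cu: "y \<le> (1 + C / cs) * (1 + F y)" if y: "0 \<le> y" for y
  proof (cases "1 \<le> y")
    case True
    have e: "1 \<le> (1 + \<epsilon>) * s" using gap(1) assms(3) mult_mono[of 1 "1 + \<epsilon>" 1 s] by simp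
    have "cs * y powr 1 \<le> cs * y powr ((1 + \<epsilon>) * s)" using True cs(1) e by (intro mult_left_mono powr_mono) auto
    also have "\<dots> = cs * (y powr (1 + \<epsilon>)) powr s" by (simp only: powr_powr)
    also have "\<dots> \<le> ?\<Psi> (y powr (1 + \<epsilon>))" using True gap(1) by (intro cs(2) ge_one_powr_ge_zero) auto
    also have "\<dots> \<le> C * (1 + F y)" by (rule gap(3)[OF y])
    finally have "y \<le> C / cs * (1 + F y)" using y cs(1) by (simp add: field_simps)
    also have "\<dots> \<le> (1 + C / cs) * (1 + F y)" using F_nonneg[of y] by (intro mult_right_mono) auto
    finally show ?thesis .
  next
    case False
    have "1 * 1 \<le> (1 + C / cs) * (1 + F y)" using F_nonneg[of y] gap(2) cs(1) by (intro mult_mono) auto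
    then show ?thesis using False by simp
  qed
  interpret L2_operator T Bt by (rule Bt)
  interpret mixed_estimate T Bt \<Phi> K' c0 CK v \<beta> A F u a D3 "1 + C / cs" "C + ?\<Psi> 1" s cs
  proof
    show "has_kernel T K'" by (rule has_kernel_cong_AE[OF assms(9) K'])
  qed (use Y K' c0 hoer F_mono F_nonneg assms(18,19) a Cu gap(2) cs D8 \<Psi>1 assms(3) in \<open>auto intro: add_pos_nonneg add_pos_pos\<close>)
  have "0 < weak_const * A" using weak_const_pos A1 by simp
  moreover have "weighted (\<lambda>x. u x * v x) {x. norm (T (\<lambda>y. f y * complex_of_real (v y)) x) / v x > t}
      \<le> ennreal (weak_const * A / t) *
        (\<integral>\<^sup>+x. ennreal (norm (f x)) *
              maximal_lux (\<lambda>z. \<phi> (z powr (1 / p))) (\<lambda>y. v y powr (1 - conj_exp q)) u x *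
              hl_maximal (\<lambda>y. Psi p q (v y)) x \<partial>lebesgue)"
    if "0 < t" "f \<in> borel_measurable lebesgue" "bounded (range f)" "compact (support f)" for t f
    using weak_type[OF that(2,3,4,1) Psi_ge[OF assms(11) pq]] unfolding F_def \<beta>_def by simp
  ultimately show ?thesis by blast
qed

end
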